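(* We can preprocess a given $C_\delta$-dense multi-set $X$ of size $n$ in time $\widetilde{O}(n)$. Given a query $t \le \Sigma(X)/2$ with $t \ge (4+2C_\lambda)\, \mu_X \max(X)\, \Sigma(X) / n^2$ we can then decide whether $t \in \mathcal{S}(X)$ in time $O(1)$. In particular, given a multi-set $X$ of size $n$ and a target $t \le \Sigma(X)/2$ with $t \ge 0.5\, C_\delta\, \mu_X \max(X)\, \Sigma(X) / n^2$, we can decide whether $t \in \mathcal{S}(X)$ in time $\widetilde{O}(n)$.
   Context: For a finite non-empty multi-set $X$ of positive integers: $|X|$ is the number of elements counted with multiplicity, $\max(X)$ is its maximum element, $\mu_X$ is the largest multiplicity of any number in $X$, $\Sigma(X)$ is the sum of all elements (with multiplicity), and $\mathcal{S}(X) := \{\Sigma(Y) \mid Y \subseteq X\}$ is the set of all subset sums. $X$ is called $\delta$-dense if $|X|^2 \ge \delta \cdot \mu_X \cdot \max(X)$. The constants are $C_\delta := 1699200 \cdot \log(2n)\log^2(2\mu_X)$ and $C_\lambda := 169920 \cdot \log(2\mu_X)$. $\widetilde{O}$ hides polylogarithmic factors. *)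

theory Defs
  imports Complex_Main "HOL-Library.Multiset" "HOL-Library.Landau_Symbols"
begin

definition max_elem :: "nat multiset \<Rightarrow> nat" where
  "max_elem X = Max (set_mset X)"

definition max_mult :: "nat multiset \<Rightarrow> nat" where
  "max_mult X = Max (count X ` set_mset X)"

definition subset_sums :: "nat multiset \<Rightarrow> nat set" where
  "subset_sums X = {\<Sum>\<^sub># Y | Y. Y \<subseteq># X}"

definition dense :: "real \<Rightarrow> nat multiset \<Rightarrow> bool" where
  "dense \<delta> X \<longleftrightarrow> real (size X) ^ 2 \<ge> \<delta> * real (max_mult X) * real (max_elem X)"

definition C_delta :: "nat multiset \<Rightarrow> real" where
  "C_delta X = 1699200 * log 2 (2 * real (size X)) * (log 2 (2 * real (max_mult X))) ^ 2"

definition C_lambda :: "nat multiset \<Rightarrow> real" where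
  "C_lambda X = 169920 * log 2 (2 * real (max_mult X))"

definition soft_O :: "(nat \<Rightarrow> real) \<Rightarrow> (nat \<Rightarrow> real) set" where
  "soft_O g = (\<Union>k. O(\<lambda>n. g n * log 2 (g n) ^ k))"

text \<open>
  Running times refer to a deterministic word RAM, presented as a structured while language over
  registers and an indirectly addressed memory.  Every elementary operation costs one unit and acts
  on single words: results are reduced modulo \<open>2 ^ w\<close>, where \<open>w\<close> is the word size.  (Without this
  reduction, unit-cost arithmetic on arbitrarily long numbers would make subset sum too easy.)
\<close>

datatype binop = Plus | Minus | Times | Divide | Modulo | Less | Equal

text \<open>Subtraction is truncated at zero; comparisons yield 0 or 1.\<close>

fun binop_val :: "binop \<Rightarrow> nat \<Rightarrow> nat \<Rightarrow> nat" where
  "binop_val Plus a b = a + b"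
| "binop_val Minus a b = a - b"
| "binop_val Times a b = a * b"
| "binop_val Divide a b = a div b"
| "binop_val Modulo a b = a mod b"
| "binop_val Less a b = of_bool (a < b)"
| "binop_val Equal a b = of_bool (a = b)"

type_synonym reg = nat

datatype com =
    Skip
  | Const reg nat
  | Arith reg binop reg reg
  | Load reg reg   \<comment> \<open>target, address\<close>
  | Store reg reg  \<comment> \<open>address, source\<close>
  | Seq com com
  | If reg com com
  | While reg com

record ram =
  regs :: "nat \<Rightarrow> nat"
  mem :: "nat \<Rightarrow> nat"

definition set_reg :: "reg \<Rightarrow> nat \<Rightarrow> ram \<Rightarrow> ram" where
  "set_reg r v s = s\<lparr>regs := (regs s)(r := v)\<rparr>"

definition set_mem :: "nat \<Rightarrow> nat \<Rightarrow> ram \<Rightarrow> ram" where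
  "set_mem a v s = s\<lparr>mem := (mem s)(a := v)\<rparr>"

text \<open>
  \<open>exec w c s k s'\<close>: with word size \<open>w\<close>, program \<open>c\<close> started in \<open>s\<close> halts in \<open>s'\<close> after exactly \<open>k\<close>
  steps.  Tests succeed if the register is non-zero.
\<close>

inductive exec :: "nat \<Rightarrow> com \<Rightarrow> ram \<Rightarrow> nat \<Rightarrow> ram \<Rightarrow> bool" for w :: nat where
  Skip: "exec w Skip s 1 s"
| Const: "exec w (Const r v) s 1 (set_reg r (v mod 2 ^ w) s)"
| Arith: "exec w (Arith r f p q) s 1
    (set_reg r (binop_val f (regs s p) (regs s q) mod 2 ^ w) s)"
| Load: "exec w (Load r p) s 1 (set_reg r (mem s (regs s p)) s)"
| Store: "exec w (Store p q) s 1 (set_mem (regs s p) (regs s q) s)"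
| Seq: "exec w c1 s k1 s1 \<Longrightarrow> exec w c2 s1 k2 s2 \<Longrightarrow> exec w (Seq c1 c2) s (k1 + k2) s2"
| IfTrue: "regs s r \<noteq> 0 \<Longrightarrow> exec w c1 s k s1 \<Longrightarrow> exec w (If r c1 c2) s (k + 1) s1"
| IfFalse: "regs s r = 0 \<Longrightarrow> exec w c2 s k s1 \<Longrightarrow> exec w (If r c1 c2) s (k + 1) s1"
| WhileFalse: "regs s r = 0 \<Longrightarrow> exec w (While r c) s 1 s"
| WhileTrue: "regs s r \<noteq> 0 \<Longrightarrow> exec w c s k1 s1 \<Longrightarrow> exec w (While r c) s1 k2 s2 \<Longrightarrow>
    exec w (While r c) s (k1 + k2 + 1) s2"

text \<open>
  A multi-set is given as an array listing its elements with repetition, in arbitrary order, in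
  memory cells \<open>0, \<dots>, n - 1\<close>; its size \<open>n\<close> is in register 0, and everything else is zero.  A target
  is passed in register 1, and answers are returned in register 0.
\<close>

definition input :: "nat list \<Rightarrow> ram" where
  "input xs = \<lparr>regs = (\<lambda>_. 0)(0 := length xs),
     mem = (\<lambda>i. if i < length xs then xs ! i else 0)\<rparr>"

definition with_target :: "nat \<Rightarrow> ram \<Rightarrow> ram" where
  "with_target t = set_reg 1 t"

text \<open>Program \<open>c\<close>, started in \<open>s\<close> with target \<open>t\<close>, decides within \<open>b\<close> steps whether \<open>t \<in> S\<close>.\<close>

definition decides :: "nat \<Rightarrow> com \<Rightarrow> real \<Rightarrow> nat set \<Rightarrow> ram \<Rightarrow> nat \<Rightarrow> ram \<Rightarrow> bool" where
  "decides w c b S s t s' \<longleftrightarrow>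
     (\<exists>k. exec w c (with_target t s) k s' \<and> real k \<le> b \<and> regs s' 0 = of_bool (t \<in> S))"

text \<open>
  A preprocessed state must support any sequence of queries, each one starting in the state left
  behind by the previous one.
\<close>

fun serves :: "nat \<Rightarrow> com \<Rightarrow> real \<Rightarrow> nat set \<Rightarrow> ram \<Rightarrow> nat list \<Rightarrow> bool" where
  "serves w c b S s [] \<longleftrightarrow> True"
| "serves w c b S s (t # ts) \<longleftrightarrow> (\<exists>s'. decides w c b S s t s' \<and> serves w c b S s' ts)"

text \<open>
  The usual assumption that the word size is at least a constant multiple \<open>\<kappa>\<close> of
  \<open>log (n + max X)\<close>.
\<close>

definition word_size_ok :: "nat \<Rightarrow> nat multiset \<Rightarrow> nat \<Rightarrow> bool" where
  "word_size_ok \<kappa> X w \<longleftrightarrow> real w \<ge> real \<kappa> * log 2 (real (size X + max_elem X))"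

end

theory Submission
  imports Defs
begin

text \<open>
  Let \<open>d\<close> be the largest number up to \<open>n / 1000\<close> that divides all but fewer than \<open>d\<close> elements of \<open>X\<close>.
  For targets in the given range, \<open>t\<close> is a subset sum of \<open>X\<close> if and only if \<open>t mod d\<close> is a subset sum
  modulo \<open>d\<close>.  After dividing out \<open>d\<close>, no small modulus divides almost all elements.  Split off two small
  parts \<open>A1\<close>, \<open>A2\<close>; by density some set \<open>B\<close> of numbers has many disjoint representations as a sum of an
  element of \<open>A1\<close> and one of \<open>A2\<close>, and sums of few elements of \<open>B\<close> cover all multiples of \<open>gcd B\<close> in an
  interval (a weak Kneser bound modulo \<open>max B\<close>, proved by Dyson's e-transform).  The remaining elements
  correct the residue modulo \<open>gcd B\<close> and approximate the target greedily.

  The modulus \<open>d\<close> is found by linking each element to a nearby one: the differences are at most \<open>n / 1000\<close>,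
  so the numbers dividing most of them are found by a sieve, and \<open>d\<close> divides the largest of these.  All
  subset sums modulo \<open>d\<close> are then computed by adding the elements one at a time.  Names of dyadic
  blocks of the characteristic string, unique by a dictionary, locate each difference between the set
  and its shift in logarithmic time, and the number of differences is bounded by the number of new
  elements, of which there are fewer than \<open>d\<close> in total.
\<close>

section \<open>Sums of residues\<close>

text \<open>The threshold \<open>n / 1000\<close> meets two needs. The interval theorem for
  \<open>X / d\<close> asks that no \<open>g\<close> up to a constant times \<rho> =
  \<open>\<mu> * sum / n ^ 2\<close> divides almost all elements; density makes \<rho> so small
  against \<open>n\<close> that \<open>d * g\<close> still lies below \<open>n / 1000\<close>, where
  the maximality of \<open>d\<close> applies. On the other hand \<open>d\<close> must be found
  without factoring elements that are bounded only by about \<open>n ^ 2\<close>; differences of at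
  most \<open>n / 1000\<close> bring all candidates into the range of a sieve.

  Scanning the residue set for each element would cost \<open>d\<close> steps each time. Locating
  only the differences costs logarithmic time per element and per new residue, but comparing the set
  with its shift by \<open>x\<close> needs names of blocks aligned with \<open>x\<close>, and naming
  them afresh for every shift is again quadratic. Equal residues are therefore processed together
  and the shifts visited in bit-reversed order, which keeps most levels valid.

  A deterministic dictionary is free here: memory starts as zero and each array has
  \<open>n ^ 10\<close> cells, so the code of a pair of names is itself an index.\<close>

definition msum :: "nat \<Rightarrow> nat set \<Rightarrow> nat set \<Rightarrow> nat set" where
  "msum a A B = {(x + y) mod a | x y. x \<in> A \<and> y \<in> B}"

lemma msumI: "x \<in> A \<Longrightarrow> y \<in> B \<Longrightarrow> (x + y) mod a \<in> msum a A B"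
  by (auto simp: msum_def)

lemma msum_less: "0 < a \<Longrightarrow> msum a A B \<subseteq> {..<a}"
  by (auto simp: msum_def)

lemma subset_msum: "A \<subseteq> {..<a} \<Longrightarrow> 0 \<in> B \<Longrightarrow> A \<subseteq> msum a A B"
proof
  fix x assume "A \<subseteq> {..<a}" "0 \<in> B" "x \<in> A"
  then show "x \<in> msum a A B" using msumI[of x A 0 B a] by auto
qed

lemma add_mod_cancel_right:
  fixes x y e a :: nat
  assumes "x < a" "y < a" "(x + e) mod a = (y + e) mod a"
  shows "x = y"
  using assms
proof (induction x y rule: linorder_wlog)
  case (le x y)
  then have "a dvd (y + e) - (x + e)" by (metis add_le_mono1 mod_eq_dvd_iff_nat)
  then have "a dvd y - x" by simp
  then have "y - x = 0" using le by (metis dvd_imp_le less_imp_diff_less linorder_not_less neq0_conv)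
  then show ?case using le by simp
qed simp

lemma inj_on_add_mod: "inj_on (\<lambda>b. (b + e) mod a) {..<a}" for a e :: nat
  by (rule inj_onI) (auto intro: add_mod_cancel_right)

text \<open>One sum \<open>A + B\<close> can gain less than \<open>card B\<close> when it is
  periodic, as in Kneser's theorem; the second copy of \<open>B\<close>, which lies in no proper
  subgroup, leads out of such a set. Among all pairs that arise from \<open>(A, B)\<close>, one with
  the smallest \<open>B'\<close> has \<open>A'\<close> stable under \<open>B'\<close>. A translate
  of \<open>B'\<close> starting outside \<open>A'\<close> then misses \<open>A'\<close>, and both
  fit into the double sum.\<close>

lemma e_transform_growth:
  fixes a :: nat
  assumes a: "0 < a" and A: "A \<subseteq> {..<a}" "A \<noteq> {}" and B: "B \<subseteq> {..<a}" "0 \<in> B"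
    and gen: "\<And>C. C \<subseteq> {..<a} \<Longrightarrow> C \<noteq> {} \<Longrightarrow> msum a C B \<subseteq> C \<Longrightarrow> C = {..<a}"
  shows "min a (card A + card B) \<le> card (msum a (msum a A B) B)"
proof -
  define ok where "ok A' B' \<longleftrightarrow> A \<subseteq> A' \<and> A' \<subseteq> {..<a} \<and> 0 \<in> B' \<and> B' \<subseteq> B \<and>
    msum a A' B' \<subseteq> msum a A B \<and> card A + card B \<le> card A' + card B'" for A' B'
  have "ok A B" using A B by (auto simp: ok_def)
  \<comment> \<open>Every transform strictly shrinks the second set, so a pair with the smallest one
    admits no further transform.\<close>
  then obtain p where p: "ok (fst p) (snd p)"
    and least: "\<And>r. ok (fst r) (snd r) \<Longrightarrow> card (snd p) \<le> card (snd r)"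
    using ex_has_least_nat[of "\<lambda>p. ok (fst p) (snd p)" "(A, B)" "\<lambda>p. card (snd p)"] by auto
  define A' B' where "A' = fst p" and "B' = snd p"
  have okAB: "ok A' B'" using p by (simp add: A'_def B'_def)
  have fin: "finite A'" "finite B'" "finite B"
    using okAB B(1) unfolding ok_def by (meson finite_lessThan finite_subset)+
  have AB': "A' \<subseteq> {..<a}" "B' \<subseteq> {..<a}" "0 \<in> B'" "B' \<subseteq> B" "A \<subseteq> A'"
    and sub: "msum a A' B' \<subseteq> msum a A B" and cards: "card A + card B \<le> card A' + card B'"
    using okAB B unfolding ok_def by auto
  have stuck: "(e + b) mod a \<in> A'" if e: "e \<in> A'" and b: "b \<in> B'" for e b
  proof (rule ccontr)
    assume neg: "(e + b) mod a \<notin> A'"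
    let ?f = "\<lambda>b. (b + e) mod a"
    \<comment> \<open>Dyson's e-transform: the elements of \<open>B'\<close> whose translate by
      \<open>e\<close> is missing from \<open>A'\<close> leave \<open>B'\<close>, and their
      translates join \<open>A'\<close>; the total size is kept.\<close>
    define A2 where "A2 = A' \<union> ?f ` B'"
    define B2 where "B2 = {b \<in> B'. ?f b \<in> A'}"
    have inj: "inj_on ?f B'" using inj_on_subset[OF inj_on_add_mod AB'(2)] .
    have "b \<notin> B2" using neg by (auto simp: B2_def add.commute)
    then have lt: "card B2 < card B'"
      using fin b by (intro psubset_card_mono) (auto simp: B2_def)
    have "A2 = A' \<union> ?f ` (B' - B2)" by (auto simp: A2_def B2_def)
    moreover have "A' \<inter> ?f ` (B' - B2) = {}" by (auto simp: B2_def)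
    ultimately have "card A2 = card A' + card (?f ` (B' - B2))"
      using fin by (simp add: card_Un_disjoint)
    also have "card (?f ` (B' - B2)) = card (B' - B2)"
      using inj by (intro card_image) (auto intro: inj_on_subset)
    also have "card (B' - B2) = card B' - card B2"
      using fin by (intro card_Diff_subset) (auto simp: B2_def)
    finally have c2: "card A2 + card B2 = card A' + card B'" using lt by simp
    have "msum a A2 B2 \<subseteq> msum a A' B'"
    proof
      fix z assume "z \<in> msum a A2 B2"
      then obtain x y where xy: "x \<in> A2" "y \<in> B2" "z = (x + y) mod a" by (auto simp: msum_def)
      then consider "x \<in> A'" | b' where "b' \<in> B'" "x = ?f b'" by (auto simp: A2_def)
      then show "z \<in> msum a A' B'"
      proof cases
        case 1 then show ?thesis using xy by (auto simp: B2_def intro: msumI)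
      next
        case 2
        then have "z = ((y + e) mod a + b') mod a" using xy by (simp add: mod_simps ac_simps)
        then show ?thesis using xy 2 by (auto simp: B2_def intro: msumI)
      qed
    qed
    then have "msum a A2 B2 \<subseteq> msum a A B" using sub by (rule subset_trans)
    moreover have "A \<subseteq> A2" "A2 \<subseteq> {..<a}" using AB' a by (auto simp: A2_def)
    moreover have "0 \<in> B2" "B2 \<subseteq> B" using AB' e by (auto simp: B2_def subset_iff)
    ultimately have "ok A2 B2" using c2 cards by (simp add: ok_def)
    then show False using least[of "(A2, B2)"] lt by (simp add: B'_def)
  qed
  show ?thesis
  proof (cases "msum a A' B \<subseteq> A'")
    case True
    then have "A' = {..<a}" using gen AB' A by blast
    moreover have "A' \<subseteq> msum a (msum a A B) B"
      using subset_msum[OF AB'(1,3)] sub subset_msum[OF msum_less[OF a] B(2), of A B] by blast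
    ultimately have "card {..<a} \<le> card (msum a (msum a A B) B)"
      by (intro card_mono) (auto intro: finite_subset[OF msum_less[OF a]])
    then show ?thesis by simp
  next
    case False
    then obtain x b where xb: "x \<in> A'" "b \<in> B" "(x + b) mod a \<notin> A'" by (auto simp: msum_def)
    define y where "y = (x + b) mod a"
    have y: "y < a" "y \<notin> A'" using a xb by (auto simp: y_def)
    have AA: "A' \<subseteq> msum a A B"
      using subset_msum[OF AB'(1,3)] sub by blast
    \<comment> \<open>Translation by \<open>b'\<close> maps the finite set \<open>A'\<close> into
      itself and is injective, so it permutes \<open>A'\<close>; the preimage of \<open>z\<close> in
      \<open>A'\<close> would have to be \<open>y\<close>.\<close>
    have "z \<notin> A'" if z: "z \<in> (\<lambda>b'. (b' + y) mod a) ` B'" for z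
    proof
      assume zA: "z \<in> A'"
      from z obtain b' where b': "b' \<in> B'" "z = (b' + y) mod a" by blast
      have "(\<lambda>e. (e + b') mod a) ` A' = A'"
        using stuck b' fin inj_on_subset[OF inj_on_add_mod AB'(1), of b']
        by (intro endo_inj_surj) auto
      then obtain e where e: "e \<in> A'" "z = (e + b') mod a" using zA by blast
      have "(e + b') mod a = (y + b') mod a" using e b' by (simp add: add.commute)
      moreover have "e < a" using e AB' by blast
      ultimately have "e = y" using add_mod_cancel_right y(1) by blast
      then show False using e y by simp
    qed
    then have disj: "A' \<inter> (\<lambda>b'. (b' + y) mod a) ` B' = {}" by blast
    have "A' \<subseteq> msum a (msum a A B) B"
      using AA subset_msum[OF msum_less[OF a] B(2), of A B] by blast
    moreover have "(\<lambda>b'. (b' + y) mod a) ` B' \<subseteq> msum a (msum a A B) B"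
    proof
      fix z assume "z \<in> (\<lambda>b'. (b' + y) mod a) ` B'"
      then obtain b' where b': "b' \<in> B'" "z = (b' + y) mod a" by blast
      then have "z = ((x + b') mod a + b) mod a" by (simp add: y_def mod_simps ac_simps)
      moreover have "(x + b') mod a \<in> msum a A B" using AA stuck xb b' by blast
      ultimately show "z \<in> msum a (msum a A B) B" using xb by (auto intro: msumI)
    qed
    ultimately have "card (A' \<union> (\<lambda>b'. (b' + y) mod a) ` B') \<le> card (msum a (msum a A B) B)"
      by (intro card_mono) (auto intro: finite_subset[OF msum_less[OF a]])
    moreover have "card (A' \<union> (\<lambda>b'. (b' + y) mod a) ` B') = card A' + card B'"
      using disj fin inj_on_subset[OF inj_on_add_mod AB'(2), of y]
      by (simp add: card_Un_disjoint card_image)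
    ultimately show ?thesis using cards by simp
  qed
qed

text \<open>The translations that preserve \<open>C\<close> form a monoid. Modulo \<open>a\<close>
  it is a group, since \<open>a - 1\<close> copies of an element act as its inverse; that supplies
  the subtraction in Bezout's identity.\<close>

lemma mod_invariant_Gcd:
  fixes a :: nat
  assumes a: "0 < a" and F: "finite F" and inv: "\<And>z c. z \<in> F \<Longrightarrow> c \<in> C \<Longrightarrow> (c + z) mod a \<in> C"
    and C: "C \<subseteq> {..<a}" and c: "c \<in> C"
  shows "(c + Gcd F) mod a \<in> C"
proof -
  define H where "H = {z. \<forall>c\<in>C. (c + z) mod a \<in> C}"
  have add: "x + y \<in> H" if "x \<in> H" "y \<in> H" for x y
  proof -
    have "(c + (x + y)) mod a = ((c + x) mod a + y) mod a" for c by (simp add: mod_simps ac_simps)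
    then show ?thesis using that by (auto simp: H_def)
  qed
  have zero: "0 \<in> H" using C by (auto simp: H_def)
  have mult: "k * x \<in> H" if "x \<in> H" for k x
    by (induction k) (use that add zero in auto)
  have cong: "y \<in> H" if "x \<in> H" "x mod a = y mod a" for x y
  proof -
    have "(c + y) mod a = (c + x) mod a" for c using that(2) by (metis mod_add_right_eq)
    then show ?thesis using that(1) by (auto simp: H_def)
  qed
  have gcd: "gcd x y \<in> H" if xy: "x \<in> H" "y \<in> H" for x y
  proof (cases "x = 0")
    case True then show ?thesis using xy by simp
  next
    case False
    then obtain u v where uv: "x * u = y * v + gcd x y" using bezout_nat by blast
    have "u * x + ((a - 1) * v) * y \<in> H" by (intro add mult xy)
    moreover have "u * x + ((a - 1) * v) * y = gcd x y + a * (v * y)"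
    proof -
      have "v * y + ((a - 1) * v) * y = a * (v * y)"
        using a by (cases a) (auto simp: algebra_simps)
      then show ?thesis using uv by (simp add: algebra_simps)
    qed
    ultimately show ?thesis by (auto intro: cong)
  qed
  have "Gcd F \<in> H" using F inv
  proof (induction F rule: finite_induct)
    case empty then show ?case using zero by simp
  next
    case (insert x F)
    then have "x \<in> H" by (auto simp: H_def)
    then show ?case using insert gcd by auto
  qed
  then show ?thesis using c by (auto simp: H_def)
qed

text \<open>By \<open>e_transform_growth\<close> two further summands gain \<open>card B\<close>
  residues. This is why the number of summands is odd and why about \<open>2 * a / card B\<close> of
  them reach every residue.\<close>

lemma residues_of_multisums:
  fixes a :: nat
  assumes a: "0 < a" and B: "B \<subseteq> {..<a}" "0 \<in> B"
    and gen: "\<And>C. C \<subseteq> {..<a} \<Longrightarrow> C \<noteq> {} \<Longrightarrow> msum a C B \<subseteq> C \<Longrightarrow> C = {..<a}"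
  shows "min a ((j + 1) * card B) \<le>
    card {\<Sum>\<^sub># M mod a | M. size M = 2 * j + 1 \<and> set_mset M \<subseteq> B}"
    (is "_ \<le> card (?T j)")
proof (induction j)
  case 0
  have "B \<subseteq> ?T 0"
  proof
    fix b assume b: "b \<in> B"
    then have "size {#b#} = 2 * 0 + 1 \<and> set_mset {#b#} \<subseteq> B" "b = \<Sum>\<^sub># {#b#} mod a" using B by auto
    then show "b \<in> ?T 0" by blast
  qed
  then have "card B \<le> card (?T 0)"
    using a by (intro card_mono) (auto intro: finite_subset[of _ "{..<a}"])
  then show ?case by simp
next
  case (Suc j)
  have sub: "?T j \<subseteq> {..<a}" for j using a by auto
  have "\<Sum>\<^sub># (replicate_mset (2 * j + 1) (0::nat)) mod a \<in> ?T j"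
    using B by (intro CollectI exI[of _ "replicate_mset (2 * j + 1) 0"]) (auto split: if_splits)
  then have "?T j \<noteq> {}" by blast
  from e_transform_growth[OF a sub this B gen]
  have "min a (card (?T j) + card B) \<le> card (msum a (msum a (?T j) B) B)" by blast
  also have "\<dots> \<le> card (?T (Suc j))"
  proof (intro card_mono)
    show "finite (?T (Suc j))" by (rule finite_subset[OF sub]) simp
    show "msum a (msum a (?T j) B) B \<subseteq> ?T (Suc j)"
    proof
      fix z assume "z \<in> msum a (msum a (?T j) B) B"
      then obtain M b b' where M: "size M = 2 * j + 1" "set_mset M \<subseteq> B" "b \<in> B" "b' \<in> B"
        and z: "z = ((\<Sum>\<^sub># M mod a + b) mod a + b') mod a" by (auto simp: msum_def)
      have "z = \<Sum>\<^sub># (add_mset b (add_mset b' M)) mod a" by (simp add: z mod_simps ac_simps)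
      then show "z \<in> ?T (Suc j)" using M
        by (intro CollectI exI[of _ "add_mset b (add_mset b' M)"]) auto
    qed
  qed
  finally show ?case using Suc by auto
qed

text \<open>After division by \<open>q\<close> the largest element is zero modulo \<open>a\<close>.
  About \<open>2 * a / card B\<close> summands reach the residue of \<open>y\<close>, and copies of
  the maximum, which leave the residue alone, fill up to \<open>y\<close> itself. The lower bound on
  \<open>y\<close> prevents the first summands from overshooting.\<close>

lemma multisums_cover:
  fixes B :: "nat set"
  assumes B: "finite B" "B \<noteq> {}" "0 \<notin> B"
    and q: "q = Gcd B" and a: "a = Max B div q" and h0: "h0 = 2 * (a div card B) + 1"
    and y: "h0 * a \<le> y" "y \<le> J * a"
  shows "\<exists>M. size M \<le> h0 + J \<and> set_mset M \<subseteq> B \<and> \<Sum>\<^sub># M = q * y"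
proof -
  have mx: "Max B \<in> B" using B by simp
  have q0: "0 < q" using B mx q by (metis Gcd_0_iff bot_nat_0.not_eq_extremum singletonD subsetD)
  have qd: "q dvd b" if "b \<in> B" for b using that q by simp
  have aq: "a * q = Max B" using qd[OF mx] a by simp
  have a0: "0 < a" using aq mx B by (metis gr0I mult_zero_left)
  define B1 where "B1 = (\<lambda>b. b div q) ` B"
  have inj: "inj_on (\<lambda>b. b div q) B" by (rule inj_onI) (metis qd dvd_div_mult_self)
  have cB1: "card B1 = card B" using inj by (simp add: B1_def card_image)
  have B1_pos: "0 < b" "b \<le> a" if "b \<in> B1" for b
  proof -
    from that obtain c where c: "c \<in> B" "b = c div q" by (auto simp: B1_def)
    then show "b \<le> a" using B a by (simp add: div_le_mono)
    show "0 < b" using c qd[OF c(1)] B by (metis dvd_div_mult_self gr0I mult_zero_left)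
  qed
  have aB1: "a \<in> B1" using mx a by (auto simp: B1_def)
  have gcd1: "Gcd B1 = 1"
  proof -
    have "q * Gcd B1 dvd Gcd B"
    proof (rule Gcd_greatest)
      fix b assume b: "b \<in> B"
      then have "Gcd B1 dvd b div q" by (auto simp: B1_def)
      then show "q * Gcd B1 dvd b" using qd[OF b] q0
        by (metis dvd_div_mult_self mult.commute mult_dvd_mono dvd_refl)
    qed
    then have "q * Gcd B1 dvd q * 1" using q by simp
    then show ?thesis using q0 by (metis dvd_times_left_cancel_iff nat_dvd_1_iff_1 neq0_conv)
  qed
  \<comment> \<open>\<open>a\<close> is replaced by the congruent \<open>0\<close>, so that sums
    with fewer proper summands also count as sums of exactly \<open>h0\<close>.\<close>
  define B2 where "B2 = insert 0 (B1 - {a})"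
  have finB1: "finite B1" using B by (simp add: B1_def)
  have "b < a" if "b \<in> B1 - {a}" for b
    using that B1_pos(2)[of b] by simp
  then have B2: "B2 \<subseteq> {..<a}" "0 \<in> B2"
    using a0 unfolding B2_def by blast+
  have cB2: "card B2 = card B"
  proof -
    have "0 \<notin> B1 - {a}" using B1_pos by auto
    then have "card B2 = Suc (card (B1 - {a}))" using finB1 by (simp add: B2_def)
    also have "\<dots> = card B1" using finB1 aB1 by (metis card_Suc_Diff1)
    finally show ?thesis using cB1 by simp
  qed
  have gen: "C = {..<a}" if C: "C \<subseteq> {..<a}" "C \<noteq> {}" "msum a C B2 \<subseteq> C" for C
  proof -
    have "(c + z) mod a \<in> C" if "z \<in> B1" "c \<in> C" for z c
    proof (cases "z = a")
      case True then show ?thesis using that C by (auto simp: subset_iff)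
    next
      case False then show ?thesis using that C using msumI[of c C z B2 a] by (auto simp: B2_def)
    qed
    from mod_invariant_Gcd[OF a0 finB1 this C(1)] gcd1
    have step: "(c + 1) mod a \<in> C" if "c \<in> C" for c using that by simp
    from C obtain c where c: "c \<in> C" by blast
    have all: "(c + k) mod a \<in> C" for k
    proof (induction k)
      case 0 then show ?case using c C by auto
    next
      case (Suc k)
      have "(c + Suc k) mod a = ((c + k) mod a + 1) mod a" by (simp add: mod_simps)
      then show ?case using step[OF Suc] by simp
    qed
    have "x \<in> C" if "x < a" for x
    proof -
      have "c < a" using c C by auto
      then have "(c + (x + (a - c))) mod a = x" using that by simp
      then show ?thesis using all[of "x + (a - c)"] by simp
    qed
    then show ?thesis using C by auto
  qed
  let ?j = "a div card B"
  let ?T = "{\<Sum>\<^sub># M mod a | M. size M = 2 * ?j + 1 \<and> set_mset M \<subseteq> B2}"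
  have "a \<le> (?j + 1) * card B"
    using B by (metis add.commute card_gt_0_iff dividend_less_times_div less_or_eq_imp_le
        mult.commute mult_Suc_right plus_1_eq_Suc)
  then have "a \<le> card ?T"
    using residues_of_multisums[OF a0 B2 gen, of ?j] cB2 by simp
  moreover have "?T \<subseteq> {..<a}" using a0 by auto
  ultimately have "?T = {..<a}"
    by (metis (no_types, lifting) card_lessThan card_seteq finite_lessThan)
  moreover have "y mod a < a" using a0 by simp
  ultimately obtain M where M: "size M = h0" "set_mset M \<subseteq> B2" "\<Sum>\<^sub># M mod a = y mod a"
    unfolding h0 by (smt (verit) lessThan_iff mem_Collect_eq)
  have "\<Sum>\<^sub># M \<le> size M * a"
    using M(2) B2(1)
  proof (induction M)
    case (add x M) then show ?case by (auto intro!: add_mono dest: less_imp_le)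
  qed simp
  then have le: "\<Sum>\<^sub># M \<le> y" using M y by simp
  then obtain k where k: "y = \<Sum>\<^sub># M + a * k" using M(3) by (metis mod_eq_nat2E)
  have kJ: "k \<le> J"
  proof -
    have "a * k \<le> J * a" using k y(2) by linarith
    then show ?thesis using a0 by (metis mult.commute mult_le_cancel1)
  qed
  \<comment> \<open>The zeros contribute nothing and are dropped; \<open>k\<close> copies of
    \<open>a\<close> supply the multiple of \<open>a\<close> that is still missing.\<close>
  define M1 where "M1 = filter_mset (\<lambda>x. x \<noteq> 0) M + replicate_mset k a"
  have sumM: "\<Sum>\<^sub># (filter_mset ((<) 0) M) = \<Sum>\<^sub># M" by (induction M) auto
  have M1: "size M1 \<le> h0 + J" "set_mset M1 \<subseteq> B1" "\<Sum>\<^sub># M1 = y"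
    using M(1,2) kJ aB1 size_filter_mset_lesseq[of "\<lambda>x. x \<noteq> 0" M]
    by (auto simp: M1_def k sumM B2_def add_mono sum_mset_replicate_mset)
  show ?thesis
  proof (intro exI[of _ "image_mset ((*) q) M1"] conjI)
    show "set_mset (image_mset ((*) q) M1) \<subseteq> B"
      using M1(2) qd by (fastforce simp: B1_def)
    show "\<Sum>\<^sub># (image_mset ((*) q) M1) = q * y"
      using sum_mset_distrib_left[of q "\<lambda>x. x" M1] M1(3) by simp
  qed (use M1 in simp)
qed

section \<open>Representations and residues of subset sums\<close>

text \<open>For fixed \<open>b\<close> each \<open>v\<close> has just one partner, so the minima add
  up to the largest number of disjoint pairs with sum \<open>b\<close>.\<close>

definition reps :: "nat multiset \<Rightarrow> nat multiset \<Rightarrow> nat \<Rightarrow> nat" where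
  "reps A1 A2 b = (\<Sum>v\<le>b. min (count A1 v) (count A2 (b - v)))"

lemma reps_remove_left: "reps A1 A2 b \<le> reps (A1 - {#x#}) A2 b + 1"
proof -
  have "reps A1 A2 b \<le> (\<Sum>v\<le>b. min (count (A1 - {#x#}) v) (count A2 (b - v)) + of_bool (v = x))"
    unfolding reps_def by (intro sum_mono) auto
  also have "\<dots> \<le> reps (A1 - {#x#}) A2 b + 1"
    by (auto simp: reps_def sum.distrib of_bool_def)
  finally show ?thesis .
qed

lemma reps_remove_right: "reps A1 A2 b \<le> reps A1 (A2 - {#x#}) b + 1"
proof -
  have "reps A1 A2 b \<le>
      (\<Sum>v\<le>b. min (count A1 v) (count (A2 - {#x#}) (b - v)) + of_bool (v = b - x))"
    unfolding reps_def by (intro sum_mono) auto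
  also have "\<dots> \<le> reps A1 (A2 - {#x#}) b + 1"
    by (auto simp: reps_def sum.distrib of_bool_def)
  finally show ?thesis .
qed

text \<open>An element lies in at most one of the disjoint pairs for \<open>b\<close>, so its
  removal costs at most one.\<close>

lemma reps_diff: "reps A1 A2 b \<le> reps (A1 - Y1) (A2 - Y2) b + (size Y1 + size Y2)"
proof -
  have 1: "reps A1 A2 b \<le> reps (A1 - Y1) A2 b + size Y1" for A1
  proof (induction Y1 arbitrary: A1)
    case (add x Y1)
    have "A1 - add_mset x Y1 = (A1 - {#x#}) - Y1" by simp
    then show ?case using add[of "A1 - {#x#}"] reps_remove_left[of A1 A2 b x] by simp
  qed simp
  have 2: "reps A1 A2 b \<le> reps A1 (A2 - Y2) b + size Y2" for A1
  proof (induction Y2 arbitrary: A2)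
    case (add x Y2)
    have "A2 - add_mset x Y2 = (A2 - {#x#}) - Y2" by simp
    then show ?case using add[of "A2 - {#x#}"] reps_remove_right[of A1 A2 b x] by simp
  qed simp
  show ?thesis using 1[of A1] 2[of "A1 - Y1"] by linarith
qed

text \<open>Greedy choice: serving one summand deletes two elements and lowers every other count by
  at most two, hence the factor 2 in the hypothesis.\<close>

lemma reps_realize:
  "(\<And>b. b \<in># bs \<Longrightarrow> 2 * size bs \<le> reps A1 A2 b) \<Longrightarrow>
    \<exists>Z1 Z2. Z1 \<subseteq># A1 \<and> Z2 \<subseteq># A2 \<and> \<Sum>\<^sub># Z1 + \<Sum>\<^sub># Z2 = \<Sum>\<^sub># bs"
proof (induction bs arbitrary: A1 A2)
  case empty
  show ?case by (intro exI[of _ "{#}"]) simp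
next
  case (add b bs)
  have "0 < reps A1 A2 b" using add.prems[of b] by simp
  then have "\<not> (\<forall>v\<in>{..b}. min (count A1 v) (count A2 (b - v)) = 0)"
    using sum.neutral[of "{..b}" "\<lambda>v. min (count A1 v) (count A2 (b - v))"]
    unfolding reps_def by linarith
  then obtain v where "v \<in> {..b}" "min (count A1 v) (count A2 (b - v)) \<noteq> 0" by blast
  then have v: "v \<le> b" "0 < min (count A1 v) (count A2 (b - v))" by simp_all
  then have v_in: "v \<in># A1" "b - v \<in># A2" by simp_all
  have "2 * size bs \<le> reps (A1 - {#v#}) (A2 - {#b - v#}) b'" if "b' \<in># bs" for b'
    using add.prems[of b'] reps_diff[of A1 A2 b' "{#v#}" "{#b - v#}"] that by simp
  from add.IH[OF this] obtain Z1 Z2 where Z: "Z1 \<subseteq># A1 - {#v#}" "Z2 \<subseteq># A2 - {#b - v#}"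
    "\<Sum>\<^sub># Z1 + \<Sum>\<^sub># Z2 = \<Sum>\<^sub># bs" by blast
  then have "add_mset v Z1 \<subseteq># A1" "add_mset (b - v) Z2 \<subseteq># A2"
    using v_in by (metis insert_DiffM mset_subset_eq_add_mset_cancel)+
  moreover have "\<Sum>\<^sub># (add_mset v Z1) + \<Sum>\<^sub># (add_mset (b - v) Z2) = \<Sum>\<^sub># (add_mset b bs)"
    using Z(3) v(1) by simp
  ultimately show ?case by blast
qed

lemma size_eq_sum_count:
  assumes "\<And>x. x \<in># A \<Longrightarrow> x \<le> (m::nat)"
  shows "size A = (\<Sum>v\<le>m. count A v)"
  unfolding size_multiset_overloaded_eq
  using assms by (intro sum.mono_neutral_left) (auto simp: not_in_iff)

text \<open>All pairs are counted by their sum; \<open>p * p' \<le> \<mu> * min p p'\<close> turns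
  products of multiplicities into numbers of disjoint pairs at the price of one factor
  \<mu>.\<close>

lemma sum_reps_ge:
  assumes m: "\<And>x. x \<in># A1 \<Longrightarrow> x \<le> m" "\<And>x. x \<in># A2 \<Longrightarrow> x \<le> m"
    and mu: "\<And>x. count A1 x \<le> \<mu>" "\<And>x. count A2 x \<le> \<mu>"
  shows "size A1 * size A2 \<le> \<mu> * (\<Sum>b\<le>2 * m. reps A1 A2 b)"
proof -
  have le: "p * p' \<le> \<mu> * min p p'" if "p \<le> \<mu>" "p' \<le> \<mu>" for p p'
    using that by (auto simp: min_def mult.commute)
  have "size A1 * size A2 = (\<Sum>v\<le>m. \<Sum>u\<le>m. count A1 v * count A2 u)"
    using m by (simp add: size_eq_sum_count[of _ m] sum_product)
  also have "\<dots> \<le> (\<Sum>v\<le>m. \<Sum>u\<le>m. \<mu> * min (count A1 v) (count A2 u))"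
    by (intro sum_mono le mu)
  also have "\<dots> = \<mu> * (\<Sum>(v, u) \<in> {..m} \<times> {..m}. min (count A1 v) (count A2 u))"
    by (simp add: sum_distrib_left sum.cartesian_product split_def)
  also have "(\<Sum>(v, u) \<in> {..m} \<times> {..m}. min (count A1 v) (count A2 u)) =
      (\<Sum>(b, v) \<in> (\<lambda>(v, u). (v + u, v)) ` ({..m} \<times> {..m}). min (count A1 v) (count A2 (b - v)))"
    by (subst sum.reindex) (auto simp: inj_on_def intro!: sum.cong)
  also have "\<dots> \<le> (\<Sum>(b, v) \<in> (SIGMA b:{..2 * m}. {..b}). min (count A1 v) (count A2 (b - v)))"
    by (intro sum_mono2) auto
  also have "\<dots> = (\<Sum>b\<le>2 * m. reps A1 A2 b)"
    by (simp add: reps_def sum.Sigma)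
  finally show ?thesis by simp
qed

lemma reps_le: "reps A1 A2 b \<le> size A1"
proof -
  have "reps A1 A2 b \<le> (\<Sum>v\<le>b. count A1 v)" unfolding reps_def by (intro sum_mono) auto
  also have "\<dots> = (\<Sum>v\<in>{..b} \<inter> set_mset A1. count A1 v)"
    by (intro sum.mono_neutral_right) (auto simp: not_in_iff)
  also have "\<dots> \<le> (\<Sum>v\<in>set_mset A1. count A1 v)" by (intro sum_mono2) auto
  finally show ?thesis by (simp add: size_multiset_overloaded_eq)
qed

section \<open>Popular sums by layers\<close>

lemma harmonic_le_log:
  assumes "1 \<le> R"
  shows "(\<Sum>h=1..R. 1 / real h) \<le> log 2 (2 * real R)"
  using assms
proof (induction R rule: dec_induct)
  case base then show ?case by simp
next
  case (step R)
  have "ln (real R / real (Suc R)) \<le> real R / real (Suc R) - 1"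
    using step by (intro ln_le_minus_one) auto
  also have "\<dots> = - (1 / real (Suc R))" by (simp add: field_simps)
  finally have 1: "1 / real (Suc R) \<le> ln (real (Suc R)) - ln (real R)"
    using step by (simp add: ln_div)
  have "ln (2::real) \<le> 1" using ln_le_minus_one[of 2] by simp
  moreover have "0 \<le> ln (real (Suc R)) - ln (real R)" using step by simp
  ultimately have "ln (real (Suc R)) - ln (real R) \<le> (ln (real (Suc R)) - ln (real R)) / ln 2"
    by (simp add: le_divide_eq mult_left_le)
  also have "\<dots> = log 2 (2 * real (Suc R)) - log 2 (2 * real R)"
  proof -
    have "log 2 (2 * x) = 1 + ln x / ln 2" if "0 < x" for x :: real
      using that by (simp add: log_mult) (simp add: log_def)
    then show ?thesis using step(1) by (simp add: diff_divide_distrib del: of_nat_Suc)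
  qed
  finally show ?case using 1 step.IH by simp
qed

lemma layer_cake:
  fixes r :: "'a \<Rightarrow> nat"
  assumes "finite S" "\<And>b. b \<in> S \<Longrightarrow> r b \<le> R"
  shows "(\<Sum>b\<in>S. r b) = (\<Sum>h=1..R. card {b \<in> S. h \<le> r b})"
proof -
  have "r b = (\<Sum>h=1..R. of_bool (h \<le> r b))" if "b \<in> S" for b
  proof -
    have "{1..R} \<inter> {h. h \<le> r b} = {1..r b}" using assms(2)[OF that] by auto
    then show ?thesis by simp
  qed
  then have "(\<Sum>b\<in>S. r b) = (\<Sum>b\<in>S. \<Sum>h=1..R. of_bool (h \<le> r b))"
    by (intro sum.cong) auto
  also have "\<dots> = (\<Sum>h=1..R. \<Sum>b\<in>S. of_bool (h \<le> r b))" by (rule sum.swap)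
  also have "\<dots> = (\<Sum>h=1..R. card {b \<in> S. h \<le> r b})"
    using assms(1) by (intro sum.cong) (auto simp: Int_def)
  finally show ?thesis .
qed

text \<open>If every level set were smaller, the layer-cake sum would stay below
  \<open>W / 2 + W / 2\<close>: the first terms add up to at most \<open>W / 2\<close> by the
  harmonic sum, the second ones to \<open>W / 2\<close>. Both lower bounds are used later, the first
  to trade representations against the size of the popular set, the second for the size
  alone.\<close>

lemma popular_level:
  fixes r :: "'a \<Rightarrow> nat"
  assumes S: "finite S" "\<And>b. b \<in> S \<Longrightarrow> r b \<le> R" and R: "1 \<le> R"
    and W: "W \<le> real (\<Sum>b\<in>S. r b)" "0 \<le> W"
  shows "\<exists>h\<ge>1. W / (2 * real h * log 2 (2 * real R)) + W / (2 * real R)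
           \<le> real (card {b \<in> S. h \<le> r b})"
proof (rule ccontr)
  let ?l = "log 2 (2 * real R)"
  have l: "0 < ?l" using R by simp
  assume "\<not> ?thesis"
  then have less: "real (card {b \<in> S. h \<le> r b}) < W / (2 * real h * ?l) + W / (2 * real R)"
    if "h \<ge> 1" for h using that by (meson not_le)
  have "real (\<Sum>b\<in>S. r b) = (\<Sum>h=1..R. real (card {b \<in> S. h \<le> r b}))"
    using layer_cake[OF S] by simp
  also have "\<dots> < (\<Sum>h=1..R. W / (2 * real h * ?l) + W / (2 * real R))"
    using less R by (intro sum_strict_mono) auto
  also have "\<dots> = (\<Sum>h=1..R. W / (2 * ?l) * (1 / real h) + W / (2 * real R))"
    by (intro sum.cong) auto
  also have "\<dots> = W / (2 * ?l) * (\<Sum>h=1..R. 1 / real h) + W / 2"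
    unfolding sum.distrib sum_distrib_left[symmetric] using R by simp
  also have "\<dots> \<le> W / (2 * ?l) * ?l + W / 2"
    using harmonic_le_log[OF R] W l by (intro add_mono mult_left_mono) auto
  also have "\<dots> = W" using l by simp
  finally show False using W by simp
qed

section \<open>Zero-sum blocks and residues modulo a number\<close>

lemma zero_sum_submultiset:
  assumes q: "0 < (q::nat)" "q \<le> size M"
  shows "\<exists>W. W \<subseteq># M \<and> W \<noteq> {#} \<and> size W \<le> q \<and> q dvd \<Sum>\<^sub># W"
proof -
  obtain xs where xs: "mset xs = M" by (metis ex_mset)
  let ?f = "\<lambda>i. sum_list (take i xs) mod q"
  \<comment> \<open>Pigeonhole: there are \<open>q + 1\<close> prefix sums and \<open>q\<close>
    residues. The segment between two equal ones has sum zero modulo \<open>q\<close>.\<close>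
  have "?f ` {..q} \<subseteq> {..<q}" using q by auto
  then have "card (?f ` {..q}) \<le> q" by (metis card_lessThan card_mono finite_lessThan)
  then have "\<not> inj_on ?f {..q}" using card_image[of ?f "{..q}"] by fastforce
  then obtain i j where ij: "i < j" "j \<le> q" "?f i = ?f j"
    unfolding inj_on_def by (metis atMost_iff linorder_neqE_nat)
  define ys where "ys = take (j - i) (drop i xs)"
  have take_j: "take j xs = take i xs @ ys"
    using take_add[of i "j - i" xs] ij(1) by (simp add: ys_def)
  have len: "length ys = j - i" using ij q xs by (auto simp: ys_def)
  have "q dvd sum_list (take j xs) - sum_list (take i xs)"
    using ij(3) take_j by (metis le_add1 mod_eq_dvd_iff_nat sum_list_append)
  then have "q dvd \<Sum>\<^sub># (mset ys)" using take_j by (simp add: sum_mset_sum_list)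
  moreover have "mset ys \<subseteq># M"
  proof -
    have "M = mset (take j xs) + mset (drop j xs)"
      using xs by (metis append_take_drop_id mset_append)
    then have "M = mset ys + (mset (take i xs) + mset (drop j xs))"
      using take_j by simp
    then show ?thesis by (metis mset_subset_eq_add_left)
  qed
  moreover have "mset ys \<noteq> {#}" using len ij by auto
  moreover have "size (mset ys) \<le> q" using len ij by auto
  ultimately show ?thesis by blast
qed

lemma mset_subset_eq_add_split:
  assumes "Z \<subseteq># M + N"
  shows "\<exists>Z1 Z2. Z = Z1 + Z2 \<and> Z1 \<subseteq># M \<and> Z2 \<subseteq># N"
proof -
  have "Z = Z \<inter># M + (Z - M)" by (auto simp: multiset_eq_iff)
  moreover have "Z - M \<subseteq># N" using assms by (simp add: subset_eq_diff_conv add.commute)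
  moreover have "Z \<inter># M \<subseteq># M" by simp
  ultimately show ?thesis by blast
qed

text \<open>Add the elements one at a time. If each non-multiple of \<open>q\<close> enlarges the
  set of sums modulo \<open>q\<close>, then \<open>q - 1\<close> of them fill it. Otherwise some
  \<open>x\<close> leaves it unchanged, so the set is invariant under \<open>x\<close> and hence
  under \<open>gcd x q\<close>, a proper divisor of \<open>q\<close>; the induction hypothesis
  reaches every class of that divisor.\<close>

lemma subset_sums_mod_complete:
  assumes "0 < (q::nat)"
    and "\<And>g. g dvd q \<Longrightarrow> 1 < g \<Longrightarrow> g \<le> size {#x \<in># M. \<not> g dvd x#} + 1"
  shows "\<exists>Z. Z \<subseteq># M \<and> \<Sum>\<^sub># Z mod q = r mod q"
  using assms
proof (induction q arbitrary: r rule: less_induct)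
  case (less q)
  define S where "S N = {\<Sum>\<^sub># Z mod q | Z. Z \<subseteq># N}" for N
  have Sq: "S N \<subseteq> {..<q}" for N using less.prems by (auto simp: S_def)
  then have finS: "finite (S N)" for N by (rule finite_subset) simp
  have mono: "S N \<subseteq> S (add_mset x N)" for N x
  proof -
    have "Z \<subseteq># add_mset x N" if "Z \<subseteq># N" for Z
      using that by (simp add: subset_mset.order_trans[of _ N])
    then show ?thesis unfolding S_def by blast
  qed
  have goal: ?case if "r mod q \<in> S M" using that by (auto simp: S_def)
  consider (grow) "\<And>N x. add_mset x N \<subseteq># M \<Longrightarrow> \<not> q dvd x \<Longrightarrow> S (add_mset x N) \<noteq> S N"
    | (stab) N x where "add_mset x N \<subseteq># M" "\<not> q dvd x" "S (add_mset x N) = S N" by blast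
  then show ?case
  proof cases
    case grow
    have "size {#x \<in># N. \<not> q dvd x#} + 1 \<le> card (S N)" if "N \<subseteq># M" for N
      using that
    proof (induction N)
      case empty
      have "0 \<in> S {#}" by (auto simp: S_def)
      then have "S {#} \<noteq> {}" by blast
      then have "0 < card (S {#})" using finS card_gt_0_iff by blast
      then show ?case by simp
    next
      case (add x N)
      have le: "card (S N) \<le> card (S (add_mset x N))" by (intro card_mono finS mono)
      have "N \<subseteq># M" using add.prems by (metis mset_subset_eq_insertD subset_mset.less_imp_le)
      then show ?case
        using add le psubset_card_mono[OF finS, of "S N" "add_mset x N"] mono[of N x] grow[of x N]
        by (cases "q dvd x") (auto simp: psubset_eq)
    qed
    from this[of M] have "q \<le> card (S M)"
      using less.prems(2)[of q] less.prems(1) by (cases "q = 1") auto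
    then have "S M = {..<q}" using Sq by (metis card_lessThan card_seteq finite_lessThan)
    then show ?thesis using less.prems by (intro goal) simp
  next
    case stab
    obtain N' where N': "M = N + N'" using stab(1)
      by (metis add_mset_add_single mset_subset_eq_exists_conv union_assoc)
    have inv: "(s + x) mod q \<in> S M" if s: "s \<in> S M" for s
    proof -
      obtain Z where Z: "Z \<subseteq># M" "s = \<Sum>\<^sub># Z mod q" using s by (auto simp: S_def)
      then obtain Z1 Z2 where Z12: "Z = Z1 + Z2" "Z1 \<subseteq># N" "Z2 \<subseteq># N'"
        using mset_subset_eq_add_split N' by blast
      have "\<Sum>\<^sub># (add_mset x Z1) mod q \<in> S (add_mset x N)"
        using Z12 unfolding S_def by (metis (mono_tags, lifting) mem_Collect_eq mset_subset_eq_add_mset_cancel)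
      then obtain Z1' where Z1': "Z1' \<subseteq># N" "\<Sum>\<^sub># (add_mset x Z1) mod q = \<Sum>\<^sub># Z1' mod q"
        using stab by (auto simp: S_def)
      have "(s + x) mod q = (\<Sum>\<^sub># (add_mset x Z1) mod q + \<Sum>\<^sub># Z2) mod q"
        using Z Z12 by (simp add: mod_simps ac_simps)
      also have "\<dots> = \<Sum>\<^sub># (Z1' + Z2) mod q" unfolding Z1'(2) by (simp add: mod_simps)
      finally show ?thesis using Z1' Z12 N' unfolding S_def
        by (metis (mono_tags, lifting) mem_Collect_eq subset_mset.add_mono)
    qed
    define g where "g = gcd x q"
    have g: "g dvd q" "g < q" "0 < g"
    proof -
      show "g dvd q" "0 < g" using less.prems(1) by (simp_all add: g_def)
      have "g \<noteq> q" using stab(2) gcd_dvd1[of x q] unfolding g_def by metis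
      then show "g < q" using gcd_le2_nat[of q x] less.prems(1) unfolding g_def by linarith
    qed
    have step: "(s + g) mod q \<in> S M" if "s \<in> S M" for s
    proof -
      have "(c + z) mod q \<in> S M" if "z \<in> {x, q}" "c \<in> S M" for z c
        using that inv Sq[of M] by auto
      from mod_invariant_Gcd[OF less.prems(1) _ this Sq \<open>s \<in> S M\<close>, of "{x, q}"]
      show ?thesis by (simp add: g_def)
    qed
    have steps: "(s + k * g) mod q \<in> S M" if "s \<in> S M" for s k
    proof (induction k)
      case 0 then show ?case using that Sq[of M] by auto
    next
      case (Suc k)
      have "(s + Suc k * g) mod q = ((s + k * g) mod q + g) mod q" by (simp add: mod_simps ac_simps)
      then show ?case using step[OF Suc] by simp
    qed
    obtain Z where Z: "Z \<subseteq># M" "\<Sum>\<^sub># Z mod g = r mod g"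
      using less.IH[OF g(2,3), of r] less.prems(2) g(1) dvd_trans by blast
    \<comment> \<open>The multiple of \<open>q\<close> keeps the difference to the sum of
      \<open>Z\<close> from being truncated.\<close>
    have "r mod g = (r + q * \<Sum>\<^sub># Z) mod g" using g(1) by (auto simp: mult.assoc)
    moreover have "\<Sum>\<^sub># Z \<le> r + q * \<Sum>\<^sub># Z" using less.prems by (simp add: trans_le_add2)
    ultimately obtain k where k: "r + q * \<Sum>\<^sub># Z = \<Sum>\<^sub># Z + g * k"
      using mod_eq_nat2E[of "\<Sum>\<^sub># Z" g "r + q * \<Sum>\<^sub># Z"] Z(2) by auto
    have "(\<Sum>\<^sub># Z mod q + k * g) mod q \<in> S M" using Z(1) by (intro steps) (auto simp: S_def)
    moreover have "(\<Sum>\<^sub># Z mod q + k * g) mod q = r mod q"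
    proof -
      have "(\<Sum>\<^sub># Z mod q + k * g) mod q = (r + q * \<Sum>\<^sub># Z) mod q"
        unfolding k by (simp add: mod_simps mult.commute)
      then show ?thesis by simp
    qed
    ultimately show ?thesis by (intro goal) simp
  qed
qed

text \<open>Deleting zero-sum blocks keeps the residue, and is possible as long as \<open>q\<close>
  elements are left.\<close>

lemma small_residue_representative:
  assumes "0 < (q::nat)" "Z \<subseteq># M"
  shows "\<exists>Z'. Z' \<subseteq># M \<and> size Z' < q \<and> \<Sum>\<^sub># Z' mod q = \<Sum>\<^sub># Z mod q"
  using assms(2)
proof (induction "size Z" arbitrary: Z rule: less_induct)
  case less
  show ?case
  proof (cases "size Z < q")
    case True then show ?thesis using less.prems by blast
  next
    case False
    then obtain W where W: "W \<subseteq># Z" "W \<noteq> {#}" "q dvd \<Sum>\<^sub># W"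
      using zero_sum_submultiset[of q Z] assms by auto
    then have ZW: "Z = (Z - W) + W" by simp
    have "size (Z - W) < size Z" using W by (metis ZW less_add_same_cancel1 nonempty_has_size size_union)
    moreover have "Z - W \<subseteq># M" using less.prems by (meson diff_subset_eq_self subset_mset.order_trans)
    ultimately obtain Z' where "Z' \<subseteq># M" "size Z' < q" "\<Sum>\<^sub># Z' mod q = \<Sum>\<^sub># (Z - W) mod q"
      using less.hyps by blast
    moreover have "\<Sum>\<^sub># Z mod q = \<Sum>\<^sub># (Z - W) mod q"
      using W(3) by (metis ZW dvd_imp_mod_0 mod_add_right_eq add_0_right sum_mset.union)
    ultimately show ?thesis by auto
  qed
qed

lemma sum_mset_le:
  assumes "\<And>x. x \<in># M \<Longrightarrow> x \<le> (m::nat)"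
  shows "\<Sum>\<^sub># M \<le> size M * m"
  using assms by (induction M) (auto intro: add_mono)

text \<open>Take a largest submultiset with a divisible sum up to \<open>u\<close>. If
  \<open>q\<close> elements remain, they contain a zero-sum block of at most \<open>q\<close>
  elements, which no longer fits; if fewer remain, nearly everything has been taken. Either way at
  most \<open>q * m\<close> is missing.\<close>

lemma greedy_divisible_sum:
  assumes q: "0 < (q::nat)" and m: "\<And>x. x \<in># G \<Longrightarrow> x \<le> m"
  shows "\<exists>Z. Z \<subseteq># G \<and> q dvd \<Sum>\<^sub># Z \<and> \<Sum>\<^sub># Z \<le> u \<and>
    (u < \<Sum>\<^sub># Z + q * m \<or> \<Sum>\<^sub># G \<le> \<Sum>\<^sub># Z + q * m)"
proof -
  let ?P = "\<lambda>Z. Z \<subseteq># G \<and> q dvd \<Sum>\<^sub># Z \<and> \<Sum>\<^sub># Z \<le> u"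
  have "?P {#}" by simp
  moreover have "\<forall>Z. ?P Z \<longrightarrow> size Z < size G + 1" using size_mset_mono by fastforce
  ultimately obtain Z where Z: "?P Z" and max: "\<And>Z'. ?P Z' \<Longrightarrow> size Z' \<le> size Z"
    using ex_has_greatest_nat[of ?P "{#}" size "size G + 1"] by blast
  have G: "G = Z + (G - Z)" using Z by simp
  have m': "x \<le> m" if "x \<in># G - Z" for x using m that by (meson in_diffD)
  show ?thesis
  proof (cases "q \<le> size (G - Z)")
    case True
    then obtain W where W: "W \<subseteq># G - Z" "W \<noteq> {#}" "size W \<le> q" "q dvd \<Sum>\<^sub># W"
      using zero_sum_submultiset[OF q] by blast
    have "\<not> ?P (Z + W)" using max[of "Z + W"] W(2) by auto
    moreover have "Z + W \<subseteq># G" using W(1) G by (metis mset_subset_eq_mono_add_left_cancel)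
    ultimately have "u < \<Sum>\<^sub># Z + \<Sum>\<^sub># W" using Z W(4) by auto
    moreover have "\<Sum>\<^sub># W \<le> size W * m"
      using m' W(1) by (intro sum_mset_le) (meson mset_subset_eqD)
    moreover have "size W * m \<le> q * m" using W(3) by simp
    ultimately have "u < \<Sum>\<^sub># Z + q * m" by linarith
    then show ?thesis using Z by blast
  next
    case False
    have "\<Sum>\<^sub># (G - Z) \<le> size (G - Z) * m" using m' by (intro sum_mset_le)
    also have "\<dots> \<le> q * m" using False by simp
    finally have "\<Sum>\<^sub># G \<le> \<Sum>\<^sub># Z + q * m" by (metis G add_left_mono sum_mset.union)
    then show ?thesis using Z by blast
  qed
qed

section \<open>Subset sums of dense multisets\<close>

lemma ex_submultiset_size:
  assumes "k \<le> size M"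
  shows "\<exists>A. A \<subseteq># M \<and> size A = k"
proof -
  obtain xs where xs: "mset xs = M" by (metis ex_mset)
  then have "M = mset (take k xs) + mset (drop k xs)" by (metis append_take_drop_id mset_append)
  then have "mset (take k xs) \<subseteq># M" by (metis mset_subset_eq_add_left)
  moreover have "size (mset (take k xs)) = k" using assms xs by auto
  ultimately show ?thesis by blast
qed

text \<open>Markov's inequality, multiplied out to stay within the natural numbers.\<close>

lemma size_below_twice_average:
  fixes X :: "nat multiset"
  assumes X: "X \<noteq> {#}" "0 \<notin># X"
  shows "size X \<le> 2 * size {#x \<in># X. x * size X \<le> 2 * \<Sum>\<^sub># X#}"
proof -
  let ?S = "{#x \<in># X. x * size X \<le> 2 * \<Sum>\<^sub># X#}"
  let ?B = "{#x \<in># X. \<not> x * size X \<le> 2 * \<Sum>\<^sub># X#}"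
  have part: "X = ?S + ?B" by (rule multiset_partition)
  have "size N * (2 * \<Sum>\<^sub># X) \<le> \<Sum>\<^sub># N * size X"
    if "\<And>x. x \<in># N \<Longrightarrow> 2 * \<Sum>\<^sub># X \<le> x * size X" for N
    using that by (induction N) (auto simp: algebra_simps intro: add_mono)
  from this[of ?B] have "size ?B * (2 * \<Sum>\<^sub># X) \<le> \<Sum>\<^sub># ?B * size X" by simp
  also have "\<dots> \<le> \<Sum>\<^sub># X * size X"
    using part by (metis le_add2 mult_le_mono1 sum_mset.union)
  finally have "(2 * size ?B) * \<Sum>\<^sub># X \<le> size X * \<Sum>\<^sub># X" by (simp add: algebra_simps)
  moreover have "0 < \<Sum>\<^sub># X"
    using X by (metis bot_nat_0.not_eq_extremum multiset_nonemptyE sum_mset_0_iff)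
  ultimately have "2 * size ?B \<le> size X" by simp
  moreover have "size X = size ?S + size ?B" by (metis part size_union)
  ultimately show ?thesis by linarith
qed

lemma card_le_Max_div_Gcd:
  fixes B :: "nat set"
  assumes "finite B" "B \<noteq> {}" "0 \<notin> B"
  shows "card B \<le> Max B div Gcd B"
proof -
  let ?q = "Gcd B"
  have "inj_on (\<lambda>b. b div ?q) B"
    by (rule inj_onI) (metis Gcd_dvd dvd_div_mult_self)
  moreover have "(\<lambda>b. b div ?q) ` B \<subseteq> {1..Max B div ?q}"
  proof
    fix z assume "z \<in> (\<lambda>b. b div ?q) ` B"
    then obtain b where b: "b \<in> B" "z = b div ?q" by blast
    have "z * ?q = b" using b by simp
    then have "z \<noteq> 0" using b assms by (metis mult_zero_left)
    moreover have "z \<le> Max B div ?q" using b assms by (simp add: div_le_mono)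
    ultimately show "z \<in> {1..Max B div ?q}" by simp
  qed
  ultimately show ?thesis
    by (metis card_atLeastAtMost card_image card_mono diff_Suc_1 finite_atLeastAtMost One_nat_def)
qed

text \<open>With \<rho> = \<open>\<mu> * s / \<nu> ^ 2\<close>, popularity makes
  \<open>card B\<close> at least \<open>\<nu> / (34 * \<mu>)\<close>. Hence \<open>q = Gcd B\<close>
  is at most \<open>136 * \<rho>\<close>, the range of the hypothesis on \<open>g\<close>, and the
  residue correction together with the least amount that sums over \<open>B\<close> can supply is at
  most \<open>952 * \<rho> * M\<close>, the lower bound on \<open>t\<close>. In the upper bound
  \<open>5 / 8\<close>, the parts \<open>A1\<close> and \<open>A2\<close> hold up to a quarter of
  the total and two error terms up to an eighth. It exceeds one half because the multiset to which
  the theorem is applied has lost a few elements.\<close>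

theorem dense_subset_sums_interval:
  fixes X :: "nat multiset" and \<mu> M t :: nat
  assumes X0: "0 \<notin># X" and mu: "\<And>x. count X x \<le> \<mu>" and M: "\<And>x. x \<in># X \<Longrightarrow> x \<le> M"
    and n: "300 \<le> size X"
    and dens: "37000 * log 2 (2 * real (size X)) * real \<mu> * real M \<le> real (size X) ^ 2"
    and nd: "\<And>g. 2 \<le> g \<Longrightarrow> real g \<le> 136 * (real \<mu> * real (\<Sum>\<^sub># X) / real (size X) ^ 2) \<Longrightarrow>
        g \<le> size {#x \<in># X. \<not> g dvd x#} + 1"
    and t: "952 * (real \<mu> * real (\<Sum>\<^sub># X) / real (size X) ^ 2) * real M \<le> real t"
      "8 * t \<le> 5 * \<Sum>\<^sub># X"
  shows "t \<in> subset_sums X"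
proof -
  define \<nu> s where "\<nu> = size X" and "s = \<Sum>\<^sub># X"
  \<comment> \<open>Two sixteenths of the elements, all at most twice the average, sum up to at most
    a quarter of \<open>s\<close>. With at least 300 elements the rounding only turns 16 into
    17.\<close>
  define n1 where "n1 = \<nu> div 16"
  have n': "300 \<le> \<nu>" using n by (simp add: \<nu>_def)
  have n1: "real \<nu> \<le> 17 * real n1" "16 * n1 \<le> \<nu>" "1 \<le> n1"
  proof -
    have "\<nu> < 16 * (\<nu> div 16) + 16" using dividend_less_div_times[of 16 \<nu>] by simp
    moreover have "18 \<le> \<nu> div 16" using n' div_le_mono[of 300 \<nu> 16] by simp
    ultimately have "\<nu> \<le> 17 * (\<nu> div 16)" by linarith
    then show "real \<nu> \<le> 17 * real n1" by (simp add: n1_def)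
  qed (use n' in \<open>auto simp: n1_def\<close>)
  have Xne: "X \<noteq> {#}" using n by auto
  then obtain x0 where x0: "x0 \<in># X" by (meson multiset_nonemptyE)
  have mu0: "0 < \<mu>" using mu[of x0] x0 by (metis count_greater_zero_iff le_zero_eq neq0_conv)
  have M0: "0 < M" using M[OF x0] x0 X0 by (metis gr0I le_zero_eq)
  define \<rho> where "\<rho> = real \<mu> * real s / real \<nu> ^ 2"
  have rho0: "0 \<le> \<rho>" by (simp add: \<rho>_def)
  define L where "L = log 2 (2 * real \<nu>)"
  have L1: "1 \<le> L" using n' by (simp add: L_def)
  have dens': "37000 * L * real \<mu> * real M \<le> real \<nu> ^ 2" using dens by (simp add: L_def \<nu>_def)
  have rhoM: "37000 * (\<rho> * real M) \<le> real s"
  proof -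
    have "37000 * real \<mu> * real M \<le> 37000 * L * real \<mu> * real M"
      using L1 by (simp add: mult_right_mono)
    then have "37000 * real \<mu> * real M * real s \<le> real \<nu> ^ 2 * real s"
      using dens' by (intro mult_right_mono) auto
    then show ?thesis using n' by (simp add: \<rho>_def divide_le_eq algebra_simps)
  qed
  define m1 where "m1 = 2 * s div \<nu>"
  \<comment> \<open>Both bounds on the elements of \<open>A1\<close> and \<open>A2\<close> matter:
    \<open>M\<close> limits the number of summands, \<open>m1\<close> limits \<open>q\<close> and
    the lower end of the interval.\<close>
  define mm where "mm = min m1 M"
  define Xs where "Xs = {#x \<in># X. x * \<nu> \<le> 2 * s#}"
  have "\<nu> \<le> 2 * size Xs"
    using size_below_twice_average[OF Xne X0] by (simp add: Xs_def \<nu>_def s_def)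
  then have sXs: "2 * n1 \<le> size Xs" using n1 by linarith
  then obtain A1 where A1: "A1 \<subseteq># Xs" "size A1 = n1"
    using ex_submultiset_size[of n1 Xs] by auto
  have "n1 \<le> size (Xs - A1)" using A1 sXs by (simp add: size_Diff_submset)
  then obtain A2 where A2: "A2 \<subseteq># Xs - A1" "size A2 = n1"
    using ex_submultiset_size by blast
  have A12: "A1 + A2 \<subseteq># Xs"
    using A1 A2 by (metis mset_subset_eq_mono_add_left_cancel subset_mset.add_diff_inverse)
  have XsX: "Xs \<subseteq># X" by (simp add: Xs_def)
  define G where "G = X - (A1 + A2)"
  have Xeq: "X = A1 + (A2 + G)"
    using A12 XsX by (metis G_def subset_mset.add_diff_inverse subset_mset.order_trans union_assoc)
  have Xs_le: "x \<le> m1" "x \<le> M" if "x \<in># Xs" for x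
    using that M n' by (auto simp: Xs_def m1_def less_eq_div_iff_mult_less_eq)
  have in12: "x \<in># A1 \<Longrightarrow> x \<in># Xs" "x \<in># A2 \<Longrightarrow> x \<in># Xs" for x
    using A12 by (meson mset_subset_eqD union_iff)+
  have sumA: "4 * (\<Sum>\<^sub># A1 + \<Sum>\<^sub># A2) \<le> s"
  proof -
    have "\<Sum>\<^sub># (A1 + A2) \<le> size (A1 + A2) * m1"
      using in12 Xs_le by (intro sum_mset_le) auto
    then have "8 * (\<Sum>\<^sub># A1 + \<Sum>\<^sub># A2) \<le> 8 * ((n1 + n1) * m1)" using A1(2) A2(2) by simp
    also have "\<dots> = (16 * n1) * m1" by simp
    also have "\<dots> \<le> \<nu> * m1" using n1(2) by (rule mult_le_mono1)
    also have "\<dots> \<le> 2 * s" by (simp add: m1_def)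
    finally show ?thesis by simp
  qed
  have sG: "s = \<Sum>\<^sub># A1 + \<Sum>\<^sub># A2 + \<Sum>\<^sub># G" using Xeq by (simp add: s_def)
  define r where "r = reps A1 A2"
  define W where "W = real n1 ^ 2 / real \<mu>"
  have "n1 * n1 \<le> \<mu> * (\<Sum>b\<le>2 * mm. r b)"
  proof -
    have "count A1 x \<le> \<mu>" "count A2 x \<le> \<mu>" for x
      using mu[of x] Xeq by (metis add_leD1 add_leD2 count_union)+
    then show ?thesis
      using sum_reps_ge[of A1 mm A2 \<mu>] in12 Xs_le A1 A2 by (simp add: mm_def r_def)
  qed
  then have "real (n1 * n1) \<le> real (\<mu> * (\<Sum>b\<le>2 * mm. r b))" by (simp only: of_nat_le_iff)
  then have Wle: "W \<le> real (\<Sum>b\<le>2 * mm. r b)"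
    using mu0 by (simp add: W_def divide_le_eq power2_eq_square mult.commute)
  have rle: "r b \<le> n1" for b using reps_le[of A1 A2 b] A1 by (simp add: r_def)
  from popular_level[of "{..2 * mm}" r n1, OF _ rle n1(3) Wle]
  obtain h where h: "1 \<le> h" and cB: "W / (2 * real h * log 2 (2 * real n1)) + W / (2 * real n1)
      \<le> real (card {b \<in> {..2 * mm}. h \<le> r b})" by (auto simp: W_def)
  define B where "B = {b \<in> {..2 * mm}. h \<le> r b}"
  define \<beta> where "\<beta> = card B"
  have W0: "0 < W" using n1 mu0 by (simp add: W_def)
  have ln0: "1 \<le> log 2 (2 * real n1)" using n1 by simp
  have b1: "W / (2 * real h * log 2 (2 * real n1)) \<le> real \<beta>" and b2: "W / (2 * real n1) \<le> real \<beta>"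
  proof -
    have "0 \<le> W / (2 * real h * log 2 (2 * real n1))" "0 \<le> W / (2 * real n1)"
      using W0 ln0 by auto
    then show "W / (2 * real h * log 2 (2 * real n1)) \<le> real \<beta>" "W / (2 * real n1) \<le> real \<beta>"
      using cB unfolding \<beta>_def B_def by linarith+
  qed
  have beta: "real \<nu> \<le> 34 * real \<mu> * real \<beta>"
  proof -
    have "W / (2 * real n1) = real n1 / (2 * real \<mu>)"
      using n1 by (simp add: W_def power2_eq_square)
    then have "real n1 \<le> 2 * real \<mu> * real \<beta>"
      using b2 mu0 by (simp add: divide_le_eq mult.commute)
    then show ?thesis using n1(1) by simp
  qed
  have beta0: "0 < \<beta>" using beta n' by (cases "\<beta> = 0") auto
  \<comment> \<open>\<open>64 * 578\<close> is just below 37000, where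
    \<open>578 = 2 * 17 ^ 2\<close> combines the loss in \<open>n1\<close> with the factor 2 of
    \<open>popular_level\<close>.\<close>
  have hb: "32 * M \<le> h * \<beta>"
  proof -
    have hpos: "0 < real h" using h by simp
    have lL: "log 2 (2 * real n1) \<le> L" using n1 unfolding L_def by simp
    have "64 * real M * (578 * real \<mu> * L) \<le> 37000 * L * real \<mu> * real M"
      using L1 by (simp add: mult_right_mono)
    also have "\<dots> \<le> real \<nu> ^ 2" by (rule dens')
    also have "\<dots> \<le> (17 * real n1) ^ 2" using n1 by (intro power_mono) auto
    also have "\<dots> = 289 * real \<mu> * W" using mu0 by (simp add: W_def power2_eq_square)
    also have "W \<le> real \<beta> * (2 * real h * log 2 (2 * real n1))"
      using b1 hpos ln0 by (simp add: divide_le_eq)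
    also have "\<dots> \<le> real \<beta> * (2 * real h * L)"
      using lL by (intro mult_left_mono) auto
    finally have "64 * real M * (578 * real \<mu> * L) \<le> real (h * \<beta>) * (578 * real \<mu> * L)"
      using mu0 by (simp add: algebra_simps)
    then have "64 * real M \<le> real (h * \<beta>)"
      using L1 mu0 by (simp only: mult_le_cancel_right) simp
    then have "real (64 * M) \<le> real (h * \<beta>)" by simp
    then have "64 * M \<le> h * \<beta>" by (simp only: of_nat_le_iff)
    then show ?thesis by simp
  qed
  have m1b: "real m1 \<le> 68 * \<rho> * real \<beta>"
  proof -
    have "m1 * \<nu> \<le> 2 * s" by (simp add: m1_def)
    then have "real (m1 * \<nu>) \<le> real (2 * s)" by (simp only: of_nat_le_iff)
    then have "real m1 \<le> 2 * real s / real \<nu>" using n' by (simp add: le_divide_eq)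
    also have "\<dots> = 2 * real s / real \<nu> ^ 2 * real \<nu>" using n' by (simp add: power2_eq_square)
    also have "\<dots> \<le> 2 * real s / real \<nu> ^ 2 * (34 * real \<mu> * real \<beta>)"
      using beta by (intro mult_left_mono) auto
    finally show ?thesis by (simp add: \<rho>_def algebra_simps)
  qed
  have finB: "finite B" and Bne: "B \<noteq> {}"
    using beta0 card_gt_0_iff unfolding \<beta>_def by blast+
  have B0: "0 \<notin> B"
  proof -
    have "0 \<notin># A1" using X0 Xeq by auto
    then have "r 0 = 0" by (simp add: r_def reps_def not_in_iff)
    then show ?thesis using h by (simp add: B_def)
  qed
  define q where "q = Gcd B"
  define a where "a = Max B div q"
  define h0 where "h0 = 2 * (a div \<beta>) + 1"
  define J where "J = h0 + M div a + 1"
  define H where "H = h0 + J"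
  have MaxB: "Max B \<in> B" using finB Bne by simp
  then have MaxB_le: "Max B \<le> 2 * mm" by (simp add: B_def)
  have qa: "q * a = Max B" using MaxB by (simp add: a_def q_def)
  have ba: "\<beta> \<le> a" using card_le_Max_div_Gcd[OF finB Bne B0] by (simp add: \<beta>_def a_def q_def)
  have q0: "0 < q" using qa MaxB B0 by (metis gr0I mult_zero_left)
  have a2: "a \<le> 2 * mm" using qa q0 MaxB_le by (metis le_trans mult_le_mono1 nat_mult_1 Suc_leI One_nat_def)
  have qb: "q * \<beta> \<le> 2 * mm" using qa ba MaxB_le by (metis le_trans mult_le_mono2)
  have mmM: "mm \<le> M" "mm \<le> m1" by (auto simp: mm_def)
  have h0b: "h0 * \<beta> \<le> 2 * a + \<beta>"
    by (simp add: h0_def algebra_simps)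
  have Hb: "H * \<beta> \<le> 15 * M"
  proof -
    have "(M div a) * \<beta> \<le> (M div a) * a" using ba by simp
    also have "\<dots> \<le> M" by simp
    finally have "(M div a) * \<beta> \<le> M" .
    moreover have "H * \<beta> = 2 * (h0 * \<beta>) + (M div a) * \<beta> + \<beta>"
      by (simp add: H_def J_def algebra_simps)
    ultimately show ?thesis using h0b a2 ba mmM by linarith
  qed
  \<comment> \<open>At most \<open>H\<close> elements of \<open>B\<close> are served at two
    representations each, and the residue correction destroys fewer than \<open>q\<close> further
    ones.\<close>
  have h_ge: "2 * H + q \<le> h"
  proof -
    have "(2 * H + q) * \<beta> \<le> 30 * M + 2 * M" using Hb qb mmM by (simp add: algebra_simps)
    also have "\<dots> \<le> h * \<beta>" using hb by simp
    finally show ?thesis using beta0 by simp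
  qed
  have q_le: "real q \<le> 136 * \<rho>"
  proof -
    have "q * \<beta> \<le> 2 * m1" using qb mmM by linarith
    then have "real (q * \<beta>) \<le> real (2 * m1)" by (simp only: of_nat_le_iff)
    then have "real q * real \<beta> \<le> (136 * \<rho>) * real \<beta>" using m1b by simp
    then show ?thesis using beta0 by (metis mult_le_cancel_right_pos of_nat_0_less_iff)
  qed
  have t_ge: "q * M + h0 * Max B \<le> t"
  proof -
    have "(q * M + h0 * Max B) * \<beta> = q * \<beta> * M + h0 * \<beta> * Max B" by (simp add: algebra_simps)
    also have "\<dots> \<le> (2 * mm) * M + (2 * (2 * mm) + 2 * mm) * (2 * mm)"
    proof -
      have "h0 * \<beta> \<le> 2 * (2 * mm) + 2 * mm" using h0b a2 ba by linarith
      then have "h0 * \<beta> * Max B \<le> (2 * (2 * mm) + 2 * mm) * (2 * mm)"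
        using MaxB_le by (rule mult_le_mono)
      moreover have "q * \<beta> * M \<le> (2 * mm) * M" using qb by (rule mult_le_mono1)
      ultimately show ?thesis by (rule add_mono[rotated])
    qed
    also have "\<dots> \<le> 2 * (mm * M) + 12 * (mm * M)" using mmM by simp
    also have "\<dots> \<le> 14 * (m1 * M)" using mmM by simp
    finally have "real ((q * M + h0 * Max B) * \<beta>) \<le> real (14 * (m1 * M))" by (simp only: of_nat_le_iff)
    also have "\<dots> \<le> 14 * (68 * \<rho> * real \<beta>) * real M"
      using mult_left_mono[OF mult_right_mono[OF m1b, of "real M"], of 14] by (simp add: mult.assoc)
    finally have "real (q * M + h0 * Max B) * real \<beta> \<le> (952 * \<rho> * real M) * real \<beta>"
      by (simp add: algebra_simps)
    then have "real (q * M + h0 * Max B) \<le> 952 * \<rho> * real M"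
      using beta0 by (metis mult_le_cancel_right_pos of_nat_0_less_iff)
    also have "\<dots> \<le> real t" using t(1) by (simp add: \<rho>_def \<nu>_def s_def)
    finally show ?thesis by (simp only: of_nat_le_iff)
  qed
  have qM: "16 * (q * M) \<le> s"
  proof -
    have "16 * (real q * real M) \<le> 16 * ((136 * \<rho>) * real M)"
      using q_le by (intro mult_left_mono mult_right_mono) auto
    also have "\<dots> \<le> real s" using rhoM rho0 by simp
    finally have "real (16 * (q * M)) \<le> real s" by simp
    then show ?thesis by (simp only: of_nat_le_iff)
  qed
  have "g \<le> size {#x \<in># X. \<not> g dvd x#} + 1" if "g dvd q" "1 < g" for g
  proof -
    have "g \<le> q" using that q0 by (simp add: dvd_imp_le)
    then have "real g \<le> 136 * \<rho>" using q_le by linarith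
    then show ?thesis using nd[of g] that by (simp add: \<rho>_def \<nu>_def s_def)
  qed
  from subset_sums_mod_complete[OF q0 this] obtain Z where "Z \<subseteq># X" "\<Sum>\<^sub># Z mod q = t mod q"
    by blast
  with small_residue_representative[OF q0] obtain Y
    where Y: "Y \<subseteq># X" "size Y < q" "\<Sum>\<^sub># Y mod q = t mod q" by metis
  from Y(1) Xeq obtain Y1 Y' where Y1: "Y = Y1 + Y'" "Y1 \<subseteq># A1" "Y' \<subseteq># A2 + G"
    using mset_subset_eq_add_split by blast
  from Y1(3) obtain Y2 YG where Y2: "Y' = Y2 + YG" "Y2 \<subseteq># A2" "YG \<subseteq># G"
    using mset_subset_eq_add_split by blast
  have sumY: "\<Sum>\<^sub># Y \<le> q * M"
  proof -
    have "\<Sum>\<^sub># Y \<le> size Y * M" using Y(1) M by (intro sum_mset_le) (meson mset_subset_eqD)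
    also have "\<dots> \<le> q * M" using Y(2) by simp
    finally show ?thesis .
  qed
  \<comment> \<open>The share of the greedy part: what remains after the residue correction and the
    least amount that the sums over \<open>B\<close> require.\<close>
  define u where "u = t - \<Sum>\<^sub># Y - h0 * Max B"
  have tu: "t = \<Sum>\<^sub># Y + h0 * Max B + u" using t_ge sumY by (simp add: u_def)
  have "x \<le> M" if "x \<in># G - YG" for x
    using that M by (metis G_def in_diffD)
  from greedy_divisible_sum[OF q0 this, of "G - YG" u] obtain Z
    where Z: "Z \<subseteq># G - YG" "q dvd \<Sum>\<^sub># Z" "\<Sum>\<^sub># Z \<le> u"
      "u < \<Sum>\<^sub># Z + q * M \<or> \<Sum>\<^sub># (G - YG) \<le> \<Sum>\<^sub># Z + q * M" by blast
  have "q dvd t - \<Sum>\<^sub># Y" using Y(3) tu by (metis le_add1 mod_eq_dvd_iff_nat add.assoc)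
  then have "q dvd (t - \<Sum>\<^sub># Y) - \<Sum>\<^sub># Z" using Z(2) by (rule dvd_diff_nat)
  then obtain y where "(t - \<Sum>\<^sub># Y) - \<Sum>\<^sub># Z = q * y" by (elim dvdE)
  then have y: "t = \<Sum>\<^sub># Y + \<Sum>\<^sub># Z + q * y" using tu Z(3) by linarith
  have y2: "q * y = q * (h0 * a) + (u - \<Sum>\<^sub># Z)"
  proof -
    have "q * (h0 * a) = h0 * Max B" using qa by (metis mult.left_commute)
    then show ?thesis using y tu Z(3) by linarith
  qed
  have y_ge: "h0 * a \<le> y" using y2 q0 by (metis le_add1 nat_mult_le_cancel1)
  have a0: "0 < a" using ba beta0 by simp
  have y_le: "y \<le> J * a"
    using Z(4)
  proof
    assume "u < \<Sum>\<^sub># Z + q * M"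
    then have "q * y < q * (h0 * a + M)" using y2 Z(3) unfolding distrib_left by linarith
    then have "y < h0 * a + M" by simp
    also have "M \<le> (M div a + 1) * a"
      using dividend_less_div_times[OF a0, of M] by (simp add: distrib_right)
    finally show ?thesis by (simp add: J_def distrib_right)
  next
    \<comment> \<open>Here the greedy part ran out of elements. Then \<open>Z\<close> holds at least
      \<open>3 / 4 - 2 / 16 = 5 / 8\<close> of the total, hence all of \<open>t\<close>, and nothing
      is left for \<open>B\<close>.\<close>
    assume *: "\<Sum>\<^sub># (G - YG) \<le> \<Sum>\<^sub># Z + q * M"
    have "\<Sum>\<^sub># G = \<Sum>\<^sub># (G - YG) + \<Sum>\<^sub># YG"
      using Y2(3) by (metis subset_mset.diff_add sum_mset.union)
    moreover have "\<Sum>\<^sub># YG \<le> q * M" using sumY Y1 Y2 by simp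
    ultimately have "8 * t \<le> 8 * \<Sum>\<^sub># Z"
      using * sG sumA t(2)[folded s_def] qM by (simp only: distrib_left)
    then have "t \<le> \<Sum>\<^sub># Z" by simp
    then have "q * y = 0" using y by simp
    then show ?thesis using q0 by simp
  qed
  have h0': "h0 = 2 * (a div card B) + 1" by (simp add: h0_def \<beta>_def)
  from multisums_cover[OF finB Bne B0 q_def a_def h0' y_ge y_le]
  obtain bs where bs: "size bs \<le> H" "set_mset bs \<subseteq> B" "\<Sum>\<^sub># bs = q * y"
    by (auto simp: H_def)
  have "2 * size bs \<le> reps (A1 - Y1) (A2 - Y2) b" if "b \<in># bs" for b
  proof -
    have "h \<le> r b" using that bs(2) by (auto simp: B_def)
    moreover have "size Y1 + size Y2 < q" using Y(2) Y1 Y2 by simp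
    ultimately show ?thesis
      using reps_diff[of A1 A2 b Y1 Y2] h_ge bs(1) unfolding r_def by linarith
  qed
  from reps_realize[OF this] obtain Z1 Z2 where Z12: "Z1 \<subseteq># A1 - Y1" "Z2 \<subseteq># A2 - Y2"
    "\<Sum>\<^sub># Z1 + \<Sum>\<^sub># Z2 = \<Sum>\<^sub># bs" by blast
  have "Y1 + Z1 \<subseteq># A1" "Y2 + Z2 \<subseteq># A2" "YG + Z \<subseteq># G"
    using Z12 Z(1) Y1(2) Y2(2,3) by (metis mset_subset_eq_mono_add_left_cancel subset_mset.add_diff_inverse)+
  then have "(Y1 + Z1) + ((Y2 + Z2) + (YG + Z)) \<subseteq># X"
    unfolding Xeq by (intro subset_mset.add_mono)
  moreover have "\<Sum>\<^sub># ((Y1 + Z1) + ((Y2 + Z2) + (YG + Z))) = t"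
    using y bs(3) Z12(3) Y1(1) Y2(1) by simp
  ultimately show ?thesis unfolding subset_sums_def by blast
qed

section \<open>Reduction to residues\<close>

definition nondiv :: "nat \<Rightarrow> nat multiset \<Rightarrow> nat" where
  "nondiv d X = size {#x \<in># X. \<not> d dvd x#}"

definition is_modulus :: "nat \<Rightarrow> nat multiset \<Rightarrow> bool" where
  "is_modulus d X \<longleftrightarrow> 1 \<le> d \<and> d \<le> size X div 1000 \<and> nondiv d X < d \<and>
     (\<forall>d'. d < d' \<longrightarrow> d' \<le> size X div 1000 \<longrightarrow> d' \<le> nondiv d' X)"

lemma count_le_max_mult: "count X x \<le> max_mult X"
proof (cases "x \<in># X")
  case True then show ?thesis unfolding max_mult_def by (intro Max_ge) auto
qed (simp add: not_in_iff)

lemma le_max_elem: "x \<in># X \<Longrightarrow> x \<le> max_elem X"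
  unfolding max_elem_def by (intro Max_ge) auto

lemma size_le_card_times_mult:
  assumes "\<And>x. count N x \<le> \<mu>"
  shows "size N \<le> card (set_mset N) * \<mu>"
  unfolding size_multiset_overloaded_eq using sum_mono[of "set_mset N" "count N" "\<lambda>_. \<mu>"] assms by simp

text \<open>All logarithms involved are at least 1, and \<open>1300 ^ 2\<close> is below
  1699200.\<close>

lemma dense_bounds:
  assumes X: "X \<noteq> {#}" "0 \<notin># X" and dens: "dense (C_delta X) X"
  shows "1699200 * log 2 (2 * real (size X)) * real (max_mult X) * real (max_elem X) \<le> real (size X) ^ 2"
    and "1 \<le> max_mult X" and "1 \<le> max_elem X" and "1300 \<le> size X"
    and "1699200 * max_mult X * max_elem X \<le> size X ^ 2"
proof -
  obtain x where x: "x \<in># X" using X by (meson multiset_nonemptyE)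
  show mu: "1 \<le> max_mult X" using count_le_max_mult[of X x] x
    by (metis One_nat_def Suc_leI count_greater_zero_iff le_trans)
  show m: "1 \<le> max_elem X" using le_max_elem[OF x] x X by (cases x) auto
  have n: "1 \<le> size X" using X by (simp add: Suc_leI nonempty_has_size)
  let ?l = "log 2 (2 * real (max_mult X))" and ?ln = "log 2 (2 * real (size X))"
  have l: "1 \<le> ?l" "1 \<le> ?ln" using mu n by auto
  have "1699200 * ?ln * real (max_mult X) * real (max_elem X) =
      1699200 * ?ln * 1 * (real (max_mult X) * real (max_elem X))" by simp
  also have "\<dots> \<le> 1699200 * ?ln * ?l ^ 2 * (real (max_mult X) * real (max_elem X))"
    using l by (intro mult_right_mono mult_left_mono) (auto simp: one_le_power)
  also have "\<dots> \<le> real (size X) ^ 2"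
    using dens by (simp add: dense_def C_delta_def mult.assoc)
  finally show 1: "1699200 * ?ln * real (max_mult X) * real (max_elem X) \<le> real (size X) ^ 2" .
  have "1699200 * 1 * (real (max_mult X) * real (max_elem X)) \<le>
      1699200 * ?ln * (real (max_mult X) * real (max_elem X))"
    using l by (intro mult_right_mono mult_left_mono) auto
  then have "real (1699200 * max_mult X * max_elem X) \<le> real (size X ^ 2)"
    using 1 by (simp add: mult.assoc)
  then show 2: "1699200 * max_mult X * max_elem X \<le> size X ^ 2" by (simp only: of_nat_le_iff)
  have "1 * 1 \<le> max_mult X * max_elem X" using mu m by (rule mult_le_mono)
  then have "1699200 * (1 * 1) \<le> 1699200 * (max_mult X * max_elem X)" by (rule mult_le_mono2)
  also have "\<dots> \<le> size X ^ 2" using 2 by (simp only: mult.assoc)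
  finally have "1300\<^sup>2 \<le> size X ^ 2" by simp
  then show "1300 \<le> size X" using power2_le_imp_le[of 1300 "size X"] by simp
qed

text \<open>At most \<open>B / (d * n)\<close> positive multiples of \<open>d\<close> are small
  enough, and each occurs at most \<mu> times.\<close>

lemma multiples_bound:
  assumes N: "\<And>x. count N x \<le> \<mu>" "\<And>x. x \<in># N \<Longrightarrow> d dvd x \<and> 0 < x \<and> x * n \<le> B" and d: "0 < d"
  shows "size N * d * n \<le> \<mu> * B"
proof (cases "n = 0")
  case False
  have "set_mset N \<subseteq> (*) d ` {1..B div (d * n)}"
  proof
    fix x assume "x \<in> set_mset N"
    then have x: "d dvd x" "0 < x" "x * n \<le> B" using N(2) by auto
    then obtain y where y: "x = d * y" by blast
    then have "y * (d * n) \<le> B" using x(3) by (simp add: mult.commute mult.left_commute)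
    then have "y \<le> B div (d * n)" using d False by (simp add: less_eq_div_iff_mult_less_eq)
    moreover have "1 \<le> y" using x y by (cases y) auto
    ultimately show "x \<in> (*) d ` {1..B div (d * n)}" using y by auto
  qed
  then have "card (set_mset N) \<le> card ((*) d ` {1..B div (d * n)})"
    by (intro card_mono) auto
  also have "\<dots> \<le> B div (d * n)" using card_image_le[of "{1..B div (d * n)}" "(*) d"] by simp
  finally have "size N \<le> B div (d * n) * \<mu>"
    using size_le_card_times_mult[OF N(1)] by (meson le_trans mult_le_mono1)
  then have "size N * (d * n) \<le> (B div (d * n) * \<mu>) * (d * n)" by (rule mult_le_mono1)
  also have "\<dots> = \<mu> * (B div (d * n) * (d * n))" by simp
  also have "\<dots> \<le> \<mu> * B" by simp
  finally show ?thesis by (simp add: mult.assoc)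
qed simp

text \<open>A number \<open>g\<close> that divides almost all of \<open>X' = E / d\<close> would
  make \<open>d * g\<close> divide almost all of \<open>X\<close>, against the maximality of
  \<open>d\<close>; so the interval theorem applies to \<open>X'\<close>. The exceptions
  \<open>F\<close>, fewer than \<open>d\<close>, supply the residue of \<open>t\<close> modulo
  \<open>d\<close>. The constant in \<open>C_lambda\<close> far exceeds what the interval theorem
  asks for, which pays for this correction.\<close>

theorem subset_sum_iff_residue:
  assumes X: "X \<noteq> {#}" "0 \<notin># X" and dens: "dense (C_delta X) X" and d: "is_modulus d X"
    and t: "real t \<le> real (\<Sum>\<^sub># X) / 2"
      "real t \<ge> (4 + 2 * C_lambda X) * real (max_mult X) * real (max_elem X)
                 * real (\<Sum>\<^sub># X) / real (size X) ^ 2"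
  shows "t \<in> subset_sums X \<longleftrightarrow> t mod d \<in> (\<lambda>s. s mod d) ` subset_sums X"
proof
  assume "t mod d \<in> (\<lambda>s. s mod d) ` subset_sums X"
  then obtain Y where Y: "Y \<subseteq># X" "\<Sum>\<^sub># Y mod d = t mod d" by (auto simp: subset_sums_def)
  define n \<mu> m \<sigma> where "n = size X" and "\<mu> = max_mult X" and "m = max_elem X" and "\<sigma> = \<Sum>\<^sub># X"
  define \<rho> where "\<rho> = real \<mu> * real \<sigma> / real n ^ 2"
  have dens1: "1699200 * log 2 (2 * real n) * real \<mu> * real m \<le> real n ^ 2"
    and mu1: "1 \<le> \<mu>" and m1: "1 \<le> m" and n1: "1300 \<le> n" and dens2: "1699200 * \<mu> * m \<le> n ^ 2"
    using dense_bounds[OF X dens] by (simp_all add: n_def \<mu>_def m_def)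
  have d0: "1 \<le> d" and dn: "1000 * d \<le> n" and ndd: "nondiv d X < d"
    and dmax: "\<And>d'. d < d' \<Longrightarrow> 1000 * d' \<le> n \<Longrightarrow> d' \<le> nondiv d' X"
    using d by (auto simp: is_modulus_def n_def)
  have rho0: "0 \<le> \<rho>" by (simp add: \<rho>_def)
  have dens2r: "1699200 * real \<mu> * real m \<le> real n ^ 2"
    using dens2 by (metis (mono_tags) of_nat_le_iff of_nat_mult of_nat_numeral of_nat_power)
  have rhom: "1699200 * (\<rho> * real m) \<le> real \<sigma>"
  proof -
    have "(1699200 * real \<mu> * real m) * real \<sigma> \<le> real n ^ 2 * real \<sigma>"
      using dens2r by (rule mult_right_mono) simp
    then show ?thesis using n1 by (simp add: \<rho>_def divide_le_eq algebra_simps)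
  qed
  have sig: "\<sigma> \<le> n * m" unfolding \<sigma>_def n_def m_def by (intro sum_mset_le le_max_elem)
  have rhon: "1699200 * \<rho> \<le> real n"
  proof -
    have "real \<sigma> \<le> real n * real m" using sig by (metis of_nat_le_iff of_nat_mult)
    then have "1699200 * (real \<mu> * real \<sigma>) \<le> 1699200 * (real \<mu> * (real n * real m))"
      by (intro mult_left_mono) auto
    also have "\<dots> = (1699200 * real \<mu> * real m) * real n" by simp
    also have "\<dots> \<le> real n ^ 2 * real n" using dens2r by (rule mult_right_mono) simp
    finally show ?thesis using n1 by (simp add: \<rho>_def divide_le_eq mult.commute)
  qed
  define E F where "E = {#x \<in># X. d dvd x#}" and "F = {#x \<in># X. \<not> d dvd x#}"
  have XEF: "X = E + F" unfolding E_def F_def by (rule multiset_partition)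
  have sF: "size F < d" using ndd by (simp add: nondiv_def F_def)
  define X' where "X' = image_mset (\<lambda>x. x div d) E"
  have E_X': "image_mset ((*) d) X' = E"
  proof -
    have "image_mset ((*) d) X' = image_mset (\<lambda>x. x) E"
      unfolding X'_def image_mset.compositionality
      by (intro image_mset_cong) (auto simp: E_def)
    then show ?thesis by simp
  qed
  have sumE: "\<Sum>\<^sub># E = d * \<Sum>\<^sub># X'"
    using sum_mset_distrib_left[of d "\<lambda>x. x" X'] E_X' by simp
  have sizeX': "size X' + size F = n" using XEF by (simp add: X'_def n_def)
  have nu: "999 * n \<le> 1000 * size X'" using sizeX' sF dn by linarith
  have nur: "999 * real n \<le> 1000 * real (size X')" using nu by linarith
  have nun: "size X' \<le> n" using sizeX' by simp
  define M where "M = m div d"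
  have dM: "d * M \<le> m" by (simp add: M_def)
  \<comment> \<open>By Markov's inequality and since the exceptions are few, almost half of the
    elements are multiples of \<open>d\<close> of at most twice the average size. Multiplicity \<mu>
    admits so many only if \<open>d\<close> is at most \<open>5 * \<rho>\<close>.\<close>
  have dm5: "real d \<le> 5 * \<rho>"
  proof -
    let ?S = "{#x \<in># X. x * n \<le> 2 * \<sigma>#}"
    let ?N = "{#x \<in># ?S. d dvd x#}"
    have "n \<le> 2 * size ?S" using size_below_twice_average[OF X] by (simp add: n_def \<sigma>_def)
    moreover have "size ?S = size ?N + size {#x \<in># ?S. \<not> d dvd x#}"
      by (metis multiset_partition size_union)
    moreover have "size {#x \<in># ?S. \<not> d dvd x#} \<le> size F"
      unfolding F_def by (intro size_mset_mono multiset_filter_mono) simp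
    ultimately have "n \<le> 2 * size ?N + 2 * d" using sF by linarith
    then have N: "499 * n \<le> 1000 * size ?N" using dn by linarith
    have "size ?N * d * n \<le> \<mu> * (2 * \<sigma>)"
    proof (rule multiples_bound)
      show "count ?N x \<le> \<mu>" for x
        unfolding \<mu>_def using count_le_max_mult[of X x] by (auto simp: count_filter_mset)
      show "d dvd x \<and> 0 < x \<and> x * n \<le> 2 * \<sigma>" if "x \<in># ?N" for x
        using that X(2) by (auto intro: gr0I)
    qed (use d0 in simp)
    then have "1000 * (size ?N * d * n) \<le> 1000 * (\<mu> * (2 * \<sigma>))" by (rule mult_le_mono2)
    also have "\<dots> = 2000 * (\<mu> * \<sigma>)" by simp
    finally have "1000 * size ?N * (d * n) \<le> 2000 * (\<mu> * \<sigma>)" by (simp only: mult.assoc)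
    moreover have "499 * n * (d * n) \<le> 1000 * size ?N * (d * n)" using N by (rule mult_le_mono1)
    ultimately have "499 * n * (d * n) \<le> 2000 * (\<mu> * \<sigma>)" by (rule le_trans[rotated])
    then have "real (499 * n * (d * n)) \<le> real (2000 * (\<mu> * \<sigma>))" by (simp only: of_nat_le_iff)
    then have "499 * (real d * real n ^ 2) \<le> 2000 * (real \<mu> * real \<sigma>)"
      by (simp add: power2_eq_square mult.assoc mult.left_commute)
    then have "499 * real d \<le> 2000 * \<rho>"
      using n1 by (simp add: \<rho>_def le_divide_eq mult.assoc)
    then show ?thesis using rho0 by linarith
  qed
  define \<rho>' where "\<rho>' = real \<mu> * real (\<Sum>\<^sub># X') / real (size X') ^ 2"
  have rho': "real d * \<rho>' \<le> 101 / 100 * \<rho>"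
  proof -
    have n'0: "0 < real (size X')" using nur n1 by simp
    have "d * \<Sum>\<^sub># X' \<le> \<sigma>" using sumE XEF by (metis \<sigma>_def le_add1 sum_mset.union)
    then have ds: "real d * real (\<Sum>\<^sub># X') \<le> real \<sigma>" by (metis of_nat_le_iff of_nat_mult)
    have "(999 * real n) ^ 2 \<le> (1000 * real (size X')) ^ 2" using nur by (intro power_mono) auto
    then have "998001 * real n ^ 2 \<le> 1000000 * real (size X') ^ 2"
      by (simp add: power_mult_distrib)
    then have sq: "real n ^ 2 \<le> 101 / 100 * real (size X') ^ 2"
      using zero_le_power2[of "real n"] by linarith
    have "real d * \<rho>' = real \<mu> * (real d * real (\<Sum>\<^sub># X')) / real (size X') ^ 2"
      by (simp add: \<rho>'_def)
    also have "\<dots> \<le> real \<mu> * real \<sigma> / real (size X') ^ 2"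
      using ds by (intro divide_right_mono mult_left_mono) auto
    also have "\<dots> \<le> 101 / 100 * (real \<mu> * real \<sigma> / real n ^ 2)"
    proof -
      have "real n ^ 2 * (real \<mu> * real \<sigma>) \<le> (101 / 100 * real (size X') ^ 2) * (real \<mu> * real \<sigma>)"
        using sq by (rule mult_right_mono) simp
      then show ?thesis using n'0 n1
        by (simp only: times_divide_eq_right frac_le_eq divide_le_eq le_divide_eq) (simp add: divide_le_eq le_divide_eq mult_ac)
    qed
    finally show ?thesis by (simp add: \<rho>_def)
  qed
  have "\<Sum>\<^sub># Y mod d = t mod d" by (fact Y(2))
  obtain YE YF where YEF: "Y = YE + YF" "YE \<subseteq># E" "YF \<subseteq># F"
    using Y(1) mset_subset_eq_add_split unfolding XEF by blast
  have "d dvd \<Sum>\<^sub># YE"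
  proof -
    have "d dvd x" if "x \<in># YE" for x using mset_subset_eqD[OF YEF(2) that] by (simp add: E_def)
    then show ?thesis by (induction YE) auto
  qed
  then have "\<Sum>\<^sub># YF mod d = t mod d"
    using Y(2) YEF(1) by (auto elim!: dvdE)
  with small_residue_representative[OF _ YEF(3), of d] d0
  \<comment> \<open>Sums over \<open>E\<close> vanish modulo \<open>d\<close>, so the residue is
    corrected by exceptions alone, and by fewer than \<open>d\<close> of them.\<close>
  obtain Y' where Y': "Y' \<subseteq># F" "size Y' < d" "\<Sum>\<^sub># Y' mod d = t mod d" by auto
  have F_le: "x \<le> m" if "x \<in># F" for x using that le_max_elem[of x X] by (simp add: F_def m_def)
  have sumY': "\<Sum>\<^sub># Y' \<le> d * m"
  proof -
    have "\<Sum>\<^sub># Y' \<le> size Y' * m" using F_le Y'(1) by (intro sum_mset_le) (meson mset_subset_eqD)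
    also have "\<dots> \<le> d * m" using Y'(2) by simp
    finally show ?thesis .
  qed
  have dm_rho: "real d * real m \<le> 5 * (\<rho> * real m)" using mult_right_mono[OF dm5, of "real m"] by simp
  have t_ge: "339840 * (\<rho> * real m) \<le> real t"
  proof -
    let ?l = "log 2 (2 * real \<mu>)"
    have "1 \<le> ?l" using mu1 by simp
    then have "339840 \<le> 4 + 2 * C_lambda X" by (simp add: C_lambda_def \<mu>_def)
    then have "339840 * (\<rho> * real m) \<le> (4 + 2 * C_lambda X) * (\<rho> * real m)"
      using rho0 by (intro mult_right_mono) auto
    also have "\<dots> \<le> real t" using t(2) by (simp add: \<rho>_def n_def \<mu>_def m_def \<sigma>_def mult.commute mult.left_commute)
    finally show ?thesis .
  qed
  have Yt: "\<Sum>\<^sub># Y' \<le> t"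
  proof -
    have "real (\<Sum>\<^sub># Y') \<le> real (d * m)" using sumY' by (simp only: of_nat_le_iff)
    also have "\<dots> \<le> real t" using dm_rho t_ge mult_nonneg_nonneg[OF rho0, of "real m"] by simp
    finally show ?thesis by (simp only: of_nat_le_iff)
  qed
  then have "d dvd t - \<Sum>\<^sub># Y'" using Y'(3) by (metis mod_eq_dvd_iff_nat)
  then obtain t' where "t - \<Sum>\<^sub># Y' = d * t'" by (elim dvdE)
  then have t': "t = \<Sum>\<^sub># Y' + d * t'" using Yt by linarith
  have "t' \<in> subset_sums X'"
  proof (rule dense_subset_sums_interval)
    show "0 \<notin># X'"
    proof
      assume "0 \<in># X'"
      then have "d * 0 \<in># image_mset ((*) d) X'" by (metis image_eqI set_image_mset)
      then show False using E_X' X(2) by (auto simp: E_def)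
    qed
    show "count X' x \<le> \<mu>" for x
    proof -
      have "count X' x \<le> count (image_mset ((*) d) X') (d * x)"
        unfolding count_image_mset
      proof (cases "x \<in># X'")
        case True
        then show "count X' x \<le> sum (count X') ((*) d -` {d * x} \<inter> set_mset X')"
          by (intro member_le_sum) auto
      qed (simp add: not_in_iff)
      also have "\<dots> = count E (d * x)" by (simp add: E_X')
      also have "\<dots> \<le> count X (d * x)" by (simp add: E_def)
      also have "\<dots> \<le> \<mu>" unfolding \<mu>_def by (rule count_le_max_mult)
      finally show ?thesis .
    qed
    show "x \<le> M" if "x \<in># X'" for x
      using that le_max_elem[of _ X] by (auto simp: X'_def M_def E_def m_def div_le_mono)
    show "300 \<le> size X'" using nu n1 by simp
    show "37000 * log 2 (2 * real (size X')) * real \<mu> * real M \<le> real (size X') ^ 2"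
    proof -
      have l: "log 2 (2 * real (size X')) \<le> log 2 (2 * real n)" "0 \<le> log 2 (2 * real (size X'))"
        using nun nu n1 by auto
      have Mm: "real M \<le> real m" using dM d0
        by (metis M_def div_le_dividend of_nat_le_iff)
      have "37000 * log 2 (2 * real (size X')) * real \<mu> * real M \<le>
          37000 * log 2 (2 * real n) * real \<mu> * real m"
        using l Mm by (intro mult_mono) auto
      also have "\<dots> \<le> 37000 / 1699200 * real n ^ 2" using dens1 by linarith
      also have "\<dots> \<le> real (size X') ^ 2"
      proof -
        have "(999 * real n) ^ 2 \<le> (1000 * real (size X')) ^ 2" using nur by (intro power_mono) auto
        then have "998001 * real n ^ 2 \<le> 1000000 * real (size X') ^ 2"
          by (simp add: power_mult_distrib)
        then show ?thesis using zero_le_power2[of "real n"] by linarith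
      qed
      finally show ?thesis .
    qed
    show "g \<le> size {#x \<in># X'. \<not> g dvd x#} + 1"
      if g: "2 \<le> g" "real g \<le> 136 * (real \<mu> * real (\<Sum>\<^sub># X') / real (size X') ^ 2)" for g
    proof -
      \<comment> \<open>\<open>138 * 1000\<close> lies below the 1699200 of \<open>rhon\<close>, so
        \<open>d * g\<close> falls into the range in which \<open>d\<close> is maximal.\<close>
      have "real g * real d \<le> 136 * \<rho>' * real d" using g(2) by (intro mult_right_mono) (auto simp: \<rho>'_def)
      also have "\<dots> \<le> 138 * \<rho>" using rho' rho0 by (simp add: algebra_simps)
      finally have "1000 * (real g * real d) \<le> real n" using rhon rho0 by linarith
      then have "real (1000 * (d * g)) \<le> real n" by (simp add: mult.commute)
      then have "1000 * (d * g) \<le> n" by (simp only: of_nat_le_iff)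
      moreover have "d < d * g" using d0 g(1) by simp
      ultimately have "d * g \<le> nondiv (d * g) X" using dmax by blast
      also have "\<dots> \<le> nondiv g X' + size F"
      proof -
        have "nondiv (d * g) X = size {#x \<in># E. \<not> d * g dvd x#} + size {#x \<in># F. \<not> d * g dvd x#}"
          unfolding nondiv_def XEF by simp
        moreover have "size {#x \<in># F. \<not> d * g dvd x#} \<le> size F" by (rule size_filter_mset_lesseq)
        moreover have "size {#x \<in># E. \<not> d * g dvd x#} = nondiv g X'"
        proof -
          have "{#x \<in># E. \<not> d * g dvd x#} = image_mset ((*) d) {#x \<in># X'. \<not> g dvd x#}"
            using d0 by (simp flip: E_X' add: filter_mset_image_mset o_def)
          then show ?thesis by (simp add: nondiv_def)
        qed
        ultimately show ?thesis by simp
      qed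
      finally have "d * g + 1 \<le> nondiv g X' + d" using sF by simp
      \<comment> \<open>This is \<open>(d - 1) * (g - 1) \<ge> 0\<close>; it absorbs the up to
        \<open>d - 1\<close> exceptions in \<open>F\<close>.\<close>
      moreover have "d + g \<le> d * g + 1"
      proof -
        obtain d1 g1 where "d = Suc d1" "g = Suc g1"
          using d0 g(1) by (metis One_nat_def Suc_le_D numeral_2_eq_2)
        then show ?thesis by simp
      qed
      ultimately show ?thesis by (simp add: nondiv_def)
    qed
    show "952 * (real \<mu> * real (\<Sum>\<^sub># X') / real (size X') ^ 2) * real M \<le> real t'"
    proof -
      have dMr: "real d * real M \<le> real m" using dM by (metis of_nat_le_iff of_nat_mult)
      have Mm: "real M \<le> real m" by (simp add: M_def)
      have "real d * (952 * \<rho>' * real M) = 952 * (real d * \<rho>') * real M" by simp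
      also have "\<dots> \<le> 952 * (101 / 100 * \<rho>) * real m"
      proof -
        have "(real d * \<rho>') * real M \<le> (101 / 100 * \<rho>) * real m"
          by (rule mult_mono[OF rho' Mm]) (use rho0 in auto)
        then show ?thesis by linarith
      qed
      also have "\<dots> \<le> real t - real d * real m"
        using t_ge dm_rho mult_nonneg_nonneg[OF rho0, of "real m"] by simp
      also have "\<dots> \<le> real d * real t'"
      proof -
        have "real (\<Sum>\<^sub># Y') \<le> real (d * m)" using sumY' by (simp only: of_nat_le_iff)
        moreover have "real t = real (\<Sum>\<^sub># Y') + real d * real t'"
          by (subst t') simp
        ultimately show ?thesis by simp
      qed
      finally have "952 * \<rho>' * real M \<le> real t'"
        using d0 by (metis mult_le_cancel_left_pos of_nat_0_less_iff less_le_trans zero_less_one)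
      then show ?thesis by (simp only: \<rho>'_def)
    qed
    \<comment> \<open>Dividing out \<open>d\<close> loses \<open>F\<close>, at most a fifth of the
      total, and \<open>1 / 2 = 5 / 8 * 4 / 5\<close>.\<close>
    show "8 * t' \<le> 5 * \<Sum>\<^sub># X'"
    proof -
      have "real (\<Sum>\<^sub># F) \<le> real d * real m"
      proof -
        have "\<Sum>\<^sub># F \<le> size F * m" using F_le by (rule sum_mset_le)
        also have "\<dots> \<le> d * m" using sF by simp
        finally show ?thesis by (metis of_nat_le_iff of_nat_mult)
      qed
      then have "5 * real (\<Sum>\<^sub># F) \<le> real \<sigma>"
        using dm_rho rhom mult_nonneg_nonneg[OF rho0, of "real m"] by simp
      moreover have "real \<sigma> = real d * real (\<Sum>\<^sub># X') + real (\<Sum>\<^sub># F)"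
        using sumE XEF by (metis \<sigma>_def of_nat_add of_nat_mult sum_mset.union)
      moreover have "d * t' \<le> t" using t' by simp
      then have "real d * real t' \<le> real t" by (metis of_nat_le_iff of_nat_mult)
      ultimately have "8 * (real d * real t') \<le> 5 * (real d * real (\<Sum>\<^sub># X'))"
        using t(1) unfolding \<sigma>_def by linarith
      then have "real d * real (8 * t') \<le> real d * real (5 * \<Sum>\<^sub># X')" by simp
      then have "real (8 * t') \<le> real (5 * \<Sum>\<^sub># X')" using d0 by (metis mult_le_cancel_left_pos of_nat_0_less_iff less_le_trans zero_less_one)
      then show ?thesis by (simp only: of_nat_le_iff)
    qed
  qed
  then obtain Z where Z: "Z \<subseteq># X'" "t' = \<Sum>\<^sub># Z" by (auto simp: subset_sums_def)
  have "image_mset ((*) d) Z \<subseteq># E" using image_mset_subseteq_mono[OF Z(1), of "(*) d"] E_X' by simp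
  then have "image_mset ((*) d) Z + Y' \<subseteq># X" unfolding XEF using Y'(1) by (rule subset_mset.add_mono)
  moreover have "\<Sum>\<^sub># (image_mset ((*) d) Z + Y') = t"
    using t' Z(2) sum_mset_distrib_left[of d "\<lambda>x. x" Z] by simp
  ultimately show "t \<in> subset_sums X" unfolding subset_sums_def by blast
qed auto

section \<open>A verified compiler for a language with arrays\<close>

datatype ex = V nat | N nat | Op binop ex ex | Arr nat ex

datatype stm =
    Asg nat ex
  | Sto nat ex ex
  | Sq stm stm  (infixr \<open>;;\<close> 60)
  | Ife ex stm stm
  | Whl ex stm
  | Blk stm

type_synonym vars = "nat \<Rightarrow> nat"
type_synonym arrs = "nat \<Rightarrow> nat \<Rightarrow> nat"
type_synonym assn = "vars \<Rightarrow> arrs \<Rightarrow> nat \<Rightarrow> bool"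

abbreviation plus_ex (infixl \<open>\<oplus>\<close> 65) where "e1 \<oplus> e2 \<equiv> Op Plus e1 e2"
abbreviation minus_ex (infixl \<open>\<ominus>\<close> 65) where "e1 \<ominus> e2 \<equiv> Op Minus e1 e2"
abbreviation times_ex (infixl \<open>\<otimes>\<close> 70) where "e1 \<otimes> e2 \<equiv> Op Times e1 e2"
abbreviation div_ex (infixl \<open>\<oslash>\<close> 70) where "e1 \<oslash> e2 \<equiv> Op Divide e1 e2"
abbreviation mod_ex (infixl \<open>\<odot>\<close> 70) where "e1 \<odot> e2 \<equiv> Op Modulo e1 e2"
abbreviation less_ex (infix \<open>\<prec>\<close> 50) where "e1 \<prec> e2 \<equiv> Op Less e1 e2"
abbreviation eq_ex (infix \<open>\<doteq>\<close> 50) where "e1 \<doteq> e2 \<equiv> Op Equal e1 e2"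

primrec ev :: "vars \<Rightarrow> arrs \<Rightarrow> ex \<Rightarrow> nat" where
  "ev v a (V x) = v x"
| "ev v a (N c) = c"
| "ev v a (Op f e1 e2) = binop_val f (ev v a e1) (ev v a e2)"
| "ev v a (Arr q e) = a q (ev v a e)"

primrec ecost :: "ex \<Rightarrow> nat" where
  "ecost (V x) = 2"
| "ecost (N c) = 1"
| "ecost (Op f e1 e2) = ecost e1 + ecost e2 + 1"
| "ecost (Arr q e) = ecost e + 4"

text \<open>Registers below 50 hold variables, register 50 holds the array stride \<open>Z\<close>, and registers from
  51 on are scratch.  Cell \<open>i\<close> of array \<open>q\<close> lives at address \<open>q * Z + i\<close>, so array 0 is the input.\<close>

primrec ce :: "ex \<Rightarrow> nat \<Rightarrow> com" where
  "ce (V x) r = Seq (Const r 0) (Arith r Plus x r)"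
| "ce (N c) r = Const r c"
| "ce (Op f e1 e2) r = Seq (ce e1 r) (Seq (ce e2 (Suc r)) (Arith r f r (Suc r)))"
| "ce (Arr q e) r = Seq (ce e r) (Seq (Const (Suc r) q) (Seq (Arith (Suc r) Times (Suc r) 50)
     (Seq (Arith r Plus r (Suc r)) (Load r r))))"

text \<open>The machine has no register move, so a value is copied by adding zero.
  \<open>While\<close> tests a register, hence the condition is evaluated before the loop and again
  at the end of each round.\<close>

primrec compile :: "stm \<Rightarrow> com" where
  "compile (Asg x e) = Seq (ce e 51) (Seq (Const 52 0) (Arith x Plus 51 52))"
| "compile (Sto q i e) = Seq (ce i 51) (Seq (Const 52 q) (Seq (Arith 52 Times 52 50)
     (Seq (Arith 51 Plus 51 52) (Seq (ce e 52) (Store 51 52)))))"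
| "compile (c1 ;; c2) = Seq (compile c1) (compile c2)"
| "compile (Ife e c1 c2) = Seq (ce e 51) (If 51 (compile c1) (compile c2))"
| "compile (Whl e c) = Seq (ce e 51) (While 51 (Seq (compile c) (ce e 51)))"
| "compile (Blk c) = compile c"

inductive_cases exec_SeqE: "exec w (Seq c1 c2) s k s'"

text \<open>Twenty arrays of stride \<open>Z\<close> occupy the addresses below
  \<open>20 * Z\<close>, so no address wraps around; \<open>2 \<le> Z\<close> leaves room for the
  truth values.\<close>

locale word_ram =
  fixes w Z :: nat
  assumes word: "20 * Z \<le> 2 ^ w" and Z2: "2 \<le> Z"
begin

text \<open>Only sums and products can leave the range below \<open>Z\<close>. With these kept
  inside, reduction modulo \<open>2 ^ w\<close> is invisible and expressions have their value in the
  natural numbers.\<close>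

fun eok :: "vars \<Rightarrow> arrs \<Rightarrow> ex \<Rightarrow> bool" where
  "eok v a (V x) \<longleftrightarrow> x < 50"
| "eok v a (N c) \<longleftrightarrow> c < Z"
| "eok v a (Op Plus e1 e2) \<longleftrightarrow> eok v a e1 \<and> eok v a e2 \<and> ev v a e1 + ev v a e2 < Z"
| "eok v a (Op Times e1 e2) \<longleftrightarrow> eok v a e1 \<and> eok v a e2 \<and> ev v a e1 * ev v a e2 < Z"
| "eok v a (Op f e1 e2) \<longleftrightarrow> eok v a e1 \<and> eok v a e2"
| "eok v a (Arr q e) \<longleftrightarrow> q < 20 \<and> eok v a e"

definition rel :: "vars \<Rightarrow> arrs \<Rightarrow> ram \<Rightarrow> bool" where
  "rel v a s \<longleftrightarrow> (\<forall>x<50. regs s x = v x) \<and> regs s 50 = Z \<and>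
     (\<forall>q<20. \<forall>i<Z. mem s (q * Z + i) = a q i) \<and> (\<forall>x. v x < Z) \<and> (\<forall>q i. a q i < Z)"

text \<open>Total correctness with a time budget that is handed on: the postcondition receives what
  is left of \<open>T\<close>, so costs are subtracted along the way and need not be added up for
  compound programs.\<close>

definition wp :: "stm \<Rightarrow> assn \<Rightarrow> assn" where
  "wp c Q v a T \<longleftrightarrow> (\<forall>s. rel v a s \<longrightarrow> (\<exists>k s' v' a' T'. exec w (compile c) s k s' \<and>
     k + T' \<le> T \<and> rel v' a' s' \<and> Q v' a' T'))"

lemma less_word: "x < Z \<Longrightarrow> x mod 2 ^ w = x" for x
  using word by (intro mod_less) linarith

lemma addr_less: "q < 20 \<Longrightarrow> i < Z \<Longrightarrow> q * Z + i < 2 ^ w"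
proof -
  assume "q < 20" "i < Z"
  then have "q * Z + i < (q + 1) * Z" by simp
  also have "\<dots> \<le> 20 * Z" using \<open>q < 20\<close> by (intro mult_le_mono1) simp
  finally show ?thesis using word by simp
qed

lemma ev_less:
  assumes "eok v a e" "\<And>x. v x < Z" "\<And>q i. a q i < Z"
  shows "ev v a e < Z"
  using assms(1)
proof (induction e)
  case (Op f e1 e2)
  show ?case
  proof (cases f)
    case Minus then show ?thesis using Op by (auto intro: le_less_trans[OF diff_le_self])
  next
    case Divide then show ?thesis using Op by (auto intro: le_less_trans[OF div_le_dividend])
  next
    case Modulo then show ?thesis using Op by (auto intro: le_less_trans[OF mod_less_eq_dividend])
  qed (use Op Z2 in auto)
qed (use assms in auto)

lemma ce_exec:
  assumes "eok v a e" "rel v a s0" "51 \<le> r" "\<And>x. x < 51 \<Longrightarrow> regs s x = regs s0 x" "mem s = mem s0"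
  shows "\<exists>s'. exec w (ce e r) s (ecost e) s' \<and> regs s' r = ev v a e \<and>
    (\<forall>x<r. regs s' x = regs s x) \<and> mem s' = mem s"
  using assms(1,3-5)
proof (induction e arbitrary: r s)
  case (V x)
  let ?s1 = "set_reg r (0 mod 2 ^ w) s"
  have "exec w (ce (V x) r) s (1 + 1)
      (set_reg r (binop_val Plus (regs ?s1 x) (regs ?s1 r) mod 2 ^ w) ?s1)"
    unfolding ce.simps by (rule exec.Seq exec.Const exec.Arith)+
  moreover have "v x < Z" "regs s x = v x" using assms(2) V by (auto simp: rel_def)
  ultimately show ?case using V
    by (intro exI[of _ "set_reg r (binop_val Plus (regs ?s1 x) (regs ?s1 r) mod 2 ^ w) ?s1"])
      (auto simp: set_reg_def less_word simp flip: numeral_2_eq_2)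
next
  case (N c)
  have "exec w (ce (N c) r) s 1 (set_reg r (c mod 2 ^ w) s)"
    unfolding ce.simps by (rule exec.Const)
  then show ?case using N
    by (intro exI[of _ "set_reg r (c mod 2 ^ w) s"]) (auto simp: set_reg_def less_word)
next
  case (Op f e1 e2)
  have ok: "eok v a e1" "eok v a e2" using Op.prems(1) by (cases f; simp)+
  from Op.IH(1)[OF ok(1) Op.prems(2-4)] obtain s1 where s1: "exec w (ce e1 r) s (ecost e1) s1"
    "regs s1 r = ev v a e1" "\<And>x. x < r \<Longrightarrow> regs s1 x = regs s x" "mem s1 = mem s" by auto
  have "\<exists>s2. exec w (ce e2 (Suc r)) s1 (ecost e2) s2 \<and> regs s2 (Suc r) = ev v a e2 \<and>
    (\<forall>x<Suc r. regs s2 x = regs s1 x) \<and> mem s2 = mem s1"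
    using Op.prems s1 by (intro Op.IH(2) ok) auto
  then obtain s2 where s2: "exec w (ce e2 (Suc r)) s1 (ecost e2) s2"
    "regs s2 (Suc r) = ev v a e2" "\<And>x. x < Suc r \<Longrightarrow> regs s2 x = regs s1 x" "mem s2 = mem s1" by auto
  have "exec w (ce (Op f e1 e2) r) s (ecost e1 + (ecost e2 + 1))
      (set_reg r (binop_val f (regs s2 r) (regs s2 (Suc r)) mod 2 ^ w) s2)"
    unfolding ce.simps by (rule s1(1) s2(1) exec.Seq exec.Arith)+
  moreover have "ev v a (Op f e1 e2) < Z"
    using Op.prems(1) assms(2) by (intro ev_less) (auto simp: rel_def)
  ultimately show ?case using s1 s2
    by (intro exI[of _ "set_reg r (binop_val f (regs s2 r) (regs s2 (Suc r)) mod 2 ^ w) s2"])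
      (auto simp: set_reg_def less_word add.assoc)
next
  case (Arr q e)
  have ok: "eok v a e" "q < 20" using Arr.prems(1) by auto
  from Arr.IH[OF ok(1) Arr.prems(2-4)] obtain s1 where s1: "exec w (ce e r) s (ecost e) s1"
    "regs s1 r = ev v a e" "\<And>x. x < r \<Longrightarrow> regs s1 x = regs s x" "mem s1 = mem s" by auto
  have lt: "ev v a e < Z" using ok assms(2) by (intro ev_less) (auto simp: rel_def)
  let ?s2 = "set_reg (Suc r) (q mod 2 ^ w) s1"
  let ?s3 = "set_reg (Suc r) (binop_val Times (regs ?s2 (Suc r)) (regs ?s2 50) mod 2 ^ w) ?s2"
  let ?s4 = "set_reg r (binop_val Plus (regs ?s3 r) (regs ?s3 (Suc r)) mod 2 ^ w) ?s3"
  let ?s5 = "set_reg r (mem ?s4 (regs ?s4 r)) ?s4"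
  have ex: "exec w (ce (Arr q e) r) s (ecost e + (1 + (1 + (1 + 1)))) ?s5"
    unfolding ce.simps by (rule s1(1) exec.Seq exec.Const exec.Arith exec.Load)+
  have "50 < r" using Arr.prems by simp
  then have r50: "regs s1 50 = Z" using s1 Arr.prems assms(2) by (auto simp: rel_def)
  have qw: "q < 2 ^ w" "q * Z < 2 ^ w" "ev v a e + q * Z < 2 ^ w"
    using addr_less[OF ok(2) lt] Z2 word ok(2) by (auto intro: le_less_trans[of _ "q * Z + ev v a e"])
  have "mem s1 (q * Z + ev v a e) = a q (ev v a e)"
    using s1 Arr.prems assms(2) ok lt by (auto simp: rel_def)
  then have "regs ?s5 r = ev v a (Arr q e)"
    using s1 r50 qw Arr.prems by (simp add: set_reg_def add.commute)
  moreover have cost: "ecost e + (1 + (1 + (1 + 1))) = ecost (Arr q e)" by simp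
  have "exec w (ce (Arr q e) r) s (ecost (Arr q e)) ?s5" using ex unfolding cost .
  moreover have "\<forall>x<r. regs ?s5 x = regs s x" "mem ?s5 = mem s"
    using s1 by (auto simp: set_reg_def)
  ultimately show ?case by blast
qed

lemma rel_scratch:
  "rel v a s \<Longrightarrow> (\<And>x. x < 51 \<Longrightarrow> regs s' x = regs s x) \<Longrightarrow> mem s' = mem s \<Longrightarrow> rel v a s'"
  by (auto simp: rel_def)

lemma wp_Asg:
  assumes "x < 50" "eok v a e" "ecost e + 2 \<le> T" "Q (v(x := ev v a e)) a (T - (ecost e + 2))"
  shows "wp (Asg x e) Q v a T"
  unfolding wp_def
proof (intro allI impI)
  fix s assume s: "rel v a s"
  from ce_exec[OF assms(2) s, of 51 s] obtain s1 where s1: "exec w (ce e 51) s (ecost e) s1"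
    "regs s1 51 = ev v a e" "\<And>x. x < 51 \<Longrightarrow> regs s1 x = regs s x" "mem s1 = mem s" by auto
  let ?s2 = "set_reg 52 (0 mod 2 ^ w) s1"
  let ?s3 = "set_reg x (binop_val Plus (regs ?s2 51) (regs ?s2 52) mod 2 ^ w) ?s2"
  have ex: "exec w (compile (Asg x e)) s (ecost e + (1 + 1)) ?s3"
    unfolding compile.simps by (rule s1(1) exec.Seq exec.Const exec.Arith)+
  have "ev v a e < Z" using assms(2) s by (intro ev_less) (auto simp: rel_def)
  then have "rel (v(x := ev v a e)) a ?s3"
    using s s1 assms(1) by (auto simp: rel_def set_reg_def less_word)
  with ex show "\<exists>k s' v' a' T'. exec w (compile (Asg x e)) s k s' \<and> k + T' \<le> T \<and>
      rel v' a' s' \<and> Q v' a' T'"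
    using assms(3,4)
    by (intro exI[of _ "ecost e + (1 + 1)"] exI[of _ ?s3] exI[of _ "v(x := ev v a e)"] exI[of _ a]
        exI[of _ "T - (ecost e + 2)"]) simp
qed

lemma wp_Sto:
  assumes "q < 20" "eok v a i" "eok v a e" "ecost i + ecost e + 4 \<le> T"
    "Q v (a(q := (a q)(ev v a i := ev v a e))) (T - (ecost i + ecost e + 4))"
  shows "wp (Sto q i e) Q v a T"
  unfolding wp_def
proof (intro allI impI)
  fix s assume s: "rel v a s"
  from ce_exec[OF assms(2) s, of 51 s] obtain s1 where s1: "exec w (ce i 51) s (ecost i) s1"
    "regs s1 51 = ev v a i" "\<And>x. x < 51 \<Longrightarrow> regs s1 x = regs s x" "mem s1 = mem s" by auto
  have vb: "v x < Z" "a p j < Z" for x p j using s unfolding rel_def by blast+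
  have lt: "ev v a i < Z" "ev v a e < Z" using ev_less[OF assms(2) vb] ev_less[OF assms(3) vb] .
  let ?s2 = "set_reg 52 (q mod 2 ^ w) s1"
  let ?s3 = "set_reg 52 (binop_val Times (regs ?s2 52) (regs ?s2 50) mod 2 ^ w) ?s2"
  let ?s4 = "set_reg 51 (binop_val Plus (regs ?s3 51) (regs ?s3 52) mod 2 ^ w) ?s3"
  have qw: "q < 2 ^ w" "q * Z < 2 ^ w" "ev v a i + q * Z < 2 ^ w"
    using addr_less[OF assms(1) lt(1)] Z2 word assms(1)
    by (auto intro: le_less_trans[of _ "q * Z + ev v a i"])
  have r50: "regs s1 50 = Z" using s1(3)[of 50] s by (auto simp: rel_def)
  have s4: "regs ?s4 51 = q * Z + ev v a i" "\<And>x. x < 51 \<Longrightarrow> regs ?s4 x = regs s x" "mem ?s4 = mem s"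
    using s1 r50 qw by (simp_all add: set_reg_def add.commute)
  have "\<exists>s5. exec w (ce e 52) ?s4 (ecost e) s5 \<and> regs s5 52 = ev v a e \<and>
    (\<forall>x<52. regs s5 x = regs ?s4 x) \<and> mem s5 = mem ?s4"
    by (rule ce_exec[OF assms(3) s]) (use s4 in auto)
  then obtain s5 where s5: "exec w (ce e 52) ?s4 (ecost e) s5" "regs s5 52 = ev v a e"
    "\<And>x. x < 52 \<Longrightarrow> regs s5 x = regs ?s4 x" "mem s5 = mem ?s4" by blast
  let ?s6 = "set_mem (regs s5 51) (regs s5 52) s5"
  have ex: "exec w (compile (Sto q i e)) s (ecost i + (1 + (1 + (1 + (ecost e + 1))))) ?s6"
    unfolding compile.simps by (rule s1(1) s5(1) exec.Seq exec.Const exec.Arith exec.Store)+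
  have "rel v (a(q := (a q)(ev v a i := ev v a e))) ?s6"
    unfolding rel_def
  proof (intro conjI allI impI)
    fix x :: nat assume "x < 50"
    then show "regs ?s6 x = v x" using s5(3)[of x] s4(2)[of x] s by (simp add: set_mem_def rel_def)
  next
    show "regs ?s6 50 = Z" using s5(3)[of 50] s4(2)[of 50] s by (simp add: set_mem_def rel_def)
  next
    fix q' j :: nat assume qj: "q' < 20" "j < Z"
    have "mem ?s6 (q' * Z + j) = (if q' * Z + j = q * Z + ev v a i then ev v a e else a q' j)"
      using s5 s4 s qj by (simp add: set_mem_def rel_def)
    also have "q' * Z + j = q * Z + ev v a i \<longleftrightarrow> q' = q \<and> j = ev v a i"
    proof
      assume eq: "q' * Z + j = q * Z + ev v a i"
      then have "(q' * Z + j) div Z = (q * Z + ev v a i) div Z"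
        "(q' * Z + j) mod Z = (q * Z + ev v a i) mod Z" by simp_all
      then show "q' = q \<and> j = ev v a i" using qj lt by simp
    qed auto
    finally show "mem ?s6 (q' * Z + j) = (a(q := (a q)(ev v a i := ev v a e))) q' j" by auto
  next
    show "v x < Z" for x using s by (simp add: rel_def)
    show "(a(q := (a q)(ev v a i := ev v a e))) q' j < Z" for q' j
      using s lt by (auto simp: rel_def)
  qed
  with ex show "\<exists>k s' v' a' T'. exec w (compile (Sto q i e)) s k s' \<and> k + T' \<le> T \<and>
      rel v' a' s' \<and> Q v' a' T'"
    using assms(4,5)
    by (intro exI[of _ "ecost i + (1 + (1 + (1 + (ecost e + 1))))"] exI[of _ ?s6] exI[of _ v]
        exI[of _ "a(q := (a q)(ev v a i := ev v a e))"] exI[of _ "T - (ecost i + ecost e + 4)"]) simp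
qed

lemma wp_Sq: "wp c1 (wp c2 Q) v a T \<Longrightarrow> wp (c1 ;; c2) Q v a T"
proof -
  assume h: "wp c1 (wp c2 Q) v a T"
  show ?thesis unfolding wp_def
  proof (intro allI impI)
    fix s assume "rel v a s"
    with h obtain k1 s1 v1 a1 T1 where 1: "exec w (compile c1) s k1 s1" "k1 + T1 \<le> T"
      "rel v1 a1 s1" "wp c2 Q v1 a1 T1" unfolding wp_def[of c1] by blast
    from 1(3,4) obtain k2 s2 v2 a2 T2 where 2: "exec w (compile c2) s1 k2 s2" "k2 + T2 \<le> T1"
      "rel v2 a2 s2" "Q v2 a2 T2" unfolding wp_def by blast
    have "exec w (compile (c1 ;; c2)) s (k1 + k2) s2" using 1(1) 2(1) by (simp add: exec.Seq)
    moreover have "k1 + k2 + T2 \<le> T" using 1(2) 2(2) by simp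
    ultimately show "\<exists>k s' v' a' T'. exec w (compile (c1 ;; c2)) s k s' \<and> k + T' \<le> T \<and>
      rel v' a' s' \<and> Q v' a' T'" using 2(3,4) by blast
  qed
qed

lemma wp_Ife:
  assumes ok: "eok v a e" and cost: "ecost e + 1 \<le> T"
    and 1: "ev v a e \<noteq> 0 \<Longrightarrow> wp c1 Q v a (T - (ecost e + 1))"
    and 2: "ev v a e = 0 \<Longrightarrow> wp c2 Q v a (T - (ecost e + 1))"
  shows "wp (Ife e c1 c2) Q v a T"
  unfolding wp_def
proof (intro allI impI)
  fix s assume s: "rel v a s"
  from ce_exec[OF ok s, of 51 s] obtain s1 where s1: "exec w (ce e 51) s (ecost e) s1"
    "regs s1 51 = ev v a e" "\<And>x. x < 51 \<Longrightarrow> regs s1 x = regs s x" "mem s1 = mem s" by auto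
  have r1: "rel v a s1" by (rule rel_scratch[OF s s1(3,4)])
  let ?c = "if ev v a e \<noteq> 0 then c1 else c2"
  have "wp ?c Q v a (T - (ecost e + 1))" using 1 2 by simp
  with r1 obtain k s' v' a' T' where k: "exec w (compile ?c) s1 k s'"
    "k + T' \<le> T - (ecost e + 1)" "rel v' a' s'" "Q v' a' T'" unfolding wp_def by blast
  have "exec w (If 51 (compile c1) (compile c2)) s1 (k + 1) s'"
    using k(1) s1(2) exec.IfTrue[of s1 51 w "compile c1" k s'] exec.IfFalse[of s1 51 w "compile c2" k s']
    by (cases "ev v a e = 0") auto
  then have "exec w (compile (Ife e c1 c2)) s (ecost e + (k + 1)) s'"
    unfolding compile.simps by (rule exec.Seq[OF s1(1)])
  moreover have "ecost e + (k + 1) + T' \<le> T" using k(2) cost by simp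
  ultimately show "\<exists>k s' v' a' T'. exec w (compile (Ife e c1 c2)) s k s' \<and> k + T' \<le> T \<and>
      rel v' a' s' \<and> Q v' a' T'" using k(3,4) by blast
qed

text \<open>The remaining time \<open>T\<close> doubles as the variant of the loop, so termination needs no extra argument.\<close>

lemma wp_Whl:
  assumes I: "I v a T"
    and ok: "\<And>v a T. I v a T \<Longrightarrow> eok v a e \<and> ecost e + 1 \<le> T"
    and body: "\<And>v a T. I v a T \<Longrightarrow> ev v a e \<noteq> 0 \<Longrightarrow> wp c I v a (T - (ecost e + 1))"
    and post: "\<And>v a T. I v a T \<Longrightarrow> ev v a e = 0 \<Longrightarrow> Q v a (T - (ecost e + 1))"
  shows "wp (Whl e c) Q v a T"
  unfolding wp_def
proof (intro allI impI)
  fix s assume "rel v a s"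
  with I show "\<exists>k s' v' a' T'. exec w (compile (Whl e c)) s k s' \<and> k + T' \<le> T \<and>
      rel v' a' s' \<and> Q v' a' T'"
  proof (induction T arbitrary: v a s rule: less_induct)
    case (less T)
    note s = less.prems(2)
    have okT: "eok v a e" "ecost e + 1 \<le> T" using ok[OF less.prems(1)] by auto
    from ce_exec[OF okT(1) s, of 51 s] obtain s1 where s1: "exec w (ce e 51) s (ecost e) s1"
      "regs s1 51 = ev v a e" "\<And>x. x < 51 \<Longrightarrow> regs s1 x = regs s x" "mem s1 = mem s" by auto
    have r1: "rel v a s1" by (rule rel_scratch[OF s s1(3,4)])
    show ?case
    proof (cases "ev v a e = 0")
      case True
      then have "exec w (compile (Whl e c)) s (ecost e + 1) s1"
        unfolding compile.simps using s1(2) by (intro exec.Seq[OF s1(1)] exec.WhileFalse) simp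
      moreover have "ecost e + 1 + (T - (ecost e + 1)) \<le> T" using okT by simp
      ultimately show ?thesis using post[OF less.prems(1) True] r1 by blast
    next
      case False
      from body[OF less.prems(1) False] r1 obtain k2 s2 v2 a2 T2 where
        2: "exec w (compile c) s1 k2 s2" "k2 + T2 \<le> T - (ecost e + 1)" "rel v2 a2 s2" "I v2 a2 T2"
        unfolding wp_def by blast
      have "T2 < T" using 2(2) okT by linarith
      from less.IH[OF this 2(4,3)] obtain k3 s3 v3 a3 T3 where
        3: "exec w (compile (Whl e c)) s2 k3 s3" "k3 + T3 \<le> T2" "rel v3 a3 s3" "Q v3 a3 T3" by blast
      from 3(1) obtain ka kb sa where ab: "exec w (ce e 51) s2 ka sa"
        "exec w (While 51 (Seq (compile c) (ce e 51))) sa kb s3" "k3 = ka + kb"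
        by (auto elim: exec_SeqE)
      have "exec w (While 51 (Seq (compile c) (ce e 51))) s1 ((k2 + ka) + kb + 1) s3"
        using s1(2) False by (intro exec.WhileTrue[OF _ exec.Seq[OF 2(1) ab(1)] ab(2)]) simp
      then have "exec w (compile (Whl e c)) s (ecost e + ((k2 + ka) + kb + 1)) s3"
        unfolding compile.simps by (rule exec.Seq[OF s1(1)])
      moreover have "ecost e + ((k2 + ka) + kb + 1) + T3 \<le> T"
        using ab(3) 2(2) 3(2) okT(2) by linarith
      ultimately show ?thesis using 3(3,4) by blast
    qed
  qed
qed

lemma wp_mono:
  "wp c Q v a T \<Longrightarrow> (\<And>v a T. Q v a T \<Longrightarrow> Q' v a T) \<Longrightarrow> wp c Q' v a T"
  unfolding wp_def by blast

text \<open>\<open>Blk\<close> marks a subprogram that is to be treated through its specification: symbolic execution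
  stops there, as it does at loops.\<close>

primrec vc :: "stm \<Rightarrow> assn \<Rightarrow> assn" where
  "vc (Asg x e) Q v a T \<longleftrightarrow> x < 50 \<and> eok v a e \<and> ecost e + 2 \<le> T \<and>
     Q (v(x := ev v a e)) a (T - (ecost e + 2))"
| "vc (Sto q i e) Q v a T \<longleftrightarrow> q < 20 \<and> eok v a i \<and> eok v a e \<and> ecost i + ecost e + 4 \<le> T \<and>
     Q v (a(q := (a q)(ev v a i := ev v a e))) (T - (ecost i + ecost e + 4))"
| "vc (c1 ;; c2) Q v a T \<longleftrightarrow> vc c1 (vc c2 Q) v a T"
| "vc (Ife e c1 c2) Q v a T \<longleftrightarrow> eok v a e \<and> ecost e + 1 \<le> T \<and>
     (if ev v a e \<noteq> 0 then vc c1 Q v a (T - (ecost e + 1)) else vc c2 Q v a (T - (ecost e + 1)))"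
| "vc (Whl e c) Q v a T \<longleftrightarrow> wp (Whl e c) Q v a T"
| "vc (Blk c) Q v a T \<longleftrightarrow> wp c Q v a T"

lemma vc_sound: "vc c Q v a T \<Longrightarrow> wp c Q v a T"
proof (induction c arbitrary: Q v a T)
  case (Sq c1 c2)
  have "wp c1 (vc c2 Q) v a T" using Sq by simp
  then have "wp c1 (wp c2 Q) v a T" by (rule wp_mono) (rule Sq.IH(2))
  then show ?case by (rule wp_Sq)
next
  case (Blk c)
  then show ?case by (simp add: wp_def)
qed (auto intro!: wp_Asg wp_Sto wp_Ife split: if_splits)

lemma vc_Blk: "vc (Blk c) Q = wp c Q"
  by (intro ext) simp

text \<open>The postcondition may assume that the budget has not grown. In this way bounds that
  couple the budget with other quantities pass through specifications that do not mention
  them.\<close>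

lemma wp_fuel: "wp c (\<lambda>v' a' T'. T' \<le> T \<longrightarrow> Q v' a' T') v a T \<Longrightarrow> wp c Q v a T"
  unfolding wp_def
proof (intro allI impI)
  fix s assume h: "\<forall>s. rel v a s \<longrightarrow> (\<exists>k s' v' a' T'. exec w (compile c) s k s' \<and> k + T' \<le> T \<and>
    rel v' a' s' \<and> (T' \<le> T \<longrightarrow> Q v' a' T'))" and s: "rel v a s"
  then obtain k s' v' a' T' where 1: "exec w (compile c) s k s'" "k + T' \<le> T" "rel v' a' s'"
    "T' \<le> T \<longrightarrow> Q v' a' T'" by blast
  then have "Q v' a' T'" by simp
  then show "\<exists>k s' v' a' T'. exec w (compile c) s k s' \<and> k + T' \<le> T \<and> rel v' a' s' \<and> Q v' a' T'"
    using 1 by blast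
qed

lemma vc_Sq: "vc (c1 ;; c2) Q = vc c1 (vc c2 Q)"
  by (intro ext) simp

end

section \<open>Finding the modulus\<close>

text \<open>Names of blocks will stay below \<open>n ^ 4\<close>, so the code of a pair of names is
  below \<open>n ^ 8\<close>, and the stride \<open>n ^ 10\<close> accommodates every index.\<close>

locale instance_ram = word_ram +
  fixes xs :: "nat list" and n :: nat
  assumes n_def: "n = length xs" and n_ge: "1300 \<le> n" and pos: "0 \<notin> set xs"
    and sparse: "1699200 * max_mult (mset xs) * max_elem (mset xs) \<le> n ^ 2" and Z_def: "Z = n ^ 10"
begin

lemma max_mult_ge: "1 \<le> max_mult (mset xs)"
proof -
  have "xs \<noteq> []" using n_ge n_def by (cases xs) auto
  then have "xs ! 0 \<in># mset xs" by simp
  then have "1 \<le> count (mset xs) (xs ! 0)" by (simp add: Suc_le_eq)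
  then show ?thesis using count_le_max_mult[of "mset xs" "xs ! 0"] by linarith
qed

text \<open>Density keeps the elements below \<open>n ^ 2\<close>, which allows them to serve as
  array indices.\<close>

lemma xs_range:
  assumes "x \<in> set xs"
  shows "0 < x \<and> x < n * n"
proof
  have x: "x \<le> max_elem (mset xs)" using assms by (intro le_max_elem) simp
  show "0 < x" using assms pos by (metis gr0I)
  have "max_elem (mset xs) \<le> max_mult (mset xs) * max_elem (mset xs)" using max_mult_ge by simp
  moreover have "1699200 * (max_mult (mset xs) * max_elem (mset xs)) \<le> n * n"
    using sparse by (simp add: power2_eq_square mult.assoc)
  ultimately show "x < n * n" using x \<open>0 < x\<close> by linarith
qed

lemma less_Z: "x \<le> n ^ 9 \<Longrightarrow> x < Z"
proof -
  assume "x \<le> n ^ 9"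
  also have "n ^ 9 < n ^ 10" using n_ge by (intro power_strict_increasing) auto
  finally show ?thesis by (simp add: Z_def)
qed

lemma less_Z_small: "x \<le> 4 * (n * n * n) \<Longrightarrow> x < Z"
proof (rule less_Z)
  assume "x \<le> 4 * (n * n * n)"
  also have "\<dots> \<le> n * (n * n * n)" using n_ge by (intro mult_le_mono1) simp
  also have "\<dots> = n ^ 4" by (simp add: eval_nat_numeral)
  also have "\<dots> \<le> n ^ 9" using n_ge by (intro power_increasing) auto
  finally show "x \<le> n ^ 9" .
qed

lemma n_le_cube: "n \<le> n * n" "n * n \<le> n * n * n" "1300 \<le> n * n"
proof -
  show "n \<le> n * n" "n * n \<le> n * n * n" using n_ge by auto
  then show "1300 \<le> n * n" using n_ge by linarith
qed

lemma less_Z_quad: "x \<le> 4 * (n * n) \<Longrightarrow> x < Z"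
  using n_le_cube by (intro less_Z_small) linarith

lemma n_less_Z: "x \<le> n + 1000 \<Longrightarrow> x < Z"
  using n_le_cube n_ge by (intro less_Z_quad) linarith

abbreviation "L \<equiv> n div 1000"

lemma L_ge: "1 \<le> L" using n_ge by (simp add: Suc_leI div_greater_zero_iff)

text \<open>Elements are linked to the previous one in the same bucket of width \<open>L\<close> and of the same
  occurrence number; the virtual predecessor in bucket 0 is 0.  The differences collected this way
  are positive, at most \<open>L\<close>, and divisible by \<open>d\<close> for almost all elements if \<open>d\<close> divides almost
  all elements.\<close>

definition link_body :: stm where
  "link_body =
     Asg 4 (Arr 0 (V 3)) ;;
     Asg 5 (Arr 10 (V 4)) ;;
     Sto 10 (V 4) (V 5 \<oplus> N 1) ;;
     Asg 6 (V 4 \<oslash> V 2) ;;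
     Asg 7 (V 5 \<otimes> (V 0 \<otimes> V 0) \<oplus> V 6) ;;
     Asg 8 (Arr 2 (V 7)) ;;
     Ife ((V 6 \<doteq> N 0) \<oplus> V 8)
       (Asg 10 ((V 4 \<ominus> V 8) \<oplus> (V 8 \<ominus> V 4)) ;;
        Sto 3 (V 10) (Arr 3 (V 10) \<oplus> N 1) ;;
        Asg 9 (V 9 \<oplus> N 1))
       (Asg 10 (N 0)) ;;
     Sto 2 (V 7) (V 4) ;;
     Asg 3 (V 3 \<oplus> N 1)"

definition link :: stm where
  "link = Asg 2 (V 0 \<oslash> N 1000) ;; Asg 3 (N 0) ;; Whl (V 3 \<prec> V 0) link_body"

text \<open>\<open>pm k\<close> is the last element of the chain with key \<open>k\<close>, or 0. An
  element not divisible by \<open>d\<close> spoils at most two differences, the one to its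
  predecessor and the one to its successor; the second term of that clause holds the charge for a
  successor still to come. An element yields no difference only if it is the first of a chain
  outside bucket 0, and the clause on sizes counts these chains.\<close>

definition linked :: "nat multiset \<Rightarrow> (nat \<Rightarrow> nat) \<Rightarrow> nat multiset \<Rightarrow> bool" where
  "linked Y pm \<Delta> \<longleftrightarrow> finite {k. pm k \<noteq> 0} \<and>
     (\<forall>d. nondiv d \<Delta> + card {k. pm k \<noteq> 0 \<and> \<not> d dvd pm k} \<le> 2 * nondiv d Y) \<and>
     size \<Delta> + card {k. pm k \<noteq> 0 \<and> pm k div L \<noteq> 0} = size Y \<and>
     (\<forall>k. pm k \<noteq> 0 \<longrightarrow> (\<exists>j<count Y (pm k). k = j * (n * n) + pm k div L)) \<and>
     (\<forall>\<delta>\<in>#\<Delta>. 1 \<le> \<delta> \<and> \<delta> \<le> L)"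

lemma linked_empty: "linked {#} (\<lambda>_. 0) {#}"
  by (simp add: linked_def nondiv_def)

lemma nondiv_add_mset: "nondiv d (add_mset x Y) = nondiv d Y + of_bool (\<not> d dvd x)"
  by (simp add: nondiv_def)

lemma mult_add_inj:
  fixes j j' b b' N :: nat
  assumes "j * N + b = j' * N + b'" "b < N" "b' < N"
  shows "j = j'" "b = b'"
proof -
  have "(j * N + b) div N = (j' * N + b') div N" "(j * N + b) mod N = (j' * N + b') mod N"
    unfolding assms(1) by (rule refl)+
  moreover have "0 < N" using assms(2) by simp
  ultimately show "j = j'" "b = b'" using assms(2,3) by simp_all
qed

lemma card_fun_upd:
  assumes "finite {k. pm k \<noteq> (0::nat)}" "x \<noteq> 0"
  shows "card {k. (pm(c := x)) k \<noteq> 0 \<and> P ((pm(c := x)) k)} + of_bool (pm c \<noteq> 0 \<and> P (pm c)) =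
    card {k. pm k \<noteq> 0 \<and> P (pm k)} + of_bool (P x)"
proof -
  define S where "S = {k. pm k \<noteq> 0 \<and> P (pm k)} - {c}"
  have S: "finite S" "c \<notin> S"
    using assms(1) by (auto simp: S_def intro: rev_finite_subset)
  have "{k. (pm(c := x)) k \<noteq> 0 \<and> P ((pm(c := x)) k)} = (if P x then insert c S else S)"
    using assms(2) by (auto simp: S_def)
  then have 1: "card {k. (pm(c := x)) k \<noteq> 0 \<and> P ((pm(c := x)) k)} = card S + of_bool (P x)"
    using S by (simp split del: if_split)
  have "{k. pm k \<noteq> 0 \<and> P (pm k)} = (if pm c \<noteq> 0 \<and> P (pm c) then insert c S else S)"
    by (auto simp: S_def)
  then have 2: "card {k. pm k \<noteq> 0 \<and> P (pm k)} = card S + of_bool (pm c \<noteq> 0 \<and> P (pm c))"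
    using S by (simp split del: if_split)
  show ?thesis unfolding 1 2 by simp
qed

lemma linked_add:
  assumes lk: "linked Y pm \<Delta>" and x: "0 < x" "x < n * n"
    and Y: "\<And>y. y \<in># Y \<Longrightarrow> y < n * n"
    and c: "c = count Y x * (n * n) + x div L" and \<delta>: "\<delta> = (x - pm c) + (pm c - x)"
  shows "linked (add_mset x Y) (pm(c := x))
    (if x div L = 0 \<or> pm c \<noteq> 0 then add_mset \<delta> \<Delta> else \<Delta>)"
proof -
  have fin: "finite {k. pm k \<noteq> 0}"
    and nd: "\<And>d. nondiv d \<Delta> + card {k. pm k \<noteq> 0 \<and> \<not> d dvd pm k} \<le> 2 * nondiv d Y"
    and sz: "size \<Delta> + card {k. pm k \<noteq> 0 \<and> pm k div L \<noteq> 0} = size Y"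
    and key: "\<And>k. pm k \<noteq> 0 \<Longrightarrow> \<exists>j<count Y (pm k). k = j * (n * n) + pm k div L"
    and rng: "\<And>\<delta>. \<delta> \<in># \<Delta> \<Longrightarrow> 1 \<le> \<delta> \<and> \<delta> \<le> L"
    using lk by (auto simp: linked_def)
  have div_lt: "y div L < n * n" if "y < n * n" for y using that by (rule le_less_trans[OF div_le_dividend])
  \<comment> \<open>Equal values have different occurrence numbers and so belong to different
    chains; hence the difference to a predecessor is not 0.\<close>
  have old: "pm c div L = x div L \<and> pm c \<noteq> x" if nz: "pm c \<noteq> 0"
  proof -
    obtain j where j: "j < count Y (pm c)" "c = j * (n * n) + pm c div L" using key[OF nz] by blast
    have "0 < count Y (pm c)" using j(1) by linarith
    then have "pm c \<in># Y" by simp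
    then have "count Y x = j" "x div L = pm c div L"
      using mult_add_inj[of "count Y x" "n * n" "x div L" j "pm c div L"] c j(2) div_lt x(2) Y by auto
    then show ?thesis using j(1) by auto
  qed
  have L0: "0 < L" using L_ge by simp
  have rng\<delta>: "1 \<le> \<delta> \<and> \<delta> \<le> L" if "x div L = 0 \<or> pm c \<noteq> 0"
  proof (cases "pm c = 0")
    case True
    then have "x div L = 0" using that by simp
    then have "x < L" using L0 div_eq_0_iff[of x L] by linarith
    then show ?thesis using True x \<delta> by simp
  next
    case False
    have "x mod L < L" "pm c mod L < L" using L0 by auto
    moreover have "x = x div L * L + x mod L" "pm c = x div L * L + pm c mod L"
      using old[OF False] by (metis div_mult_mod_eq)+
    ultimately show ?thesis using old[OF False] unfolding \<delta> by linarith
  qed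
  let ?\<Delta> = "if x div L = 0 \<or> pm c \<noteq> 0 then add_mset \<delta> \<Delta> else \<Delta>"
  have "nondiv d ?\<Delta> + card {k. (pm(c := x)) k \<noteq> 0 \<and> \<not> d dvd (pm(c := x)) k}
      \<le> 2 * nondiv d (add_mset x Y)" for d
  proof -
    have 1: "card {k. (pm(c := x)) k \<noteq> 0 \<and> \<not> d dvd (pm(c := x)) k} + of_bool (pm c \<noteq> 0 \<and> \<not> d dvd pm c) =
        card {k. pm k \<noteq> 0 \<and> \<not> d dvd pm k} + of_bool (\<not> d dvd x)"
      using card_fun_upd[OF fin, of x c "\<lambda>y. \<not> d dvd y"] x by simp
    have 2: "d dvd \<delta>" if "d dvd x" "d dvd pm c"
      unfolding \<delta> using that by (intro dvd_add dvd_diff_nat)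
    have "nondiv d ?\<Delta> \<le> nondiv d \<Delta> + of_bool (pm c \<noteq> 0 \<and> \<not> d dvd pm c) + of_bool (\<not> d dvd x)"
      using 2 by (auto simp: nondiv_add_mset)
    then show ?thesis using 1 nd[of d] by (simp add: nondiv_add_mset)
  qed
  moreover have "size ?\<Delta> + card {k. (pm(c := x)) k \<noteq> 0 \<and> (pm(c := x)) k div L \<noteq> 0} = size (add_mset x Y)"
  proof -
    have "card {k. (pm(c := x)) k \<noteq> 0 \<and> (pm(c := x)) k div L \<noteq> 0} +
        of_bool (pm c \<noteq> 0 \<and> pm c div L \<noteq> 0) =
        card {k. pm k \<noteq> 0 \<and> pm k div L \<noteq> 0} + of_bool (x div L \<noteq> 0)"
      using card_fun_upd[OF fin, of x c "\<lambda>y. y div L \<noteq> 0"] x by simp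
    then show ?thesis using sz old by (cases "pm c = 0") auto
  qed
  moreover have "\<exists>j<count (add_mset x Y) ((pm(c := x)) k). k = j * (n * n) + (pm(c := x)) k div L"
    if "(pm(c := x)) k \<noteq> 0" for k
  proof (cases "k = c")
    case True
    then show ?thesis by (intro exI[of _ "count Y x"]) (simp add: c)
  next
    case False
    then have "pm k \<noteq> 0" using that by simp
    from key[OF this] obtain j where "j < count Y (pm k)" "k = j * (n * n) + pm k div L" by blast
    then show ?thesis using False by (intro exI[of _ j]) simp
  qed
  moreover have "finite {k. (pm(c := x)) k \<noteq> 0}"
    by (rule finite_subset[of _ "insert c {k. pm k \<noteq> 0}"]) (use fin in auto)
  moreover have "1 \<le> \<delta>' \<and> \<delta>' \<le> L" if "\<delta>' \<in># ?\<Delta>" for \<delta>'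
    using that rng rng\<delta> by (auto split: if_splits)
  ultimately show ?thesis unfolding linked_def by blast
qed

lemma linked_size: "linked Y pm \<Delta> \<Longrightarrow> size \<Delta> \<le> size Y"
  unfolding linked_def by (elim conjE) linarith

definition link_inv :: "vars \<Rightarrow> arrs \<Rightarrow> nat \<Rightarrow> assn" where
  "link_inv v0 a0 R v a T \<longleftrightarrow> v 3 \<le> n \<and> v 0 = n \<and> v 2 = L \<and> R + 200 * (n - v 3) + 20 \<le> T \<and>
     (\<forall>r. r \<notin> {2..10} \<longrightarrow> v r = v0 r) \<and> (\<forall>q. q \<notin> {10, 2, 3} \<longrightarrow> a q = a0 q) \<and>
     a 10 = count (mset (take (v 3) xs)) \<and>
     (\<exists>\<Delta>. a 3 = count \<Delta> \<and> v 9 = size \<Delta> \<and> linked (mset (take (v 3) xs)) (a 2) \<Delta>)"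

lemma link_body:
  assumes I: "link_inv v0 a0 R v a T" and lt: "v 3 < v 0"
    and a0: "\<And>i. i < n \<Longrightarrow> a0 0 i = xs ! i"
  shows "wp link_body (link_inv v0 a0 R) v a (T - 6)"
proof -
  define i where "i = v 3"
  define x where "x = xs ! i"
  define Y where "Y = mset (take i xs)"
  define c where "c = count Y x * (n * n) + x div L"
  obtain \<Delta> where \<Delta>: "a 3 = count \<Delta>" "v 9 = size \<Delta>" "linked Y (a 2) \<Delta>"
    and v: "v 0 = n" "v 2 = L" and T: "R + 200 * (n - i) + 20 \<le> T"
    and fr: "\<forall>r. r \<notin> {2..10} \<longrightarrow> v r = v0 r" "\<forall>q. q \<notin> {10, 2, 3} \<longrightarrow> a q = a0 q"
    and a1: "a 10 = count Y"
    using I unfolding link_inv_def i_def Y_def by blast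
  have i: "i < n" using lt v by (simp add: i_def)
  have T220: "220 \<le> T"
  proof -
    have "1 \<le> n - i" using i by simp
    then show ?thesis using T by linarith
  qed
  have x_in: "x \<in> set xs" using i n_def by (simp add: x_def)
  have x: "0 < x" "x < n * n" using xs_range[OF x_in] by auto
  have a0x: "a 0 i = x" using fr(2) a0[OF i] by (simp add: x_def)
  have Ylt: "y < n * n" if "y \<in># Y" for y
    using that xs_range by (auto simp: Y_def dest: in_set_takeD)
  have sY: "size Y = i" using i n_def by (simp add: Y_def)
  have take_Suc: "mset (take (Suc i) xs) = add_mset x Y"
    using i n_def by (simp add: take_Suc_conv_app_nth x_def Y_def)
  have cnt: "count Y x \<le> n" using count_le_size[of Y x] sY i by simp
  have szD: "size \<Delta> \<le> i" using linked_size[OF \<Delta>(3)] sY by simp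
  have cD: "count \<Delta> y \<le> n" for y using count_le_size[of \<Delta> y] szD i by simp
  have cY: "count Y x * (n * n) \<le> n * n * n" using mult_le_mono1[OF cnt, of "n * n"] by (simp add: mult_ac)
  have xL: "x div L < n * n" using x(2) by (rule le_less_trans[OF div_le_dividend])
  have pm_lt: "a 2 c < n * n"
  proof (cases "a 2 c = 0")
    case False
    then obtain j where "j < count Y (a 2 c)" using \<Delta>(3) unfolding linked_def by blast
    then have "0 < count Y (a 2 c)" by linarith
    then have "a 2 c \<in># Y" by simp
    then show ?thesis by (rule Ylt)
  qed (use n_ge in auto)
  define \<delta> where "\<delta> = (x - a 2 c) + (a 2 c - x)"
  have bounds: "1 < Z" "1000 < Z" "count Y x + 1 < Z" "Suc (count Y x) < Z" "n * n < Z"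
    "count Y x * (n * n) < Z" "c < Z" "1 + a 2 c < Z" "Suc (a 2 c) < Z" "a 2 c < Z" "\<delta> < Z"
    "Suc (count \<Delta> \<delta>) < Z" "Suc (size \<Delta>) < Z" "Suc i < Z" "0 < Z"
    using n_ge n_le_cube cnt cY xL x pm_lt szD i cD[of \<delta>]
    by - (rule less_Z_small; simp only: c_def \<delta>_def; linarith)+
  have lk: "linked (add_mset x Y) ((a 2)(c := x))
      (if x div L = 0 \<or> a 2 c \<noteq> 0 then add_mset \<delta> \<Delta> else \<Delta>)"
    by (rule linked_add[OF \<Delta>(3) x Ylt c_def \<delta>_def])
  have a1': "(count Y)(x := Suc (count Y x)) = count (add_mset x Y)" by auto
  have Z1: "Suc 0 < Z" using bounds(1) by simp
  have v3: "v 3 = i" by (simp add: i_def)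
  show ?thesis
  proof (cases "x div L = 0 \<or> a 2 c \<noteq> 0")
    case True
    have a3': "(count \<Delta>)(\<delta> := Suc (count \<Delta> \<delta>)) = count (add_mset \<delta> \<Delta>)" by auto
    have cond: "of_bool (x div L = 0) + a 2 c \<noteq> 0" using True by auto
    let ?v = "v(4 := x, 5 := count Y x, 6 := x div L, 7 := c, 8 := a 2 c, 10 := \<delta>, 9 := Suc (size \<Delta>), 3 := Suc i)"
    let ?a = "a(10 := count (add_mset x Y), 3 := count (add_mset \<delta> \<Delta>), 2 := (a 2)(c := x))"
    have inv: "link_inv v0 a0 R ?v ?a (T - t)" if "t \<le> 200" for t
      unfolding link_inv_def
    proof (intro conjI exI[of _ "add_mset \<delta> \<Delta>"])
      show "R + 200 * (n - ?v 3) + 20 \<le> T - t" using T i that by simp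
      show "\<forall>r. r \<notin> {2..10} \<longrightarrow> ?v r = v0 r" using fr(1) by simp
      show "\<forall>q. q \<notin> {10, 2, 3} \<longrightarrow> ?a q = a0 q" using fr(2) by simp
      show "linked (mset (take (?v 3) xs)) (?a 2) (add_mset \<delta> \<Delta>)" using lk True take_Suc by simp
    qed (use i v take_Suc in simp_all)
    show ?thesis
      by (rule vc_sound)
        (use inv T220 cond in \<open>simp add: link_body_def v v3 a0x a1 a1' a3' \<Delta> bounds Z1
          flip: c_def \<delta>_def;
          intro conjI impI; linarith\<close>)
  next
    case False
    then have cond: "of_bool (x div L = 0) + a 2 c = 0" by auto
    let ?v = "v(4 := x, 5 := count Y x, 6 := x div L, 7 := c, 8 := a 2 c, 10 := 0, 3 := Suc i)"
    let ?a = "a(10 := count (add_mset x Y), 2 := (a 2)(c := x))"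
    have inv: "link_inv v0 a0 R ?v ?a (T - t)" if "t \<le> 200" for t
      unfolding link_inv_def
    proof (intro conjI exI[of _ \<Delta>])
      show "R + 200 * (n - ?v 3) + 20 \<le> T - t" using T i that by simp
      show "\<forall>r. r \<notin> {2..10} \<longrightarrow> ?v r = v0 r" using fr(1) by simp
      show "\<forall>q. q \<notin> {10, 2, 3} \<longrightarrow> ?a q = a0 q" using fr(2) by simp
      show "linked (mset (take (?v 3) xs)) (?a 2) \<Delta>" using lk False take_Suc by simp
    qed (use i v take_Suc \<Delta> in simp_all)
    show ?thesis
      by (rule vc_sound)
        (use inv T220 cond in \<open>simp add: link_body_def v v3 a0x a1 a1' \<Delta> bounds Z1
          flip: c_def \<delta>_def;
          intro conjI impI; linarith\<close>)
  qed
qed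

lemma link:
  assumes v: "v 0 = n" "v 9 = 0" and a0: "\<And>i. i < n \<Longrightarrow> a 0 i = xs ! i"
    and az: "a 10 = (\<lambda>_. 0)" "a 2 = (\<lambda>_. 0)" "a 3 = (\<lambda>_. 0)" and T: "R + 200 * n + 60 \<le> T"
    and post: "\<And>v' a' T' pm \<Delta>. R \<le> T' \<Longrightarrow> \<forall>r. r \<notin> {2..10} \<longrightarrow> v' r = v r \<Longrightarrow>
      \<forall>q. q \<notin> {10, 2, 3} \<longrightarrow> a' q = a q \<Longrightarrow> v' 2 = L \<Longrightarrow> v' 9 = size \<Delta> \<Longrightarrow> a' 3 = count \<Delta> \<Longrightarrow>
      linked (mset xs) pm \<Delta> \<Longrightarrow> Q v' a' T'"
  shows "wp link Q v a T"
proof -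
  have loop: "wp (Whl (V 3 \<prec> V 0) link_body) Q (v(2 := L, 3 := 0)) a (T - t)" if "t \<le> 20" for t
  proof (rule wp_Whl[where I = "link_inv v a R"])
    have "count {#} = (\<lambda>_::nat. 0)" by auto
    then show "link_inv v a R (v(2 := L, 3 := 0)) a (T - t)"
      unfolding link_inv_def using v az T that linked_empty by simp
    fix v' a' T' assume I: "link_inv v a R v' a' T'"
    have I0: "v' 0 = n" "v' 3 \<le> n" "R + 200 * (n - v' 3) + 20 \<le> T'"
      using I unfolding link_inv_def by blast+
    show "eok v' a' (V 3 \<prec> V 0) \<and> ecost (V 3 \<prec> V 0) + 1 \<le> T'" using I0(3) by simp
    show "wp link_body (link_inv v a R) v' a' (T' - (ecost (V 3 \<prec> V 0) + 1))"
      if "ev v' a' (V 3 \<prec> V 0) \<noteq> 0"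
      using link_body[OF I _ a0] that by simp
    show "Q v' a' (T' - (ecost (V 3 \<prec> V 0) + 1))" if "ev v' a' (V 3 \<prec> V 0) = 0"
    proof -
      have v3: "v' 3 = n" using that I0 by simp
      obtain \<Delta> where "a' 3 = count \<Delta>" "v' 9 = size \<Delta>" "linked (mset xs) (a' 2) \<Delta>"
        using I v3 n_def unfolding link_inv_def by auto
      moreover have "\<forall>r. r \<notin> {2..10} \<longrightarrow> v' r = v r" "\<forall>q. q \<notin> {10, 2, 3} \<longrightarrow> a' q = a q" "v' 2 = L"
        using I unfolding link_inv_def by blast+
      moreover have "R \<le> T' - (ecost (V 3 \<prec> V 0) + 1)" using I0(3) by simp
      ultimately show ?thesis by (intro post)
    qed
  qed
  have "1000 < Z" "0 < Z" using n_less_Z[of 1000] by simp_all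
  then show ?thesis
    by (intro vc_sound) (use T in \<open>simp add: link_def v loop\<close>)
qed

text \<open>Elements without a difference number at most one per chain outside bucket 0. There are
  at most \<mu> occurrence numbers and \<open>m / L\<close> such buckets, and density makes the
  product at most \<open>n / 4\<close>. In \<open>modulus_dvd_last\<close> this majority forces some
  difference to be divisible by two candidates at once.\<close>

lemma linked_many:
  assumes "linked (mset xs) pm \<Delta>"
  shows "3 * n \<le> 4 * size \<Delta>"
proof -
  define \<mu> m where "\<mu> = max_mult (mset xs)" and "m = max_elem (mset xs)"
  let ?K = "{k. pm k \<noteq> 0 \<and> pm k div L \<noteq> 0}"
  have "?K \<subseteq> (\<lambda>(j, b). j * (n * n) + b) ` ({..<\<mu>} \<times> {1..m div L})"
  proof
    fix k assume k: "k \<in> ?K"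
    then obtain j where j: "j < count (mset xs) (pm k)" "k = j * (n * n) + pm k div L"
      using assms unfolding linked_def by blast
    have "j < \<mu>" using j(1) count_le_max_mult[of "mset xs" "pm k"] unfolding \<mu>_def by linarith
    moreover have "0 < count (mset xs) (pm k)" using j(1) by linarith
    then have "pm k \<le> m" unfolding m_def by (intro le_max_elem) (simp only: count_greater_zero_iff)
    then have "pm k div L \<le> m div L" by (rule div_le_mono)
    ultimately show "k \<in> (\<lambda>(j, b). j * (n * n) + b) ` ({..<\<mu>} \<times> {1..m div L})"
      using k j(2) by (intro image_eqI[of _ _ "(j, pm k div L)"]) auto
  qed
  then have "card ?K \<le> card ((\<lambda>(j, b). j * (n * n) + b) ` ({..<\<mu>} \<times> {1..m div L}))"
    by (intro card_mono) auto
  also have "\<dots> \<le> card ({..<\<mu>} \<times> {1..m div L})" by (intro card_image_le) auto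
  finally have K: "card ?K \<le> \<mu> * (m div L)" by simp
  have "4 * (\<mu> * (m div L)) * L \<le> n * L"
  proof -
    have "1699200 * (\<mu> * m) \<le> n * n" using sparse by (simp add: \<mu>_def m_def power2_eq_square mult.assoc)
    also have "\<dots> \<le> n * (2000 * L)"
    proof (rule mult_le_mono2)
      show "n \<le> 2000 * L" using dividend_less_div_times[of 1000 n] L_ge by linarith
    qed
    finally have 1: "1699200 * (\<mu> * m) \<le> 2000 * (n * L)" by (simp only: mult.left_commute)
    have "\<mu> * ((m div L) * L) \<le> \<mu> * m" by (intro mult_le_mono2) simp
    then have "4 * (\<mu> * (m div L)) * L \<le> 4 * (\<mu> * m)" by (simp only: mult.assoc)
    then show ?thesis using 1 by linarith
  qed
  then have "4 * (\<mu> * (m div L)) \<le> n" using L_ge mult_le_cancel2[of "4 * (\<mu> * (m div L))" L n] by linarith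
  moreover have "size \<Delta> + card ?K = n" using assms n_def unfolding linked_def by simp
  ultimately show ?thesis using K by linarith
qed

section \<open>Sums over multiples\<close>

definition sum_multiples :: "nat \<Rightarrow> nat \<Rightarrow> stm" where
  "sum_multiples q hi = Asg 13 (N 0) ;; Asg 12 (N 0) ;;
     Whl (V 12 \<prec> V hi) (Asg 13 (V 13 \<oplus> Arr q (V 12)) ;; Asg 12 (V 12 \<oplus> V 11))"

definition mult_sum :: "(nat \<Rightarrow> nat) \<Rightarrow> nat \<Rightarrow> nat \<Rightarrow> nat" where
  "mult_sum f d B = (\<Sum>j | j < B \<and> d dvd j. f j)"

lemma mult_sum_Suc: "0 < d \<Longrightarrow> mult_sum f d (Suc k * d) = mult_sum f d (k * d) + f (k * d)"
proof -
  assume d: "0 < d"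
  have "{j. j < Suc k * d \<and> d dvd j} = insert (k * d) {j. j < k * d \<and> d dvd j}"
  proof (intro equalityI subsetI)
    fix j assume j: "j \<in> {j. j < Suc k * d \<and> d dvd j}"
    then obtain i where i: "j = d * i" by (auto elim: dvdE)
    have "i * d < Suc k * d" using j i by (simp add: mult.commute)
    then have "i < Suc k" using d mult_less_cancel2 by blast
    then show "j \<in> insert (k * d) {j. j < k * d \<and> d dvd j}"
      using d i by (cases "i = k") (simp_all add: mult.commute)
  qed (use d in \<open>auto simp: mult.commute\<close>)
  then show ?thesis using d by (simp add: mult_sum_def)
qed

lemma mult_sum_eq:
  assumes "0 < d" "B \<le> k * d" "k = 0 \<or> (k - 1) * d < B"
  shows "mult_sum f d (k * d) = mult_sum f d B"
proof -
  have "j < B" if lt: "j < k * d" and dvd: "d dvd j" for j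
  proof -
    obtain i where i: "j = i * d" using dvd by (metis dvdE mult.commute)
    then have ik: "i < k" using lt assms(1) by simp
    then have "i * d \<le> (k - 1) * d" by (intro mult_le_mono1) simp
    then show ?thesis using assms(3) i ik by linarith
  qed
  then have "{j. j < k * d \<and> d dvd j} = {j. j < B \<and> d dvd j}" using assms(2) by auto
  then show ?thesis by (simp add: mult_sum_def)
qed

text \<open>The time is proportional to \<open>B div d\<close>; over all \<open>d\<close> this adds
  up to a harmonic sum.\<close>

lemma sum_multiples:
  assumes v: "v 11 = d" "0 < d" "d \<le> n" "v hi = B" "B \<le> n" and hi: "hi < 50" "hi \<noteq> 12" "hi \<noteq> 13"
    and q: "q < 20" and bnd: "\<And>J. mult_sum (a q) d J \<le> n" and T: "R + 40 * (B div d) + 80 \<le> T"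
    and post: "\<And>v' T'. R \<le> T' \<Longrightarrow> \<forall>r. r \<notin> {12, 13} \<longrightarrow> v' r = v r \<Longrightarrow>
      v' 13 = mult_sum (a q) d B \<Longrightarrow> Q v' a T'"
  shows "wp (sum_multiples q hi) Q v a T"
proof -
  \<comment> \<open>\<open>k\<close> is the number of multiples visited so far. The condition on
    \<open>k - 1\<close> says that the last one visited was below \<open>B\<close>, which makes the
    sum exact at exit.\<close>
  define I where "I v' a' T' \<longleftrightarrow> a' = a \<and> (\<forall>r. r \<notin> {12, 13} \<longrightarrow> v' r = v r) \<and> (\<exists>k. v' 12 = k * d \<and>
    v' 13 = mult_sum (a q) d (k * d) \<and> (k = 0 \<or> (k - 1) * d < B) \<and> k \<le> B div d + 1 \<and>
    R + 40 * (B div d + 1 - k) + 20 \<le> T')" for v' a' T'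
  have loop: "wp (Whl (V 12 \<prec> V hi) (Asg 13 (V 13 \<oplus> Arr q (V 12)) ;; Asg 12 (V 12 \<oplus> V 11))) Q
      (v(13 := 0, 12 := 0)) a (T - t)" if "t \<le> 20" for t
  proof (rule wp_Whl[where I = I])
    have "mult_sum (a q) d 0 = 0" by (simp add: mult_sum_def)
    then show "I (v(13 := 0, 12 := 0)) a (T - t)"
      unfolding I_def using that T by (intro conjI exI[of _ 0]) auto
    fix v' a' T' assume I: "I v' a' T'"
    then obtain k where k: "v' 12 = k * d" "v' 13 = mult_sum (a q) d (k * d)"
      "k = 0 \<or> (k - 1) * d < B" "k \<le> B div d + 1" "R + 40 * (B div d + 1 - k) + 20 \<le> T'"
      and a': "a' = a" and fr: "\<forall>r. r \<notin> {12, 13} \<longrightarrow> v' r = v r" unfolding I_def by blast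
    have v': "v' hi = B" "v' 11 = d" using fr hi v by simp_all
    show "eok v' a' (V 12 \<prec> V hi) \<and> ecost (V 12 \<prec> V hi) + 1 \<le> T'" using k(5) hi by simp
    show "Q v' a' (T' - (ecost (V 12 \<prec> V hi) + 1))" if "ev v' a' (V 12 \<prec> V hi) = 0"
    proof -
      have "B \<le> k * d" using that k(1) v' by simp
      then have "v' 13 = mult_sum (a q) d B" using k(2,3) mult_sum_eq[OF v(2)] by simp
      moreover have "R \<le> T' - (ecost (V 12 \<prec> V hi) + 1)" using k(5) by simp
      ultimately show ?thesis unfolding a' using fr by (intro post)
    qed
    show "wp (Asg 13 (V 13 \<oplus> Arr q (V 12)) ;; Asg 12 (V 12 \<oplus> V 11)) I v' a'
        (T' - (ecost (V 12 \<prec> V hi) + 1))" if "ev v' a' (V 12 \<prec> V hi) \<noteq> 0"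
    proof -
      have lt: "k * d < B" using that k(1) v' by simp
      then have kB: "k \<le> B div d" using v(2) by (simp add: less_eq_div_iff_mult_less_eq)
      have T60: "60 \<le> T'" using k(5) kB by linarith
      have s: "mult_sum (a q) d (k * d) + a q (k * d) = mult_sum (a q) d (Suc k * d)"
        using mult_sum_Suc[OF v(2)] by simp
      have sk: "k * d + d = Suc k * d" by simp
      have b1: "mult_sum (a q) d (Suc k * d) < Z"
        using bnd[of "Suc k * d"] by (intro n_less_Z) linarith
      have "Suc k * d \<le> n + n" using lt v by simp
      then have b2: "Suc k * d < Z" by (intro less_Z_quad) (use n_le_cube(1) in linarith)
      have "I (v'(13 := mult_sum (a q) d (Suc k * d), 12 := Suc k * d)) a (T' - t)" if "t \<le> 40" for t
        unfolding I_def
      proof (intro conjI exI[of _ "Suc k"])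
        show "R + 40 * (B div d + 1 - Suc k) + 20 \<le> T' - t" using k(5) kB that by linarith
      qed (use fr lt kB in simp_all)
      then show ?thesis
        by (intro vc_sound) (use T60 in \<open>simp add: k(1,2) v' a' q s sk b1 b2 del: mult_Suc;
          intro conjI; linarith\<close>)
    qed
  qed
  have "0 < Z" using n_less_Z by simp
  then show ?thesis
    by (intro vc_sound) (use T in \<open>simp add: sum_multiples_def loop\<close>)
qed

lemma mult_sum_count:
  "mult_sum (count M) d B = size {#x \<in># M. x < B \<and> d dvd x#}"
proof (induction M)
  case empty then show ?case by (simp add: mult_sum_def)
next
  case (add x M)
  have "mult_sum (count (add_mset x M)) d B =
      (\<Sum>j | j < B \<and> d dvd j. count M j + (if j = x then 1 else 0))"
    unfolding mult_sum_def by (intro sum.cong) auto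
  also have "\<dots> = mult_sum (count M) d B + (\<Sum>j | j < B \<and> d dvd j. if j = x then 1 else 0)"
    unfolding mult_sum_def by (rule sum.distrib)
  also have "(\<Sum>j | j < B \<and> d dvd j. if j = x then 1 else 0) = (if x < B \<and> d dvd x then 1 else (0::nat))"
    by simp
  finally show ?case using add by simp
qed

lemma size_filter_nondiv: "size {#x \<in># M. d dvd x#} + nondiv d M = size M"
  unfolding nondiv_def by (metis multiset_partition size_union)

section \<open>Linear search\<close>

definition last_sat :: "(nat \<Rightarrow> bool) \<Rightarrow> nat \<Rightarrow> nat \<Rightarrow> bool" where
  "last_sat P B e \<longleftrightarrow> (e = 0 \<or> 1 \<le> e \<and> e < B \<and> P e) \<and> (\<forall>d. e < d \<and> d < B \<longrightarrow> \<not> P d)"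

lemma last_sat_Suc: "last_sat P d e \<Longrightarrow> 1 \<le> d \<Longrightarrow> last_sat P (Suc d) (if P d then d else e)"
  unfolding last_sat_def by (auto simp: less_Suc_eq)

definition search_body :: "stm \<Rightarrow> stm" where
  "search_body body = Blk body ;; Asg 11 (V 11 \<oplus> N 1)"

definition search :: "nat \<Rightarrow> stm \<Rightarrow> stm" where
  "search res body = Asg 11 (N 1) ;; Asg res (N 0) ;; Whl (V 11 \<prec> V 15) (search_body body)"

text \<open>The body is given by a rule in continuation style, for arbitrary \<open>R'\<close> and
  \<open>Q'\<close>, so that one proof serves both searches; the cost \<open>C d\<close> varies with
  \<open>d\<close>, as a harmonic bound requires. Candidates start at 1, which leaves 0 as the sign
  that none has passed.\<close>

lemma search:
  assumes v: "v 15 = B" "1 \<le> B" "B \<le> n" and res: "res \<notin> {10, 11, 12, 13, 15}" "res < 50"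
    and body: "\<And>d v' T' R' Q'. 1 \<le> d \<Longrightarrow> d < B \<Longrightarrow> v' 11 = d \<Longrightarrow>
      \<forall>r. r \<notin> {10, 11, 12, 13, res} \<longrightarrow> v' r = v r \<Longrightarrow> R' + C d \<le> T' \<Longrightarrow>
      (\<And>v'' T''. R' \<le> T'' \<Longrightarrow> \<forall>r. r \<notin> {10, 12, 13, res} \<longrightarrow> v'' r = v' r \<Longrightarrow>
        v'' res = (if P d then d else v' res) \<Longrightarrow> Q' v'' a T'') \<Longrightarrow> wp body Q' v' a T'"
    and T: "R + (\<Sum>d=1..<B. C d + 30) + 40 \<le> T"
    and post: "\<And>v' T'. R \<le> T' \<Longrightarrow> \<forall>r. r \<notin> {10, 11, 12, 13, res} \<longrightarrow> v' r = v r \<Longrightarrow>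
      last_sat P B (v' res) \<Longrightarrow> Q v' a T'"
  shows "wp (search res body) Q v a T"
proof -
  define I where "I v' a' T' \<longleftrightarrow> a' = a \<and> (\<forall>r. r \<notin> {10, 11, 12, 13, res} \<longrightarrow> v' r = v r) \<and>
    1 \<le> v' 11 \<and> v' 11 \<le> B \<and> last_sat P (v' 11) (v' res) \<and>
    R + (\<Sum>d=v' 11..<B. C d + 30) + 10 \<le> T'" for v' a' T'
  have Z1: "Suc 0 < Z" "0 < Z" using n_less_Z by simp_all
  have loop: "wp (Whl (V 11 \<prec> V 15) (search_body body)) Q (v(11 := Suc 0, res := 0)) a (T - t)"
    if "t \<le> 20" for t
  proof (rule wp_Whl[where I = I])
    show "I (v(11 := Suc 0, res := 0)) a (T - t)"
      unfolding I_def using that T v res by (auto simp: last_sat_def)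
    fix v' a' T' assume I: "I v' a' T'"
    then have a': "a' = a" and fr: "\<forall>r. r \<notin> {10, 11, 12, 13, res} \<longrightarrow> v' r = v r"
      and d: "1 \<le> v' 11" "v' 11 \<le> B" and ls: "last_sat P (v' 11) (v' res)"
      and T': "R + (\<Sum>d=v' 11..<B. C d + 30) + 10 \<le> T'" unfolding I_def by blast+
    have v15: "v' 15 = B" using fr res v by simp
    show "eok v' a' (V 11 \<prec> V 15) \<and> ecost (V 11 \<prec> V 15) + 1 \<le> T'" using T' by simp
    show "Q v' a' (T' - (ecost (V 11 \<prec> V 15) + 1))" if "ev v' a' (V 11 \<prec> V 15) = 0"
    proof -
      have "v' 11 = B" using that v15 d by simp
      then show ?thesis unfolding a' using fr ls T' by (intro post) auto
    qed
    show "wp (search_body body) I v' a' (T' - (ecost (V 11 \<prec> V 15) + 1))"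
      if "ev v' a' (V 11 \<prec> V 15) \<noteq> 0"
    proof -
      have lt: "v' 11 < B" using that v15 by simp
      have sum: "(\<Sum>d=v' 11..<B. C d + 30) = C (v' 11) + 30 + (\<Sum>d=Suc (v' 11)..<B. C d + 30)"
        using lt by (rule sum.atLeast_Suc_lessThan)
      have "wp body (vc (Asg 11 (V 11 \<oplus> N 1)) I) v' a (T' - 6)"
      proof (rule body[where R' = "R + (\<Sum>d=Suc (v' 11)..<B. C d + 30) + 30"])
        show "R + (\<Sum>d=Suc (v' 11)..<B. C d + 30) + 30 + C (v' 11) \<le> T' - 6"
          using T' unfolding sum by linarith
        fix v'' T'' assume R: "R + (\<Sum>d=Suc (v' 11)..<B. C d + 30) + 30 \<le> T''"
          and fr': "\<forall>r. r \<notin> {10, 12, 13, res} \<longrightarrow> v'' r = v' r"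
          and vres: "v'' res = (if P (v' 11) then v' 11 else v' res)"
        have v11: "v'' 11 = v' 11" using fr' res by simp
        have "I (v''(11 := Suc (v' 11))) a (T'' - t)" if "t \<le> 20" for t
          unfolding I_def
        proof (intro conjI)
          show "\<forall>r. r \<notin> {10, 11, 12, 13, res} \<longrightarrow> (v''(11 := Suc (v' 11))) r = v r"
            using fr fr' by simp
          show "last_sat P ((v''(11 := Suc (v' 11))) 11) ((v''(11 := Suc (v' 11))) res)"
            using last_sat_Suc[OF ls d(1)] vres res by simp
          show "R + (\<Sum>d=(v''(11 := Suc (v' 11))) 11..<B. C d + 30) + 10 \<le> T'' - t"
            using R that by simp
        qed (use lt in simp_all)
        moreover have "v' 11 + 1 < Z" using lt v by (intro n_less_Z) linarith
        ultimately show "vc (Asg 11 (V 11 \<oplus> N 1)) I v'' a T''"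
          using R Z1 by (simp add: v11)
      qed (use d lt fr in auto)
      then show ?thesis unfolding a' by (intro vc_sound) (simp add: search_body_def)
    qed
  qed
  have "40 \<le> T" using T by linarith
  then show ?thesis
    by (intro vc_sound) (use Z1 res in \<open>simp add: search_def loop; linarith\<close>)
qed

section \<open>Histogram of residues\<close>

definition hist_body :: "nat \<Rightarrow> nat \<Rightarrow> stm" where
  "hist_body q mr =
     Asg 4 (Arr 0 (V 3) \<odot> V mr) ;; Sto q (V 4) (Arr q (V 4) \<oplus> N 1) ;; Asg 3 (V 3 \<oplus> N 1)"

definition hist :: "nat \<Rightarrow> nat \<Rightarrow> stm" where
  "hist q mr = Asg 3 (N 0) ;; Whl (V 3 \<prec> V 0) (hist_body q mr)"

lemma hist:
  assumes v: "v 0 = n" "v mr = m" and mr: "mr < 50" "mr \<notin> {3, 4}" and q: "q < 20" "q \<noteq> 0"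
    and a0: "\<And>i. i < n \<Longrightarrow> a 0 i = xs ! i" and aq: "a q = (\<lambda>_. 0)" and T: "R + 60 * n + 60 \<le> T"
    and post: "\<And>v' T'. R \<le> T' \<Longrightarrow> \<forall>r. r \<notin> {3, 4} \<longrightarrow> v' r = v r \<Longrightarrow>
      Q v' (a(q := count (image_mset (\<lambda>x. x mod m) (mset xs)))) T'"
  shows "wp (hist q mr) Q v a T"
proof -
  let ?H = "\<lambda>i. image_mset (\<lambda>x. x mod m) (mset (take i xs))"
  define I where "I v' a' T' \<longleftrightarrow> v' 3 \<le> n \<and> (\<forall>r. r \<notin> {3, 4} \<longrightarrow> v' r = v r) \<and>
    a' = a(q := count (?H (v' 3))) \<and> R + 60 * (n - v' 3) + 20 \<le> T'" for v' a' T'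
  have loop: "wp (Whl (V 3 \<prec> V 0) (hist_body q mr)) Q (v(3 := 0)) a (T - t)" if "t \<le> 20" for t
  proof (rule wp_Whl[where I = I])
    have "count {#} = (\<lambda>_::nat. 0)" by auto
    then have "a = a(q := count (?H 0))" using aq by auto
    then show "I (v(3 := 0)) a (T - t)" unfolding I_def using that T by simp
    fix v' a' T' assume I: "I v' a' T'"
    then have i: "v' 3 \<le> n" and fr: "\<forall>r. r \<notin> {3, 4} \<longrightarrow> v' r = v r"
      and a': "a' = a(q := count (?H (v' 3)))" and T': "R + 60 * (n - v' 3) + 20 \<le> T'"
      unfolding I_def by blast+
    have v': "v' 0 = n" "v' mr = m" using fr v mr by simp_all
    show "eok v' a' (V 3 \<prec> V 0) \<and> ecost (V 3 \<prec> V 0) + 1 \<le> T'" using T' by simp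
    show "Q v' a' (T' - (ecost (V 3 \<prec> V 0) + 1))" if "ev v' a' (V 3 \<prec> V 0) = 0"
    proof -
      have "take (v' 3) xs = xs" using that v' n_def by simp
      then have "a' = a(q := count (image_mset (\<lambda>x. x mod m) (mset xs)))" using a' by simp
      moreover have "R \<le> T' - (ecost (V 3 \<prec> V 0) + 1)" using T' by simp
      ultimately show ?thesis using post fr by simp
    qed
    show "wp (hist_body q mr) I v' a' (T' - (ecost (V 3 \<prec> V 0) + 1))" if "ev v' a' (V 3 \<prec> V 0) \<noteq> 0"
    proof -
      define i where "i = v' 3"
      have lt: "i < n" using that v' by (simp add: i_def)
      define y where "y = xs ! i mod m"
      have "1 \<le> n - i" using lt by simp
      then have T80: "80 \<le> T'" using T' unfolding i_def by linarith
      have a0i: "a' 0 i = xs ! i" using a' q a0[OF lt] by simp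
      have a'q: "a' q = count (?H i)" using a' by (simp add: i_def)
      have "mset (take (Suc i) xs) = add_mset (xs ! i) (mset (take i xs))"
        using lt n_def by (simp add: take_Suc_conv_app_nth)
      then have H: "?H (Suc i) = add_mset y (?H i)" by (simp add: y_def)
      have cnt: "(count (?H i))(y := Suc (count (?H i) y)) = count (?H (Suc i))"
        unfolding H by auto
      have "count (?H i) y \<le> i" using count_le_size[of "?H i" y] lt n_def by simp
      then have b: "Suc (count (?H i) y) < Z" "Suc i < Z" "Suc 0 < Z" using lt by (auto intro!: n_less_Z)
      have "I (v'(4 := y, 3 := Suc i)) (a'(q := count (?H (Suc i)))) (T' - t)" if "t \<le> 60" for t
        unfolding I_def
      proof (intro conjI)
        show "R + 60 * (n - (v'(4 := y, 3 := Suc i)) 3) + 20 \<le> T' - t"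
          using T' lt that by (simp add: i_def)
      qed (use lt fr a' in auto)
      then show ?thesis
        by (intro vc_sound) (use T80 in \<open>simp add: hist_body_def i_def[symmetric] v' mr q a0i a'q y_def[symmetric] b cnt;
          intro conjI; linarith\<close>)
    qed
  qed
  have "0 < Z" using n_less_Z by simp
  then show ?thesis
    by (intro vc_sound) (use T in \<open>simp add: hist_def loop\<close>)
qed

section \<open>The two sieves for the modulus\<close>

definition link_test :: stm where
  "link_test = Blk (sum_multiples 3 15) ;;
     Ife (V 9 \<ominus> V 13 \<prec> V 11 \<oplus> V 11) (Asg 14 (V 11)) (Asg 10 (N 0))"

definition div_test :: stm where
  "div_test = Ife (V 14 \<odot> V 11 \<doteq> N 0)
     (Blk (sum_multiples 4 14) ;; Ife (V 0 \<ominus> V 13 \<prec> V 11) (Asg 16 (V 11)) (Asg 10 (N 0)))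
     (Asg 10 (N 0))"

definition find_modulus :: stm where
  "find_modulus = Blk link ;; Asg 15 (V 2 \<oplus> N 1) ;; Blk (search 14 link_test) ;; Blk (hist 4 14) ;;
     Asg 15 (V 14 \<oplus> N 1) ;; Blk (search 16 div_test)"

lemma mult_sum_count_le: "mult_sum (count M) d J \<le> size M"
  unfolding mult_sum_count by (rule size_filter_mset_lesseq)

lemma link_test:
  assumes v: "v 15 = Suc L" "v 9 = size \<Delta>" and a3: "a 3 = count \<Delta>"
    and D: "\<And>\<delta>. \<delta> \<in># \<Delta> \<Longrightarrow> \<delta> \<le> L" "size \<Delta> \<le> n"
    and d: "1 \<le> d" "d < Suc L" "v' 11 = d" and fr: "\<forall>r. r \<notin> {10, 11, 12, 13, 14} \<longrightarrow> v' r = v r"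
    and T: "R + (40 * (Suc L div d) + 120) \<le> T"
    and post: "\<And>v'' T''. R \<le> T'' \<Longrightarrow> \<forall>r. r \<notin> {10, 12, 13, 14} \<longrightarrow> v'' r = v' r \<Longrightarrow>
        v'' 14 = (if nondiv d \<Delta> < 2 * d then d else v' 14) \<Longrightarrow> Q v'' a T''"
  shows "wp link_test Q v' a T"
proof -
  have Ln: "Suc L \<le> n" "d \<le> n" using d n_ge by auto
  have "mult_sum (a 3) d (Suc L) = size {#x \<in># \<Delta>. d dvd x#}"
    unfolding a3 mult_sum_count
    by (intro arg_cong[where f = size] filter_mset_cong) (use D(1) in \<open>auto simp: less_Suc_eq_le\<close>)
  then have ms: "size \<Delta> - mult_sum (a 3) d (Suc L) = nondiv d \<Delta>"
    using size_filter_nondiv[of d \<Delta>] by simp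
  have dd: "d + d < Z" using Ln n_le_cube by (intro less_Z_quad) linarith
  have Z0: "0 < Z" using n_less_Z by simp
  have "wp (sum_multiples 3 15)
    (vc (Ife (V 9 \<ominus> V 13 \<prec> V 11 \<oplus> V 11) (Asg 14 (V 11)) (Asg 10 (N 0))) Q) v' a T"
  proof (rule sum_multiples[where R = "R + 40" and d = d and B = "Suc L"])
    show "mult_sum (a 3) d J \<le> n" for J
      unfolding a3 using mult_sum_count_le[of \<Delta> d J] D(2) by simp
    show "R + 40 + 40 * (Suc L div d) + 80 \<le> T" using T by simp
    fix v'' T'' assume R: "R + 40 \<le> T''" and fr': "\<forall>r. r \<notin> {12, 13} \<longrightarrow> v'' r = v' r"
      and v13: "v'' 13 = mult_sum (a 3) d (Suc L)"
    have v'': "v'' 9 = size \<Delta>" "v'' 11 = d" using fr fr' v d by simp_all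
    have Q1: "Q (v''(14 := d)) a (T'' - t)" if "nondiv d \<Delta> < 2 * d" "t \<le> 40" for t
      by (rule post) (use that R fr' in auto)
    have Q2: "Q (v''(10 := 0)) a (T'' - t)" if "\<not> nondiv d \<Delta> < 2 * d" "t \<le> 40" for t
      by (rule post) (use that R fr' in auto)
    show "vc (Ife (V 9 \<ominus> V 13 \<prec> V 11 \<oplus> V 11) (Asg 14 (V 11)) (Asg 10 (N 0))) Q v'' a T''"
      using R Q1 Q2 dd Z0 by (cases "nondiv d \<Delta> < 2 * d") (simp_all add: v'' v13 ms mult_2)
  qed (use d Ln fr v in simp_all)
  then show ?thesis by (intro vc_sound) (simp add: link_test_def)
qed

lemma div_test:
  assumes v: "v 14 = e" "1 \<le> e" "e \<le> L" "v 0 = n"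
    and a4: "a 4 = count (image_mset (\<lambda>x. x mod e) (mset xs))"
    and d: "1 \<le> d" "d < Suc e" "v' 11 = d" and fr: "\<forall>r. r \<notin> {10, 11, 12, 13, 16} \<longrightarrow> v' r = v r"
    and T: "R + (40 * (Suc L div d) + 120) \<le> T"
    and post: "\<And>v'' T''. R \<le> T'' \<Longrightarrow> \<forall>r. r \<notin> {10, 12, 13, 16} \<longrightarrow> v'' r = v' r \<Longrightarrow>
        v'' 16 = (if d dvd e \<and> nondiv d (mset xs) < d then d else v' 16) \<Longrightarrow> Q v'' a T''"
  shows "wp div_test Q v' a T"
proof -
  have Ln: "e \<le> n" "d \<le> n" using d v n_ge by auto
  have Z0: "0 < Z" using n_less_Z by simp
  have v': "v' 14 = e" "v' 0 = n" using fr v by simp_all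
  show ?thesis
  proof (cases "d dvd e")
    case False
    then have "e mod d \<noteq> 0" by (simp add: dvd_eq_mod_eq_0)
    moreover have "Q (v'(10 := 0)) a (T - t)" if "t \<le> 40" for t
      by (rule post) (use that T False in auto)
    ultimately show ?thesis
      by (intro vc_sound) (use T Z0 in \<open>simp add: div_test_def v' d\<close>)
  next
    case True
    then have e0: "e mod d = 0" by simp
    have "mult_sum (a 4) d e = size {#x \<in># image_mset (\<lambda>x. x mod e) (mset xs). d dvd x#}"
      unfolding a4 mult_sum_count
      by (intro arg_cong[where f = size] filter_mset_cong) (use v(2) in auto)
    also have "\<dots> = size {#x \<in># mset xs. d dvd x mod e#}"
      by (simp add: filter_mset_image_mset o_def)
    \<comment> \<open>A histogram modulo \<open>e\<close> decides divisibility by every divisor of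
      \<open>e\<close>, so one table serves all candidates.\<close>
    also have "{#x \<in># mset xs. d dvd x mod e#} = {#x \<in># mset xs. d dvd x#}"
      by (intro filter_mset_cong) (use True in \<open>auto simp: dvd_mod_iff\<close>)
    finally have ms: "n - mult_sum (a 4) d e = nondiv d (mset xs)"
      using size_filter_nondiv[of d "mset xs"] n_def by simp
    have "wp (sum_multiples 4 14)
      (vc (Ife (V 0 \<ominus> V 13 \<prec> V 11) (Asg 16 (V 11)) (Asg 10 (N 0))) Q) v' a (T - t)" if t: "t \<le> 10" for t
    proof (rule sum_multiples[where R = "R + 30" and d = d and B = e])
      show "mult_sum (a 4) d J \<le> n" for J
        unfolding a4 using mult_sum_count_le[of "image_mset (\<lambda>x. x mod e) (mset xs)" d J] n_def by simp
      have "e div d \<le> Suc L div d" using v by (intro div_le_mono) simp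
      then show "R + 30 + 40 * (e div d) + 80 \<le> T - t" using T t by linarith
      fix v'' T'' assume R: "R + 30 \<le> T''" and fr': "\<forall>r. r \<notin> {12, 13} \<longrightarrow> v'' r = v' r"
        and v13: "v'' 13 = mult_sum (a 4) d e"
      have v'': "v'' 0 = n" "v'' 11 = d" using fr' v' d by simp_all
      have Q1: "Q (v''(16 := d)) a (T'' - t)" if "nondiv d (mset xs) < d" "t \<le> 30" for t
        by (rule post) (use that R fr' True in auto)
      have Q2: "Q (v''(10 := 0)) a (T'' - t)" if "\<not> nondiv d (mset xs) < d" "t \<le> 30" for t
        by (rule post) (use that R fr' in auto)
      show "vc (Ife (V 0 \<ominus> V 13 \<prec> V 11) (Asg 16 (V 11)) (Asg 10 (N 0))) Q v'' a T''"
        using R Q1 Q2 Z0 by (cases "nondiv d (mset xs) < d") (simp_all add: v'' v13 ms)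
    qed (use d Ln v' in simp_all)
    then show ?thesis
      by (intro vc_sound) (use T Z0 in \<open>simp add: div_test_def v' d e0\<close>)
  qed
qed

text \<open>All but fewer than \<open>2 * d\<close> differences are divisible by \<open>d\<close>,
  and all but fewer than \<open>2 * e\<close> by \<open>e\<close>; the factor 2 comes from
  \<open>linked\<close>. If \<open>d\<close> does not divide \<open>e\<close>, their lcm is at least
  \<open>2 * e\<close>, hence at least \<open>d + e\<close>, and fails for fewer than
  \<open>2 * d + 2 * e\<close> differences. These are too few to exhaust all differences, so the lcm
  divides one of them, is at most \<open>L\<close>, and contradicts the choice of \<open>e\<close>
  as the last hit.\<close>

lemma modulus_dvd_last:
  assumes lk: "linked (mset xs) pm \<Delta>" and e: "last_sat (\<lambda>d. nondiv d \<Delta> < 2 * d) (Suc L) e"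
    and d: "1 \<le> d" "d \<le> L" "nondiv d (mset xs) < d"
  shows "1 \<le> e \<and> e \<le> L \<and> d dvd e"
proof -
  have nd: "nondiv d \<Delta> \<le> 2 * nondiv d (mset xs)" for d
    using lk unfolding linked_def by (meson add_leD1)
  have rng: "1 \<le> \<delta> \<and> \<delta> \<le> L" if "\<delta> \<in># \<Delta>" for \<delta> using lk that unfolding linked_def by blast
  have qd: "nondiv d \<Delta> < 2 * d" using nd[of d] d(3) by linarith
  then have de: "d \<le> e" using e d(2) unfolding last_sat_def by (meson le_imp_less_Suc not_le)
  then have e1: "1 \<le> e" "e \<le> L" "nondiv e \<Delta> < 2 * e" using e d(1) unfolding last_sat_def by auto
  have "d dvd e"
  proof (rule ccontr)
    assume ndvd: "\<not> d dvd e"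
    let ?l = "lcm d e"
    have "{#x \<in># \<Delta>. \<not> ?l dvd x#} \<subseteq># {#x \<in># \<Delta>. \<not> d dvd x#} + {#x \<in># \<Delta>. \<not> e dvd x#}"
      by (auto simp: subseteq_mset_def)
    then have le: "nondiv ?l \<Delta> \<le> nondiv d \<Delta> + nondiv e \<Delta>"
      unfolding nondiv_def by (metis size_mset_mono size_union)
    have "size \<Delta> \<noteq> nondiv ?l \<Delta>"
    proof -
      have "1000 * L \<le> n" by simp
      then show ?thesis using le qd e1 d(2) linked_many[OF lk] L_ge by linarith
    qed
    then have "size {#x \<in># \<Delta>. ?l dvd x#} \<noteq> 0" using size_filter_nondiv[of ?l \<Delta>] by linarith
    then have "{#x \<in># \<Delta>. ?l dvd x#} \<noteq> {#}" by force
    then obtain \<delta> where "\<delta> \<in># {#x \<in># \<Delta>. ?l dvd x#}" by (meson multiset_nonemptyE)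
    then have \<delta>: "\<delta> \<in># \<Delta>" "?l dvd \<delta>" by simp_all
    then have "?l \<le> \<delta>" using rng[of \<delta>] by (intro dvd_imp_le) auto
    then have lL: "?l \<le> L" using rng[OF \<delta>(1)] by linarith
    obtain k where k: "?l = e * k" by (metis dvd_lcm2 dvdE)
    have "k \<noteq> 0" using k d e1 by (metis lcm_eq_0_iff mult_0_right not_one_le_zero)
    moreover have "k \<noteq> 1" using k ndvd by (metis dvd_lcm1 mult.right_neutral)
    ultimately have "2 \<le> k" by linarith
    then have "e * 2 \<le> ?l" unfolding k by (rule mult_le_mono2)
    then have l2: "d + e \<le> ?l" "e < ?l" using de e1 by linarith+
    then have "nondiv ?l \<Delta> < 2 * ?l" using le qd e1 by linarith
    then show False using e l2 lL unfolding last_sat_def by (meson le_imp_less_Suc)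
  qed
  then show ?thesis using e1 by simp
qed

definition search_time :: nat where
  "search_time = (\<Sum>d=1..<Suc L. 40 * (Suc L div d) + 120 + 30)"

lemma find_modulus:
  assumes v: "v 0 = n" "v 9 = 0" and a0: "\<And>i. i < n \<Longrightarrow> a 0 i = xs ! i"
    and az: "\<And>q. q \<in> {2, 3, 4, 10} \<Longrightarrow> a q = (\<lambda>_. 0)"
    and T: "R + 260 * n + 2 * search_time + 400 \<le> T"
    and post: "\<And>v' a' T'. R \<le> T' \<Longrightarrow> \<forall>r. r \<notin> {2..16} \<longrightarrow> v' r = v r \<Longrightarrow>
      \<forall>q. q \<notin> {2, 3, 4, 10} \<longrightarrow> a' q = a q \<Longrightarrow> is_modulus (v' 16) (mset xs) \<Longrightarrow> Q v' a' T'"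
  shows "wp find_modulus Q v a T"
proof -
  have Z1: "Suc 0 < Z" "0 < Z" "Suc L < Z" using n_less_Z by simp_all
  let ?c2 = "Blk (search 16 div_test)"
  let ?c1 = "Asg 15 (V 14 \<oplus> N 1) ;; ?c2"
  let ?c0 = "Blk (hist 4 14) ;; ?c1"
  have "wp link (vc (Asg 15 (V 2 \<oplus> N 1) ;; Blk (search 14 link_test) ;; ?c0) Q) v a T"
  proof (rule link[where R = "R + 60 * n + 2 * search_time + 300"])
    fix v1 a1 T1 pm \<Delta>
    assume T1: "R + 60 * n + 2 * search_time + 300 \<le> T1" and fr1: "\<forall>r. r \<notin> {2..10} \<longrightarrow> v1 r = v r"
      and fa1: "\<forall>q. q \<notin> {10, 2, 3} \<longrightarrow> a1 q = a q" and v1: "v1 2 = L" "v1 9 = size \<Delta>"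
      and a1: "a1 3 = count \<Delta>" and lk: "linked (mset xs) pm \<Delta>"
    have Drng: "\<delta> \<le> L" if "\<delta> \<in># \<Delta>" for \<delta> using lk that unfolding linked_def by blast
    have Dsz: "size \<Delta> \<le> n" using linked_size[OF lk] n_def by simp
    have "wp (search 14 link_test) (vc ?c0 Q) (v1(15 := Suc L)) a1 (T1 - t)" if "t \<le> 20" for t
    proof (rule search[where P = "\<lambda>d. nondiv d \<Delta> < 2 * d" and B = "Suc L"
          and C = "\<lambda>d. 40 * (Suc L div d) + 120" and R = "R + 60 * n + search_time + 200"])
      show "R + 60 * n + search_time + 200 + (\<Sum>d=1..<Suc L. 40 * (Suc L div d) + 120 + 30) + 40 \<le> T1 - t"
        using T1 that unfolding search_time_def by linarith
      show "wp link_test Q' v' a1 T'" if "1 \<le> d" "d < Suc L" "v' 11 = d"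
        "\<forall>r. r \<notin> {10, 11, 12, 13, 14} \<longrightarrow> v' r = (v1(15 := Suc L)) r"
        "R' + (40 * (Suc L div d) + 120) \<le> T'"
        "\<And>v'' T''. R' \<le> T'' \<Longrightarrow> \<forall>r. r \<notin> {10, 12, 13, 14} \<longrightarrow> v'' r = v' r \<Longrightarrow>
          v'' 14 = (if nondiv d \<Delta> < 2 * d then d else v' 14) \<Longrightarrow> Q' v'' a1 T''" for d v' T' R' Q'
        by (rule link_test[where v = "v1(15 := Suc L)" and \<Delta> = \<Delta> and d = d and R = R'])
          (fact a1 | fact Drng | fact Dsz | (rule that; assumption) | simp add: v1)+
      fix v2 T2 assume T2: "R + 60 * n + search_time + 200 \<le> T2"
        and fr2: "\<forall>r. r \<notin> {10, 11, 12, 13, 14} \<longrightarrow> v2 r = (v1(15 := Suc L)) r"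
        and ls: "last_sat (\<lambda>d. nondiv d \<Delta> < 2 * d) (Suc L) (v2 14)"
      define e where "e = v2 14"
      note dvd = modulus_dvd_last[OF lk ls[folded e_def]]
      have e: "1 \<le> e" "e \<le> L" using dvd[of 1] L_ge by (simp_all add: nondiv_def)
      have "wp (hist 4 14) (vc ?c1 Q) v2 a1 T2"
      proof (rule hist[where R = "R + search_time + 140" and m = e])
        show "R + search_time + 140 + 60 * n + 60 \<le> T2" using T2 by simp
        fix v3 T3 assume T3: "R + search_time + 140 \<le> T3" and fr3: "\<forall>r. r \<notin> {3, 4} \<longrightarrow> v3 r = v2 r"
        let ?a3 = "a1(4 := count (image_mset (\<lambda>x. x mod e) (mset xs)))"
        have v3: "v3 14 = e" "v3 0 = n" using fr1 fr2 fr3 v by (simp_all add: e_def)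
        have "wp (search 16 div_test) Q (v3(15 := Suc e)) ?a3 (T3 - t)" if "t \<le> 20" for t
        proof (rule search[where P = "\<lambda>d. d dvd e \<and> nondiv d (mset xs) < d" and B = "Suc e"
              and C = "\<lambda>d. 40 * (Suc L div d) + 120" and R = R])
          have "(\<Sum>d=1..<Suc e. 40 * (Suc L div d) + 120 + 30) \<le> search_time"
            unfolding search_time_def using e by (intro sum_mono2) auto
          then show "R + (\<Sum>d=1..<Suc e. 40 * (Suc L div d) + 120 + 30) + 40 \<le> T3 - t"
            using T3 that by linarith
          show "wp div_test Q' v' ?a3 T'" if "1 \<le> d" "d < Suc e" "v' 11 = d"
            "\<forall>r. r \<notin> {10, 11, 12, 13, 16} \<longrightarrow> v' r = (v3(15 := Suc e)) r"
            "R' + (40 * (Suc L div d) + 120) \<le> T'"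
            "\<And>v'' T''. R' \<le> T'' \<Longrightarrow> \<forall>r. r \<notin> {10, 12, 13, 16} \<longrightarrow> v'' r = v' r \<Longrightarrow>
              v'' 16 = (if d dvd e \<and> nondiv d (mset xs) < d then d else v' 16) \<Longrightarrow> Q' v'' ?a3 T''"
            for d v' T' R' Q'
            by (rule div_test[where v = "v3(15 := Suc e)" and e = e and d = d and R = R'])
              (fact e | (rule that; assumption) | simp add: v3)+
          fix v4 T4 assume T4: "R \<le> T4"
            and fr4: "\<forall>r. r \<notin> {10, 11, 12, 13, 16} \<longrightarrow> v4 r = (v3(15 := Suc e)) r"
            and ls4: "last_sat (\<lambda>d. d dvd e \<and> nondiv d (mset xs) < d) (Suc e) (v4 16)"
          show "Q v4 ?a3 T4"
          proof (rule post[OF T4])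
            show "\<forall>r. r \<notin> {2..16} \<longrightarrow> v4 r = v r"
            proof (intro allI impI)
              fix r :: nat assume "r \<notin> {2..16}"
              then have "r < 2 \<or> 16 < r" by auto
              then show "v4 r = v r" using fr1 fr2 fr3 fr4 by auto
            qed
            show "\<forall>q. q \<notin> {2, 3, 4, 10} \<longrightarrow> ?a3 q = a q" using fa1 by simp
            have "1 \<le> v4 16"
            proof (rule ccontr)
              assume "\<not> 1 \<le> v4 16"
              then have "\<not> (1 dvd e \<and> nondiv 1 (mset xs) < 1)"
                using ls4[unfolded last_sat_def, THEN conjunct2, rule_format, of 1] e(1) by linarith
              then show False by (simp add: nondiv_def)
            qed
            then have d1: "1 \<le> v4 16" "v4 16 \<le> e" "nondiv (v4 16) (mset xs) < v4 16"
              using ls4 unfolding last_sat_def by auto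
            \<comment> \<open>The second search tests divisors of \<open>e\<close> only; every
              competitor is one, so it would have been met.\<close>
            have "d' \<le> nondiv d' (mset xs)" if "v4 16 < d'" "d' \<le> L" for d'
            proof (rule ccontr)
              assume "\<not> d' \<le> nondiv d' (mset xs)"
              then have nd: "nondiv d' (mset xs) < d'" by simp
              have "1 \<le> d'" using that by simp
              from dvd[OF this that(2) nd] have "d' dvd e" "d' \<le> e" using e by (auto dest: dvd_imp_le)
              then show False using ls4 that nd unfolding last_sat_def by auto
            qed
            then show "is_modulus (v4 16) (mset xs)"
              unfolding is_modulus_def using d1 e n_def by auto
          qed
        qed (use e n_ge in auto)
        then show "vc ?c1 Q v3 ?a3 T3"
          using T3 Z1 e by (simp add: v3)
      qed (use fr1 fr2 v fa1 a0 az T2 in \<open>auto simp: e_def\<close>)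
      then show "vc ?c0 Q v2 a1 T2" by simp
    qed (use n_ge in auto)
    then show "vc (Asg 15 (V 2 \<oplus> N 1) ;; Blk (search 14 link_test) ;; ?c0) Q v1 a1 T1"
      using T1 Z1 by (simp add: v1)
  qed (use v a0 az T in auto)
  then show ?thesis by (intro vc_sound) (simp add: find_modulus_def)
qed

end

section \<open>Names of dyadic blocks\<close>

text \<open>Names of dyadic blocks: cell \<open>k * N2 + i\<close> of \<open>A\<close> names the block of length \<open>2 ^ k\<close> that starts
  at position \<open>i\<close>.  The dictionary \<open>D\<close> maps the (encoded) pair of names of the two halves of a block
  to the name of the block.\<close>

definition dict_ok :: "(nat \<Rightarrow> nat) \<Rightarrow> nat \<Rightarrow> bool" where
  "dict_ok D nxt \<longleftrightarrow> (\<forall>m m'. D m = D m' \<longrightarrow> D m \<noteq> 0 \<longrightarrow> m = m') \<and> (\<forall>m. D m \<le> nxt)"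

text \<open>Entries are never overwritten, so names once given stay valid while the dictionary
  grows.\<close>

definition dict_ext :: "(nat \<Rightarrow> nat) \<Rightarrow> (nat \<Rightarrow> nat) \<Rightarrow> bool" where
  "dict_ext D D' \<longleftrightarrow> (\<forall>m. D m \<noteq> 0 \<longrightarrow> D' m = D m)"

lemma dict_ext_refl: "dict_ext D D"
  by (simp add: dict_ext_def)

lemma dict_ext_trans: "dict_ext D D' \<Longrightarrow> dict_ext D' D'' \<Longrightarrow> dict_ext D D''"
  by (simp add: dict_ext_def)

lemma dict_insert:
  assumes "dict_ok D nxt" "D m = 0"
  shows "dict_ok (D(m := Suc nxt)) (Suc nxt)" "dict_ext D (D(m := Suc nxt))"
proof -
  have le: "D m' \<le> nxt" and inj: "\<And>m''. D m' = D m'' \<Longrightarrow> D m' \<noteq> 0 \<Longrightarrow> m' = m''" for m'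
    using assms(1) unfolding dict_ok_def by blast+
  have ne: "D m' \<noteq> Suc nxt" for m' using le[of m'] by simp
  have "m1 = m2" if "(D(m := Suc nxt)) m1 = (D(m := Suc nxt)) m2" "(D(m := Suc nxt)) m1 \<noteq> 0" for m1 m2
    using that inj[of m1 m2] ne[of m1] ne[of m2] by (auto split: if_splits)
  moreover have "(D(m := Suc nxt)) m' \<le> Suc nxt" for m' using le[of m'] by auto
  ultimately show "dict_ok (D(m := Suc nxt)) (Suc nxt)" unfolding dict_ok_def by blast
  show "dict_ext D (D(m := Suc nxt))" using assms(2) unfolding dict_ext_def by auto
qed

lemma same_block_start:
  fixes i i' y m :: nat
  assumes "i mod m = i' mod m" "i \<le> y" "y < i + m" "i' \<le> y" "y < i' + m"
  shows "i = i'"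
  using assms
proof (induction i i' rule: linorder_wlog)
  case (le i i')
  then have "m dvd i' - i" by (metis mod_eq_dvd_iff_nat)
  moreover have "i' - i < m" using le by linarith
  ultimately have "i' - i = 0" by (metis dvd_imp_le linorder_not_less neq0_conv)
  then show ?case using le by simp
qed (simp add: eq_commute)

lemma mod_double:
  fixes i j k :: nat
  assumes "i mod 2 ^ Suc k = j mod 2 ^ Suc k"
  shows "i mod 2 ^ k = j mod 2 ^ k"
proof -
  have "(i mod 2 ^ Suc k) mod 2 ^ k = (j mod 2 ^ Suc k) mod 2 ^ k" using assms by simp
  moreover have "(2::nat) ^ k dvd 2 ^ Suc k" by simp
  ultimately show ?thesis by (metis mod_mod_cancel)
qed

locale naming =
  fixes N2 Bn K :: nat
begin

text \<open>A cell is judged against the two names one level below, whatever these are. This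
  locality allows levels and paths to be repaired one at a time.\<close>

definition okc :: "(nat \<Rightarrow> nat) \<Rightarrow> (nat \<Rightarrow> nat) \<Rightarrow> nat \<Rightarrow> nat \<Rightarrow> bool" where
  "okc D A k i \<longleftrightarrow> A (k * N2 + i) \<noteq> 0 \<and>
     A (k * N2 + i) = D (A ((k - 1) * N2 + i) * Bn + A ((k - 1) * N2 + (i + 2 ^ (k - 1))))"

text \<open>Only blocks aligned with the shift \<rho> are constrained; other cells may hold stale
  names from earlier shifts.\<close>

definition lev_ok :: "(nat \<Rightarrow> nat) \<Rightarrow> (nat \<Rightarrow> nat) \<Rightarrow> nat \<Rightarrow> nat \<Rightarrow> bool" where
  "lev_ok D A \<rho> k \<longleftrightarrow> (\<forall>i. i mod 2 ^ k = \<rho> mod 2 ^ k \<longrightarrow> i + 2 ^ k \<le> N2 \<longrightarrow> okc D A k i)"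

definition tree_ok :: "(nat \<Rightarrow> nat) \<Rightarrow> (nat \<Rightarrow> nat) \<Rightarrow> nat \<Rightarrow> bool" where
  "tree_ok D A \<rho> \<longleftrightarrow> (\<forall>k. 1 \<le> k \<longrightarrow> k \<le> K \<longrightarrow> lev_ok D A \<rho> k)"

text \<open>All blocks are named correctly, except possibly those of level at least \<open>k\<close> that contain the
  position \<open>y\<close>.\<close>

definition path_ok :: "(nat \<Rightarrow> nat) \<Rightarrow> (nat \<Rightarrow> nat) \<Rightarrow> nat \<Rightarrow> nat \<Rightarrow> nat \<Rightarrow> bool" where
  "path_ok D A \<rho> y k \<longleftrightarrow> (\<forall>k' i. 1 \<le> k' \<longrightarrow> k' \<le> K \<longrightarrow> i mod 2 ^ k' = \<rho> mod 2 ^ k' \<longrightarrow>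
     i + 2 ^ k' \<le> N2 \<longrightarrow> k' < k \<or> \<not> (i \<le> y \<and> y < i + 2 ^ k') \<longrightarrow> okc D A k' i)"

lemma okc_ext:
  assumes "okc D A k i" "dict_ext D D'"
  shows "okc D' A k i"
  using assms unfolding okc_def dict_ext_def by metis

lemma lev_ok_ext: "lev_ok D A \<rho> k \<Longrightarrow> dict_ext D D' \<Longrightarrow> lev_ok D' A \<rho> k"
  unfolding lev_ok_def using okc_ext by blast

lemma tree_ok_ext: "tree_ok D A \<rho> \<Longrightarrow> dict_ext D D' \<Longrightarrow> tree_ok D' A \<rho>"
  unfolding tree_ok_def using lev_ok_ext by blast

lemma path_ok_ext: "path_ok D A \<rho> y k \<Longrightarrow> dict_ext D D' \<Longrightarrow> path_ok D' A \<rho> y k"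
  unfolding path_ok_def using okc_ext by blast

lemma path_ok_tree: "path_ok D A \<rho> y (Suc K) \<Longrightarrow> tree_ok D A \<rho>"
  unfolding path_ok_def tree_ok_def lev_ok_def by (meson le_imp_less_Suc)

lemma cell_inj:
  assumes "i < N2" "i' < N2" "k * N2 + i = k' * N2 + i'"
  shows "k = k'" "i = i'"
proof -
  have N2: "0 < N2" using assms(1) by simp
  have "(k * N2 + i) div N2 = (k' * N2 + i') div N2" "(k * N2 + i) mod N2 = (k' * N2 + i') mod N2"
    unfolding assms(3) by (rule refl)+
  then show "k = k'" "i = i'" using N2 assms(1,2) by simp_all
qed

lemma half_less: "1 \<le> k \<Longrightarrow> i + 2 ^ k \<le> N2 \<Longrightarrow> i < N2 \<and> i + 2 ^ (k - 1) < N2" for i k :: nat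
proof -
  assume k: "1 \<le> k" and le: "i + 2 ^ k \<le> N2"
  have "(2::nat) ^ k = 2 * 2 ^ (k - 1)" using k by (simp add: power_eq_if)
  moreover have "(0::nat) < 2 ^ (k - 1)" by simp
  ultimately show ?thesis using le by linarith
qed

lemma okc_cong:
  assumes "okc D A k i" "A' (k * N2 + i) = A (k * N2 + i)"
    "A' ((k - 1) * N2 + i) = A ((k - 1) * N2 + i)"
    "A' ((k - 1) * N2 + (i + 2 ^ (k - 1))) = A ((k - 1) * N2 + (i + 2 ^ (k - 1)))"
  shows "okc D A' k i"
  using assms unfolding okc_def by simp

lemma path_start:
  assumes "tree_ok D A \<rho>" "y < N2"
  shows "path_ok D (A(y := c)) \<rho> y 1"
  unfolding path_ok_def
proof (intro allI impI)
  fix k i assume k: "1 \<le> k" "k \<le> K" and i: "i mod 2 ^ k = \<rho> mod 2 ^ k" "i + 2 ^ k \<le> N2"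
    and y: "k < 1 \<or> \<not> (i \<le> y \<and> y < i + 2 ^ k)"
  have ok: "okc D A k i" using assms k i unfolding tree_ok_def lev_ok_def by blast
  have hl: "i < N2" "i + 2 ^ (k - 1) < N2" using half_less[OF k(1) i(2)] by auto
  have pw: "(2::nat) ^ k = 2 * 2 ^ (k - 1)" using k by (simp add: power_eq_if)
  have p0: "(0::nat) < 2 ^ (k - 1)" by simp
  have ny: "\<not> (i \<le> y \<and> y < i + 2 ^ k)" using y k by auto
  show "okc D (A(y := c)) k i"
  proof (rule okc_cong[OF ok])
    have "k * N2 + i \<noteq> 0 * N2 + y" using cell_inj(1)[OF hl(1) assms(2), of k 0] k by auto
    then show "(A(y := c)) (k * N2 + i) = A (k * N2 + i)" by simp
    have "(k - 1) * N2 + i \<noteq> 0 * N2 + y"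
      using cell_inj(2)[OF hl(1) assms(2), of "k - 1" 0] ny p0 pw by auto
    then show "(A(y := c)) ((k - 1) * N2 + i) = A ((k - 1) * N2 + i)" by simp
    have "(k - 1) * N2 + (i + 2 ^ (k - 1)) \<noteq> 0 * N2 + y"
      using cell_inj(2)[OF hl(2) assms(2), of "k - 1" 0] ny p0 pw by auto
    then show "(A(y := c)) ((k - 1) * N2 + (i + 2 ^ (k - 1))) = A ((k - 1) * N2 + (i + 2 ^ (k - 1)))"
      by simp
  qed
qed

text \<open>On each level at most one aligned block contains \<open>y\<close>. Renaming it can
  invalidate only its parent, which contains \<open>y\<close> as well and is still exempt.\<close>

lemma path_step:
  assumes ok: "path_ok D A \<rho> y k" and D: "dict_ext D D'" and k: "1 \<le> k" "k \<le> K"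
    and i0: "i0 mod 2 ^ k = \<rho> mod 2 ^ k" "i0 + 2 ^ k \<le> N2" "i0 \<le> y" "y < i0 + 2 ^ k"
    and c: "c \<noteq> 0" "c = D' (A ((k - 1) * N2 + i0) * Bn + A ((k - 1) * N2 + (i0 + 2 ^ (k - 1))))"
  shows "path_ok D' (A(k * N2 + i0 := c)) \<rho> y (Suc k)"
  unfolding path_ok_def
proof (intro allI impI)
  fix k' i assume k': "1 \<le> k'" "k' \<le> K" and i: "i mod 2 ^ k' = \<rho> mod 2 ^ k'" "i + 2 ^ k' \<le> N2"
    and y: "k' < Suc k \<or> \<not> (i \<le> y \<and> y < i + 2 ^ k')"
  let ?A = "A(k * N2 + i0 := c)"
  have hl: "i < N2" "i + 2 ^ (k' - 1) < N2" using half_less[OF k'(1) i(2)] by auto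
  have hl0: "i0 < N2" "i0 + 2 ^ (k - 1) < N2" using half_less[OF k(1) i0(2)] by auto
  have other: "?A (j * N2 + x) = A (j * N2 + x)" if "x < N2" "j \<noteq> k \<or> x \<noteq> i0" for j x
    using cell_inj[OF that(1) hl0(1), of j k] that(2) by auto
  show "okc D' ?A k' i"
  proof (cases "k' = k \<and> i = i0")
    case True
    have "?A ((k - 1) * N2 + i0) = A ((k - 1) * N2 + i0)"
      "?A ((k - 1) * N2 + (i0 + 2 ^ (k - 1))) = A ((k - 1) * N2 + (i0 + 2 ^ (k - 1)))"
      by (rule other; use hl0 k(1) in simp)+
    then show ?thesis using True c unfolding okc_def by simp
  next
    case False
    have "k' < k \<or> \<not> (i \<le> y \<and> y < i + 2 ^ k')"
    proof (cases "k' = k")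
      case True
      then show ?thesis using False same_block_start[of i "2 ^ k" i0 y] i i0 by auto
    qed (use y in auto)
    then have "okc D' A k' i"
      using ok k' i okc_ext[OF _ D] unfolding path_ok_def by blast
    then show ?thesis
    proof (rule okc_cong)
      show "?A (k' * N2 + i) = A (k' * N2 + i)" using other[OF hl(1)] False by blast
      have "\<not> (i \<le> y \<and> y < i + 2 ^ k')" if "k' - 1 = k"
        using y that k' by auto
      moreover have "(2::nat) ^ k' = 2 * 2 ^ (k' - 1)" using k' by (simp add: power_eq_if)
      ultimately have "i \<noteq> i0 \<and> i + 2 ^ (k' - 1) \<noteq> i0" if "k' - 1 = k" using that i0 by auto
      then show "?A ((k' - 1) * N2 + i) = A ((k' - 1) * N2 + i)"
        "?A ((k' - 1) * N2 + (i + 2 ^ (k' - 1))) = A ((k' - 1) * N2 + (i + 2 ^ (k' - 1)))"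
        using other[OF hl(1), of "k' - 1"] other[OF hl(2), of "k' - 1"] by blast+
    qed
  qed
qed

text \<open>Near the ends of the array no complete aligned block may contain \<open>y\<close>; then
  the level is correct already.\<close>

lemma path_skip:
  assumes ok: "path_ok D A \<rho> y k"
    and no: "\<And>i. i mod 2 ^ k = \<rho> mod 2 ^ k \<Longrightarrow> i + 2 ^ k \<le> N2 \<Longrightarrow> i \<le> y \<Longrightarrow> \<not> y < i + 2 ^ k"
  shows "path_ok D A \<rho> y (Suc k)"
  unfolding path_ok_def
proof (intro allI impI)
  fix k' i assume k': "1 \<le> k'" "k' \<le> K" and i: "i mod 2 ^ k' = \<rho> mod 2 ^ k'" "i + 2 ^ k' \<le> N2"
    and y: "k' < Suc k \<or> \<not> (i \<le> y \<and> y < i + 2 ^ k')"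
  have "k' < k \<or> \<not> (i \<le> y \<and> y < i + 2 ^ k')"
    using y no[of i] i by (cases "k' = k") auto
  then show "okc D A k' i" using ok k' i unfolding path_ok_def by blast
qed

text \<open>Both trees draw their names from one dictionary, so names can be compared across
  different alignments. The dictionary is injective on its entries and pairs are decoded uniquely in
  base \<open>Bn\<close>; equality of names therefore descends to the halves, down to single
  positions.\<close>

lemma names_eq_iff:
  assumes dict: "dict_ok D nxt" and nxt: "nxt < Bn"
    and A: "tree_ok D A \<rho>" "\<And>i. A i \<le> nxt" and A': "tree_ok D A' \<rho>'" "\<And>i. A' i \<le> nxt"
    and i: "i mod 2 ^ k = \<rho> mod 2 ^ k" "i + 2 ^ k \<le> N2"
      "i' mod 2 ^ k = \<rho>' mod 2 ^ k" "i' + 2 ^ k \<le> N2" and k: "k \<le> K"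
  shows "A (k * N2 + i) = A' (k * N2 + i') \<longleftrightarrow> (\<forall>z<2 ^ k. A (i + z) = A' (i' + z))"
  using i k
proof (induction k arbitrary: i i')
  case 0
  then show ?case by simp
next
  case (Suc k)
  let ?h = "2 ^ k :: nat"
  have h2: "2 ^ Suc k = 2 * ?h" by simp
  have ok: "okc D A (Suc k) i" "okc D A' (Suc k) i'"
    using A(1) A'(1) Suc.prems unfolding tree_ok_def lev_ok_def by auto
  have m: "i mod ?h = \<rho> mod ?h" "i' mod ?h = \<rho>' mod ?h"
    using mod_double[OF Suc.prems(1)] mod_double[OF Suc.prems(3)] by auto
  have m2: "(i + ?h) mod ?h = \<rho> mod ?h" "(i' + ?h) mod ?h = \<rho>' mod ?h" using m by auto
  have IH1: "A (k * N2 + i) = A' (k * N2 + i') \<longleftrightarrow> (\<forall>z<?h. A (i + z) = A' (i' + z))"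
    using Suc.prems m by (intro Suc.IH) auto
  have IH2: "A (k * N2 + (i + ?h)) = A' (k * N2 + (i' + ?h)) \<longleftrightarrow> (\<forall>z<?h. A (i + ?h + z) = A' (i' + ?h + z))"
    using Suc.prems m2 by (intro Suc.IH) auto
  let ?p = "A (k * N2 + i) * Bn + A (k * N2 + (i + ?h))"
  let ?p' = "A' (k * N2 + i') * Bn + A' (k * N2 + (i' + ?h))"
  have e: "A (Suc k * N2 + i) = D ?p" "D ?p \<noteq> 0" "A' (Suc k * N2 + i') = D ?p'" "D ?p' \<noteq> 0"
    using ok unfolding okc_def by simp_all
  have "A (Suc k * N2 + i) = A' (Suc k * N2 + i') \<longleftrightarrow> ?p = ?p'"
    unfolding e(1,3) using dict e(2) unfolding dict_ok_def by metis
  also have "\<dots> \<longleftrightarrow> A (k * N2 + i) = A' (k * N2 + i') \<and>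
      A (k * N2 + (i + ?h)) = A' (k * N2 + (i' + ?h))"
  proof
    assume eq: "?p = ?p'"
    have "A (k * N2 + (i + ?h)) < Bn" "A' (k * N2 + (i' + ?h)) < Bn"
      using A(2) A'(2) nxt by (meson le_less_trans)+
    moreover have "?p div Bn = ?p' div Bn" "?p mod Bn = ?p' mod Bn" unfolding eq by (rule refl)+
    ultimately show "A (k * N2 + i) = A' (k * N2 + i') \<and>
      A (k * N2 + (i + ?h)) = A' (k * N2 + (i' + ?h))" using nxt by simp
  qed auto
  also have "\<dots> \<longleftrightarrow> (\<forall>z<2 ^ Suc k. A (i + z) = A' (i' + z))"
    unfolding IH1 IH2
  proof safe
    fix z :: nat assume 1: "\<forall>z<?h. A (i + z) = A' (i' + z)" and
      2: "\<forall>z<?h. A (i + ?h + z) = A' (i' + ?h + z)" and z: "z < 2 ^ Suc k"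
    show "A (i + z) = A' (i' + z)"
    proof (cases "z < ?h")
      case False
      then have "z - ?h < ?h" "?h + (z - ?h) = z" using z by auto
      then show ?thesis using 2 by (metis add.assoc)
    qed (use 1 in auto)
  next
    fix z :: nat assume 1: "\<forall>z<2 ^ Suc k. A (i + z) = A' (i' + z)" and z: "z < ?h"
    then have "?h + z < 2 ^ Suc k" by simp
    then show "A (i + ?h + z) = A' (i' + ?h + z)" using 1 by (metis add.assoc)
    show "A (i + z) = A' (i' + z)" using 1 z by simp
  qed
  finally show ?case .
qed

end

text \<open>Bit reversal of the \<open>k\<close> low bits: the lowest bit becomes the highest, and
  bits beyond the first \<open>k\<close> are dropped.\<close>

fun brev :: "nat \<Rightarrow> nat \<Rightarrow> nat" where
  "brev 0 u = 0"
| "brev (Suc k) u = brev k (u div 2) + (u mod 2) * 2 ^ k"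

lemma brev_less: "brev k u < 2 ^ k"
proof (induction k arbitrary: u)
  case (Suc k)
  have "u mod 2 \<le> 1" by simp
  then have "(u mod 2) * 2 ^ k \<le> 1 * 2 ^ k" by (rule mult_le_mono1)
  then show ?case using Suc[of "u div 2"] unfolding brev.simps power_Suc by linarith
qed simp

text \<open>The low bits of the reversal are the high bits of \<open>u\<close>, so the residue
  modulo \<open>2 ^ k\<close> is constant on runs of \<open>2 ^ j\<close> consecutive
  indices.\<close>

lemma brev_mod: "brev (k + j) u mod 2 ^ k = brev k (u div 2 ^ j)"
proof (induction j arbitrary: u)
  case 0
  then show ?case using brev_less by simp
next
  case (Suc j)
  have "brev (k + Suc j) u mod 2 ^ k = (brev (k + j) (u div 2) + (u mod 2) * 2 ^ j * 2 ^ k) mod 2 ^ k"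
    by (simp add: power_add mult_ac)
  also have "\<dots> = brev k (u div 2 div 2 ^ j)" using Suc by simp
  also have "u div 2 div 2 ^ j = u div 2 ^ Suc j" by (simp add: div_mult2_eq)
  finally show ?case .
qed

lemma inj_on_brev: "inj_on (brev k) {..<2 ^ k}"
proof (induction k)
  case (Suc k)
  show ?case
  proof (rule inj_onI)
    fix u u' :: nat assume u: "u \<in> {..<2 ^ Suc k}" "u' \<in> {..<2 ^ Suc k}"
      and eq: "brev (Suc k) u = brev (Suc k) u'"
    have "brev k (u div 2) + u mod 2 * 2 ^ k = brev k (u' div 2) + u' mod 2 * 2 ^ k" using eq by simp
    then have eq': "u mod 2 * 2 ^ k + brev k (u div 2) = u' mod 2 * 2 ^ k + brev k (u' div 2)" by simp
    have qr: "(u mod 2 * 2 ^ k + brev k (u div 2)) div 2 ^ k = u mod 2"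
      "(u mod 2 * 2 ^ k + brev k (u div 2)) mod 2 ^ k = brev k (u div 2)" for u
      using brev_less[of k "u div 2"] by simp_all
    have 1: "u mod 2 = u' mod 2" using qr(1)[of u] qr(1)[of u'] unfolding eq' by simp
    have 2: "brev k (u div 2) = brev k (u' div 2)"
      using qr(2)[of u] qr(2)[of u'] unfolding eq' by simp
    have "u div 2 \<in> {..<2 ^ k}" "u' div 2 \<in> {..<2 ^ k}" using u by auto
    with 2 have 3: "u div 2 = u' div 2" by (rule inj_onD[OF Suc])
    have "u = u div 2 * 2 + u mod 2" by simp
    also have "\<dots> = u'" unfolding 1 3 by simp
    finally show "u = u'" .
  qed
qed (simp add: inj_on_def)

lemma bij_betw_brev: "bij_betw (brev k) {..<2 ^ k} {..<2 ^ k}"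
  unfolding bij_betw_def
  using inj_on_brev brev_less by (intro conjI endo_inj_surj) auto

section \<open>Descent lists, shifts and residue sums\<close>

definition children :: "(nat \<Rightarrow> bool) \<Rightarrow> nat \<Rightarrow> nat list \<Rightarrow> nat list" where
  "children P h ls = concat (map (\<lambda>i. filter P [i, i + h]) ls)"

lemma children_snoc: "children P h (ls @ [i]) = children P h ls @ filter P [i, i + h]"
  by (simp add: children_def)

lemma set_children: "set (children P h ls) = {c. P c \<and> (\<exists>i\<in>set ls. c = i \<or> c = i + h)}"
  by (auto simp: children_def split: if_splits)

lemma length_children_ge:
  "(\<And>i. i \<in> set ls \<Longrightarrow> P i \<or> P (i + h)) \<Longrightarrow> length ls \<le> length (children P h ls)"
proof (induction ls)
  case (Cons i ls)
  have "P i \<or> P (i + h)" "length ls \<le> length (children P h ls)" using Cons by auto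
  then show ?case by (auto simp: children_def)
qed simp

text \<open>Division by \<open>2 * h\<close> recovers the parent of either child, so different
  parents have different children.\<close>

lemma distinct_children:
  assumes "distinct ls" "\<And>i. i \<in> set ls \<Longrightarrow> 2 * h dvd i" "0 < h"
  shows "distinct (children P h ls)"
  using assms(1,2)
proof (induction ls)
  case (Cons i ls)
  have d: "2 * h dvd i" using Cons by simp
  have "c \<noteq> i \<and> c \<noteq> i + h" if "c \<in> set (children P h ls)" for c
  proof -
    obtain j where j: "j \<in> set ls" "c = j \<or> c = j + h" using \<open>c \<in> _\<close> by (auto simp: set_children)
    have dj: "2 * h dvd j" "j \<noteq> i" using Cons j by auto
    obtain p r where pr: "i = 2 * h * p" "j = 2 * h * r" using d dj by (auto elim!: dvdE)
    have pr2: "p \<noteq> r" using dj pr by auto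
    have "(i + a * h) div (2 * h) = p" "(j + a * h) div (2 * h) = r" if "a < 2" for a
    proof -
      have "a * h < 2 * h" using that assms(3) by simp
      then show "(i + a * h) div (2 * h) = p" "(j + a * h) div (2 * h) = r"
        using assms(3) unfolding pr by (simp_all add: div_mult_self3 add.commute)
    qed
    from this[of 0] this[of 1] have "i div (2 * h) = p" "(i + h) div (2 * h) = p"
      "j div (2 * h) = r" "(j + h) div (2 * h) = r" by simp_all
    then show ?thesis using j(2) pr2 by metis
  qed
  then have "set (filter P [i, i + h]) \<inter> set (children P h ls) = {}" by auto
  moreover have "distinct (filter P [i, i + h])" using assms(3) by simp
  moreover have "distinct (children P h ls)" using Cons by simp
  moreover have "children P h (i # ls) = filter P [i, i + h] @ children P h ls"
    by (simp add: children_def)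
  ultimately show ?case by (metis distinct_append)
qed (simp add: children_def)

definition shift :: "nat \<Rightarrow> nat \<Rightarrow> nat set \<Rightarrow> nat set" where
  "shift d X S = (\<lambda>s. (s + X) mod d) ` S"

text \<open>A shift modulo \<open>d\<close> gains as many elements as it loses, so per period the number of differences is
  twice the number of new elements.\<close>

lemma card_differences:
  assumes d: "0 < d" and S: "S \<subseteq> {..<d}" and W: "W \<le> 2 * d"
  shows "card {i. i < W \<and> (i mod d \<in> S) \<noteq> ((i + X) mod d \<in> S)} \<le> 4 * (card (S \<union> shift d X S) - card S)"
proof -
  \<comment> \<open>The preimage of \<open>S\<close> under the shift. The shift maps
    \<open>S - P\<close> onto the new elements, and \<open>P - S\<close> has the same size because
    \<open>P\<close> and \<open>S\<close> have.\<close>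
  define P where "P = {j. j < d \<and> (j + X) mod d \<in> S}"
  define new where "new = card (S \<union> shift d X S) - card S"
  let ?f = "\<lambda>j. (j + X) mod d"
  have finS: "finite S" using S finite_subset by blast
  have finP: "finite P" by (simp add: P_def)
  have inj: "inj_on ?f {..<d}" by (rule inj_on_add_mod)
  have surj: "?f ` {..<d} = {..<d}" using inj d by (intro endo_inj_surj) auto
  have "?f ` P = S"
  proof
    show "S \<subseteq> ?f ` P"
    proof
      fix s assume s: "s \<in> S"
      then have "s \<in> ?f ` {..<d}" using surj S by auto
      then show "s \<in> ?f ` P" using s by (auto simp: P_def)
    qed
  qed (auto simp: P_def)
  moreover have "inj_on ?f P" using inj by (rule inj_on_subset) (auto simp: P_def)
  ultimately have cPS: "card P = card S" by (metis card_image)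
  have cnew: "card (S - P) = new"
  proof -
    have "?f ` (S - P) = shift d X S - S"
      using S by (auto simp: P_def shift_def)
    moreover have "inj_on ?f (S - P)" using inj by (rule inj_on_subset) (use S in auto)
    ultimately have "card (S - P) = card (shift d X S - S)" by (metis card_image)
    moreover have "card (S \<union> shift d X S) = card S + card (shift d X S - S)"
      using finS by (subst card_Un_disjoint[symmetric]) (auto simp: shift_def)
    ultimately show ?thesis by (simp add: new_def)
  qed
  have "card (P - S) = card (S - P)"
    using cPS card_Diff_subset_Int[of P S] card_Diff_subset_Int[of S P] finS finP
    by (simp add: Int_commute)
  then have cD: "card ((S - P) \<union> (P - S)) \<le> 2 * new"
    using cnew card_Un_le[of "S - P" "P - S"] by simp
  let ?E = "{i. i < W \<and> (i mod d \<in> S) \<noteq> ((i + X) mod d \<in> S)}"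
  have "?E \<subseteq> (\<lambda>(b, j). b * d + j) ` ({..<2} \<times> ((S - P) \<union> (P - S)))"
  proof
    fix i assume i: "i \<in> ?E"
    have md: "i mod d < d" using d by simp
    have "(i mod d + X) mod d = (i + X) mod d" by (simp add: mod_simps)
    then have "i mod d \<in> (S - P) \<union> (P - S)" using i md by (auto simp: P_def)
    moreover have "i div d < 2" using i W d by (auto simp: div_less_iff_less_mult)
    moreover have "i = i div d * d + i mod d" by simp
    ultimately show "i \<in> (\<lambda>(b, j). b * d + j) ` ({..<2} \<times> ((S - P) \<union> (P - S)))"
      by (intro image_eqI[of _ _ "(i div d, i mod d)"]) auto
  qed
  then have "card ?E \<le> card ((\<lambda>(b, j). b * d + j) ` ({..<2::nat} \<times> ((S - P) \<union> (P - S))))"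
    using finS finP by (intro card_mono) auto
  also have "\<dots> \<le> card ({..<2::nat} \<times> ((S - P) \<union> (P - S)))"
    using finS finP by (intro card_image_le) auto
  also have "\<dots> \<le> 2 * (2 * new)" using cD by (simp add: card_cartesian_product)
  finally show ?thesis by (simp add: new_def)
qed

definition residue_sums :: "nat \<Rightarrow> nat multiset \<Rightarrow> nat set" where
  "residue_sums d M = (\<lambda>s. s mod d) ` subset_sums M"

lemma residue_sums_empty: "residue_sums d {#} = {0}" if "0 < d" for d
  using that by (auto simp: residue_sums_def subset_sums_def)

lemma residue_sums_less: "0 < d \<Longrightarrow> residue_sums d M \<subseteq> {..<d}"
  by (auto simp: residue_sums_def)

lemma subset_add_mset_iff: "Y \<subseteq># add_mset x M \<longleftrightarrow> Y \<subseteq># M \<or> (\<exists>Y'. Y' \<subseteq># M \<and> Y = add_mset x Y')"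
proof
  assume Y: "Y \<subseteq># add_mset x M"
  show "Y \<subseteq># M \<or> (\<exists>Y'. Y' \<subseteq># M \<and> Y = add_mset x Y')"
  proof (cases "x \<in># Y")
    case True
    then obtain Y' where "Y = add_mset x Y'" by (meson mset_add)
    then show ?thesis using Y by auto
  next
    case False
    have "count Y z \<le> count M z" for z
      using mset_subset_eq_count[OF Y, of z] False by (cases "z = x") (simp_all add: not_in_iff)
    then have "Y \<subseteq># M" by (simp add: subseteq_mset_def)
    then show ?thesis ..
  qed
qed (auto intro: subset_mset.order_trans[of _ M])

lemma residue_sums_add:
  "residue_sums d (add_mset x M) = residue_sums d M \<union> shift d x (residue_sums d M)"
proof -
  have "subset_sums (add_mset x M) = subset_sums M \<union> (\<lambda>s. s + x) ` subset_sums M"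
  proof (intro equalityI subsetI)
    fix s assume "s \<in> subset_sums (add_mset x M)"
    then obtain Y where s: "s = \<Sum>\<^sub># Y" and Y: "Y \<subseteq># add_mset x M" unfolding subset_sums_def by blast
    from Y consider "Y \<subseteq># M" | Y' where "Y' \<subseteq># M" "Y = add_mset x Y'"
      unfolding subset_add_mset_iff by blast
    then show "s \<in> subset_sums M \<union> (\<lambda>s. s + x) ` subset_sums M"
    proof cases
      case 1 then show ?thesis using s unfolding subset_sums_def by blast
    next
      case 2
      then have "s = \<Sum>\<^sub># Y' + x" using s by simp
      moreover have "\<Sum>\<^sub># Y' \<in> subset_sums M" using 2 unfolding subset_sums_def by blast
      ultimately show ?thesis by blast
    qed
  next
    fix s assume "s \<in> subset_sums M \<union> (\<lambda>s. s + x) ` subset_sums M"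
    then consider Y where "Y \<subseteq># M" "s = \<Sum>\<^sub># Y" | Y where "Y \<subseteq># M" "s = \<Sum>\<^sub># Y + x"
      unfolding subset_sums_def by blast
    then show "s \<in> subset_sums (add_mset x M)"
    proof cases
      case 1
      then have "Y \<subseteq># add_mset x M" unfolding subset_add_mset_iff by blast
      then show ?thesis using 1 unfolding subset_sums_def by blast
    next
      case 2
      then have "add_mset x Y \<subseteq># add_mset x M" "s = \<Sum>\<^sub># (add_mset x Y)" by simp_all
      then show ?thesis unfolding subset_sums_def by blast
    qed
  qed
  then show ?thesis
    unfolding residue_sums_def shift_def by (simp add: image_Un image_image mod_simps)
qed

lemma residue_sums_mod: "residue_sums d (image_mset (\<lambda>x. x mod d) M) = residue_sums d M"
  by (induction M) (simp_all add: residue_sums_add shift_def mod_simps)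

section \<open>Maintaining the names\<close>

text \<open>The characteristic string modulo \<open>d\<close> is repeated periodically up to
  position \<open>N2 = 2 * Nn\<close>, so that \<open>i + X\<close> needs no wrap-around for
  \<open>i\<close> and \<open>X\<close> below \<open>Nn\<close>. The power of two between
  \<open>d\<close> and \<open>2 * d\<close> makes all blocks complete and keeps the string shorter
  than four periods.\<close>

locale shift_tree = instance_ram w Z xs n + naming N2 Bn K
  for w Z xs n N2 Bn K +
  fixes d Nn :: nat
  assumes d1: "1 \<le> d" and dL: "d \<le> n div 1000" and Nn: "Nn = 2 ^ K" and dN: "d \<le> Nn" "Nn < 2 * d"
    and N2: "N2 = 2 * Nn" and Bn: "Bn = n ^ 4"
begin

lemma N2_le: "N2 \<le> n" "Nn < N2" "0 < N2" "N2 < 4 * d" "0 < Nn"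
proof -
  have "1000 * d \<le> n" using dL by linarith
  then show "N2 \<le> n" "N2 < 4 * d" using N2 dN d1 by linarith+
  show "0 < Nn" using dN d1 by linarith
  then show "Nn < N2" "0 < N2" using N2 by linarith+
qed

lemma K_le: "K \<le> n"
proof -
  have "K < 2 ^ K" by (rule less_exp)
  then show ?thesis using N2_le Nn by linarith
qed

lemma pow_le: "k \<le> K \<Longrightarrow> 2 ^ k \<le> Nn"
  unfolding Nn by (intro power_increasing) auto

lemma addr_bound: "k \<le> K + 1 \<Longrightarrow> i \<le> 2 * N2 \<Longrightarrow> k * N2 + i < Z"
proof (rule less_Z_quad)
  assume "k \<le> K + 1" "i \<le> 2 * N2"
  then have "k * N2 \<le> (n + 1) * n" using K_le N2_le by (intro mult_le_mono) auto
  moreover have "(n + 1) * n = n * n + n" by simp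
  ultimately show "k * N2 + i \<le> 4 * (n * n)" using \<open>i \<le> 2 * N2\<close> N2_le(1) n_le_cube(1) by linarith
qed

lemma addr_bound0: "k \<le> K + 1 \<Longrightarrow> k * N2 < Z"
  using addr_bound[of k 0] by simp

lemma name_bound: "x < Bn \<Longrightarrow> y < Bn \<Longrightarrow> x * Bn + y < Z" "x < Bn \<Longrightarrow> x * Bn < Z" "x \<le> Bn \<Longrightarrow> x < Z"
proof -
  have le: "n ^ 8 \<le> n ^ 9" using n_ge by (intro power_increasing) auto
  have sq: "Bn * Bn = n ^ 8" unfolding Bn by (simp flip: power_add)
  show 1: "x * Bn + y < Z" if "x < Bn" "y < Bn" for x y
  proof (rule less_Z)
    have "x * Bn + y < (x + 1) * Bn" using that by simp
    also have "\<dots> \<le> Bn * Bn" using that by (intro mult_le_mono1) simp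
    finally show "x * Bn + y \<le> n ^ 9" using sq le by linarith
  qed
  show "x * Bn < Z" if "x < Bn" for x using 1[of x 0] that by simp
  have "n ^ 4 \<le> n ^ 9" using n_ge by (intro power_increasing) auto
  then show "x \<le> Bn \<Longrightarrow> x < Z" unfolding Bn by (intro less_Z) linarith
qed

text \<open>Register use: 16 \<open>d\<close>, 17 \<open>Nn\<close>, 18 \<open>K\<close>, 19 \<open>N2\<close>, 20 last name given out, 21 \<open>Bn\<close>, 22 index of the
  current shift, 23 the shift itself, 24 level \<open>k\<close>, 25 \<open>2 ^ (k - 1)\<close>, 26 block position, 37 constantly 0.
  Arrays 6 and 7 hold the names of the blocks starting at positions congruent to 0 and to the shift;
  array 8 is the dictionary, array 9 the work list, array 5 the histogram of the residues.\<close>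

definition cell :: "nat \<Rightarrow> stm" where
  "cell q =
     Asg 27 (Arr q ((V 24 \<ominus> N 1) \<otimes> V 19 \<oplus> V 26) \<otimes> V 21
       \<oplus> Arr q ((V 24 \<ominus> N 1) \<otimes> V 19 \<oplus> (V 26 \<oplus> V 25))) ;;
     Asg 28 (Arr 8 (V 27)) ;;
     Ife (V 28) (Asg 27 (N 0)) (Asg 20 (V 20 \<oplus> N 1) ;; Asg 28 (V 20) ;; Sto 8 (V 27) (V 20)) ;;
     Sto q (V 24 \<otimes> V 19 \<oplus> V 26) (V 28)"

text \<open>Each new name costs at least one step, so \<open>v 20 + T\<close> never increases; the
  invariant \<open>v 20 + T < Bn\<close> thus keeps all names below \<open>Bn\<close> without
  counting them.\<close>

lemma cell:
  assumes q: "q = 6 \<or> q = 7" and v: "v 24 = k" "v 25 = 2 ^ (k - 1)" "v 26 = i" "v 19 = N2" "v 21 = Bn"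
    and k: "1 \<le> k" "k \<le> K" and i: "i + 2 ^ k \<le> N2"
    and dict: "dict_ok (a 8) (v 20)" and cells: "\<And>j. a q j \<le> v 20"
    and T: "v 20 + T < Bn" "R + 100 \<le> T"
    and post: "\<And>v' D' c T'. R \<le> T' \<Longrightarrow> v' 20 + T' < Bn \<Longrightarrow> v 20 \<le> v' 20 \<Longrightarrow>
      \<forall>r. r \<notin> {20, 27, 28} \<longrightarrow> v' r = v r \<Longrightarrow> dict_ok D' (v' 20) \<Longrightarrow> dict_ext (a 8) D' \<Longrightarrow>
      c \<noteq> 0 \<Longrightarrow> c \<le> v' 20 \<Longrightarrow>
      c = D' (a q ((k - 1) * N2 + i) * Bn + a q ((k - 1) * N2 + (i + 2 ^ (k - 1)))) \<Longrightarrow>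
      Q v' (a(8 := D', q := (a q)(k * N2 + i := c))) T'"
  shows "wp (cell q) Q v a T"
proof -
  have q': "q < 20" "q \<noteq> 8" using q by auto
  define h :: nat where "h = 2 ^ (k - 1)"
  have hl: "i < N2" "i + h < N2" using half_less[OF k(1) i] by (auto simp: h_def)
  define k1 where "k1 = k - 1"
  have k1: "k - Suc 0 = k1" by (simp add: k1_def)
  define x y m where "x = a q (k1 * N2 + i)" and "y = a q (k1 * N2 + (i + h))"
    and "m = x * Bn + y"
  have xy: "x < Bn" "y < Bn" "v 20 + 100 < Bn"
    using cells[of "k1 * N2 + i"] cells[of "k1 * N2 + (i + h)"] T unfolding x_def y_def
    by linarith+
  have bnd: "k1 * N2 < Z" "k1 * N2 + i < Z" "i + h < Z" "k1 * N2 + (i + h) < Z"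
    "x * Bn < Z" "m < Z" "k * N2 < Z" "k * N2 + i < Z" "Suc (v 20) < Z" "Suc 0 < Z" "0 < Z"
    using addr_bound[of k1 i] addr_bound[of k1 "i + h"] addr_bound[of 0 "i + h"]
      addr_bound0[of k1] addr_bound0[of k] addr_bound[of k i] k hl k1_def
      name_bound(1)[OF xy(1,2)] name_bound(2)[OF xy(1)] name_bound(3)[of "Suc (v 20)"] xy n_less_Z
    by (simp_all add: m_def)
  have v25: "v 25 = h" using v by (simp add: h_def)
  have T100: "100 \<le> T" using T by linarith
  show ?thesis
  proof (cases "a 8 m = 0")
    case False
    have fin: "Q (v(28 := a 8 m, 27 := 0)) (a(q := (a q)(k * N2 + i := a 8 m))) (T - t)"
      if "t \<le> 100" for t
    proof -
      have "Q (v(28 := a 8 m, 27 := 0)) (a(8 := a 8, q := (a q)(k * N2 + i := a 8 m))) (T - t)"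
      proof (rule post)
        show "R \<le> T - t" using T that by linarith
        show "a 8 m \<le> (v(28 := a 8 m, 27 := 0)) 20" using dict unfolding dict_ok_def by simp
        show "a 8 m = a 8 (a q ((k - 1) * N2 + i) * Bn + a q ((k - 1) * N2 + (i + 2 ^ (k - 1))))"
          by (simp only: m_def x_def y_def h_def k1_def)
      qed (use T dict False dict_ext_refl in auto)
      then show ?thesis by simp
    qed
    show ?thesis
      by (rule vc_sound) (use fin False T100 in \<open>simp add: cell_def v(1,3-5) v25 k1 bnd q' flip: x_def y_def m_def;
        intro conjI; linarith\<close>)
  next
    case True
    let ?v = "v(27 := m, 20 := Suc (v 20), 28 := Suc (v 20))"
    let ?D = "(a 8)(m := Suc (v 20))"
    \<comment> \<open>\<open>1 \<le> t\<close> pays for the increment of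
      \<open>v 20\<close>.\<close>
    have fin: "Q ?v (a(8 := ?D, q := (a q)(k * N2 + i := Suc (v 20)))) (T - t)"
      if "1 \<le> t" "t \<le> 100" for t
    proof (rule post)
      show "R \<le> T - t" "?v 20 + (T - t) < Bn" using T that by auto
      show "dict_ok ?D (?v 20)" using dict_insert(1)[OF dict True] by simp
      show "dict_ext (a 8) ?D" by (rule dict_insert(2)[OF dict True])
      show "Suc (v 20) = ?D (a q ((k - 1) * N2 + i) * Bn + a q ((k - 1) * N2 + (i + 2 ^ (k - 1))))"
        by (simp add: m_def x_def y_def h_def k1_def)
    qed auto
    have up: "v(27 := m, 28 := 0, 20 := Suc (v 20), 28 := Suc (v 20)) = ?v" by auto
    show ?thesis
      by (rule vc_sound) (use fin True T100 in \<open>simp add: cell_def v(1,3-5) v25 k1 bnd q' up flip: x_def y_def m_def;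
        intro conjI; linarith\<close>)
  qed
qed

definition rebuild_body :: "nat \<Rightarrow> stm" where
  "rebuild_body q = Blk (cell q) ;; Asg 26 (V 26 \<oplus> (V 25 \<oplus> V 25))"

definition rebuild :: "nat \<Rightarrow> nat \<Rightarrow> stm" where
  "rebuild q r = Asg 26 (V r) ;; Whl ((V 19 \<prec> V 26 \<oplus> (V 25 \<oplus> V 25)) \<doteq> N 0) (rebuild_body q)"

lemma pow_half: "1 \<le> k \<Longrightarrow> 2 ^ (k - 1) + 2 ^ (k - 1) = (2::nat) ^ k"
  by (simp add: power_eq_if)

lemma rebuild:
  assumes q: "q = 6 \<or> q = 7" and v: "v 24 = k" "v 25 = 2 ^ (k - 1)" "v r = \<rho>" "v 19 = N2" "v 21 = Bn"
    and r: "r < 50" "r \<notin> {20, 26, 27, 28}" and k: "1 \<le> k" "k \<le> K" and rho: "\<rho> < 2 ^ k"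
    and dict: "dict_ok (a 8) (v 20)" and cells: "\<And>j. a q j \<le> v 20"
    and T: "v 20 + T < Bn" "R + 150 * (N2 div 2 ^ k + 1) + 50 \<le> T"
    and post: "\<And>v' D' A' T'. R \<le> T' \<Longrightarrow> v' 20 + T' < Bn \<Longrightarrow> v 20 \<le> v' 20 \<Longrightarrow>
      \<forall>r. r \<notin> {20, 26, 27, 28} \<longrightarrow> v' r = v r \<Longrightarrow> dict_ok D' (v' 20) \<Longrightarrow> dict_ext (a 8) D' \<Longrightarrow>
      (\<And>j. A' j \<le> v' 20) \<Longrightarrow> lev_ok D' A' \<rho> k \<Longrightarrow>
      (\<And>k' i. k' \<noteq> k \<Longrightarrow> i < N2 \<Longrightarrow> A' (k' * N2 + i) = a q (k' * N2 + i)) \<Longrightarrow>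
      Q v' (a(8 := D', q := A')) T'"
  shows "wp (rebuild q r) Q v a T"
proof -
  have q': "q < 20" "q \<noteq> 8" using q by auto
  define P h :: nat where "P = 2 ^ k" and "h = 2 ^ (k - 1)"
  have P: "h + h = P" "0 < P" "P \<le> Nn"
    using pow_half[OF k(1)] pow_le[OF k(2)] by (auto simp: P_def h_def)
  define I where "I v' a' T' \<longleftrightarrow> (\<exists>D' A' s. v' 26 = \<rho> + s * P \<and> v' 26 \<le> N2 + P \<and> a' = a(8 := D', q := A') \<and>
    R + 150 * (N2 div P + 1 - s) + 30 \<le> T' \<and> s \<le> N2 div P + 1 \<and> v' 20 + T' < Bn \<and> v 20 \<le> v' 20 \<and>
    (\<forall>r. r \<notin> {20, 26, 27, 28} \<longrightarrow> v' r = v r) \<and> dict_ok D' (v' 20) \<and> dict_ext (a 8) D' \<and>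
    (\<forall>j. A' j \<le> v' 20) \<and>
    (\<forall>i. i mod P = \<rho> \<longrightarrow> i < v' 26 \<longrightarrow> i + P \<le> N2 \<longrightarrow> okc D' A' k i) \<and>
    (\<forall>k' i. k' \<noteq> k \<longrightarrow> i < N2 \<longrightarrow> A' (k' * N2 + i) = a q (k' * N2 + i)))" for v' a' T'
  let ?e = "(V 19 \<prec> V 26 \<oplus> (V 25 \<oplus> V 25)) \<doteq> N 0"
  have Z1: "Suc 0 < Z" "0 < Z" using n_less_Z by simp_all
  have loop: "wp (Whl ?e (rebuild_body q)) Q (v(26 := \<rho>)) a (T - t)" if "t \<le> 10" for t
  proof (rule wp_Whl[where I = I])
    show "I (v(26 := \<rho>)) a (T - t)" unfolding I_def
    proof (rule exI[of _ "a 8"], rule exI[of _ "a q"], rule exI[of _ 0], intro conjI)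
      show "\<forall>i. i mod P = \<rho> \<longrightarrow> i < (v(26 := \<rho>)) 26 \<longrightarrow> i + P \<le> N2 \<longrightarrow> okc (a 8) (a q) k i"
      proof (intro allI impI)
        fix i assume "i mod P = \<rho>" "i < (v(26 := \<rho>)) 26"
        then show "okc (a 8) (a q) k i" using mod_less_eq_dividend[of i P] by simp
      qed
      show "R + 150 * (N2 div P + 1 - 0) + 30 \<le> T - t" using T(2)[folded P_def] \<open>t \<le> 10\<close> by simp
      show "(v(26 := \<rho>)) 26 \<le> N2 + P" using rho by (simp add: P_def)
    qed (use T dict cells dict_ext_refl in auto)
    fix v1 a1 T1 assume I: "I v1 a1 T1"
    then obtain D1 A1 s where v1: "v1 26 = \<rho> + s * P" "v1 26 \<le> N2 + P" and a1: "a1 = a(8 := D1, q := A1)"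
      and T1: "R + 150 * (N2 div P + 1 - s) + 30 \<le> T1" "v1 20 + T1 < Bn" and s: "s \<le> N2 div P + 1"
      and nx: "v 20 \<le> v1 20"
      and fr: "\<forall>r. r \<notin> {20, 26, 27, 28} \<longrightarrow> v1 r = v r" and dict1: "dict_ok D1 (v1 20)" "dict_ext (a 8) D1"
      and cells1: "\<forall>j. A1 j \<le> v1 20"
      and okcs: "\<forall>i. i mod P = \<rho> \<longrightarrow> i < v1 26 \<longrightarrow> i + P \<le> N2 \<longrightarrow> okc D1 A1 k i"
      and oth: "\<forall>k' i. k' \<noteq> k \<longrightarrow> i < N2 \<longrightarrow> A1 (k' * N2 + i) = a q (k' * N2 + i)"
      unfolding I_def by blast
    have v1c: "v1 24 = k" "v1 25 = h" "v1 19 = N2" "v1 21 = Bn" using fr v by (simp_all add: h_def)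
    define i where "i = v1 26"
    have b: "i + P < Z" "P < Z"
      using v1(2) P(3) N2_le(1,2) n_le_cube(1) unfolding i_def by (intro less_Z_quad; linarith)+
    show "eok v1 a1 ?e \<and> ecost ?e + 1 \<le> T1" using T1(1) b Z1 by (simp add: v1c P(1) flip: i_def)
    show "Q v1 a1 (T1 - (ecost ?e + 1))" if "ev v1 a1 ?e = 0"
    proof -
      have ge: "N2 < i + P" using that by (simp add: v1c P(1) flip: i_def split: if_splits)
      show ?thesis unfolding a1
      proof (rule post)
        show "R \<le> T1 - (ecost ?e + 1)" "v1 20 + (T1 - (ecost ?e + 1)) < Bn" using T1 by auto
        show "lev_ok D1 A1 \<rho> k" unfolding lev_ok_def
        proof (intro allI impI)
          fix j assume j: "j mod 2 ^ k = \<rho> mod 2 ^ k" "j + 2 ^ k \<le> N2"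
          then have "j < i" using ge by (simp add: P_def)
          then show "okc D1 A1 k j" using okcs j rho by (simp add: P_def i_def)
        qed
      qed (use fr dict1 cells1 oth nx in auto)
    qed
    show "wp (rebuild_body q) I v1 a1 (T1 - (ecost ?e + 1))" if "ev v1 a1 ?e \<noteq> 0"
    proof -
      have le: "i + P \<le> N2" using that by (simp add: v1c P(1) flip: i_def split: if_splits)
      have imod: "i mod P = \<rho>" using v1(1) rho by (simp add: i_def P_def)
      have "(s + 1) * P \<le> N2" using le v1(1) by (simp add: i_def)
      then have s1: "s + 1 \<le> N2 div P" using P(2) by (simp add: less_eq_div_iff_mult_less_eq)
      then have T1': "R + 150 * (N2 div P + 1 - (s + 1)) + 180 \<le> T1" using T1(1) by linarith
      have "wp (cell q) (vc (Asg 26 (V 26 \<oplus> (V 25 \<oplus> V 25))) I) v1 a1 (T1 - t)" if t: "t \<le> 20" for t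
      proof (rule cell[where k = k and i = i and R = "R + 150 * (N2 div P + 1 - (s + 1)) + 60"])
        show "R + 150 * (N2 div P + 1 - (s + 1)) + 60 + 100 \<le> T1 - t" using T1' t by linarith
        show "v1 20 + (T1 - t) < Bn" using T1(2) by linarith
        fix v2 D2 c T2 assume T2: "R + 150 * (N2 div P + 1 - (s + 1)) + 60 \<le> T2" "v2 20 + T2 < Bn"
          and nx2: "v1 20 \<le> v2 20" and fr2: "\<forall>r. r \<notin> {20, 27, 28} \<longrightarrow> v2 r = v1 r"
          and dict2: "dict_ok D2 (v2 20)" "dict_ext (a1 8) D2" and c: "c \<noteq> 0" "c \<le> v2 20"
            "c = D2 (a1 q ((k - 1) * N2 + i) * Bn + a1 q ((k - 1) * N2 + (i + 2 ^ (k - 1))))"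
        define A2 where "A2 = A1(k * N2 + i := c)"
        have a18: "a1 8 = D1" "a1 q = A1" using a1 q' by auto
        have a2: "a1(8 := D2, q := (a1 q)(k * N2 + i := c)) = a(8 := D2, q := A2)"
          using q' a1 by (auto simp: A2_def fun_eq_iff)
        have iN: "i < N2" "i + 2 ^ (k - 1) < N2"
          using half_less[OF k(1)] le by (auto simp: P_def)
        have A2o: "A2 (k' * N2 + j) = A1 (k' * N2 + j)" if "j < N2" "k' \<noteq> k \<or> j \<noteq> i" for k' j
          using cell_inj[OF that(1) iN(1), of k' k] that(2) by (auto simp: A2_def)
        have ext2: "dict_ext D1 D2" using dict2(2) a18 by simp
        have km: "k - 1 \<noteq> k" using k by linarith
        have ok2: "okc D2 A2 k j" if j: "j mod P = \<rho>" "j < i + P" "j + P \<le> N2" for j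
        proof (cases "j = i")
          case True
          have "A2 ((k - 1) * N2 + i) = A1 ((k - 1) * N2 + i)"
            "A2 ((k - 1) * N2 + (i + 2 ^ (k - 1))) = A1 ((k - 1) * N2 + (i + 2 ^ (k - 1)))"
            using A2o[OF iN(1), of "k - 1"] A2o[OF iN(2), of "k - 1"] km by blast+
          then show ?thesis using True c unfolding okc_def a18 by (simp add: A2_def)
        next
          case False
          have "j < i"
          proof (rule ccontr)
            assume "\<not> j < i"
            then have "i = j" using same_block_start[of i P j j] imod j P(2) by auto
            then show False using False by simp
          qed
          then have "okc D1 A1 k j" using okcs j by (simp add: i_def)
          then have "okc D2 A1 k j" using ext2 by (rule okc_ext)
          then show ?thesis
          proof (rule okc_cong)
            have jN: "j < N2" "j + 2 ^ (k - 1) < N2" using half_less[OF k(1)] j(3) by (auto simp: P_def)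
            show "A2 (k * N2 + j) = A1 (k * N2 + j)" using A2o[OF jN(1)] False by blast
            show "A2 ((k - 1) * N2 + j) = A1 ((k - 1) * N2 + j)"
              "A2 ((k - 1) * N2 + (j + 2 ^ (k - 1))) = A1 ((k - 1) * N2 + (j + 2 ^ (k - 1)))"
              using A2o[OF jN(1), of "k - 1"] A2o[OF jN(2), of "k - 1"] km by blast+
          qed
        qed
        have v2: "v2 26 = i" "v2 25 = h" using fr2 v1c by (simp_all add: i_def)
        have "I (v2(26 := i + P)) (a(8 := D2, q := A2)) (T2 - t)" if "t \<le> 20" for t
          unfolding I_def
        proof (rule exI[of _ D2], rule exI[of _ A2], rule exI[of _ "s + 1"], intro conjI)
          show "(v2(26 := i + P)) 26 = \<rho> + (s + 1) * P" using v1(1) by (simp add: i_def)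
          show "R + 150 * (N2 div P + 1 - (s + 1)) + 30 \<le> T2 - t" using T2 that by linarith
          show "\<forall>r. r \<notin> {20, 26, 27, 28} \<longrightarrow> (v2(26 := i + P)) r = v r" using fr fr2 by simp
          show "dict_ext (a 8) D2" using dict1(2) ext2 by (rule dict_ext_trans)
          show "\<forall>j. A2 j \<le> (v2(26 := i + P)) 20"
            using cells1 nx2 c(2) by (auto simp: A2_def intro: le_trans)
          show "\<forall>k' i. k' \<noteq> k \<longrightarrow> i < N2 \<longrightarrow> A2 (k' * N2 + i) = a q (k' * N2 + i)"
            using A2o oth by simp
        qed (use le s1 T2 nx nx2 dict2 ok2 in auto)
        then show "vc (Asg 26 (V 26 \<oplus> (V 25 \<oplus> V 25))) I v2 (a1(8 := D2, q := (a1 q)(k * N2 + i := c))) T2"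
          unfolding a2 using T2(1) b by (simp add: v2 P(1))
      qed (use q v1c k le dict1 cells1 a1 q' in \<open>auto simp: i_def P_def h_def\<close>)
      then show ?thesis by (intro vc_sound) (simp add: rebuild_body_def)
    qed
  qed
  have "50 \<le> T" using T by linarith
  then show ?thesis
    by (intro vc_sound) (use r in \<open>simp add: rebuild_def v loop\<close>)
qed

definition pathcell :: "nat \<Rightarrow> nat \<Rightarrow> stm" where
  "pathcell q r =
     Asg 30 ((V 29 \<oplus> (V 25 \<oplus> V 25) \<ominus> (V r \<odot> (V 25 \<oplus> V 25))) \<odot> (V 25 \<oplus> V 25)) ;;
     Ife ((V 29 \<prec> V 30) \<oplus> (V 19 \<prec> V 29 \<ominus> V 30 \<oplus> (V 25 \<oplus> V 25))) (Asg 27 (N 0))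
       (Asg 26 (V 29 \<ominus> V 30) ;; Blk (cell q))"

text \<open>\<open>s\<close> is \<open>(y - \<rho>) mod P\<close>, with \<open>P\<close> added so
  that the subtraction is not truncated: the distance from \<open>y\<close> back to the start of the
  only aligned block that can contain it.\<close>

lemma block_offset:
  fixes y P \<rho> :: nat
  assumes P: "0 < P"
  defines "s \<equiv> (y + P - \<rho> mod P) mod P"
  shows "s \<le> y \<Longrightarrow> (y - s) mod P = \<rho> mod P \<and> y - s \<le> y \<and> y < y - s + P"
    and "i mod P = \<rho> mod P \<Longrightarrow> i \<le> y \<Longrightarrow> y < i + P \<Longrightarrow> y = i + s"
proof -
  have rP: "\<rho> mod P < P" "s < P" using P by (simp_all add: s_def)
  have s: "(s + \<rho> mod P) mod P = y mod P"
  proof -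
    have "(s + \<rho> mod P) mod P = (y + P - \<rho> mod P + \<rho> mod P) mod P"
      unfolding s_def by (simp add: mod_simps)
    also have "y + P - \<rho> mod P + \<rho> mod P = y + P" using rP(1) by linarith
    finally show ?thesis by simp
  qed
  show "(y - s) mod P = \<rho> mod P \<and> y - s \<le> y \<and> y < y - s + P" if le: "s \<le> y"
  proof -
    have "((y - s) mod P + s) mod P = (\<rho> mod P + s) mod P"
      using s le by (simp add: mod_simps add.commute)
    then have "(y - s) mod P = \<rho> mod P"
      using add_mod_cancel_right[of "(y - s) mod P" P "\<rho> mod P" s] P by simp
    then show ?thesis using le rP by auto
  qed
  show "y = i + s" if i: "i mod P = \<rho> mod P" "i \<le> y" "y < i + P"
  proof -
    have "(s + i) mod P = (s + \<rho> mod P) mod P" using i(1) by (metis mod_add_right_eq mod_mod_trivial)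
    then have "(s + i) mod P = ((y - i) + i) mod P" using s i(2) by simp
    then have "s = y - i" using add_mod_cancel_right[of s P "y - i" i] rP i by auto
    then show ?thesis using i by simp
  qed
qed

lemma pathcell:
  assumes q: "q = 6 \<or> q = 7" and v: "v 24 = k" "v 25 = 2 ^ (k - 1)" "v r = \<rho>" "v 19 = N2" "v 21 = Bn" "v 29 = y"
    and r: "r < 50" and k: "1 \<le> k" "k \<le> K" and y: "y < N2"
    and dict: "dict_ok (a 8) (v 20)" and cells: "\<And>j. a q j \<le> v 20"
    and path: "path_ok (a 8) (a q) \<rho> y k"
    and T: "v 20 + T < Bn" "R + 180 \<le> T"
    and post: "\<And>v' D' A' T'. R \<le> T' \<Longrightarrow> v' 20 + T' < Bn \<Longrightarrow> v 20 \<le> v' 20 \<Longrightarrow>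
      \<forall>r. r \<notin> {20, 26, 27, 28, 30} \<longrightarrow> v' r = v r \<Longrightarrow> dict_ok D' (v' 20) \<Longrightarrow> dict_ext (a 8) D' \<Longrightarrow>
      (\<And>j. A' j \<le> v' 20) \<Longrightarrow> path_ok D' A' \<rho> y (Suc k) \<Longrightarrow>
      (\<And>i. i < N2 \<Longrightarrow> A' i = a q i) \<Longrightarrow> Q v' (a(8 := D', q := A')) T'"
  shows "wp (pathcell q r) Q v a T"
proof -
  have q': "q < 20" "q \<noteq> 8" using q by auto
  define P h :: nat where "P = 2 ^ k" and "h = 2 ^ (k - 1)"
  have P: "h + h = P" "0 < P" "P \<le> Nn"
    using pow_half[OF k(1)] pow_le[OF k(2)] by (auto simp: P_def h_def)
  define s where "s = (y + P - \<rho> mod P) mod P"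
  have sP: "s < P" using P by (simp add: s_def)
  have b: "P < Z" "y + P < Z" "y - s + P < Z" "0 < Z" "Suc (Suc 0) < Z" "Suc 0 < Z"
    using y P(3) N2_le(1,2) n_le_cube(1,3) by (intro less_Z_quad; linarith)+
  have T180: "180 \<le> T" using T by linarith
  have v25: "v 25 = h" using v(2) by (simp add: h_def)
  let ?v = "v(30 := s)"
  show ?thesis
  proof (cases "y < s \<or> N2 < y - s + P")
    case True
    have fin: "Q (v(30 := s, 27 := 0)) a (T - t)" if "t \<le> 100" for t
    proof -
      have "Q (v(30 := s, 27 := 0)) (a(8 := a 8, q := a q)) (T - t)"
      proof (rule post)
        show "path_ok (a 8) (a q) \<rho> y (Suc k)"
        proof (rule path_skip[OF path])
          fix i assume i: "i mod 2 ^ k = \<rho> mod 2 ^ k" "i + 2 ^ k \<le> N2" "i \<le> y"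
          show "\<not> y < i + 2 ^ k"
          proof
            assume "y < i + 2 ^ k"
            then have "y < i + P" by (simp add: P_def)
            moreover have "i mod P = \<rho> mod P" using i(1) by (simp add: P_def)
            ultimately have "y = i + s" using block_offset(2)[OF P(2), of i \<rho> y] i(3) by (simp add: s_def)
            then show False using True i(2) unfolding P_def by linarith
          qed
        qed
      qed (use T that dict cells dict_ext_refl in auto)
      then show ?thesis by simp
    qed
    have cond: "of_bool (y < s) + of_bool (N2 < y - s + P) \<noteq> (0::nat)" using True by auto
    show ?thesis
      by (rule vc_sound) (use fin T180 True in
        \<open>simp add: pathcell_def v(1,3-6) v25 r b P(1) flip: s_def; intro conjI impI; linarith\<close>)
  next
    case False
    define i where "i = y - s"
    have i: "i mod P = \<rho> mod P" "i \<le> y" "y < i + P" "i + P \<le> N2"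
      using block_offset(1)[OF P(2), of y \<rho>] False unfolding s_def[symmetric] by (auto simp: i_def)
    have cl: "wp (cell q) Q (v(30 := s, 26 := i)) a (T - t)" if "t \<le> 70" for t
    proof (rule cell[where k = k and i = i and R = R])
      show "R + 100 \<le> T - t" "(v(30 := s, 26 := i)) 20 + (T - t) < Bn" using T that by auto
      fix v2 D2 c T2 assume T2: "R \<le> T2" "v2 20 + T2 < Bn" and nx: "(v(30 := s, 26 := i)) 20 \<le> v2 20"
        and fr: "\<forall>r. r \<notin> {20, 27, 28} \<longrightarrow> v2 r = (v(30 := s, 26 := i)) r"
        and D2: "dict_ok D2 (v2 20)" "dict_ext (a 8) D2" and c: "c \<noteq> 0" "c \<le> v2 20"
          "c = D2 (a q ((k - 1) * N2 + i) * Bn + a q ((k - 1) * N2 + (i + 2 ^ (k - 1))))"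
      show "Q v2 (a(8 := D2, q := (a q)(k * N2 + i := c))) T2"
      proof (rule post)
        show "path_ok D2 ((a q)(k * N2 + i := c)) \<rho> y (Suc k)"
          using i by (intro path_step[OF path D2(2) k _ _ _ _ c(1,3)]) (auto simp: P_def)
        show "((a q)(k * N2 + i := c)) j \<le> v2 20" for j
          using cells[of j] nx c(2) by auto
        have "N2 \<le> k * N2 + i" using k(1) by (cases k) auto
        then show "((a q)(k * N2 + i := c)) j = a q j" if "j < N2" for j using that by auto
      qed (use T2 nx fr D2 in auto)
    qed (use q v k i dict cells in \<open>auto simp: P_def\<close>)
    have nb: "\<not> y < s" "\<not> N2 < i + P" "i + P < Z" using False b by (auto simp: i_def)
    show ?thesis
      by (rule vc_sound) (use cl T180 in
        \<open>simp add: pathcell_def v(1,3-6) v25 r b nb P(1) flip: s_def i_def; intro conjI; linarith\<close>)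
  qed
qed


section \<open>Changing one position of the string\<close>

definition consts_ok :: "vars \<Rightarrow> bool" where
  "consts_ok v \<longleftrightarrow> v 16 = d \<and> v 17 = Nn \<and> v 18 = K \<and> v 19 = N2 \<and> v 21 = Bn \<and> v 37 = 0"

text \<open>On level 0 the name 1 means absent and 2 means present. As 0 marks missing entries and
  the dictionary must not reuse 1 and 2, the counter satisfies \<open>2 \<le> v 20\<close>.\<close>

definition trees_ok :: "nat \<Rightarrow> (nat \<Rightarrow> bool) \<Rightarrow> vars \<Rightarrow> arrs \<Rightarrow> bool" where
  "trees_ok X str v a \<longleftrightarrow> consts_ok v \<and> v 23 = X \<and> 2 \<le> v 20 \<and> dict_ok (a 8) (v 20) \<and>
     (\<forall>j. a 6 j \<le> v 20) \<and> (\<forall>j. a 7 j \<le> v 20) \<and> tree_ok (a 8) (a 6) 0 \<and> tree_ok (a 8) (a 7) X \<and>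
     (\<forall>y<N2. a 6 y = 1 + of_bool (str y) \<and> a 7 y = 1 + of_bool (str y))"

definition path_body :: stm where
  "path_body = Blk (pathcell 6 37) ;; Blk (pathcell 7 23) ;;
     Asg 24 (V 24 \<oplus> N 1) ;; Asg 25 (V 25 \<oplus> V 25)"

definition point_update :: stm where
  "point_update = Sto 6 (V 29) (N 2) ;; Sto 7 (V 29) (N 2) ;; Asg 24 (N 1) ;; Asg 25 (N 1) ;;
     Whl ((V 18 \<prec> V 24) \<doteq> N 0) path_body"

definition path_inv :: "nat \<Rightarrow> nat \<Rightarrow> (nat \<Rightarrow> bool) \<Rightarrow> vars \<Rightarrow> arrs \<Rightarrow> nat \<Rightarrow> assn" where
  "path_inv X y str v0 a0 R v a T \<longleftrightarrow> (\<forall>r. r \<notin> {20, 24, 25, 26, 27, 28, 30} \<longrightarrow> v r = v0 r) \<and>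
     (\<forall>q. q \<notin> {6, 7, 8} \<longrightarrow> a q = a0 q) \<and> 1 \<le> v 24 \<and> v 24 \<le> K + 1 \<and> v 25 = 2 ^ (v 24 - 1) \<and>
     2 \<le> v 20 \<and> dict_ok (a 8) (v 20) \<and> (\<forall>j. a 6 j \<le> v 20) \<and> (\<forall>j. a 7 j \<le> v 20) \<and>
     path_ok (a 8) (a 6) 0 y (v 24) \<and> path_ok (a 8) (a 7) X y (v 24) \<and>
     (\<forall>z<N2. a 6 z = 1 + of_bool (str z) \<and> a 7 z = 1 + of_bool (str z)) \<and>
     v 20 + T < Bn \<and> R + 420 * (K + 1 - v 24) + 20 \<le> T"

lemma path_body:
  assumes I: "path_inv X y str v0 a0 R v a T" and lt: "v 24 \<le> K"
    and c: "consts_ok v0" "v0 23 = X" "v0 29 = y" "y < N2" and t: "t \<le> 10"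
  shows "wp path_body (path_inv X y str v0 a0 R) v a (T - t)"
proof -
  define k where "k = v 24"
  have fr: "\<forall>r. r \<notin> {20, 24, 25, 26, 27, 28, 30} \<longrightarrow> v r = v0 r" and fa: "\<forall>q. q \<notin> {6, 7, 8} \<longrightarrow> a q = a0 q"
    and k: "1 \<le> k" "v 25 = 2 ^ (k - 1)" and nx: "2 \<le> v 20" and dict: "dict_ok (a 8) (v 20)"
    and cells: "\<And>j. a 6 j \<le> v 20" "\<And>j. a 7 j \<le> v 20"
    and path: "path_ok (a 8) (a 6) 0 y k" "path_ok (a 8) (a 7) X y k"
    and str: "\<forall>z<N2. a 6 z = 1 + of_bool (str z) \<and> a 7 z = 1 + of_bool (str z)"
    and T: "v 20 + T < Bn" "R + 420 * (K + 1 - k) + 20 \<le> T"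
    using I unfolding path_inv_def k_def by blast+
  have kK: "k \<le> K" using lt by (simp add: k_def)
  have T': "R + 420 * (K - k) + 440 \<le> T" using T(2) kK by linarith
  have vc0: "v 19 = N2" "v 21 = Bn" "v 37 = 0" "v 23 = X" "v 29 = y"
    using fr c unfolding consts_ok_def by simp_all
  let ?c2 = "Asg 24 (V 24 \<oplus> N 1) ;; Asg 25 (V 25 \<oplus> V 25)"
  let ?c1 = "Blk (pathcell 7 23) ;; ?c2"
  have "wp (pathcell 6 37) (vc ?c1 (path_inv X y str v0 a0 R)) v a (T - t)"
  proof (rule pathcell[where k = k and y = y and \<rho> = 0 and R = "R + 420 * (K - k) + 240"])
    show "R + 420 * (K - k) + 240 + 180 \<le> T - t" using T' t by linarith
    show "v 20 + (T - t) < Bn" using T(1) by linarith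
    fix v1 D1 A1 T1 assume T1: "R + 420 * (K - k) + 240 \<le> T1" "v1 20 + T1 < Bn" and nx1: "v 20 \<le> v1 20"
      and fr1: "\<forall>r. r \<notin> {20, 26, 27, 28, 30} \<longrightarrow> v1 r = v r" and dict1: "dict_ok D1 (v1 20)" "dict_ext (a 8) D1"
      and cells1: "\<And>j. A1 j \<le> v1 20" and path1: "path_ok D1 A1 0 y (Suc k)"
      and lev0: "\<And>i. i < N2 \<Longrightarrow> A1 i = a 6 i"
    let ?a1 = "a(8 := D1, 6 := A1)"
    have v1: "v1 24 = k" "v1 25 = 2 ^ (k - 1)" "v1 19 = N2" "v1 21 = Bn" "v1 23 = X" "v1 29 = y"
      using fr1 k vc0 by (simp_all add: k_def)
    have "wp (pathcell 7 23) (vc ?c2 (path_inv X y str v0 a0 R)) v1 ?a1 T1"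
    proof (rule pathcell[where k = k and y = y and \<rho> = X and R = "R + 420 * (K - k) + 60"])
      show "R + 420 * (K - k) + 60 + 180 \<le> T1" using T1 by linarith
      show "path_ok (?a1 8) (?a1 7) X y k" using path_ok_ext[OF path(2) dict1(2)] by simp
      show "?a1 7 j \<le> v1 20" for j using cells(2)[of j] nx1 by simp
      fix v2 D2 A2 T2 assume T2: "R + 420 * (K - k) + 60 \<le> T2" "v2 20 + T2 < Bn" and nx2: "v1 20 \<le> v2 20"
        and fr2: "\<forall>r. r \<notin> {20, 26, 27, 28, 30} \<longrightarrow> v2 r = v1 r"
        and dict2: "dict_ok D2 (v2 20)" "dict_ext (?a1 8) D2"
        and cells2: "\<And>j. A2 j \<le> v2 20" and path2: "path_ok D2 A2 X y (Suc k)"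
        and lev02: "\<And>i. i < N2 \<Longrightarrow> A2 i = ?a1 7 i"
      let ?a2 = "?a1(8 := D2, 7 := A2)"
      have a2: "?a2 8 = D2" "?a2 6 = A1" "?a2 7 = A2" by simp_all
      have v2: "v2 24 = k" "v2 25 = 2 ^ (k - 1)" using fr2 v1 by simp_all
      have ph: "2 ^ (k - 1) + 2 ^ (k - 1) = (2::nat) ^ k" using k by (simp add: power_eq_if)
      have "path_inv X y str v0 a0 R (v2(24 := Suc k, 25 := 2 ^ k)) ?a2 (T2 - t)" if "t \<le> 40" for t
        unfolding path_inv_def a2
      proof (intro conjI)
        show "\<forall>r. r \<notin> {20, 24, 25, 26, 27, 28, 30} \<longrightarrow> (v2(24 := Suc k, 25 := 2 ^ k)) r = v0 r"
          using fr fr1 fr2 by simp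
        show "\<forall>q. q \<notin> {6, 7, 8} \<longrightarrow> ?a2 q = a0 q" using fa by simp
        show "\<forall>j. A1 j \<le> (v2(24 := Suc k, 25 := 2 ^ k)) 20" using cells1 nx2 by (auto intro: le_trans)
        show "path_ok D2 A1 0 y ((v2(24 := Suc k, 25 := 2 ^ k)) 24)"
          using path_ok_ext[OF path1] dict2(2) by simp
        show "\<forall>z<N2. A1 z = 1 + of_bool (str z) \<and> A2 z = 1 + of_bool (str z)"
          using lev0 lev02 str by simp
        show "R + 420 * (K + 1 - (v2(24 := Suc k, 25 := 2 ^ k)) 24) + 20 \<le> T2 - t" using T2 that by simp
      qed (use kK nx nx1 nx2 dict2 cells2 path2 T2 in auto)
      moreover have "Suc k < Z" "Suc 0 < Z" "2 ^ k < Z"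
        using kK K_le pow_le[OF kK] N2_le by (auto intro!: n_less_Z)
      ultimately show "vc ?c2 (path_inv X y str v0 a0 R) v2 ?a2 T2"
        using T2(1) by (simp add: v2 ph[simplified])
    qed (use v1 k kK c dict1 T1 in auto)
    then show "vc ?c1 (path_inv X y str v0 a0 R) v1 ?a1 T1" by simp
  qed (use k kK vc0 c dict cells path in \<open>auto simp: k_def\<close>)
  then show ?thesis by (intro vc_sound) (simp add: path_body_def)
qed

text \<open>A position lies in at most one aligned block per level of each tree, so a single path of
  \<open>K\<close> cells per tree is repaired, bottom-up.\<close>

lemma point_update:
  assumes I: "trees_ok X str v a" and y: "v 29 = y" "y < N2"
    and T: "v 20 + T < Bn" "R + 420 * K + 100 \<le> T"
    and post: "\<And>v' a' T'. R \<le> T' \<Longrightarrow> v' 20 + T' < Bn \<Longrightarrow> trees_ok X (str(y := True)) v' a' \<Longrightarrow>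
      \<forall>r. r \<notin> {20, 24, 25, 26, 27, 28, 30} \<longrightarrow> v' r = v r \<Longrightarrow> \<forall>q. q \<notin> {6, 7, 8} \<longrightarrow> a' q = a q \<Longrightarrow> Q v' a' T'"
  shows "wp point_update Q v a T"
proof -
  have c: "consts_ok v" "v 23 = X" and nx: "2 \<le> v 20" and dict: "dict_ok (a 8) (v 20)"
    and cells: "\<And>j. a 6 j \<le> v 20" "\<And>j. a 7 j \<le> v 20"
    and tree: "tree_ok (a 8) (a 6) 0" "tree_ok (a 8) (a 7) X"
    and str: "\<forall>y<N2. a 6 y = 1 + of_bool (str y) \<and> a 7 y = 1 + of_bool (str y)"
    using I unfolding trees_ok_def by blast+
  let ?v = "v(24 := Suc 0, 25 := Suc 0)"
  let ?a = "a(6 := (a 6)(y := 2), 7 := (a 7)(y := 2))"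
  let ?I = "path_inv X y (str(y := True)) v a R"
  let ?e = "(V 18 \<prec> V 24) \<doteq> N 0"
  have Z1: "Suc 0 < Z" "0 < Z" "2 < Z" using n_less_Z by simp_all
  have loop: "wp (Whl ?e path_body) Q ?v ?a (T - t)" if "t \<le> 50" for t
  proof (rule wp_Whl[where I = ?I])
    show "?I ?v ?a (T - t)"
      unfolding path_inv_def
    proof (intro conjI)
      show "path_ok (?a 8) (?a 6) 0 y (?v 24)" "path_ok (?a 8) (?a 7) X y (?v 24)"
        using path_start[OF tree(1) y(2)] path_start[OF tree(2) y(2)] by simp_all
      show "R + 420 * (K + 1 - ?v 24) + 20 \<le> T - t" using T that by simp
    qed (use nx dict cells str T in auto)
    fix v' a' T' assume I: "?I v' a' T'"
    have fr: "\<forall>r. r \<notin> {20, 24, 25, 26, 27, 28, 30} \<longrightarrow> v' r = v r" and T': "v' 20 + T' < Bn"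
      "R + 420 * (K + 1 - v' 24) + 20 \<le> T'" and k: "1 \<le> v' 24" "v' 24 \<le> K + 1"
      using I unfolding path_inv_def by blast+
    have v18: "v' 18 = K" using fr c unfolding consts_ok_def by simp
    show "eok v' a' ?e \<and> ecost ?e + 1 \<le> T'" using T' Z1 by simp
    show "wp path_body ?I v' a' (T' - (ecost ?e + 1))" if "ev v' a' ?e \<noteq> 0"
    proof -
      have "v' 24 \<le> K" using that v18 by (simp split: if_splits)
      then show ?thesis by (rule path_body[OF I _ c y]) simp
    qed
    show "Q v' a' (T' - (ecost ?e + 1))" if "ev v' a' ?e = 0"
    proof (rule post)
      have "v' 24 = Suc K" using that v18 k by (simp split: if_splits)
      then have "tree_ok (a' 8) (a' 6) 0" "tree_ok (a' 8) (a' 7) X"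
        using I path_ok_tree unfolding path_inv_def by auto
      moreover have "consts_ok v'" "v' 23 = X" using fr c unfolding consts_ok_def by simp_all
      ultimately show "trees_ok X (str(y := True)) v' a'"
        using I unfolding trees_ok_def path_inv_def by blast
      show "R \<le> T' - (ecost ?e + 1)" "v' 20 + (T' - (ecost ?e + 1)) < Bn" using T' by auto
      show "\<forall>q. q \<notin> {6, 7, 8} \<longrightarrow> a' q = a q"
        using I unfolding path_inv_def by simp
    qed (use fr in auto)
  qed
  have "100 \<le> T" using T by linarith
  then show ?thesis
    by (intro vc_sound) (use Z1 in \<open>simp add: point_update_def y loop; intro conjI; linarith\<close>)
qed

definition insert_body :: stm where
  "insert_body = Blk point_update ;; Asg 29 (V 29 \<oplus> V 16)"

definition insert_res :: stm where
  "insert_res = Asg 29 (V 34) ;; Whl (V 29 \<prec> V 19) insert_body"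

abbreviation "in_res S y \<equiv> y mod d \<in> S"

lemma trees_ok_cong: "trees_ok X str v a \<Longrightarrow> (\<And>y. y < N2 \<Longrightarrow> str y = str' y) \<Longrightarrow> trees_ok X str' v a"
  unfolding trees_ok_def by simp

lemma trees_ok_vars:
  "trees_ok X str v a \<Longrightarrow> (\<And>r. r \<in> {16, 17, 18, 19, 20, 21, 23, 37} \<Longrightarrow> v' r = v r) \<Longrightarrow> trees_ok X str v' a"
  unfolding trees_ok_def consts_ok_def by simp

abbreviation "insert_time \<equiv> 5 * (420 * K + 150)"

text \<open>A residue occupies at most four positions of the periodic string, as
  \<open>N2 < 4 * d\<close>; the fifth share of \<open>insert_time\<close> covers the
  overhead.\<close>

lemma insert_res:
  assumes I: "trees_ok X (in_res S) v a" and u: "v 34 = u" "u < d"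
    and T: "v 20 + T < Bn" "R + insert_time \<le> T"
    and post: "\<And>v' a' T'. R \<le> T' \<Longrightarrow> v' 20 + T' < Bn \<Longrightarrow> trees_ok X (in_res (insert u S)) v' a' \<Longrightarrow>
      \<forall>r. r \<notin> {20, 24, 25, 26, 27, 28, 29, 30} \<longrightarrow> v' r = v r \<Longrightarrow> \<forall>q. q \<notin> {6, 7, 8} \<longrightarrow> a' q = a q \<Longrightarrow> Q v' a' T'"
  shows "wp insert_res Q v a T"
proof -
  define I where "I v' a' T' \<longleftrightarrow> (\<exists>j. v' 29 = u + j * d \<and> j \<le> 4 \<and>
    trees_ok X (\<lambda>y. in_res S y \<or> y mod d = u \<and> y < v' 29) v' a' \<and>
    (\<forall>r. r \<notin> {20, 24, 25, 26, 27, 28, 29, 30} \<longrightarrow> v' r = v r) \<and> (\<forall>q. q \<notin> {6, 7, 8} \<longrightarrow> a' q = a q) \<and>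
    v' 20 + T' < Bn \<and> R + (420 * K + 150) * (4 - j) + 20 \<le> T')" for v' a' T'
  have v: "v 19 = N2" "v 16 = d" using I unfolding trees_ok_def consts_ok_def by blast+
  let ?e = "V 29 \<prec> V 19"
  have loop: "wp (Whl ?e insert_body) Q (v(29 := u)) a (T - t)" if "t \<le> 50" for t
  proof (rule wp_Whl[where I = I])
    show "I (v(29 := u)) a (T - t)" unfolding I_def
    proof (rule exI[of _ 0], intro conjI)
      have "trees_ok X (in_res S) (v(29 := u)) a" using I by (rule trees_ok_vars) auto
      then show "trees_ok X (\<lambda>y. in_res S y \<or> y mod d = u \<and> y < (v(29 := u)) 29) (v(29 := u)) a"
      proof (rule trees_ok_cong)
        fix y
        have "\<not> (y mod d = u \<and> y < u)" using mod_less_eq_dividend[of y d] by linarith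
        then show "in_res S y = (in_res S y \<or> y mod d = u \<and> y < (v(29 := u)) 29)"
          unfolding fun_upd_same by blast
      qed
      show "R + (420 * K + 150) * (4 - 0) + 20 \<le> T - t" using T(2) that by simp
    qed (use T in auto)
    fix v1 a1 T1 assume "I v1 a1 T1"
    then obtain j where j: "v1 29 = u + j * d" "j \<le> 4"
      and tr: "trees_ok X (\<lambda>y. in_res S y \<or> y mod d = u \<and> y < v1 29) v1 a1"
      and fr: "\<forall>r. r \<notin> {20, 24, 25, 26, 27, 28, 29, 30} \<longrightarrow> v1 r = v r" and fa: "\<forall>q. q \<notin> {6, 7, 8} \<longrightarrow> a1 q = a q"
      and T1: "v1 20 + T1 < Bn" "R + (420 * K + 150) * (4 - j) + 20 \<le> T1" unfolding I_def by blast
    have v1: "v1 19 = N2" "v1 16 = d" using fr v by simp_all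
    show "eok v1 a1 ?e \<and> ecost ?e + 1 \<le> T1" using T1 by simp
    show "Q v1 a1 (T1 - (ecost ?e + 1))" if "ev v1 a1 ?e = 0"
    proof (rule post)
      have ge: "N2 \<le> v1 29" using that v1 by simp
      show "trees_ok X (in_res (insert u S)) v1 a1"
        by (rule trees_ok_cong[OF tr]) (use ge in auto)
      show "R \<le> T1 - (ecost ?e + 1)" "v1 20 + (T1 - (ecost ?e + 1)) < Bn" using T1 by auto
    qed (use fr fa in auto)
    show "wp insert_body I v1 a1 (T1 - (ecost ?e + 1))" if "ev v1 a1 ?e \<noteq> 0"
    proof -
      define y where "y = v1 29"
      have y: "y < N2" using that v1 by (simp add: y_def)
      have "j * d < 4 * d" using y j(1) N2_le(4) unfolding y_def by linarith
      then have j4: "j < 4" by simp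
      have "wp point_update (vc (Asg 29 (V 29 \<oplus> V 16)) I) v1 a1 (T1 - t)" if t: "t \<le> 10" for t
      proof (rule point_update[OF tr y_def[symmetric] y, where R = "R + (420 * K + 150) * (4 - Suc j) + 40"])
        have "4 - j = Suc (4 - Suc j)" using j4 by simp
        then have e: "(420 * K + 150) * (4 - j) = (420 * K + 150) * (4 - Suc j) + (420 * K + 150)" by simp
        show "R + (420 * K + 150) * (4 - Suc j) + 40 + 420 * K + 100 \<le> T1 - t"
          using T1(2) t unfolding e by linarith
        show "v1 20 + (T1 - t) < Bn" using T1(1) by linarith
        fix v2 a2 T2 assume T2: "R + (420 * K + 150) * (4 - Suc j) + 40 \<le> T2" "v2 20 + T2 < Bn"
          and tr2: "trees_ok X ((\<lambda>y. in_res S y \<or> y mod d = u \<and> y < v1 29)(y := True)) v2 a2"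
          and fr2: "\<forall>r. r \<notin> {20, 24, 25, 26, 27, 28, 30} \<longrightarrow> v2 r = v1 r"
          and fa2: "\<forall>q. q \<notin> {6, 7, 8} \<longrightarrow> a2 q = a1 q"
        have v2: "v2 29 = y" "v2 16 = d" using fr2 v1 by (simp_all add: y_def)
        have ymod: "y mod d = u" using j u by (simp add: y_def)
        have "I (v2(29 := y + d)) a2 (T2 - t)" if "t \<le> 20" for t
          unfolding I_def
        proof (rule exI[of _ "Suc j"], intro conjI)
          have "trees_ok X ((\<lambda>y. in_res S y \<or> y mod d = u \<and> y < v1 29)(y := True)) (v2(29 := y + d)) a2"
            using tr2 by (rule trees_ok_vars) auto
          then show "trees_ok X (\<lambda>z. in_res S z \<or> z mod d = u \<and> z < (v2(29 := y + d)) 29) (v2(29 := y + d)) a2"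
          proof (rule trees_ok_cong)
            fix z
            have "z = y" if "z mod d = u" "y \<le> z" "z < y + d"
              using same_block_start[of y d z z] that ymod d1 by auto
            then have "z = y \<or> z < y" if "z mod d = u" "z < y + d" using that by (meson not_le)
            then show "((\<lambda>y. in_res S y \<or> y mod d = u \<and> y < v1 29)(y := True)) z =
              (in_res S z \<or> z mod d = u \<and> z < (v2(29 := y + d)) 29)"
              using ymod d1 by (cases "z = y") (auto simp flip: y_def)
          qed
          show "R + (420 * K + 150) * (4 - Suc j) + 20 \<le> T2 - t" using T2(1) that by linarith
          show "(v2(29 := y + d)) 29 = u + Suc j * d" using j by (simp add: y_def)
        qed (use j4 fr fr2 fa fa2 T2 in auto)
        moreover have "y + d < Z" using y N2_le(1) dN(1) N2_le(2) n_le_cube(1)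
          by (intro less_Z_quad) linarith
        ultimately show "vc (Asg 29 (V 29 \<oplus> V 16)) I v2 a2 T2" using T2 by (simp add: v2)
      qed
      then show ?thesis by (intro vc_sound) (simp add: insert_body_def)
    qed
  qed
  have "100 \<le> insert_time" by simp
  then have "100 \<le> T" using T(2) by (meson le_trans trans_le_add2)
  then show ?thesis
    by (intro vc_sound) (simp add: insert_res_def u loop)
qed

end

section \<open>Adding a residue\<close>

definition differ :: "(nat \<Rightarrow> bool) \<Rightarrow> nat \<Rightarrow> nat \<Rightarrow> nat \<Rightarrow> bool" where
  "differ str X k i \<longleftrightarrow> (\<exists>z<2 ^ k. str (i + z) \<noteq> str (i + X + z))"

lemma differ_Suc: "differ str X (Suc k) i \<longleftrightarrow> differ str X k i \<or> differ str X k (i + 2 ^ k)"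
proof
  assume "differ str X (Suc k) i"
  then obtain z where z: "z < 2 ^ Suc k" "str (i + z) \<noteq> str (i + X + z)" unfolding differ_def by blast
  show "differ str X k i \<or> differ str X k (i + 2 ^ k)"
  proof (cases "z < 2 ^ k")
    case True then show ?thesis using z unfolding differ_def by blast
  next
    case False
    then have e: "z - 2 ^ k < 2 ^ k" "i + 2 ^ k + (z - 2 ^ k) = i + z"
      "i + 2 ^ k + X + (z - 2 ^ k) = i + X + z" using z(1) by auto
    have "str (i + 2 ^ k + (z - 2 ^ k)) \<noteq> str (i + 2 ^ k + X + (z - 2 ^ k))"
      unfolding e(2,3) by (fact z(2))
    then have "differ str X k (i + 2 ^ k)" unfolding differ_def using e(1) by blast
    then show ?thesis ..
  qed
next
  assume "differ str X k i \<or> differ str X k (i + 2 ^ k)"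
  then show "differ str X (Suc k) i"
  proof
    assume "differ str X k i"
    then obtain z where z: "z < 2 ^ k" "str (i + z) \<noteq> str (i + X + z)" unfolding differ_def by blast
    then show ?thesis unfolding differ_def by (intro exI[of _ z]) simp
  next
    assume "differ str X k (i + 2 ^ k)"
    then obtain z where z: "z < 2 ^ k" "str (i + 2 ^ k + z) \<noteq> str (i + 2 ^ k + X + z)"
      unfolding differ_def by blast
    then show ?thesis unfolding differ_def by (intro exI[of _ "2 ^ k + z"]) (simp add: ac_simps)
  qed
qed

context shift_tree
begin

fun levels :: "(nat \<Rightarrow> bool) \<Rightarrow> nat \<Rightarrow> nat \<Rightarrow> nat list" where
  "levels str X 0 = filter (differ str X K) [0]"
| "levels str X (Suc j) = children (differ str X (K - Suc j)) (2 ^ (K - Suc j)) (levels str X j)"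

lemma levels_set:
  assumes "j \<le> K"
  shows "distinct (levels str X j) \<and>
    set (levels str X j) = {i. i < Nn \<and> 2 ^ (K - j) dvd i \<and> differ str X (K - j) i}"
  using assms
proof (induction j)
  case 0
  have "i = 0" if "i < Nn" "2 ^ K dvd i" for i
    using that unfolding Nn by (metis dvd_imp_le linorder_not_less neq0_conv)
  then show ?case using N2_le(5) by auto
next
  case (Suc j)
  define k where "k = K - Suc j"
  define h :: nat where "h = 2 ^ k"
  have kj: "K - j = Suc k" using Suc.prems by (simp add: k_def)
  have h: "2 ^ Suc k = 2 * h" "0 < h" by (simp_all add: h_def)
  let ?ls = "levels str X j"
  have IH: "distinct ?ls" "set ?ls = {i. i < Nn \<and> 2 * h dvd i \<and> differ str X (Suc k) i}"
    using Suc kj h(1) by auto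
  have dvdN: "2 * h dvd Nn" unfolding Nn h(1)[symmetric] using kj by (intro le_imp_power_dvd) simp
  have lev: "levels str X (Suc j) = children (differ str X k) h ?ls" by (simp add: k_def h_def)
  have "distinct (levels str X (Suc j))" unfolding lev
    by (rule distinct_children) (use IH h in auto)
  moreover have "set (levels str X (Suc j)) = {c. c < Nn \<and> h dvd c \<and> differ str X k c}"
  proof (intro equalityI subsetI)
    fix c assume "c \<in> set (levels str X (Suc j))"
    then obtain i where c: "differ str X k c" and i: "i \<in> set ?ls" "c = i \<or> c = i + h"
      unfolding lev set_children by blast
    then have i2: "i < Nn" "2 * h dvd i" using IH by auto
    have "2 * h dvd Nn - i" using dvdN i2 by (simp add: dvd_diff_nat)
    then have "2 * h \<le> Nn - i" using i2 by (intro dvd_imp_le) auto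
    moreover have "h dvd i" using i2(2) by (rule dvd_mult_right)
    moreover have "c < Nn" using \<open>2 * h \<le> Nn - i\<close> i2(1) i(2) h(2) by linarith
    ultimately show "c \<in> {c. c < Nn \<and> h dvd c \<and> differ str X k c}" using c i(2) by auto
  next
    fix c assume c: "c \<in> {c. c < Nn \<and> h dvd c \<and> differ str X k c}"
    then obtain p where p: "c = h * p" by (auto elim: dvdE)
    define i where "i = 2 * h * (p div 2)"
    have ci: "c = i + h * (p mod 2)"
    proof -
      have "h * p = h * (2 * (p div 2) + p mod 2)" by simp
      also have "\<dots> = 2 * h * (p div 2) + h * (p mod 2)" by (simp only: distrib_left mult_ac)
      finally show ?thesis unfolding p i_def .
    qed
    have "p mod 2 = 0 \<or> p mod 2 = 1" by auto
    then have ch: "c = i \<or> c = i + h" using ci by auto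
    have "differ str X (Suc k) i"
      using c ch unfolding differ_Suc h_def by auto
    moreover have "2 * h dvd i" by (simp add: i_def)
    moreover have "i < Nn" using c ci by auto
    ultimately have "i \<in> set ?ls" using IH by simp
    then show "c \<in> set (levels str X (Suc j))" unfolding lev set_children using c ch by blast
  qed
  ultimately show ?case by (simp add: k_def h_def)
qed

text \<open>A differing block has a differing half, so the lists never shrink, and the last one, the
  list of differing positions, bounds the work on every level.\<close>

lemma levels_mono: "j \<le> j' \<Longrightarrow> j' \<le> K \<Longrightarrow> length (levels str X j) \<le> length (levels str X j')"
proof (induction j' rule: dec_induct)
  case (step m)
  have "differ str X (K - Suc m) i \<or> differ str X (K - Suc m) (i + 2 ^ (K - Suc m))"
    if "i \<in> set (levels str X m)" for i
  proof -
    have "K - m = Suc (K - Suc m)" using step by simp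
    then show ?thesis using that levels_set[of m str X] step differ_Suc by auto
  qed
  then have "length (levels str X m) \<le> length (levels str X (Suc m))"
    by (simp add: length_children_ge)
  then show ?case using step by simp
qed simp

lemma levels_length:
  assumes "j \<le> K"
  shows "length (levels str X j) \<le> Nn"
proof -
  have "length (levels str X j) = card (set (levels str X j))"
    using levels_set[OF assms, of str X] distinct_card[symmetric] by blast
  also have "\<dots> \<le> card {..<Nn}" using levels_set[OF assms, of str X] by (intro card_mono) auto
  finally show ?thesis by simp
qed

text \<open>A block at \<open>i\<close> is aligned with 0 and its shifted copy at
  \<open>i + X\<close> with \<open>X\<close>; this is why two trees of names are kept.\<close>

lemma trees_differ:
  assumes tr: "trees_ok X str v a" and nx: "v 20 < Bn" and X: "X < Nn"
    and k: "k \<le> K" and i: "i < Nn" "2 ^ k dvd i"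
  shows "a 6 (k * N2 + i) = a 7 (k * N2 + (i + X)) \<longleftrightarrow> \<not> differ str X k i"
proof -
  have dict: "dict_ok (a 8) (v 20)" and cells: "\<And>j. a 6 j \<le> v 20" "\<And>j. a 7 j \<le> v 20"
    and tree: "tree_ok (a 8) (a 6) 0" "tree_ok (a 8) (a 7) X"
    and str: "\<And>y. y < N2 \<Longrightarrow> a 6 y = 1 + of_bool (str y)" "\<And>y. y < N2 \<Longrightarrow> a 7 y = 1 + of_bool (str y)"
    using tr unfolding trees_ok_def by blast+
  have "2 ^ k dvd Nn" unfolding Nn using k by (rule le_imp_power_dvd)
  then have "2 ^ k dvd Nn - i" using i by (simp add: dvd_diff_nat)
  then have le: "i + 2 ^ k \<le> Nn" using i(1) dvd_imp_le[of "2 ^ k" "Nn - i"] by linarith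
  have "a 6 (k * N2 + i) = a 7 (k * N2 + (i + X)) \<longleftrightarrow> (\<forall>z<2 ^ k. a 6 (i + z) = a 7 (i + X + z))"
  proof (rule names_eq_iff[OF dict nx tree(1) cells(1) tree(2) cells(2) _ _ _ _ k])
    show "i mod 2 ^ k = 0 mod 2 ^ k" using i by simp
    show "(i + X) mod 2 ^ k = X mod 2 ^ k" using i by (auto elim!: dvdE)
    show "i + 2 ^ k \<le> N2" "i + X + 2 ^ k \<le> N2" using le X N2 by linarith+
  qed
  also have "\<dots> \<longleftrightarrow> \<not> differ str X k i"
  proof -
    have "a 6 (i + z) = a 7 (i + X + z) \<longleftrightarrow> str (i + z) = str (i + X + z)" if "z < 2 ^ k" for z
      using str(1)[of "i + z"] str(2)[of "i + X + z"] that le X N2 by auto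
    then show ?thesis unfolding differ_def by blast
  qed
  finally show ?thesis .
qed

definition test :: "ex \<Rightarrow> stm" where
  "test e = Ife (Arr 6 (V 24 \<otimes> V 19 \<oplus> e) \<doteq> Arr 7 (V 24 \<otimes> V 19 \<oplus> (e \<oplus> V 23))) (Asg 27 (N 0))
     (Sto 9 (V 24 \<otimes> V 19 \<oplus> V 32) e ;; Asg 32 (V 32 \<oplus> N 1))"

text \<open>Each level has its own row of the array, so the list being read is not overwritten by
  the list being written.\<close>

definition stored :: "arrs \<Rightarrow> nat \<Rightarrow> nat list \<Rightarrow> bool" where
  "stored a k ls \<longleftrightarrow> (\<forall>j<length ls. a 9 (k * N2 + j) = ls ! j)"

lemma test:
  assumes tr: "trees_ok X str v a" "v 20 < Bn" "X < Nn" and k: "v 24 = k" "k \<le> K"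
    and e: "ev v a e = i" "eok v a e" "ecost e \<le> 5" and i: "i < Nn" "2 ^ k dvd i"
    and l: "v 32 = length ls" "length ls < N2" "stored a k ls" and T: "R + 80 \<le> T"
    and post: "\<And>v' a' T'. R \<le> T' \<Longrightarrow> \<forall>r. r \<notin> {27, 32} \<longrightarrow> v' r = v r \<Longrightarrow> \<forall>q. q \<noteq> 9 \<longrightarrow> a' q = a q \<Longrightarrow>
      (\<And>k' j. k' \<noteq> k \<Longrightarrow> j < N2 \<Longrightarrow> a' 9 (k' * N2 + j) = a 9 (k' * N2 + j)) \<Longrightarrow>
      v' 32 = length (ls @ filter (differ str X k) [i]) \<Longrightarrow> stored a' k (ls @ filter (differ str X k) [i]) \<Longrightarrow>
      Q v' a' T'"
  shows "wp (test e) Q v a T"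
proof -
  have c: "v 19 = N2" "v 23 = X" using tr(1) unfolding trees_ok_def consts_ok_def by blast+
  have iff: "a 6 (k * N2 + i) = a 7 (k * N2 + (i + X)) \<longleftrightarrow> \<not> differ str X k i"
    by (rule trees_differ[OF tr k(2) i])
  have b: "k * N2 < Z" "k * N2 + i < Z" "k * N2 + (i + X) < Z" "i + X < Z" "k * N2 + length ls < Z"
    "Suc (length ls) < Z" "0 < Z" "Suc 0 < Z"
    using addr_bound[of k i] addr_bound[of k "i + X"] addr_bound0[of k] addr_bound[of 0 "i + X"]
      addr_bound[of k "length ls"] addr_bound[of 0 "Suc (length ls)"] k(2) i(1) tr(3) l(2) N2 N2_le(5) n_less_Z
    by simp_all
  have T80: "80 \<le> T" using T by linarith
  show ?thesis
  proof (cases "differ str X k i")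
    case False
    then have eq: "a 6 (k * N2 + i) = a 7 (k * N2 + (i + X))" using iff by simp
    have "Q (v(27 := 0)) a (T - t)" if "t \<le> 80" for t
      by (rule post) (use that T l False in auto)
    then show ?thesis
      by (intro vc_sound) (use T80 e(3) in \<open>simp add: test_def k(1) c e(1,2) b eq\<close>)
  next
    case True
    then have neq: "a 6 (k * N2 + i) \<noteq> a 7 (k * N2 + (i + X))" using iff by simp
    let ?a = "a(9 := (a 9)(k * N2 + length ls := i))"
    have "Q (v(32 := Suc (length ls))) ?a (T - t)" if "t \<le> 80" for t
    proof (rule post)
      show "?a 9 (k' * N2 + j) = a 9 (k' * N2 + j)" if "k' \<noteq> k" "j < N2" for k' j
        using cell_inj(1)[OF that(2) l(2), of k' k] that(1) by auto
      show "stored ?a k (ls @ filter (differ str X k) [i])"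
        using l(3) True unfolding stored_def by (auto simp: nth_append less_Suc_eq)
    qed (use that T True in auto)
    then show ?thesis
      by (intro vc_sound) (use T80 e(3) in \<open>simp add: test_def k(1) c e(1,2) b neq l(1); linarith\<close>)
  qed
qed

section \<open>Breadth-first descent to the differences\<close>

definition bfs_inner :: stm where
  "bfs_inner = Asg 26 (Arr 9 ((V 24 \<oplus> N 1) \<otimes> V 19 \<oplus> V 33)) ;; Blk (test (V 26)) ;;
     Blk (test (V 26 \<oplus> V 25)) ;; Asg 33 (V 33 \<oplus> N 1)"

definition bfs_level :: stm where
  "bfs_level = Asg 24 (V 24 \<ominus> N 1) ;; Asg 25 (V 25 \<oslash> N 2) ;; Asg 32 (N 0) ;; Asg 33 (N 0) ;;
     Whl (V 33 \<prec> V 31) bfs_inner ;; Asg 31 (V 32)"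

definition bfs :: stm where
  "bfs = Asg 24 (V 18) ;; Asg 25 (V 17) ;; Asg 32 (N 0) ;; Blk (test (N 0)) ;; Asg 31 (V 32) ;;
     Whl (V 24) bfs_level"

abbreviation "bfs_regs \<equiv> {24, 25, 26, 27, 31, 32, 33}"

lemma children_take_length: "length (children P h (take j ls)) \<le> length (children P h ls)"
proof -
  have "children P h ls = children P h (take j ls) @ children P h (drop j ls)"
    unfolding children_def by (metis append_take_drop_id concat_append map_append)
  then show ?thesis by simp
qed

definition bfs_inv ::
  "(nat \<Rightarrow> bool) \<Rightarrow> nat \<Rightarrow> nat \<Rightarrow> nat list \<Rightarrow> vars \<Rightarrow> arrs \<Rightarrow> nat \<Rightarrow> assn" where
  "bfs_inv str X k ls v0 a0 R v a T \<longleftrightarrow>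
    v 33 \<le> length ls \<and> v 24 = k \<and> v 25 = 2 ^ k \<and> v 31 = length ls \<and>
    (\<forall>r. r \<notin> bfs_regs \<longrightarrow> v r = v0 r) \<and> (\<forall>q. q \<noteq> 9 \<longrightarrow> a q = a0 q) \<and> stored a (Suc k) ls \<and>
    stored a k (children (differ str X k) (2 ^ k) (take (v 33) ls)) \<and>
    v 32 = length (children (differ str X k) (2 ^ k) (take (v 33) ls)) \<and>
    R + 220 * (length ls - v 33) + 20 \<le> T"

lemma bfs_inner:
  fixes ls :: "nat list" and k X :: nat and str :: "nat \<Rightarrow> bool"
  assumes tr: "trees_ok X str v0 a0" "v0 20 < Bn" "X < Nn" and k: "k < K"
    and ls: "length ls \<le> Nn" "length (children (differ str X k) (2 ^ k) ls) \<le> Nn"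
      "\<And>i. i \<in> set ls \<Longrightarrow> i + 2 * 2 ^ k \<le> Nn \<and> 2 ^ k dvd i"
    and inv: "bfs_inv str X k ls v0 a0 R v a T" and lt: "v 33 < length ls" and t: "t \<le> 10"
  shows "wp bfs_inner (bfs_inv str X k ls v0 a0 R) v a (T - t)"
proof -
  define cs where "cs j = children (differ str X k) (2 ^ k) (take j ls)" for j
  let ?I = "bfs_inv str X k ls v0 a0 R"
  define j where "j = v 33"
  define i where "i = ls ! j"
  define h :: nat where "h = 2 ^ k"
  have jl: "j < length ls" using lt by (simp add: j_def)
  have v: "v 24 = k" "v 25 = h" "v 31 = length ls" and fr: "\<forall>r. r \<notin> bfs_regs \<longrightarrow> v r = v0 r"
    and fa: "\<forall>q. q \<noteq> 9 \<longrightarrow> a q = a0 q" and st: "stored a (Suc k) ls" "stored a k (cs j)"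
    and v32: "v 32 = length (cs j)" and T: "R + 220 * (length ls - j) + 20 \<le> T"
    using inv unfolding bfs_inv_def j_def h_def cs_def by blast+
  have T': "R + 220 * (length ls - Suc j) + 240 \<le> T" using T jl by linarith
  have i: "i < Nn" "i + h < Nn" "h dvd i" "h dvd i + h"
  proof -
    have "i \<in> set ls" using jl by (simp add: i_def)
    then have "i + 2 * h \<le> Nn" "h dvd i" using ls(3) unfolding h_def by blast+
    moreover have "0 < h" by (simp add: h_def)
    ultimately show "i < Nn" "i + h < Nn" "h dvd i" "h dvd i + h" by auto
  qed
  have tr': "trees_ok X str v' a'" if "\<forall>r. r \<notin> bfs_regs \<longrightarrow> v' r = v0 r" "\<forall>q. q \<noteq> 9 \<longrightarrow> a' q = a0 q" for v' a'
  proof -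
    have "trees_ok X str v' a0" using tr(1) by (rule trees_ok_vars) (use that in auto)
    then show ?thesis using that(2) unfolding trees_ok_def by simp
  qed
  have csS: "cs (Suc j) = cs j @ filter (differ str X k) [i] @ filter (differ str X k) [i + h]"
    using jl by (simp add: cs_def take_Suc_conv_app_nth children_snoc i_def h_def)
  have csl: "length (cs j') \<le> Nn" for j'
    using children_take_length[of "differ str X k" "2 ^ k" j' ls] ls(2) by (simp add: cs_def)
  have NN: "Nn < N2" by (rule N2_le(2))
  let ?c3 = "Asg 33 (V 33 \<oplus> N 1)"
  let ?c2 = "Blk (test (V 26 \<oplus> V 25)) ;; ?c3"
  have a9: "a 9 (Suc k * N2 + j) = i" using st(1) jl unfolding stored_def i_def by blast
  have c19: "v 19 = N2" using tr(1) fr unfolding trees_ok_def consts_ok_def by simp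
  have "wp (test (V 26)) (vc ?c2 ?I) (v(26 := i)) a (T - t')" if t': "t' \<le> 40" for t'
  proof (rule test[where X = X and str = str and k = k and i = i and ls = "cs j"
        and R = "R + 220 * (length ls - Suc j) + 120"])
    show "trees_ok X str (v(26 := i)) a" by (rule tr') (use fr fa in auto)
    show "R + 220 * (length ls - Suc j) + 120 + 80 \<le> T - t'" using T' t' by linarith
    show "length (cs j) < N2" using csl[of j] NN by linarith
    fix v1 a1 T1 assume T1: "R + 220 * (length ls - Suc j) + 120 \<le> T1"
      and fr1: "\<forall>r. r \<notin> {27, 32} \<longrightarrow> v1 r = (v(26 := i)) r" and fa1: "\<forall>q. q \<noteq> 9 \<longrightarrow> a1 q = a q"
      and oth1: "\<And>k' j. k' \<noteq> k \<Longrightarrow> j < N2 \<Longrightarrow> a1 9 (k' * N2 + j) = a 9 (k' * N2 + j)"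
      and v321: "v1 32 = length (cs j @ filter (differ str X k) [i])"
      and st1: "stored a1 k (cs j @ filter (differ str X k) [i])"
    have "length (cs j @ filter (differ str X k) [i]) \<le> length (cs (Suc j))" by (simp add: csS)
    then have len1: "length (cs j @ filter (differ str X k) [i]) < N2" using csl[of "Suc j"] NN by linarith
    have v1: "v1 24 = k" "v1 25 = h" "v1 26 = i" "v1 33 = j" using fr1 v by (simp_all add: j_def)
    have "wp (test (V 26 \<oplus> V 25)) (vc ?c3 ?I) v1 a1 T1"
    proof (rule test[where X = X and str = str and k = k and i = "i + h"
          and ls = "cs j @ filter (differ str X k) [i]" and R = "R + 220 * (length ls - Suc j) + 40"])
      show "trees_ok X str v1 a1" by (rule tr') (use fr fa fr1 fa1 in auto)
      show "R + 220 * (length ls - Suc j) + 40 + 80 \<le> T1" using T1 by linarith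
      have "i + h < Z" using i N2_le by (intro n_less_Z) linarith
      then show "eok v1 a1 (V 26 \<oplus> V 25)" by (simp add: v1)
      fix v2 a2 T2 assume T2: "R + 220 * (length ls - Suc j) + 40 \<le> T2"
        and fr2: "\<forall>r. r \<notin> {27, 32} \<longrightarrow> v2 r = v1 r" and fa2: "\<forall>q. q \<noteq> 9 \<longrightarrow> a2 q = a1 q"
        and oth2: "\<And>k' j. k' \<noteq> k \<Longrightarrow> j < N2 \<Longrightarrow> a2 9 (k' * N2 + j) = a1 9 (k' * N2 + j)"
        and v322: "v2 32 = length ((cs j @ filter (differ str X k) [i]) @ filter (differ str X k) [i + h])"
        and st2: "stored a2 k ((cs j @ filter (differ str X k) [i]) @ filter (differ str X k) [i + h])"
      have v2: "v2 33 = j" "v2 24 = k" "v2 25 = h" "v2 31 = length ls" using fr2 fr1 v1 v by simp_all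
      have "?I (v2(33 := Suc j)) a2 (T2 - t)" if "t \<le> 20" for t
        unfolding bfs_inv_def cs_def[symmetric]
      proof (intro conjI)
        show "\<forall>r. r \<notin> bfs_regs \<longrightarrow> (v2(33 := Suc j)) r = v0 r" using fr fr1 fr2 by simp
        show "\<forall>q. q \<noteq> 9 \<longrightarrow> a2 q = a0 q" using fa fa1 fa2 by simp
        show "stored a2 (Suc k) ls"
          unfolding stored_def
        proof (intro allI impI)
          fix p assume p: "p < length ls"
          then have "p < N2" using ls(1) NN by linarith
          then have "a2 9 (Suc k * N2 + p) = a 9 (Suc k * N2 + p)" using oth1[of "Suc k"] oth2[of "Suc k"] by simp
          then show "a2 9 (Suc k * N2 + p) = ls ! p" using st(1) p unfolding stored_def by simp
        qed
        show "stored a2 k (cs ((v2(33 := Suc j)) 33))" using st2 by (simp add: csS)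
        show "(v2(33 := Suc j)) 32 = length (cs ((v2(33 := Suc j)) 33))" using v322 by (simp add: csS)
        show "R + 220 * (length ls - (v2(33 := Suc j)) 33) + 20 \<le> T2 - t" using T2 that by simp
      qed (use jl v2 in \<open>auto simp: h_def\<close>)
      moreover have "Suc j < Z" "Suc 0 < Z" using jl ls(1) N2_le by (auto intro!: n_less_Z)
      ultimately show "vc ?c3 ?I v2 a2 T2" using T2 by (simp add: v2)
    qed (use tr fr fr1 k v1 i v321 len1 st1 in \<open>auto simp: h_def\<close>)
    then show "vc ?c2 ?I v1 a1 T1" by simp
  qed (use tr fr k v i v32 st in \<open>auto simp: h_def\<close>)
  moreover have "Suc k * N2 < Z" "Suc k * N2 + j < Z" "Suc k < Z" "Suc 0 < Z"
    using addr_bound0[of "Suc k"] addr_bound[of "Suc k" j] k jl ls(1) NN K_le n_less_Z by simp_all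
  ultimately show ?thesis
    by (intro vc_sound) (use T' t in \<open>simp add: bfs_inner_def v c19 j_def[symmetric] a9 del: mult_Suc\<close>)
qed

lemma trees_frame:
  assumes "trees_ok X str v0 a0" "\<forall>r. r \<notin> bfs_regs \<union> {34} \<longrightarrow> v r = v0 r" "\<forall>q. q \<noteq> 9 \<longrightarrow> a q = a0 q"
  shows "trees_ok X str v a"
proof -
  have "trees_ok X str v a0" using assms(1) by (rule trees_ok_vars) (use assms(2) in auto)
  then show ?thesis using assms(3) unfolding trees_ok_def by simp
qed

definition bfs_outer ::
  "(nat \<Rightarrow> bool) \<Rightarrow> nat \<Rightarrow> vars \<Rightarrow> arrs \<Rightarrow> nat \<Rightarrow> assn" where
  "bfs_outer str X v0 a0 R v a T \<longleftrightarrow> v 24 \<le> K \<and> v 25 = 2 ^ v 24 \<and>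
     v 31 = length (levels str X (K - v 24)) \<and> stored a (v 24) (levels str X (K - v 24)) \<and>
     (\<forall>r. r \<notin> bfs_regs \<longrightarrow> v r = v0 r) \<and> (\<forall>q. q \<noteq> 9 \<longrightarrow> a q = a0 q) \<and>
     R + v 24 * (220 * length (levels str X K) + 100) + 20 \<le> T"

lemma bfs_level:
  assumes tr: "trees_ok X str v0 a0" "v0 20 < Bn" "X < Nn"
    and inv: "bfs_outer str X v0 a0 R v a T" and nz: "v 24 \<noteq> 0" and t: "t \<le> 10"
  shows "wp bfs_level (bfs_outer str X v0 a0 R) v a (T - t)"
proof -
  obtain k where vk: "v 24 = Suc k" using nz by (cases "v 24") auto
  define ls where "ls = levels str X (K - Suc k)"
  define M0 where "M0 = length (levels str X K)"
  have k: "k < K" and v25: "v 25 = 2 ^ Suc k" and v31: "v 31 = length ls" and st: "stored a (Suc k) ls"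
    and fr: "\<forall>r. r \<notin> bfs_regs \<longrightarrow> v r = v0 r" and fa: "\<forall>q. q \<noteq> 9 \<longrightarrow> a q = a0 q"
    and T: "R + Suc k * (220 * M0 + 100) + 20 \<le> T"
    using inv vk unfolding bfs_outer_def ls_def M0_def by auto
  have lsM: "length ls \<le> M0" unfolding ls_def M0_def by (rule levels_mono) auto
  have nxt: "children (differ str X k) (2 ^ k) ls = levels str X (K - k)"
  proof -
    have "K - k = Suc (K - Suc k)" "K - Suc (K - Suc k) = k" using k by auto
    then show ?thesis unfolding ls_def by simp
  qed
  have lsN: "length ls \<le> Nn" "length (children (differ str X k) (2 ^ k) ls) \<le> Nn"
  proof -
    show "length ls \<le> Nn" unfolding ls_def by (rule levels_length) simp
    show "length (children (differ str X k) (2 ^ k) ls) \<le> Nn" unfolding nxt by (rule levels_length) simp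
  qed
  have lsi: "i + 2 * 2 ^ k \<le> Nn \<and> 2 ^ k dvd i" if "i \<in> set ls" for i
  proof -
    have "K - (K - Suc k) = Suc k" using k by simp
    then have i: "i < Nn" "2 ^ Suc k dvd i" using that levels_set[of "K - Suc k" str X] unfolding ls_def by auto
    have "2 ^ Suc k dvd Nn" unfolding Nn using k by (intro le_imp_power_dvd) simp
    then have "2 ^ Suc k dvd Nn - i" using i(2) by (rule dvd_diff_nat)
    then have "2 ^ Suc k \<le> Nn - i" using i(1) by (intro dvd_imp_le) auto
    moreover have "2 ^ k dvd i" using i(2) by (metis dvd_mult_right power_Suc)
    ultimately show ?thesis using i(1) by auto
  qed
  define R' where "R' = R + k * (220 * M0 + 100) + 40"
  have T': "R' + 220 * length ls + 80 \<le> T"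
    using T lsM unfolding R'_def by simp
  let ?v = "v(24 := k, 25 := 2 ^ k, 32 := 0, 33 := 0)"
  let ?e = "V 33 \<prec> V 31"
  have Z2: "2 < Z" "Suc 0 < Z" "0 < Z" using n_less_Z by simp_all
  have loop: "wp (Whl ?e bfs_inner) (vc (Asg 31 (V 32)) (bfs_outer str X v0 a0 R)) ?v a (T - t)"
    if t: "t \<le> 40" for t
  proof (rule wp_Whl[where I = "bfs_inv str X k ls v0 a0 R'"])
    show "bfs_inv str X k ls v0 a0 R' ?v a (T - t)"
      unfolding bfs_inv_def
    proof (intro conjI)
      show "R' + 220 * (length ls - ?v 33) + 20 \<le> T - t" using T' t by simp
    qed (use v31 fr fa st in \<open>auto simp: stored_def children_def\<close>)
    fix v1 a1 T1 assume I: "bfs_inv str X k ls v0 a0 R' v1 a1 T1"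
    have v1: "v1 33 \<le> length ls" "v1 31 = length ls" "v1 24 = k" "v1 25 = 2 ^ k"
      and T1: "R' + 220 * (length ls - v1 33) + 20 \<le> T1"
      using I unfolding bfs_inv_def by blast+
    show "eok v1 a1 ?e \<and> ecost ?e + 1 \<le> T1" using T1 by simp
    show "wp bfs_inner (bfs_inv str X k ls v0 a0 R') v1 a1 (T1 - (ecost ?e + 1))" if "ev v1 a1 ?e \<noteq> 0"
      by (rule bfs_inner[OF tr k lsN lsi I]) (use that v1 in \<open>auto split: if_splits\<close>)
    show "vc (Asg 31 (V 32)) (bfs_outer str X v0 a0 R) v1 a1 (T1 - (ecost ?e + 1))" if "ev v1 a1 ?e = 0"
    proof -
      have "v1 33 = length ls" using that v1 by (simp split: if_splits)
      then have fin: "stored a1 k (levels str X (K - k))" "v1 32 = length (levels str X (K - k))"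
        "\<forall>r. r \<notin> bfs_regs \<longrightarrow> v1 r = v0 r" "\<forall>q. q \<noteq> 9 \<longrightarrow> a1 q = a0 q"
        using I nxt unfolding bfs_inv_def by auto
      have "bfs_outer str X v0 a0 R (v1(31 := v1 32)) a1 (T1 - t)" if "t \<le> 30" for t
        unfolding bfs_outer_def M0_def[symmetric] using fin v1 k T1 that by (simp add: R'_def)
      then show ?thesis using T1 unfolding R'_def by simp
    qed
  qed
  have k1: "Suc k - 1 = k" "Suc k - Suc 0 = k" "(2::nat) ^ Suc k div 2 = 2 ^ k" by simp_all
  have T80: "80 \<le> T" using T' by linarith
  show ?thesis
    by (intro vc_sound) (use T80 t Z2 in \<open>simp add: bfs_level_def vk v25 k1 loop del: power_Suc; linarith\<close>)
qed

text \<open>Each of the \<open>K\<close> levels is charged the length of the final list, which makes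
  the descent logarithmic per difference found.\<close>

lemma bfs:
  assumes tr: "trees_ok X str v a" "v 20 < Bn" "X < Nn"
    and T: "R + K * (220 * length (levels str X K) + 100) + 200 \<le> T"
    and post: "\<And>v' a' T'. R \<le> T' \<Longrightarrow> \<forall>r. r \<notin> bfs_regs \<longrightarrow> v' r = v r \<Longrightarrow> \<forall>q. q \<noteq> 9 \<longrightarrow> a' q = a q \<Longrightarrow>
      v' 31 = length (levels str X K) \<Longrightarrow> stored a' 0 (levels str X K) \<Longrightarrow> Q v' a' T'"
  shows "wp bfs Q v a T"
proof -
  define C where "C = K * (220 * length (levels str X K) + 100)"
  have c: "v 17 = Nn" "v 18 = K" using tr(1) unfolding trees_ok_def consts_ok_def by blast+
  let ?v = "v(24 := K, 25 := Nn, 32 := 0)"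
  let ?c = "Asg 31 (V 32) ;; Whl (V 24) bfs_level"
  have T200: "R + C + 200 \<le> T" using T by (simp add: C_def)
  have Z0: "0 < Z" "Suc 0 < Z" using n_less_Z by simp_all
  have "wp (test (N 0)) (vc ?c Q) ?v a (T - t)" if t: "t \<le> 40" for t
  proof (rule test[where X = X and str = str and k = K and i = 0 and ls = "[]" and R = "R + C + 60"])
    show "trees_ok X str ?v a" by (rule trees_frame[OF tr(1)]) auto
    show "R + C + 60 + 80 \<le> T - t" using T200 t by linarith
    fix v1 a1 T1 assume T1: "R + C + 60 \<le> T1"
      and fr1: "\<forall>r. r \<notin> {27, 32} \<longrightarrow> v1 r = ?v r" and fa1: "\<forall>q. q \<noteq> 9 \<longrightarrow> a1 q = a q"
      and v32: "v1 32 = length ([] @ filter (differ str X K) [0])"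
      and st: "stored a1 K ([] @ filter (differ str X K) [0])"
    have v1: "v1 24 = K" "v1 25 = Nn" using fr1 by simp_all
    have loop: "wp (Whl (V 24) bfs_level) Q (v1(31 := v1 32)) a1 (T1 - t)" if t: "t \<le> 20" for t
    proof (rule wp_Whl[where I = "bfs_outer str X v a R"])
      show "bfs_outer str X v a R (v1(31 := v1 32)) a1 (T1 - t)"
        unfolding bfs_outer_def
      proof (intro conjI)
        show "\<forall>r. r \<notin> bfs_regs \<longrightarrow> (v1(31 := v1 32)) r = v r" using fr1 by simp
        show "R + (v1(31 := v1 32)) 24 * (220 * length (levels str X K) + 100) + 20 \<le> T1 - t"
          using T1 t v1 by (simp add: C_def)
      qed (use v1 v32 st fa1 Nn in auto)
      fix v2 a2 T2 assume I: "bfs_outer str X v a R v2 a2 T2"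
      have T2: "R + v2 24 * (220 * length (levels str X K) + 100) + 20 \<le> T2"
        using I unfolding bfs_outer_def by blast
      show "eok v2 a2 (V 24) \<and> ecost (V 24) + 1 \<le> T2" using T2 by simp
      show "wp bfs_level (bfs_outer str X v a R) v2 a2 (T2 - (ecost (V 24) + 1))" if "ev v2 a2 (V 24) \<noteq> 0"
        by (rule bfs_level[OF tr I]) (use that in auto)
      show "Q v2 a2 (T2 - (ecost (V 24) + 1))" if "ev v2 a2 (V 24) = 0"
      proof (rule post)
        have v24: "v2 24 = 0" using that by simp
        show "v2 31 = length (levels str X K)" "stored a2 0 (levels str X K)"
          using I v24 unfolding bfs_outer_def by auto
        show "\<forall>r. r \<notin> bfs_regs \<longrightarrow> v2 r = v r" "\<forall>q. q \<noteq> 9 \<longrightarrow> a2 q = a q"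
          using I unfolding bfs_outer_def by blast+
        show "R \<le> T2 - (ecost (V 24) + 1)" using T2 by simp
      qed
    qed
    show "vc ?c Q v1 a1 T1" using T1 loop by simp
  qed (use tr N2_le(3,5) Z0 in \<open>auto simp: stored_def\<close>)
  then show ?thesis
    by (intro vc_sound) (use T200 Z0 in \<open>simp add: bfs_def c; linarith\<close>)
qed

section \<open>Inserting the new residues\<close>

definition drain_body :: stm where
  "drain_body = Asg 26 (Arr 9 (V 33)) ;; Asg 34 ((V 26 \<oplus> V 23) \<odot> V 16) ;;
     Ife ((Arr 6 (V 26) \<doteq> N 2) \<otimes> (Arr 6 (V 34) \<doteq> N 1)) (Blk insert_res) (Asg 27 (N 0)) ;;
     Asg 33 (V 33 \<oplus> N 1)"

definition process :: stm where
  "process = Blk bfs ;; Asg 33 (N 0) ;; Whl (V 33 \<prec> V 31) drain_body"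

abbreviation "process_regs \<equiv> {20, 24, 25, 26, 27, 28, 29, 30, 31, 32, 33, 34}"

text \<open>The list belongs to the old set \<open>S\<close>, whereas the trees follow the growing
  set \<open>S'\<close>. The budget reserves one insertion for each element of the target set that
  \<open>S'\<close> still lacks.\<close>

definition drain_inv ::
  "nat \<Rightarrow> nat set \<Rightarrow> nat list \<Rightarrow> vars \<Rightarrow> arrs \<Rightarrow> nat \<Rightarrow> assn" where
  "drain_inv X S ls v0 a0 R v a T \<longleftrightarrow> (\<exists>S'. S \<subseteq> S' \<and> S' \<subseteq> S \<union> shift d X S \<and>
     (\<forall>j<v 33. in_res S (ls ! j) \<longrightarrow> in_res S' (ls ! j + X)) \<and> v 33 \<le> length ls \<and> v 31 = length ls \<and>
     stored a 0 ls \<and> trees_ok X (in_res S') v a \<and> v 20 + T < Bn \<and>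
     (\<forall>r. r \<notin> process_regs \<longrightarrow> v r = v0 r) \<and> (\<forall>q. q \<notin> {6, 7, 8, 9} \<longrightarrow> a q = a0 q) \<and>
     R + 100 * (length ls - v 33) + insert_time * (card (S \<union> shift d X S) - card S') + 20 \<le> T)"

lemma drain_body:
  assumes S: "S \<subseteq> {..<d}" and X: "X < Nn" and len: "length ls \<le> Nn"
    and ls: "\<And>i. i \<in> set ls \<Longrightarrow> i < Nn \<and> in_res S i \<noteq> in_res S (i + X)"
    and inv: "drain_inv X S ls v0 a0 R v a T" and lt: "v 33 < length ls" and t: "t \<le> 10"
  shows "wp drain_body (drain_inv X S ls v0 a0 R) v a (T - t)"
proof -
  let ?I = "drain_inv X S ls v0 a0 R"
  define F where "F = S \<union> shift d X S"
  define IT where "IT = insert_time"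
  define j where "j = v 33"
  define i where "i = ls ! j"
  define u where "u = (i + X) mod d"
  obtain S' where S': "S \<subseteq> S'" "S' \<subseteq> F" and dn: "\<forall>j'<j. in_res S (ls ! j') \<longrightarrow> in_res S' (ls ! j' + X)"
    and v31: "v 31 = length ls" and st: "stored a 0 ls" and tr: "trees_ok X (in_res S') v a"
    and fr: "\<forall>r. r \<notin> process_regs \<longrightarrow> v r = v0 r" and fa: "\<forall>q. q \<notin> {6, 7, 8, 9} \<longrightarrow> a q = a0 q"
    and T: "v 20 + T < Bn" "R + 100 * (length ls - j) + IT * (card F - card S') + 20 \<le> T"
    using inv unfolding drain_inv_def F_def j_def IT_def by blast
  have jl: "j < length ls" using lt by (simp add: j_def)
  have i: "i < Nn" "in_res S i \<noteq> in_res S (i + X)" using ls[of i] jl by (auto simp: i_def)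
  have ud: "u < d" using d1 by (simp add: u_def)
  have finF: "finite F" using S finite_subset[of S "{..<d}"] by (auto simp: F_def shift_def)
  have T': "R + 100 * (length ls - Suc j) + IT * (card F - card S') + 120 \<le> T" using T(2) jl by linarith
  have c: "v 16 = d" "v 23 = X" using tr unfolding trees_ok_def consts_ok_def by blast+
  have v33: "v 33 = j" by (simp add: j_def)
  have a9: "a 9 j = i" using st jl unfolding stored_def i_def by simp
  have a6i: "a 6 i = 1 + of_bool (in_res S' i)"
    using tr i(1) N2_le(2) unfolding trees_ok_def by simp
  have "u < N2" using ud dN N2_le(2) by linarith
  then have a6u: "a 6 u = 1 + of_bool (u \<in> S')"
    using tr ud unfolding trees_ok_def by simp
  have b: "i + X < Z" "2 < Z" "Suc 0 < Z" "0 < Z" "Suc j < Z"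
    using i(1) X N2_le(1) N2 jl len by (intro n_less_Z; linarith)+
  show ?thesis
  proof (cases "in_res S' i \<and> u \<notin> S'")
    case True
    \<comment> \<open>A position outside \<open>S\<close> is on the list because its shift lies in
      \<open>S\<close>. So a residue that entered during the drain triggers no insertion, and
      nothing is shifted twice.\<close>
    have iS: "in_res S i"
    proof (rule ccontr)
      assume "\<not> in_res S i"
      then have "u \<in> S" using i(2) by (simp add: u_def)
      then show False using True S' by auto
    qed
    have uF: "u \<in> F"
    proof -
      have "u = (i mod d + X) mod d" by (simp add: u_def mod_simps)
      then show ?thesis using iS unfolding F_def shift_def by blast
    qed
    have cS: "card F - card S' = Suc (card F - card (insert u S'))"
    proof -
      have "finite S'" using finF S' by (meson finite_subset)
      then have "card (insert u S') = Suc (card S')" using True by simp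
      moreover have "card (insert u S') \<le> card F" using finF uF S' by (intro card_mono) auto
      ultimately show ?thesis by linarith
    qed
    have "wp insert_res (vc (Asg 33 (V 33 \<oplus> N 1)) ?I) (v(26 := i, 34 := u)) a (T - t')" if t': "t' \<le> 60" for t'
    proof (rule insert_res[where X = X and S = S' and u = u
          and R = "R + 100 * (length ls - Suc j) + IT * (card F - card (insert u S')) + 50"])
      show "trees_ok X (in_res S') (v(26 := i, 34 := u)) a" using tr by (rule trees_ok_vars) auto
      show "R + 100 * (length ls - Suc j) + IT * (card F - card (insert u S')) + 50 + insert_time \<le> T - t'"
        using T' t' unfolding cS IT_def by simp
      fix v1 a1 T1
      assume T1: "R + 100 * (length ls - Suc j) + IT * (card F - card (insert u S')) + 50 \<le> T1" "v1 20 + T1 < Bn"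
        and tr1: "trees_ok X (in_res (insert u S')) v1 a1"
        and fr1: "\<forall>r. r \<notin> {20, 24, 25, 26, 27, 28, 29, 30} \<longrightarrow> v1 r = (v(26 := i, 34 := u)) r"
        and fa1: "\<forall>q. q \<notin> {6, 7, 8} \<longrightarrow> a1 q = a q"
      have v1: "v1 33 = j" "v1 31 = length ls" using fr1 v31 v33 by simp_all
      have "?I (v1(33 := Suc j)) a1 (T1 - t)" if "t \<le> 20" for t
        unfolding drain_inv_def F_def[symmetric] IT_def[symmetric]
      proof (rule exI[of _ "insert u S'"], intro conjI)
        show "\<forall>j'<(v1(33 := Suc j)) 33. in_res S (ls ! j') \<longrightarrow> in_res (insert u S') (ls ! j' + X)"
          using dn by (auto simp: less_Suc_eq i_def u_def)
        show "stored a1 0 ls" using st fa1 unfolding stored_def by simp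
        show "trees_ok X (in_res (insert u S')) (v1(33 := Suc j)) a1" using tr1 by (rule trees_ok_vars) auto
        show "R + 100 * (length ls - (v1(33 := Suc j)) 33) + IT * (card F - card (insert u S')) + 20 \<le> T1 - t"
          using T1(1) that by simp
        show "\<forall>r. r \<notin> process_regs \<longrightarrow> (v1(33 := Suc j)) r = v0 r" using fr fr1 by simp
        show "\<forall>q. q \<notin> {6, 7, 8, 9} \<longrightarrow> a1 q = a0 q" using fa fa1 by simp
      qed (use S' uF jl v1 T1 in auto)
      then show "vc (Asg 33 (V 33 \<oplus> N 1)) ?I v1 a1 T1" using T1(1) b by (simp add: v1)
    qed (use ud T in auto)
    then show ?thesis
      by (intro vc_sound) (use T' t True in \<open>simp add: drain_body_def v33 c a9 u_def[symmetric] a6i a6u b;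
        intro conjI; linarith\<close>)
  next
    case False
    have "?I (v(26 := i, 34 := u, 27 := 0, 33 := Suc j)) a (T - t)" if "t \<le> 100" for t
      unfolding drain_inv_def F_def[symmetric] IT_def[symmetric]
    proof (rule exI[of _ S'], intro conjI)
      have "in_res S' (i + X)" if "in_res S i" using False that S' by (auto simp: u_def)
      then show "\<forall>j'<(v(26 := i, 34 := u, 27 := 0, 33 := Suc j)) 33. in_res S (ls ! j') \<longrightarrow> in_res S' (ls ! j' + X)"
        using dn by (auto simp: less_Suc_eq i_def)
      show "trees_ok X (in_res S') (v(26 := i, 34 := u, 27 := 0, 33 := Suc j)) a"
        using tr by (rule trees_ok_vars) auto
      show "R + 100 * (length ls - (v(26 := i, 34 := u, 27 := 0, 33 := Suc j)) 33) +
        IT * (card F - card S') + 20 \<le> T - t" using T' that by simp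
    qed (use S' jl v31 st T fr fa in auto)
    then show ?thesis
      by (intro vc_sound) (use T' t False in \<open>simp add: drain_body_def v33 c a9 u_def[symmetric] a6i a6u b;
        intro conjI impI; linarith\<close>)
  qed
qed


abbreviation "item_time \<equiv> 100 * K + 400"
text \<open>The list has at most four entries per new element: \<open>880 = 4 * 220\<close> for each
  level of the descent and \<open>400 = 4 * 100\<close> for the drain.\<close>

abbreviation "new_time \<equiv> 880 * K + 400 + insert_time"

lemma process:
  assumes tr: "trees_ok X (in_res S) v a" and S: "S \<subseteq> {..<d}" and X: "X < Nn"
    and T: "v 20 + T < Bn" "R + item_time + new_time * (card (S \<union> shift d X S) - card S) \<le> T"
    and post: "\<And>v' a' T'. R \<le> T' \<Longrightarrow> v' 20 + T' < Bn \<Longrightarrow> trees_ok X (in_res (S \<union> shift d X S)) v' a' \<Longrightarrow>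
      \<forall>r. r \<notin> process_regs \<longrightarrow> v' r = v r \<Longrightarrow> \<forall>q. q \<notin> {6, 7, 8, 9} \<longrightarrow> a' q = a q \<Longrightarrow> Q v' a' T'"
  shows "wp process Q v a T"
proof -
  define F where "F = S \<union> shift d X S"
  define new where "new = card F - card S"
  define IT where "IT = insert_time"
  define ls where "ls = levels (in_res S) X K"
  have set_ls: "set ls = {i. i < Nn \<and> in_res S i \<noteq> in_res S (i + X)}" "distinct ls"
    using levels_set[of K "in_res S" X] by (auto simp: ls_def differ_def)
  have len: "length ls \<le> Nn" unfolding ls_def by (rule levels_length) simp
  have M0: "length ls \<le> 4 * new"
  proof -
    have "length ls = card (set ls)" using set_ls(2) by (rule distinct_card[symmetric])
    also have "\<dots> \<le> 4 * new"
      unfolding set_ls(1) new_def F_def using d1 S dN(2) by (intro card_differences) auto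
    finally show ?thesis .
  qed
  let ?c = "Asg 33 (N 0) ;; Whl (V 33 \<prec> V 31) drain_body"
  have T': "R + 100 * length ls + IT * new + 100 + K * (220 * length ls + 100) + 200 \<le> T"
  proof -
    have "K * (220 * length ls) \<le> K * (220 * (4 * new))" using M0 by simp
    moreover have "new_time * new = 880 * (K * new) + 400 * new + IT * new"
      by (simp add: IT_def algebra_simps)
    moreover have "K * (220 * length ls + 100) = K * (220 * length ls) + 100 * K"
      "K * (220 * (4 * new)) = 880 * (K * new)" by (simp_all add: algebra_simps)
    moreover have "R + (100 * K + 400) + new_time * new \<le> T" using T(2) by (simp add: F_def new_def)
    ultimately show ?thesis using M0 by linarith
  qed
  have "wp bfs (vc ?c Q) v a T"
  proof (rule wp_fuel, rule bfs[OF tr _ X, where R = "R + 100 * length ls + IT * new + 100"])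
    show "v 20 < Bn" using T by linarith
    show "R + 100 * length ls + IT * new + 100 + K * (220 * length (levels (in_res S) X K) + 100) + 200 \<le> T"
      using T' by (simp add: ls_def)
    fix v1 a1 T1 assume T1: "R + 100 * length ls + IT * new + 100 \<le> T1"
      and fr1: "\<forall>r. r \<notin> bfs_regs \<longrightarrow> v1 r = v r" and fa1: "\<forall>q. q \<noteq> 9 \<longrightarrow> a1 q = a q"
      and v31: "v1 31 = length (levels (in_res S) X K)" and st: "stored a1 0 (levels (in_res S) X K)"
    show "T1 \<le> T \<longrightarrow> vc ?c Q v1 a1 T1"
    proof
      assume T1T: "T1 \<le> T"
      have tr1: "trees_ok X (in_res S) v1 a1" by (rule trees_frame[OF tr]) (use fr1 fa1 in auto)
      have v20: "v1 20 = v 20" using fr1 by simp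
      let ?I = "drain_inv X S ls v a R"
      let ?e = "V 33 \<prec> V 31"
      have loop: "wp (Whl ?e drain_body) Q (v1(33 := 0)) a1 (T1 - t)" if t: "t \<le> 20" for t
      proof (rule wp_Whl[where I = ?I])
        show "?I (v1(33 := 0)) a1 (T1 - t)"
          unfolding drain_inv_def F_def[symmetric] IT_def[symmetric]
        proof (rule exI[of _ S], intro conjI)
          show "trees_ok X (in_res S) (v1(33 := 0)) a1" using tr1 by (rule trees_ok_vars) auto
          show "(v1(33 := 0)) 20 + (T1 - t) < Bn" using T(1) T1T v20 by simp
          show "R + 100 * (length ls - (v1(33 := 0)) 33) + IT * (card F - card S) + 20 \<le> T1 - t"
            using T1 t by (simp add: new_def)
          show "\<forall>r. r \<notin> process_regs \<longrightarrow> (v1(33 := 0)) r = v r" using fr1 by simp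
        qed (use v31 st fa1 in \<open>auto simp: F_def ls_def\<close>)
        fix v2 a2 T2 assume I: "?I v2 a2 T2"
        then obtain S' where S': "S \<subseteq> S'" "S' \<subseteq> F"
          and dn: "\<forall>j<v2 33. in_res S (ls ! j) \<longrightarrow> in_res S' (ls ! j + X)"
          and v2: "v2 33 \<le> length ls" "v2 31 = length ls" and tr2: "trees_ok X (in_res S') v2 a2"
          and fr2: "\<forall>r. r \<notin> process_regs \<longrightarrow> v2 r = v r" and fa2: "\<forall>q. q \<notin> {6, 7, 8, 9} \<longrightarrow> a2 q = a q"
          and T2: "v2 20 + T2 < Bn" "R + 100 * (length ls - v2 33) + IT * (card F - card S') + 20 \<le> T2"
          unfolding drain_inv_def F_def IT_def by blast
        show "eok v2 a2 ?e \<and> ecost ?e + 1 \<le> T2" using T2(2) by simp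
        show "wp drain_body ?I v2 a2 (T2 - (ecost ?e + 1))" if "ev v2 a2 ?e \<noteq> 0"
          by (rule drain_body[OF S X len _ I]) (use that v2 set_ls in \<open>auto split: if_splits\<close>)
        show "Q v2 a2 (T2 - (ecost ?e + 1))" if "ev v2 a2 ?e = 0"
        proof (rule post)
          have v33: "v2 33 = length ls" using that v2 by (simp split: if_splits)
          \<comment> \<open>An element whose shift is new is itself a differing position, so the
            drain has inserted its shift.\<close>
          have "F \<subseteq> S'"
          proof
            fix f assume "f \<in> F"
            then consider "f \<in> S" | s where "s \<in> S" "f = (s + X) mod d" "f \<notin> S"
              unfolding F_def shift_def by blast
            then show "f \<in> S'"
            proof cases
              case 1 then show ?thesis using S' by blast
            next
              case 2
              have sd: "s < d" using 2 S by blast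
              then have "s \<in> set ls" using 2 dN(1) unfolding set_ls(1) by simp
              then obtain j where "j < length ls" "ls ! j = s" by (meson in_set_conv_nth)
              then have "in_res S' (s + X)" using dn v33 2 sd by auto
              then show ?thesis using 2 by simp
            qed
          qed
          then have "S' = F" using S' by blast
          then show "trees_ok X (in_res (S \<union> shift d X S)) v2 a2" using tr2 by (simp add: F_def)
          show "R \<le> T2 - (ecost ?e + 1)" "v2 20 + (T2 - (ecost ?e + 1)) < Bn" using T2 by auto
        qed (use fr2 fa2 in auto)
      qed
      have "0 < Z" using n_less_Z by simp
      then show "vc ?c Q v1 a1 T1" using T1 loop by simp
    qed
  qed
  then show ?thesis by (intro vc_sound) (simp add: process_def)
qed

section \<open>Passing from one shift to the next\<close>

definition base_ok :: "(nat \<Rightarrow> bool) \<Rightarrow> vars \<Rightarrow> arrs \<Rightarrow> bool" where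
  "base_ok str v a \<longleftrightarrow> consts_ok v \<and> 2 \<le> v 20 \<and> dict_ok (a 8) (v 20) \<and>
     (\<forall>j. a 6 j \<le> v 20) \<and> (\<forall>j. a 7 j \<le> v 20) \<and> tree_ok (a 8) (a 6) 0 \<and>
     (\<forall>y<N2. a 6 y = 1 + of_bool (str y) \<and> a 7 y = 1 + of_bool (str y))"

lemma trees_ok_iff: "trees_ok X str v a \<longleftrightarrow> base_ok str v a \<and> v 23 = X \<and> tree_ok (a 8) (a 7) X"
  unfolding trees_ok_def base_ok_def by blast

lemma lev_ok_mod: "\<rho> mod 2 ^ k = \<rho>' mod 2 ^ k \<Longrightarrow> lev_ok D A \<rho> k = lev_ok D A \<rho>' k"
  unfolding lev_ok_def by simp

lemma lev_ok_cong:
  assumes "lev_ok D A \<rho> k" "dict_ext D D'" "1 \<le> k"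
    and "\<And>i. i < N2 \<Longrightarrow> A' (k * N2 + i) = A (k * N2 + i)"
    and "\<And>i. i < N2 \<Longrightarrow> A' ((k - 1) * N2 + i) = A ((k - 1) * N2 + i)"
  shows "lev_ok D' A' \<rho> k"
  unfolding lev_ok_def
proof (intro allI impI)
  fix i assume i: "i mod 2 ^ k = \<rho> mod 2 ^ k" "i + 2 ^ k \<le> N2"
  then have "okc D' A k i" using assms(1) okc_ext[OF _ assms(2)] unfolding lev_ok_def by blast
  then show "okc D' A' k i" by (rule okc_cong) (use assms half_less[OF assms(3) i(2)] in auto)
qed

definition shift_tail :: stm where
  "shift_tail = Asg 24 (V 24 \<oplus> N 1) ;; Asg 25 (V 25 \<oplus> V 25) ;; Asg 36 (V 36 \<oslash> N 2)"

text \<open>The shift is the bit reversal of the index in register 22; it is assembled one bit per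
  level, just in time for the rebuild of that level. Register 36 holds \<open>2 ^ (K - k)\<close>,
  which both selects the bit and decides whether the level has to be rebuilt.\<close>

definition shift_level :: stm where
  "shift_level = Asg 23 (V 23 \<oplus> (V 22 \<oslash> V 36 \<odot> N 2) \<otimes> V 25) ;;
     Ife (V 22 \<odot> V 36) (Asg 27 (N 0)) (Blk (rebuild 7 23)) ;; Blk shift_tail"

definition set_shift :: stm where
  "set_shift = Asg 23 (N 0) ;; Asg 24 (N 1) ;; Asg 25 (N 1) ;; Asg 36 (V 17 \<oslash> N 2) ;;
     Whl ((V 18 \<prec> V 24) \<doteq> N 0) shift_level"

text \<open>Shifts are handled in bit-reversed order: passing from the \<open>c\<close>-th shift to the next one changes its
  residue modulo \<open>2 ^ k\<close> only if \<open>2 ^ (K - k)\<close> divides the new index, so level \<open>k\<close> of array 7 is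
  rebuilt only \<open>2 ^ k\<close> times altogether.\<close>

definition rot :: "nat \<Rightarrow> nat \<Rightarrow> nat" where
  "rot c k = brev k (c div 2 ^ (K - k))"

lemma rot_less: "rot c k < 2 ^ k"
  unfolding rot_def by (rule brev_less)

lemma rot_Suc: "k < K \<Longrightarrow> rot c (Suc k) = rot c k + (c div 2 ^ (K - Suc k) mod 2) * 2 ^ k"
proof -
  assume "k < K"
  then have "K - k = Suc (K - Suc k)" by simp
  then have "c div 2 ^ (K - k) = c div 2 ^ (K - Suc k) div 2"
    by (simp add: power_Suc2 div_mult2_eq del: power_Suc)
  then show ?thesis unfolding rot_def by simp
qed

lemma rot_mod: "k \<le> K \<Longrightarrow> rot c K mod 2 ^ k = rot c k"
  unfolding rot_def using brev_mod[of k "K - k" c] by simp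

text \<open>The levels of array 7 that are kept on entering index \<open>c\<close>. For
  \<open>c = 0\<close> every power divides and nothing is claimed, which suits the initial array
  with no blocks named.\<close>

definition class_ok :: "nat \<Rightarrow> arrs \<Rightarrow> bool" where
  "class_ok c a \<longleftrightarrow> (\<forall>k. 1 \<le> k \<longrightarrow> k \<le> K \<longrightarrow> \<not> 2 ^ (K - k) dvd c \<longrightarrow> lev_ok (a 8) (a 7) (rot c k) k)"

text \<open>An increment changes the quotient by \<open>2 ^ (K - k)\<close> only on reaching a
  multiple of it; on all other levels the residue of the shift, and with it the alignment,
  persists.\<close>

lemma class_ok_Suc:
  assumes "tree_ok (a 8) (a 7) (rot c K)"
  shows "class_ok (Suc c) a"
  unfolding class_ok_def
proof (intro allI impI)
  fix k assume k: "1 \<le> k" "k \<le> K" and nd: "\<not> 2 ^ (K - k) dvd Suc c"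
  have "Suc c div 2 ^ (K - k) = c div 2 ^ (K - k)"
    using nd by (simp add: div_Suc dvd_eq_mod_eq_0)
  then have "rot (Suc c) k = rot c k" unfolding rot_def by simp
  moreover have "lev_ok (a 8) (a 7) (rot c K) k" using assms k unfolding tree_ok_def by blast
  moreover have "rot c K mod 2 ^ k = rot c k mod 2 ^ k"
    using rot_mod[OF k(2), of c] rot_less[of c k] by simp
  ultimately show "lev_ok (a 8) (a 7) (rot (Suc c) k) k" using lev_ok_mod by metis
qed

definition level_time :: "nat \<Rightarrow> nat \<Rightarrow> nat" where
  "level_time c k = (if 2 ^ (K - k) dvd c then 150 * (N2 div 2 ^ k + 1) + 200 else 150)"

definition shift_inv :: "nat \<Rightarrow> (nat \<Rightarrow> bool) \<Rightarrow> vars \<Rightarrow> arrs \<Rightarrow> nat \<Rightarrow> assn" where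
  "shift_inv c str v0 a0 R v a T \<longleftrightarrow> base_ok str v a \<and> 1 \<le> v 24 \<and> v 24 \<le> K + 1 \<and> v 25 = 2 ^ (v 24 - 1) \<and>
     (v 24 \<le> K \<longrightarrow> v 36 = 2 ^ (K - v 24)) \<and> v 23 = rot c (v 24 - 1) \<and>
     (\<forall>k. 1 \<le> k \<longrightarrow> k \<le> K \<longrightarrow> k < v 24 \<or> \<not> 2 ^ (K - k) dvd c \<longrightarrow> lev_ok (a 8) (a 7) (rot c k) k) \<and>
     (\<forall>r. r \<notin> {20, 23, 24, 25, 26, 27, 28, 36} \<longrightarrow> v r = v0 r) \<and> (\<forall>q. q \<notin> {7, 8} \<longrightarrow> a q = a0 q) \<and>
     v 20 + T < Bn \<and> R + (\<Sum>k = v 24..K. level_time c k) + 20 \<le> T"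

lemma shift_level:
  assumes inv: "shift_inv c str v0 a0 R v a T" and c: "v0 22 = c" "c < Nn" and lt: "v 24 \<le> K" and t: "t \<le> 10"
  shows "wp shift_level (shift_inv c str v0 a0 R) v a (T - t)"
proof -
  let ?I = "shift_inv c str v0 a0 R"
  define k where "k = v 24"
  define h :: nat where "h = 2 ^ (k - 1)"
  define g :: nat where "g = 2 ^ (K - k)"
  define RT where "RT = R + (\<Sum>k' = Suc k..K. level_time c k')"
  have bs: "base_ok str v a" and k: "1 \<le> k" "k \<le> K" and v25: "v 25 = h" and v36: "v 36 = g"
    and v23: "v 23 = rot c (k - 1)"
    and lev: "\<And>k'. 1 \<le> k' \<Longrightarrow> k' \<le> K \<Longrightarrow> k' < k \<or> \<not> 2 ^ (K - k') dvd c \<Longrightarrow> lev_ok (a 8) (a 7) (rot c k') k'"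
    and fr: "\<forall>r. r \<notin> {20, 23, 24, 25, 26, 27, 28, 36} \<longrightarrow> v r = v0 r" and fa: "\<forall>q. q \<notin> {7, 8} \<longrightarrow> a q = a0 q"
    and T0: "v 20 + T < Bn" "R + (\<Sum>k' = k..K. level_time c k') + 20 \<le> T"
    using inv lt unfolding shift_inv_def k_def h_def g_def by blast+
  have T: "RT + level_time c k + 20 \<le> T"
    using T0(2) k(2) unfolding RT_def by (simp add: sum.atLeast_Suc_atMost)
  have hh: "h + h = 2 ^ k" unfolding h_def by (rule pow_half[OF k(1)])
  have v22: "v 22 = c" using fr c by simp
  have v23': "v 23 = rot c (k - Suc 0)" using v23 by simp
  have X: "rot c (k - 1) + c div g mod 2 * h = rot c k"
  proof -
    have "Suc (k - 1) = k" "k - 1 < K" using k by auto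
    then show ?thesis using rot_Suc[of "k - 1" c] unfolding g_def h_def by simp
  qed
  have hN: "2 ^ k \<le> Nn" by (rule pow_le[OF k(2)])
  have "h \<le> Nn" using hh hN by linarith
  moreover have mh: "c div g mod 2 * h \<le> h" by (cases "c div g mod 2 = 0") (auto simp: mod2_eq_if)
  ultimately have b: "c div g mod 2 * h < Z" "rot c k < Z" "Suc k < Z" "2 ^ k < Z" "2 < Z" "Suc 0 < Z" "0 < Z"
    using rot_less[of c k] hN N2_le(1,2) K_le k(2) by (intro n_less_Z; linarith)+
  have tail: "wp shift_tail ?I v1 a1 T1"
    if T1: "RT + 60 \<le> T1" "v1 20 + T1 < Bn" and fr1: "\<forall>r. r \<notin> {20, 26, 27, 28} \<longrightarrow> v1 r = (v(23 := rot c k)) r"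
      and fa1: "\<forall>q. q \<notin> {7, 8} \<longrightarrow> a1 q = a q" and bs1: "base_ok str v1 a1"
      and lev1: "\<And>k'. 1 \<le> k' \<Longrightarrow> k' \<le> K \<Longrightarrow> k' < Suc k \<or> \<not> 2 ^ (K - k') dvd c \<Longrightarrow>
        lev_ok (a1 8) (a1 7) (rot c k') k'" for v1 a1 T1
  proof -
    have v1: "v1 24 = k" "v1 25 = h" "v1 36 = g" "v1 23 = rot c k"
      using fr1 v25 v36 by (simp_all add: k_def)
    have "?I (v1(24 := Suc k, 25 := 2 ^ k, 36 := g div 2)) a1 (T1 - t)" if "t \<le> 40" for t
      unfolding shift_inv_def
    proof (intro conjI)
      show "base_ok str (v1(24 := Suc k, 25 := 2 ^ k, 36 := g div 2)) a1"
        using bs1 unfolding base_ok_def consts_ok_def by simp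
      show "(v1(24 := Suc k, 25 := 2 ^ k, 36 := g div 2)) 24 \<le> K \<longrightarrow>
        (v1(24 := Suc k, 25 := 2 ^ k, 36 := g div 2)) 36 = 2 ^ (K - (v1(24 := Suc k, 25 := 2 ^ k, 36 := g div 2)) 24)"
      proof
        assume "(v1(24 := Suc k, 25 := 2 ^ k, 36 := g div 2)) 24 \<le> K"
        then have "K - k = Suc (K - Suc k)" by simp
        then show "(v1(24 := Suc k, 25 := 2 ^ k, 36 := g div 2)) 36 =
          2 ^ (K - (v1(24 := Suc k, 25 := 2 ^ k, 36 := g div 2)) 24)" unfolding g_def by simp
      qed
      show "\<forall>k'. 1 \<le> k' \<longrightarrow> k' \<le> K \<longrightarrow> k' < (v1(24 := Suc k, 25 := 2 ^ k, 36 := g div 2)) 24 \<or>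
        \<not> 2 ^ (K - k') dvd c \<longrightarrow> lev_ok (a1 8) (a1 7) (rot c k') k'" using lev1 by simp
      show "\<forall>r. r \<notin> {20, 23, 24, 25, 26, 27, 28, 36} \<longrightarrow> (v1(24 := Suc k, 25 := 2 ^ k, 36 := g div 2)) r = v0 r"
        using fr fr1 by simp
      show "R + (\<Sum>k' = (v1(24 := Suc k, 25 := 2 ^ k, 36 := g div 2)) 24..K. level_time c k') + 20 \<le> T1 - t"
        using T1(1) that unfolding RT_def by simp
    qed (use v1 k fa fa1 T1 in auto)
    then show ?thesis
      by (intro vc_sound) (use T1(1) b hh in \<open>simp add: shift_tail_def v1; intro conjI; linarith\<close>)
  qed
  have tr7: "lev_ok (a 8) (a 7) (rot c k') k'" if "1 \<le> k'" "k' \<le> K" "k' < k" for k' using lev that by blast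
  have bs23: "base_ok str (v(23 := rot c k)) a" using bs unfolding base_ok_def consts_ok_def by simp
  have cst: "v 19 = N2" "v 21 = Bn" using bs unfolding base_ok_def consts_ok_def by blast+
  have cells: "\<And>j. a 7 j \<le> v 20" and dict: "dict_ok (a 8) (v 20)"
    using bs unfolding base_ok_def by blast+
  show ?thesis
  proof (cases "g dvd c")
    case False
    then have cg: "c mod g \<noteq> 0" by (simp add: dvd_eq_mod_eq_0)
    have "level_time c k = 150" using False unfolding level_time_def g_def by simp
    then have T150: "RT + 170 \<le> T" using T by simp
    have "wp shift_tail ?I
      (v(23 := rot c k, 27 := 0)) a (T - t)" if "t \<le> 100" for t
    proof (rule tail)
      show "lev_ok (a 8) (a 7) (rot c k') k'" if "1 \<le> k'" "k' \<le> K" "k' < Suc k \<or> \<not> 2 ^ (K - k') dvd c" for k'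
        using lev[OF that(1,2)] that(3) False unfolding g_def by (cases "k' = k") auto
      show "base_ok str (v(23 := rot c k, 27 := 0)) a" using bs unfolding base_ok_def consts_ok_def by simp
    qed (use T150 T0 that in auto)
    then show ?thesis
      by (intro vc_sound) (use T150 t cg in \<open>simp add: shift_level_def v22 v23' v25 v36 X[simplified] b;
        intro conjI; linarith\<close>)
  next
    case True
    then have cg: "c mod g = 0" by simp
    have "level_time c k = 150 * (N2 div 2 ^ k + 1) + 200" using True unfolding level_time_def g_def by simp
    then have TT: "RT + 60 + 150 * (N2 div 2 ^ k + 1) + 160 \<le> T" using T by linarith
    have "wp (rebuild 7 23) (wp shift_tail ?I)
      (v(23 := rot c k)) a (T - t')" if t': "t' \<le> 60" for t'
    proof (rule rebuild[where k = k and \<rho> = "rot c k" and R = "RT + 60"])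
      show "RT + 60 + 150 * (N2 div 2 ^ k + 1) + 50 \<le> T - t'" using TT t' by linarith
      show "(v(23 := rot c k)) 20 + (T - t') < Bn" using T0(1) by simp
      fix v1 D1 A1 T1 assume T1: "RT + 60 \<le> T1" "v1 20 + T1 < Bn" and nx: "(v(23 := rot c k)) 20 \<le> v1 20"
        and fr1: "\<forall>r. r \<notin> {20, 26, 27, 28} \<longrightarrow> v1 r = (v(23 := rot c k)) r"
        and dict1: "dict_ok D1 (v1 20)" "dict_ext (a 8) D1" and cells1: "\<And>j. A1 j \<le> v1 20"
        and lev1: "lev_ok D1 A1 (rot c k) k"
        and oth: "\<And>k' i. k' \<noteq> k \<Longrightarrow> i < N2 \<Longrightarrow> A1 (k' * N2 + i) = a 7 (k' * N2 + i)"
      let ?a = "a(8 := D1, 7 := A1)"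
      show "wp shift_tail ?I v1 ?a T1"
      proof (rule tail[OF T1 fr1])
        have "A1 y = a 7 y" if "y < N2" for y using oth[of 0 y] that k(1) by simp
        then show "base_ok str v1 ?a"
          using bs dict1 cells1 nx fr1 tree_ok_ext[OF _ dict1(2)] unfolding base_ok_def consts_ok_def
          by (auto intro: le_trans)
        show "lev_ok (?a 8) (?a 7) (rot c k') k'"
          if k': "1 \<le> k'" "k' \<le> K" "k' < Suc k \<or> \<not> 2 ^ (K - k') dvd c" for k'
        proof -
          \<comment> \<open>If level \<open>k\<close> has to be rebuilt, so have all higher levels,
            because \<open>2 ^ (K - k')\<close> divides \<open>2 ^ (K - k)\<close>. Hence no level
            that is kept refers to the names just changed.\<close>
          have le: "k' \<le> k"
          proof (rule ccontr)
            assume "\<not> k' \<le> k"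
            then have "2 ^ (K - k') dvd (2::nat) ^ (K - k)" by (intro le_imp_power_dvd) simp
            then have "2 ^ (K - k') dvd c" using True unfolding g_def by (rule dvd_trans)
            then show False using k'(3) \<open>\<not> k' \<le> k\<close> by simp
          qed
          show ?thesis
          proof (cases "k' = k")
            case True then show ?thesis using lev1 by simp
          next
            case False
            then have "k' < k" using le by simp
            then have "lev_ok D1 A1 (rot c k') k'"
              using oth by (intro lev_ok_cong[OF tr7[OF k'(1,2)] dict1(2) k'(1)]) auto
            then show ?thesis by simp
          qed
        qed
      qed auto
    qed (use k v25 v36 cst dict cells rot_less in \<open>auto simp: k_def h_def\<close>)
    then show ?thesis
      by (intro vc_sound) (use TT t cg in \<open>simp add: shift_level_def vc_Blk v22 v23' v25 v36 X[simplified] b;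
        intro conjI; linarith\<close>)
  qed
qed

lemma set_shift:
  assumes bs: "base_ok str v a" "class_ok c a" and c: "v 22 = c" "c < Nn"
    and T: "v 20 + T < Bn" "R + (\<Sum>k = 1..K. level_time c k) + 100 \<le> T"
    and post: "\<And>v' a' T'. R \<le> T' \<Longrightarrow> v' 20 + T' < Bn \<Longrightarrow> trees_ok (rot c K) str v' a' \<Longrightarrow>
      \<forall>r. r \<notin> {20, 23, 24, 25, 26, 27, 28, 36} \<longrightarrow> v' r = v r \<Longrightarrow> \<forall>q. q \<notin> {7, 8} \<longrightarrow> a' q = a q \<Longrightarrow> Q v' a' T'"
  shows "wp set_shift Q v a T"
proof -
  let ?I = "shift_inv c str v a R"
  let ?e = "(V 18 \<prec> V 24) \<doteq> N 0"
  let ?v = "v(23 := 0, 24 := Suc 0, 25 := Suc 0, 36 := Nn div 2)"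
  have v17: "v 17 = Nn" using bs unfolding base_ok_def consts_ok_def by blast
  have Z2: "2 < Z" "Suc 0 < Z" "0 < Z" using n_less_Z by simp_all
  have loop: "wp (Whl ?e shift_level) Q ?v a (T - t)" if t: "t \<le> 40" for t
  proof (rule wp_Whl[where I = ?I])
    show "?I ?v a (T - t)"
      unfolding shift_inv_def
    proof (intro conjI)
      show "base_ok str ?v a" using bs unfolding base_ok_def consts_ok_def by simp
      show "?v 24 \<le> K \<longrightarrow> ?v 36 = 2 ^ (K - ?v 24)"
        unfolding Nn by (cases K) auto
      show "\<forall>k. 1 \<le> k \<longrightarrow> k \<le> K \<longrightarrow> k < ?v 24 \<or> \<not> 2 ^ (K - k) dvd c \<longrightarrow> lev_ok (a 8) (a 7) (rot c k) k"
        using bs(2) unfolding class_ok_def by simp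
      show "R + (\<Sum>k = ?v 24..K. level_time c k) + 20 \<le> T - t" using T(2) t by simp
    qed (use T in \<open>auto simp: rot_def\<close>)
    fix v1 a1 T1 assume I: "?I v1 a1 T1"
    have b1: "base_ok str v1 a1" and T1: "v1 20 + T1 < Bn" "R + (\<Sum>k = v1 24..K. level_time c k) + 20 \<le> T1"
      and k: "1 \<le> v1 24" "v1 24 \<le> K + 1" and v23: "v1 23 = rot c (v1 24 - 1)"
      using I unfolding shift_inv_def by blast+
    have v18: "v1 18 = K" using b1 unfolding base_ok_def consts_ok_def by blast
    show "eok v1 a1 ?e \<and> ecost ?e + 1 \<le> T1" using T1(2) Z2 by simp
    show "wp shift_level ?I v1 a1 (T1 - (ecost ?e + 1))" if "ev v1 a1 ?e \<noteq> 0"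
    proof -
      have "v1 24 \<le> K" using that v18 by (simp split: if_splits)
      then show ?thesis by (rule shift_level[OF I c]) simp
    qed
    show "Q v1 a1 (T1 - (ecost ?e + 1))" if "ev v1 a1 ?e = 0"
    proof (rule post)
      have v24: "v1 24 = Suc K" using that v18 k by (simp split: if_splits)
      have "tree_ok (a1 8) (a1 7) (rot c K)"
        unfolding tree_ok_def
      proof (intro allI impI)
        fix k assume k: "1 \<le> k" "k \<le> K"
        then have "lev_ok (a1 8) (a1 7) (rot c k) k" using I v24 unfolding shift_inv_def by auto
        moreover have "rot c K mod 2 ^ k = rot c k mod 2 ^ k"
          using rot_mod[OF k(2), of c] rot_less[of c k] by simp
        ultimately show "lev_ok (a1 8) (a1 7) (rot c K) k" using lev_ok_mod by metis
      qed
      then show "trees_ok (rot c K) str v1 a1" unfolding trees_ok_iff using b1 v23 v24 by simp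
      show "R \<le> T1 - (ecost ?e + 1)" "v1 20 + (T1 - (ecost ?e + 1)) < Bn" using T1 by auto
      show "\<forall>r. r \<notin> {20, 23, 24, 25, 26, 27, 28, 36} \<longrightarrow> v1 r = v r" "\<forall>q. q \<notin> {7, 8} \<longrightarrow> a1 q = a q"
        using I unfolding shift_inv_def by blast+
    qed
  qed
  have "100 \<le> T" using T by linarith
  then show ?thesis
    by (intro vc_sound) (use Z2 in \<open>simp add: set_shift_def v17 loop; intro conjI; linarith\<close>)
qed

end

section \<open>Adding all residues\<close>

context shift_tree
begin

definition next_item :: stm where
  "next_item = Asg 35 (V 35 \<ominus> N 1)"

definition items_body :: stm where
  "items_body = Blk process ;; Blk next_item"

definition items :: stm where
  "items = Whl (V 35) items_body"

text \<open>All copies of one residue share a shift. Their costs telescope, so every new residue is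
  paid for once.\<close>

lemma items:
  assumes tr: "trees_ok X (in_res (residue_sums d M)) v a" and X: "X < Nn" and p: "v 35 = p"
    and T: "v 20 + T < Bn" "R + (item_time + 50) * p +
      new_time * (card (residue_sums d (M + replicate_mset p X)) - card (residue_sums d M)) + 20 \<le> T"
    and post: "\<And>v' a' T'. R \<le> T' \<Longrightarrow> v' 20 + T' < Bn \<Longrightarrow>
      trees_ok X (in_res (residue_sums d (M + replicate_mset p X))) v' a' \<Longrightarrow>
      \<forall>r. r \<notin> process_regs \<longrightarrow> r \<noteq> 35 \<longrightarrow> v' r = v r \<Longrightarrow> \<forall>q. q \<notin> {6, 7, 8, 9} \<longrightarrow> a' q = a q \<Longrightarrow> Q v' a' T'"
  shows "wp items Q v a T"
proof -
  define IT where "IT = item_time"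
  define NT where "NT = new_time"
  define g where "g i = residue_sums d (M + replicate_mset i X)" for i
  have gS: "g (Suc i) = g i \<union> shift d X (g i)" for i
    using residue_sums_add[of d X "M + replicate_mset i X"] by (simp add: g_def)
  have gd: "g i \<subseteq> {..<d}" for i unfolding g_def using d1 by (intro residue_sums_less) simp
  have fin: "finite (g i)" for i using gd finite_subset by blast
  have mono: "g i \<subseteq> g j" if "i \<le> j" for i j using that by (rule lift_Suc_mono_le[rotated]) (auto simp: gS)
  have card_le: "card (g i) \<le> card (g j)" if "i \<le> j" for i j using mono[OF that] fin by (rule card_mono[rotated])
  define I where "I v' a' T' \<longleftrightarrow> v' 35 \<le> p \<and> trees_ok X (in_res (g (p - v' 35))) v' a' \<and>
    (\<forall>r. r \<notin> process_regs \<longrightarrow> r \<noteq> 35 \<longrightarrow> v' r = v r) \<and> (\<forall>q. q \<notin> {6, 7, 8, 9} \<longrightarrow> a' q = a q) \<and>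
    v' 20 + T' < Bn \<and> R + (IT + 50) * v' 35 + NT * (card (g p) - card (g (p - v' 35))) + 20 \<le> T'" for v' a' T'
  have Z1: "Suc 0 < Z" using n_less_Z by simp
  show ?thesis unfolding items_def
  proof (rule wp_Whl[where I = I])
    show "I v a T" unfolding I_def using tr p T by (simp add: g_def IT_def NT_def)
    fix v1 a1 T1 assume "I v1 a1 T1"
    then have le: "v1 35 \<le> p" and tr1: "trees_ok X (in_res (g (p - v1 35))) v1 a1"
      and fr: "\<forall>r. r \<notin> process_regs \<longrightarrow> r \<noteq> 35 \<longrightarrow> v1 r = v r" and fa: "\<forall>q. q \<notin> {6, 7, 8, 9} \<longrightarrow> a1 q = a q"
      and T1: "v1 20 + T1 < Bn" "R + (IT + 50) * v1 35 + NT * (card (g p) - card (g (p - v1 35))) + 20 \<le> T1"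
      unfolding I_def by blast+
    show "eok v1 a1 (V 35) \<and> ecost (V 35) + 1 \<le> T1" using T1(2) by simp
    show "Q v1 a1 (T1 - (ecost (V 35) + 1))" if "ev v1 a1 (V 35) = 0"
    proof (rule post)
      have z: "v1 35 = 0" using that by simp
      show "trees_ok X (in_res (residue_sums d (M + replicate_mset p X))) v1 a1" using tr1 z by (simp add: g_def)
      show "R \<le> T1 - (ecost (V 35) + 1)" "v1 20 + (T1 - (ecost (V 35) + 1)) < Bn" using T1 by auto
    qed (use fr fa in auto)
    show "wp items_body I v1 a1 (T1 - (ecost (V 35) + 1))" if "ev v1 a1 (V 35) \<noteq> 0"
    proof -
      define j where "j = v1 35 - 1"
      have j: "v1 35 = Suc j" "p - j = Suc (p - Suc j)" "Suc j \<le> p" using that le by (auto simp: j_def)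
      define S where "S = g (p - Suc j)"
      have S': "S \<union> shift d X S = g (p - j)" unfolding S_def j(2) gS ..
      have c1: "card S \<le> card (g (p - j))" "card (g (p - j)) \<le> card (g p)"
        unfolding S_def using j by (intro card_le; simp)+
      define RR where "RR = R + (IT + 50) * j + NT * (card (g p) - card (g (p - j))) + 40"
      have "NT * (card (g p) - card S) = NT * (card (g p) - card (g (p - j))) + NT * (card (g (p - j)) - card S)"
        using c1 by (simp flip: distrib_left)
      moreover have "(IT + 50) * Suc j = (IT + 50) * j + IT + 50" by simp
      ultimately have TT: "RR + IT + NT * (card (S \<union> shift d X S) - card S) + 30 \<le> T1"
        using T1(2) unfolding j(1) S_def[symmetric] S' RR_def by linarith
      have "wp process (wp next_item I) v1 a1 (T1 - 3)"
      proof (rule process[where S = S and X = X and R = RR])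
        show "trees_ok X (in_res S) v1 a1" using tr1 by (simp add: S_def j(1))
        show "S \<subseteq> {..<d}" unfolding S_def by (rule gd)
        show "v1 20 + (T1 - 3) < Bn" using T1(1) by linarith
        show "RR + item_time + new_time * (card (S \<union> shift d X S) - card S) \<le> T1 - 3"
          using TT unfolding IT_def[symmetric] NT_def[symmetric] by linarith
        fix v2 a2 T2 assume T2: "RR \<le> T2" "v2 20 + T2 < Bn" and tr2: "trees_ok X (in_res (S \<union> shift d X S)) v2 a2"
          and fr2: "\<forall>r. r \<notin> process_regs \<longrightarrow> v2 r = v1 r" and fa2: "\<forall>q. q \<notin> {6, 7, 8, 9} \<longrightarrow> a2 q = a1 q"
        have v2: "v2 35 = Suc j" using fr2 j(1) by simp
        have "I (v2(35 := j)) a2 (T2 - t)" if "t \<le> 20" for t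
          unfolding I_def
        proof (intro conjI)
          have "trees_ok X (in_res (g (p - j))) (v2(35 := j)) a2" using tr2 unfolding S' by (rule trees_ok_vars) auto
          then show "trees_ok X (in_res (g (p - (v2(35 := j)) 35))) (v2(35 := j)) a2" by simp
          show "R + (IT + 50) * (v2(35 := j)) 35 + NT * (card (g p) - card (g (p - (v2(35 := j)) 35))) + 20 \<le> T2 - t"
            using T2(1) that unfolding RR_def fun_upd_same by linarith
        qed (use j T2 fr fr2 fa fa2 in auto)
        moreover have "40 \<le> T2" using T2(1) by (simp add: RR_def)
        ultimately show "wp next_item I v2 a2 T2"
          by (intro vc_sound) (use Z1 in \<open>simp add: next_item_def v2\<close>)
      qed (use X in auto)
      then show ?thesis by (intro vc_sound) (simp add: items_body_def vc_Blk)
    qed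
  qed
qed

definition next_class :: stm where
  "next_class = Asg 22 (V 22 \<oplus> N 1)"

definition main_body :: stm where
  "main_body = Blk set_shift ;; Asg 35 (Arr 5 (V 23)) ;; Blk items ;; Blk next_class"

definition main_loop :: stm where
  "main_loop = Asg 22 (N 0) ;; Whl (V 22 \<prec> V 17) main_body"

definition handled :: "nat multiset \<Rightarrow> nat \<Rightarrow> nat multiset" where
  "handled H c = {#x \<in># H. x \<in> brev K ` {..<c}#}"

lemma handled_Suc: "c < Nn \<Longrightarrow> handled H (Suc c) = handled H c + replicate_mset (count H (brev K c)) (brev K c)"
proof (rule multiset_eqI)
  fix x assume c: "c < Nn"
  have "brev K c \<notin> brev K ` {..<c}"
  proof
    assume "brev K c \<in> brev K ` {..<c}"
    then obtain c' where "c' < c" "brev K c = brev K c'" by auto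
    then show False using inj_onD[OF inj_on_brev, of K c c'] c unfolding Nn by auto
  qed
  then show "count (handled H (Suc c)) x = count (handled H c + replicate_mset (count H (brev K c)) (brev K c)) x"
    unfolding handled_def by (auto simp: lessThan_Suc)
qed

lemma handled_Nn: "(\<And>x. x \<in># H \<Longrightarrow> x < Nn) \<Longrightarrow> handled H Nn = H"
  unfolding handled_def Nn bij_betw_imp_surj_on[OF bij_betw_brev] by (simp add: filter_mset_eq_conv)

definition main_time :: "nat \<Rightarrow> nat" where
  "main_time c = (\<Sum>c'=c..<Nn. (\<Sum>k = 1..K. level_time c' k) + 250)"

text \<open>The budget is a potential with three parts: shifts not yet visited, elements not yet
  processed, and residues not yet reached. The last part is at most \<open>d\<close> for the whole
  run, whatever the number of elements.\<close>

definition main_inv :: "nat multiset \<Rightarrow> vars \<Rightarrow> arrs \<Rightarrow> nat \<Rightarrow> assn" where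
  "main_inv H v0 a0 R v a T \<longleftrightarrow> v 22 \<le> Nn \<and> base_ok (in_res (residue_sums d (handled H (v 22)))) v a \<and>
     class_ok (v 22) a \<and> (\<forall>r. r \<notin> process_regs \<union> {22, 23, 35, 36} \<longrightarrow> v r = v0 r) \<and>
     (\<forall>q. q \<notin> {6, 7, 8, 9} \<longrightarrow> a q = a0 q) \<and> v 20 + T < Bn \<and>
     R + main_time (v 22) + (item_time + 50) * (size H - size (handled H (v 22))) +
       new_time * (d - card (residue_sums d (handled H (v 22)))) + 20 \<le> T"

lemma base_ok_vars:
  "base_ok str v a \<Longrightarrow> (\<And>r. r \<in> {16, 17, 18, 19, 20, 21, 37} \<Longrightarrow> v' r = v r) \<Longrightarrow> base_ok str v' a"
  unfolding base_ok_def consts_ok_def by simp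

lemma rot_K: "rot c K = brev K c"
  by (simp add: rot_def)

lemma main_body:
  assumes I: "main_inv H v0 a0 R v a T" and a5: "a0 5 = count H" and lt: "v 22 < Nn" and t: "t \<le> 10"
  shows "wp main_body (main_inv H v0 a0 R) v a (T - t)"
proof -
  define IT where "IT = item_time"
  define NT where "NT = new_time"
  define c where "c = v 22"
  define X where "X = brev K c"
  define M where "M = handled H c"
  define M' where "M' = handled H (Suc c)"
  define lt where "lt = (\<Sum>k = 1..K. level_time c k)"
  have base: "base_ok (in_res (residue_sums d M)) v a" "class_ok c a"
    and fr: "\<forall>r. r \<notin> process_regs \<union> {22, 23, 35, 36} \<longrightarrow> v r = v0 r" and fa: "\<forall>q. q \<notin> {6, 7, 8, 9} \<longrightarrow> a q = a0 q"
    and T: "v 20 + T < Bn" "R + main_time c + (IT + 50) * (size H - size M) +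
       NT * (d - card (residue_sums d M)) + 20 \<le> T"
    using I unfolding main_inv_def c_def M_def IT_def NT_def by blast+
  have c: "c < Nn" using assms(3) by (simp add: c_def)
  have X: "X < Nn" unfolding X_def Nn by (rule brev_less)
  have M': "M' = M + replicate_mset (count H X) X" unfolding M'_def M_def X_def by (rule handled_Suc[OF c])
  have mt: "main_time c = main_time (Suc c) + (lt + 250)"
    unfolding main_time_def lt_def using c by (simp add: sum.atLeast_Suc_lessThan)
  have "size M' \<le> size H" unfolding M'_def handled_def by (rule size_filter_mset_lesseq)
  then have sz: "size H - size M = (size H - size M') + count H X" unfolding M' by simp
  have "residue_sums d M' \<subseteq> {..<d}" using d1 by (intro residue_sums_less) simp
  then have rd: "card (residue_sums d M') \<le> d" "finite (residue_sums d M')"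
    using card_mono[of "{..<d}" "residue_sums d M'"] finite_subset by auto
  have "residue_sums d M \<subseteq> residue_sums d M'"
    unfolding M' residue_sums_def subset_sums_def by (fastforce intro: subset_mset.order_trans)
  then have cl: "card (residue_sums d M) \<le> card (residue_sums d M')" using rd(2) by (intro card_mono)
  define RR where "RR = R + main_time (Suc c) + (IT + 50) * (size H - size M') + NT * (d - card (residue_sums d M')) + 40"
  define RI where "RI = RR + (IT + 50) * count H X + NT * (card (residue_sums d M') - card (residue_sums d M)) + 60"
  have "NT * (d - card (residue_sums d M)) = NT * (d - card (residue_sums d M')) +
      NT * (card (residue_sums d M') - card (residue_sums d M))" using cl rd(1) by (simp flip: distrib_left)
  moreover have "(IT + 50) * (size H - size M) = (IT + 50) * (size H - size M') + (IT + 50) * count H X"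
    unfolding sz by (rule distrib_left)
  ultimately have TT: "RI + lt + 100 + 50 \<le> T" using T(2) unfolding RI_def RR_def mt by linarith
  let ?I = "main_inv H v0 a0 R"
  have "wp set_shift (vc (Asg 35 (Arr 5 (V 23)) ;; Blk items ;; Blk next_class) ?I) v a (T - t)"
  proof (rule set_shift[OF base c_def[symmetric] c, where R = RI])
    show "v 20 + (T - t) < Bn" using T(1) by linarith
    show "RI + (\<Sum>k = 1..K. level_time c k) + 100 \<le> T - t" using TT t unfolding lt_def by linarith
    fix v1 a1 T1 assume T1: "RI \<le> T1" "v1 20 + T1 < Bn"
      and tr1: "trees_ok (rot c K) (in_res (residue_sums d M)) v1 a1"
      and fr1: "\<forall>r. r \<notin> {20, 23, 24, 25, 26, 27, 28, 36} \<longrightarrow> v1 r = v r" and fa1: "\<forall>q. q \<notin> {7, 8} \<longrightarrow> a1 q = a q"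
    have tr1': "trees_ok X (in_res (residue_sums d M)) v1 a1" using tr1 unfolding rot_K X_def .
    have v23: "v1 23 = X" using tr1' unfolding trees_ok_def by blast
    have a15: "a1 5 = count H" using fa1 fa a5 by simp
    let ?v = "v1(35 := count H X)"
    have "wp items (wp next_class ?I) ?v a1 (T1 - t)" if t: "t \<le> 30" for t
    proof (rule items[where X = X and M = M and p = "count H X" and R = RR])
      show "trees_ok X (in_res (residue_sums d M)) ?v a1" using tr1' by (rule trees_ok_vars) auto
      show "?v 20 + (T1 - t) < Bn" using T1(2) by simp
      show "RR + (item_time + 50) * count H X + new_time * (card (residue_sums d (M + replicate_mset (count H X) X))
        - card (residue_sums d M)) + 20 \<le> T1 - t"
        using T1(1) t unfolding RI_def M'[symmetric] IT_def[symmetric] NT_def[symmetric] by linarith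
      fix v2 a2 T2 assume T2: "RR \<le> T2" "v2 20 + T2 < Bn"
        and tr2: "trees_ok X (in_res (residue_sums d (M + replicate_mset (count H X) X))) v2 a2"
        and fr2: "\<forall>r. r \<notin> process_regs \<longrightarrow> r \<noteq> 35 \<longrightarrow> v2 r = ?v r" and fa2: "\<forall>q. q \<notin> {6, 7, 8, 9} \<longrightarrow> a2 q = a1 q"
      have tr2': "base_ok (in_res (residue_sums d M')) v2 a2" "tree_ok (a2 8) (a2 7) (rot c K)"
        using tr2 unfolding trees_ok_iff M'[symmetric] by (auto simp: rot_K X_def)
      have v22: "v2 22 = c" using fr2 fr1 by (simp add: c_def)
      have "?I (v2(22 := Suc c)) a2 (T2 - t)" if "t \<le> 20" for t
        unfolding main_inv_def fun_upd_same
      proof (intro conjI)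
        show "base_ok (in_res (residue_sums d (handled H (Suc c)))) (v2(22 := Suc c)) a2"
          using tr2'(1) unfolding M'_def by (rule base_ok_vars) auto
        show "class_ok (Suc c) a2" by (rule class_ok_Suc[OF tr2'(2)])
        show "R + main_time (Suc c) + (item_time + 50) * (size H - size (handled H (Suc c))) +
          new_time * (d - card (residue_sums d (handled H (Suc c)))) + 20 \<le> T2 - t"
          using T2(1) that unfolding RR_def M'_def[symmetric] IT_def[symmetric] NT_def[symmetric] by linarith
        show "\<forall>r. r \<notin> process_regs \<union> {22, 23, 35, 36} \<longrightarrow> (v2(22 := Suc c)) r = v0 r"
          using fr fr1 fr2 by auto
      qed (use c T2 fa fa1 fa2 in auto)
      moreover have "40 \<le> T2" using T2(1) by (simp add: RR_def)
      moreover have "Suc c < Z" "Suc 0 < Z" using c N2_le by (auto intro!: n_less_Z)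
      ultimately show "wp next_class ?I v2 a2 T2"
        by (intro vc_sound) (simp add: next_class_def v22)
    qed (use X in auto)
    moreover have "100 \<le> T1" using T1(1) by (simp add: RI_def RR_def)
    ultimately show "vc (Asg 35 (Arr 5 (V 23)) ;; Blk items ;; Blk next_class) ?I v1 a1 T1"
      by (simp add: v23 a15 vc_Blk)
  qed
  then show ?thesis by (intro vc_sound) (simp add: main_body_def)
qed

lemma main_loop:
  assumes base: "base_ok (in_res {0}) v a" and a5: "a 5 = count H" and H: "\<And>x. x \<in># H \<Longrightarrow> x < Nn"
    and T: "v 20 + T < Bn" "R + main_time 0 + (item_time + 50) * size H + new_time * d + 50 \<le> T"
    and post: "\<And>v' a' T'. R \<le> T' \<Longrightarrow> (\<And>y. y < N2 \<Longrightarrow> a' 6 y = 1 + of_bool (y mod d \<in> residue_sums d H)) \<Longrightarrow>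
      \<forall>r. r \<notin> process_regs \<union> {22, 23, 35, 36} \<longrightarrow> v' r = v r \<Longrightarrow> \<forall>q. q \<notin> {6, 7, 8, 9} \<longrightarrow> a' q = a q \<Longrightarrow> Q v' a' T'"
  shows "wp main_loop Q v a T"
proof -
  let ?I = "main_inv H v a R"
  let ?e = "V 22 \<prec> V 17"
  have u0: "handled H 0 = {#}" by (simp add: handled_def)
  have rs: "residue_sums d {#} = {0}" using d1 by (intro residue_sums_empty) simp
  have loop: "wp (Whl ?e main_body) Q (v(22 := 0)) a (T - t)" if t: "t \<le> 20" for t
  proof (rule wp_Whl[where I = ?I])
    show "?I (v(22 := 0)) a (T - t)"
      unfolding main_inv_def fun_upd_same u0 rs
    proof (intro conjI)
      show "base_ok (in_res {0}) (v(22 := 0)) a" using base by (rule base_ok_vars) auto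
      show "class_ok 0 a" unfolding class_ok_def by simp
      have "new_time * (d - card {0::nat}) \<le> new_time * d" by (rule mult_le_mono2) simp
      then show "R + main_time 0 + (item_time + 50) * (size H - size {#}) + new_time * (d - card {0::nat}) + 20 \<le> T - t"
        using T(2) t unfolding size_empty diff_zero by linarith
    qed (use T in auto)
    fix v1 a1 T1 assume I: "?I v1 a1 T1"
    have le: "v1 22 \<le> Nn" and base1: "base_ok (in_res (residue_sums d (handled H (v1 22)))) v1 a1"
      and T1: "R + main_time (v1 22) + (item_time + 50) * (size H - size (handled H (v1 22))) +
       new_time * (d - card (residue_sums d (handled H (v1 22)))) + 20 \<le> T1"
      using I unfolding main_inv_def by blast+
    have T20: "R + 20 \<le> T1" using T1 by linarith
    have v17: "v1 17 = Nn" using base1 unfolding base_ok_def consts_ok_def by blast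
    show "eok v1 a1 ?e \<and> ecost ?e + 1 \<le> T1" using T20 by simp
    show "wp main_body ?I v1 a1 (T1 - (ecost ?e + 1))" if "ev v1 a1 ?e \<noteq> 0"
      by (rule main_body[OF I a5]) (use that v17 in \<open>auto split: if_splits\<close>)
    show "Q v1 a1 (T1 - (ecost ?e + 1))" if "ev v1 a1 ?e = 0"
    proof (rule post)
      have "v1 22 = Nn" using that v17 le by (simp split: if_splits)
      then have u: "handled H (v1 22) = H" using handled_Nn[OF H] by simp
      show "a1 6 y = 1 + of_bool (y mod d \<in> residue_sums d H)" if "y < N2" for y
        using base1 that unfolding u base_ok_def by blast
      show "R \<le> T1 - (ecost ?e + 1)" using T20 by simp
      show "\<forall>r. r \<notin> process_regs \<union> {22, 23, 35, 36} \<longrightarrow> v1 r = v r" "\<forall>q. q \<notin> {6, 7, 8, 9} \<longrightarrow> a1 q = a q"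
        using I unfolding main_inv_def by blast+
    qed
  qed
  have "50 \<le> T" using T(2) by linarith
  moreover have "0 < Z" using n_less_Z by simp
  ultimately show ?thesis by (intro vc_sound) (simp add: main_loop_def loop)
qed


section \<open>Initial sizes, string and names\<close>

definition size_body :: stm where
  "size_body = Asg 17 (V 17 \<oplus> V 17) ;; Asg 18 (V 18 \<oplus> N 1)"

definition setup_sizes :: stm where
  "setup_sizes = Asg 17 (N 1) ;; Asg 18 (N 0) ;; Whl (V 17 \<prec> V 16) size_body"

lemma setup_sizes:
  assumes v: "v 16 = d" and T: "R + 40 * K + 40 \<le> T"
    and post: "\<And>T'. R \<le> T' \<Longrightarrow> T' \<le> T \<Longrightarrow> Q (v(17 := Nn, 18 := K)) a T'"
  shows "wp setup_sizes Q v a T"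
proof -
  let ?e = "V 17 \<prec> V 16"
  define I where "I v' a' T' \<longleftrightarrow> (\<exists>j\<le>K. v' = v(17 := 2 ^ j, 18 := j) \<and> a' = a \<and> T' \<le> T \<and>
    R + 40 * (K - j) + 10 \<le> T')" for v' and a' :: arrs and T'
  have loop: "wp (Whl ?e size_body) Q (v(17 := Suc 0, 18 := 0)) a (T - t)" if t: "t \<le> 20" for t
  proof (rule wp_Whl[where I = I])
    show "I (v(17 := Suc 0, 18 := 0)) a (T - t)" unfolding I_def
      using T t by (intro exI[of _ 0]) auto
    fix v1 a1 T1 assume "I v1 a1 T1"
    then obtain j where j: "j \<le> K" and v1: "v1 = v(17 := 2 ^ j, 18 := j)" and a1: "a1 = a"
      and T1: "R + 40 * (K - j) + 10 \<le> T1" "T1 \<le> T" unfolding I_def by blast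
    show "eok v1 a1 ?e \<and> ecost ?e + 1 \<le> T1" using T1 by simp
    show "Q v1 a1 (T1 - (ecost ?e + 1))" if "ev v1 a1 ?e = 0"
    proof -
      have ge: "d \<le> 2 ^ j" using that v by (simp add: v1 split: if_splits)
      have "j = K"
      proof (rule ccontr)
        assume "j \<noteq> K"
        then have "(2::nat) ^ Suc j \<le> 2 ^ K" using j by (intro power_increasing) auto
        then show False using ge dN(2) Nn by simp
      qed
      then show ?thesis unfolding v1 a1 using T1 post[unfolded Nn] by simp
    qed
    show "wp size_body I v1 a1 (T1 - (ecost ?e + 1))" if "ev v1 a1 ?e \<noteq> 0"
    proof -
      have lt: "2 ^ j < d" using that v by (simp add: v1 split: if_splits)
      have jK: "j < K"
      proof (rule ccontr)
        assume "\<not> j < K"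
        then show False using lt dN(1) Nn j by simp
      qed
      have "K - j = Suc (K - Suc j)" using jK by simp
      then have T1': "R + 40 * (K - Suc j) + 50 \<le> T1" using T1(1) by simp
      have "I (v(17 := 2 * 2 ^ j, 18 := Suc j)) a (T1 - t)" if "t \<le> 40" for t
        unfolding I_def using jK T1(2) T1' that by (intro exI[of _ "Suc j"]) auto
      moreover have "2 * 2 ^ j < Z" "Suc j < Z" "Suc 0 < Z"
        using lt dN(1) N2_le(1,2) N2 K_le jK by (auto intro!: n_less_Z)
      ultimately show ?thesis using T1'
        by (intro vc_sound) (simp add: size_body_def v1 a1 fun_upd_twist[of 17 18] flip: mult_2; intro conjI; linarith)
    qed
  qed
  have "40 \<le> T" using T by linarith
  moreover have "0 < Z" "Suc 0 < Z" using n_less_Z by simp_all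
  ultimately show ?thesis by (intro vc_sound) (simp add: setup_sizes_def loop)
qed

definition fill_next :: stm where
  "fill_next = Asg 26 (V 26 \<oplus> N 1)"

definition fill_body :: stm where
  "fill_body = Sto 6 (V 26) (N 1 \<oplus> (V 26 \<odot> V 16 \<doteq> N 0)) ;;
     Sto 7 (V 26) (N 1 \<oplus> (V 26 \<odot> V 16 \<doteq> N 0)) ;; Blk fill_next"

definition fill :: stm where
  "fill = Asg 26 (N 0) ;; Whl (V 26 \<prec> V 19) fill_body"

lemma fill:
  assumes v: "v 16 = d" "v 19 = N2" and a: "a 6 = (\<lambda>_. 0)" "a 7 = (\<lambda>_. 0)" and T: "R + 60 * N2 + 50 \<le> T"
    and post: "\<And>A i T'. R \<le> T' \<Longrightarrow> T' \<le> T \<Longrightarrow> (\<And>j. A j \<le> 2) \<Longrightarrow>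
      (\<And>y. y < N2 \<Longrightarrow> A y = 1 + of_bool (y mod d \<in> {0})) \<Longrightarrow> Q (v(26 := i)) (a(6 := A, 7 := A)) T'"
  shows "wp fill Q v a T"
proof -
  let ?e = "V 26 \<prec> V 19"
  define F :: "nat \<Rightarrow> nat \<Rightarrow> nat" where "F i y = (if y < i then Suc (of_bool (y mod d = 0)) else 0)" for i y
  define I where "I v' a' T' \<longleftrightarrow> (\<exists>i\<le>N2. v' = v(26 := i) \<and> a' = a(6 := F i, 7 := F i) \<and> T' \<le> T \<and>
    R + 60 * (N2 - i) + 10 \<le> T')" for v' and a' :: arrs and T'
  have F_Suc: "F (Suc i) = (F i)(i := Suc (of_bool (i mod d = 0)))" for i
    by (auto simp: F_def fun_eq_iff less_Suc_eq)
  have F0: "F 0 = (\<lambda>_. 0)" by (simp add: F_def fun_eq_iff)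
  have Z1: "0 < Z" "Suc 0 < Z" "Suc (Suc 0) < Z" using n_less_Z by simp_all
  have loop: "wp (Whl ?e fill_body) Q (v(26 := 0)) a (T - t)" if t: "t \<le> 20" for t
  proof (rule wp_Whl[where I = I])
    have "a(6 := F 0, 7 := F 0) = a" using a by (auto simp: F0)
    then show "I (v(26 := 0)) a (T - t)" unfolding I_def
      using T t by (intro exI[of _ 0]) auto
    fix v1 a1 T1 assume "I v1 a1 T1"
    then obtain i where i: "i \<le> N2" and v1: "v1 = v(26 := i)" and a1: "a1 = a(6 := F i, 7 := F i)"
      and T1: "R + 60 * (N2 - i) + 10 \<le> T1" "T1 \<le> T" unfolding I_def by blast
    show "eok v1 a1 ?e \<and> ecost ?e + 1 \<le> T1" using T1 by simp
    show "Q v1 a1 (T1 - (ecost ?e + 1))" if "ev v1 a1 ?e = 0"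
    proof -
      have "i = N2" using that v i by (simp add: v1 split: if_splits)
      then show ?thesis unfolding v1 a1 using T1 by (intro post) (auto simp: F_def)
    qed
    show "wp fill_body I v1 a1 (T1 - (ecost ?e + 1))" if "ev v1 a1 ?e \<noteq> 0"
    proof -
      have iN: "i < N2" using that v by (simp add: v1 split: if_splits)
      then have "N2 - i = Suc (N2 - Suc i)" by simp
      then have T1': "R + 60 * (N2 - Suc i) + 70 \<le> T1" using T1(1) by simp
      have "I (v(26 := Suc i)) (a(6 := F (Suc i), 7 := F (Suc i))) (T1 - t)" if "t \<le> 60" for t
        unfolding I_def using iN T1(2) T1' that by (intro exI[of _ "Suc i"]) auto
      moreover have "Suc i < Z" using iN N2_le by (intro n_less_Z) linarith
      ultimately have "wp fill_next I (v(26 := i)) (a(6 := F (Suc i), 7 := F (Suc i))) (T1 - t)" if "t \<le> 50" for t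
        by (intro vc_sound) (use T1' Z1 that in \<open>simp add: fill_next_def\<close>)
      moreover have "(a(7 := F i, 6 := F (Suc i), 7 := F (Suc i))) = a(6 := F (Suc i), 7 := F (Suc i))" by auto
      ultimately show ?thesis using T1' Z1
        by (intro vc_sound) (simp add: fill_body_def v1 a1 v fun_upd_twist[of 7 6] flip: F_Suc; intro conjI impI; linarith)
    qed
  qed
  have "50 \<le> T" using T by linarith
  then show ?thesis using Z1 by (intro vc_sound) (simp add: fill_def loop)
qed

definition grow_next :: stm where
  "grow_next = Asg 24 (V 24 \<oplus> N 1) ;; Asg 25 (V 25 \<oplus> V 25)"

definition grow_body :: stm where
  "grow_body = Blk (rebuild 6 37) ;; Blk grow_next"

definition grow :: stm where
  "grow = Asg 24 (N 1) ;; Asg 25 (N 1) ;; Whl ((V 18 \<prec> V 24) \<doteq> N 0) grow_body"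

definition grow_time :: "nat \<Rightarrow> nat" where
  "grow_time k = (\<Sum>k'=k..K. 150 * (N2 div 2 ^ k' + 1) + 150)"

definition grow_inv :: "(nat \<Rightarrow> bool) \<Rightarrow> vars \<Rightarrow> arrs \<Rightarrow> nat \<Rightarrow> assn" where
  "grow_inv str v0 a0 R v a T \<longleftrightarrow> consts_ok v \<and> 2 \<le> v 20 \<and> dict_ok (a 8) (v 20) \<and>
     (\<forall>j. a 6 j \<le> v 20) \<and> (\<forall>j. a 7 j \<le> v 20) \<and>
     (\<forall>y<N2. a 6 y = 1 + of_bool (str y) \<and> a 7 y = 1 + of_bool (str y)) \<and>
     1 \<le> v 24 \<and> v 24 \<le> K + 1 \<and> v 25 = 2 ^ (v 24 - 1) \<and>
     (\<forall>k. 1 \<le> k \<longrightarrow> k < v 24 \<longrightarrow> lev_ok (a 8) (a 6) 0 k) \<and>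
     (\<forall>r. r \<notin> {20, 24, 25, 26, 27, 28} \<longrightarrow> v r = v0 r) \<and> (\<forall>q. q \<notin> {6, 8} \<longrightarrow> a q = a0 q) \<and>
     v 20 + T < Bn \<and> R + grow_time (v 24) + 20 \<le> T"

lemma grow_body:
  assumes inv: "grow_inv str v0 a0 R v a T" and lt: "v 24 \<le> K" and t: "t \<le> 10"
  shows "wp grow_body (grow_inv str v0 a0 R) v a (T - t)"
proof -
  let ?I = "grow_inv str v0 a0 R"
  define k where "k = v 24"
  have cst: "consts_ok v" and nx0: "2 \<le> v 20" and dict: "dict_ok (a 8) (v 20)"
    and cells: "\<And>j. a 6 j \<le> v 20" "\<And>j. a 7 j \<le> v 20"
    and str: "\<forall>y<N2. a 6 y = 1 + of_bool (str y) \<and> a 7 y = 1 + of_bool (str y)"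
    and k: "1 \<le> k" "k \<le> K" and v25: "v 25 = 2 ^ (k - 1)"
    and lev: "\<And>k'. 1 \<le> k' \<Longrightarrow> k' < k \<Longrightarrow> lev_ok (a 8) (a 6) 0 k'"
    and fr: "\<forall>r. r \<notin> {20, 24, 25, 26, 27, 28} \<longrightarrow> v r = v0 r" and fa: "\<forall>q. q \<notin> {6, 8} \<longrightarrow> a q = a0 q"
    and T: "v 20 + T < Bn" "R + grow_time k + 20 \<le> T"
    using inv lt unfolding grow_inv_def k_def by blast+
  have TT: "R + grow_time (Suc k) + 150 * (N2 div 2 ^ k + 1) + 170 \<le> T"
    using T(2) k(2) unfolding grow_time_def by (simp add: sum.atLeast_Suc_atMost)
  have hh: "2 ^ (k - Suc 0) + 2 ^ (k - Suc 0) = (2::nat) ^ k" using pow_half[OF k(1)] by simp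
  have c: "v 19 = N2" "v 21 = Bn" "v 37 = 0" using cst unfolding consts_ok_def by blast+
  have "wp (rebuild 6 37) (wp grow_next ?I) v a (T - t)"
  proof (rule rebuild[where k = k and \<rho> = 0 and R = "R + grow_time (Suc k) + 80"])
    show "R + grow_time (Suc k) + 80 + 150 * (N2 div 2 ^ k + 1) + 50 \<le> T - t" using TT t by linarith
    show "v 20 + (T - t) < Bn" using T(1) by simp
    fix v1 D1 A1 T1 assume T1: "R + grow_time (Suc k) + 80 \<le> T1" "v1 20 + T1 < Bn" and nx: "v 20 \<le> v1 20"
      and fr1: "\<forall>r. r \<notin> {20, 26, 27, 28} \<longrightarrow> v1 r = v r"
      and dict1: "dict_ok D1 (v1 20)" "dict_ext (a 8) D1" and cells1: "\<And>j. A1 j \<le> v1 20"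
      and lev1: "lev_ok D1 A1 0 k"
      and oth: "\<And>k' i. k' \<noteq> k \<Longrightarrow> i < N2 \<Longrightarrow> A1 (k' * N2 + i) = a 6 (k' * N2 + i)"
    let ?a = "a(8 := D1, 6 := A1)"
    let ?v = "v1(24 := Suc k, 25 := 2 ^ k)"
    have v1: "v1 24 = k" "v1 25 = 2 ^ (k - Suc 0)" using fr1 v25 by (simp_all add: k_def)
    have a1: "?a 8 = D1" "?a 6 = A1" "?a 7 = a 7" by simp_all
    have v24: "?v 24 = Suc k" "?v 20 = v1 20" by simp_all
    have "?I ?v ?a (T1 - t)" if "t \<le> 40" for t
      unfolding grow_inv_def a1 v24
    proof (intro conjI)
      show "consts_ok ?v" using cst fr1 unfolding consts_ok_def by simp
      show "\<forall>y<N2. A1 y = 1 + of_bool (str y) \<and> a 7 y = 1 + of_bool (str y)"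
        using str oth[of 0] k(1) by auto
      show "\<forall>j. a 7 j \<le> v1 20" using cells(2) nx le_trans by blast
      show "\<forall>k'. 1 \<le> k' \<longrightarrow> k' < Suc k \<longrightarrow> lev_ok D1 A1 0 k'"
      proof (intro allI impI)
        fix k' assume k': "1 \<le> k'" "k' < Suc k"
        show "lev_ok D1 A1 0 k'"
        proof (cases "k' = k")
          case False
          then have "k' < k" using k' by simp
          then show ?thesis using oth k' by (intro lev_ok_cong[OF lev dict1(2)]) auto
        qed (use lev1 in simp)
      qed
      show "\<forall>r. r \<notin> {20, 24, 25, 26, 27, 28} \<longrightarrow> ?v r = v0 r" using fr fr1 by simp
      show "R + grow_time (Suc k) + 20 \<le> T1 - t" using T1(1) that by linarith
    qed (use k nx nx0 dict1 cells1 fa T1 in auto)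
    moreover have "80 \<le> T1" using T1 by linarith
    moreover have "Suc k < Z" "2 ^ k < Z" "Suc 0 < Z"
      using k K_le pow_le[OF k(2)] N2_le by (auto intro!: n_less_Z)
    ultimately show "wp grow_next ?I v1 ?a T1"
      by (intro vc_sound) (simp add: grow_next_def v1 hh)
  qed (use k v25 c dict cells in \<open>auto simp: k_def\<close>)
  then show ?thesis by (intro vc_sound) (simp add: grow_body_def vc_Blk)
qed

lemma grow:
  assumes cst: "consts_ok v" "2 \<le> v 20" and dict: "dict_ok (a 8) (v 20)"
    and cells: "\<And>j. a 6 j \<le> v 20" "\<And>j. a 7 j \<le> v 20"
    and str: "\<And>y. y < N2 \<Longrightarrow> a 6 y = 1 + of_bool (str y)" "\<And>y. y < N2 \<Longrightarrow> a 7 y = 1 + of_bool (str y)"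
    and T: "v 20 + T < Bn" "R + grow_time 1 + 100 \<le> T"
    and post: "\<And>v' a' T'. R \<le> T' \<Longrightarrow> v' 20 + T' < Bn \<Longrightarrow> base_ok str v' a' \<Longrightarrow>
      \<forall>r. r \<notin> {20, 24, 25, 26, 27, 28} \<longrightarrow> v' r = v r \<Longrightarrow> \<forall>q. q \<notin> {6, 8} \<longrightarrow> a' q = a q \<Longrightarrow> Q v' a' T'"
  shows "wp grow Q v a T"
proof -
  let ?I = "grow_inv str v a R"
  let ?e = "(V 18 \<prec> V 24) \<doteq> N 0"
  let ?v = "v(24 := Suc 0, 25 := Suc 0)"
  have Z1: "0 < Z" "Suc 0 < Z" using n_less_Z by simp_all
  have loop: "wp (Whl ?e grow_body) Q ?v a (T - t)" if t: "t \<le> 30" for t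
  proof (rule wp_Whl[where I = ?I])
    show "?I ?v a (T - t)"
      unfolding grow_inv_def
    proof (intro conjI)
      show "consts_ok ?v" using cst unfolding consts_ok_def by simp
      show "R + grow_time (?v 24) + 20 \<le> T - t" using T(2) t by simp
    qed (use cst dict cells str T in auto)
    fix v1 a1 T1 assume I: "?I v1 a1 T1"
    have cst1: "consts_ok v1" and k: "1 \<le> v1 24" "v1 24 \<le> K + 1"
      and T1: "v1 20 + T1 < Bn" "R + grow_time (v1 24) + 20 \<le> T1"
      using I unfolding grow_inv_def by blast+
    have v18: "v1 18 = K" using cst1 unfolding consts_ok_def by blast
    show "eok v1 a1 ?e \<and> ecost ?e + 1 \<le> T1" using T1(2) Z1 by simp
    show "wp grow_body ?I v1 a1 (T1 - (ecost ?e + 1))" if "ev v1 a1 ?e \<noteq> 0"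
    proof -
      have "v1 24 \<le> K" using that v18 by (simp split: if_splits)
      then show ?thesis by (rule grow_body[OF I]) simp
    qed
    show "Q v1 a1 (T1 - (ecost ?e + 1))" if "ev v1 a1 ?e = 0"
    proof (rule post)
      have "v1 24 = Suc K" using that v18 k by (simp split: if_splits)
      moreover have "\<forall>k. 1 \<le> k \<longrightarrow> k < v1 24 \<longrightarrow> lev_ok (a1 8) (a1 6) 0 k"
        using I unfolding grow_inv_def by blast
      ultimately have "tree_ok (a1 8) (a1 6) 0" unfolding tree_ok_def by simp
      moreover note I[unfolded grow_inv_def]
      ultimately show "base_ok str v1 a1"
        unfolding base_ok_def by (elim conjE, intro conjI) assumption+
      show "R \<le> T1 - (ecost ?e + 1)" "v1 20 + (T1 - (ecost ?e + 1)) < Bn" using T1 by auto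
      show "\<forall>r. r \<notin> {20, 24, 25, 26, 27, 28} \<longrightarrow> v1 r = v r" "\<forall>q. q \<notin> {6, 8} \<longrightarrow> a1 q = a q"
        using I unfolding grow_inv_def by blast+
    qed
  qed
  have "100 \<le> T" using T(2) by linarith
  then show ?thesis using Z1 by (intro vc_sound) (simp add: grow_def loop; intro conjI; linarith)
qed

definition setup_consts :: stm where
  "setup_consts = Asg 19 (V 17 \<oplus> V 17) ;; Asg 20 (N 2) ;; Asg 21 ((V 0 \<otimes> V 0) \<otimes> (V 0 \<otimes> V 0)) ;; Asg 37 (N 0)"

definition residues :: stm where
  "residues = Blk setup_sizes ;; Blk setup_consts ;; Blk fill ;; Blk grow ;; Blk main_loop"

abbreviation "residues_time \<equiv> 40 * K + 60 * N2 + grow_time 1 + main_time 0 +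
  (item_time + 50) * n + new_time * d + 400"

text \<open>\<open>T + 2 < n ^ 4\<close> starts the invariant on names: two names, for absent and
  present, are in use before the first block is named.\<close>

lemma residues:
  assumes v: "v 16 = d" "v 0 = n" and a: "\<And>q. q \<in> {6, 7, 8} \<Longrightarrow> a q = (\<lambda>_. 0)"
    and a5: "a 5 = count (image_mset (\<lambda>x. x mod d) (mset xs))"
    and T: "T + 2 < n ^ 4" "R + residues_time \<le> T"
    and post: "\<And>v' a' T'. R \<le> T' \<Longrightarrow> (\<And>y. y < d \<Longrightarrow> a' 6 y = 1 + of_bool (y \<in> residue_sums d (mset xs))) \<Longrightarrow>
      \<forall>r. r \<notin> {17..37} \<longrightarrow> v' r = v r \<Longrightarrow> Q v' a' T'"
  shows "wp residues Q v a T"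
proof -
  let ?H = "image_mset (\<lambda>x. x mod d) (mset xs)"
  define R4 where "R4 = R + main_time 0 + (item_time + 50) * n + new_time * d + 50"
  define R3 where "R3 = R4 + grow_time 1 + 100"
  define R2 where "R2 = R3 + 60 * N2 + 50"
  have TT: "R2 + 100 + 40 * K + 40 \<le> T" using T(2) unfolding R2_def R3_def R4_def by linarith
  have "wp setup_sizes (wp setup_consts (wp fill (wp grow (wp main_loop Q)))) v a T"
  proof (rule setup_sizes[where R = "R2 + 100"])
    fix T1 assume T1: "R2 + 100 \<le> T1" "T1 \<le> T"
    let ?v1 = "v(17 := Nn, 18 := K)"
    let ?v2 = "?v1(19 := N2, 20 := 2, 21 := Bn, 37 := 0)"
    have "wp fill (wp grow (wp main_loop Q)) ?v2 a (T1 - t)" if t: "t \<le> 60" for t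
    proof (rule fill[where R = R3])
      show "R3 + 60 * N2 + 50 \<le> T1 - t" using T1 t unfolding R2_def by linarith
      fix A :: "nat \<Rightarrow> nat" and i T2 assume T2: "R3 \<le> T2" "T2 \<le> T1 - t" and A: "\<And>j. A j \<le> 2"
        "\<And>y. y < N2 \<Longrightarrow> A y = 1 + of_bool (y mod d \<in> {0})"
      let ?a2 = "a(6 := A, 7 := A)"
      show "wp grow (wp main_loop Q) (?v2(26 := i)) ?a2 T2"
      proof (rule grow[where R = R4 and str = "in_res {0}"])
        show "consts_ok (?v2(26 := i))" using v unfolding consts_ok_def by simp
        show "dict_ok (?a2 8) ((?v2(26 := i)) 20)" using a[of 8] unfolding dict_ok_def by simp
        show "(?v2(26 := i)) 20 + T2 < Bn" using T2(2) T1(2) T(1) unfolding Bn by simp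
        show "R4 + grow_time 1 + 100 \<le> T2" using T2(1) unfolding R3_def .
        fix v3 a3 T3 assume T3: "R4 \<le> T3" "v3 20 + T3 < Bn" and base: "base_ok (in_res {0}) v3 a3"
          and fr3: "\<forall>r. r \<notin> {20, 24, 25, 26, 27, 28} \<longrightarrow> v3 r = (?v2(26 := i)) r"
          and fa3: "\<forall>q. q \<notin> {6, 8} \<longrightarrow> a3 q = ?a2 q"
        show "wp main_loop Q v3 a3 T3"
        proof (rule main_loop[OF base _ _ T3(2), where H = ?H and R = R])
          show "a3 5 = count ?H" using fa3 a5 by simp
          show "x < Nn" if "x \<in># ?H" for x
          proof -
            have "x < d" using that d1 by auto
            then show ?thesis using dN(1) by linarith
          qed
          show "R + main_time 0 + (item_time + 50) * size ?H + new_time * d + 50 \<le> T3"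
            using T3(1) unfolding R4_def size_image_mset size_mset n_def[symmetric] .
          fix v4 and a4 :: arrs and T4 assume T4: "R \<le> T4" and a4: "\<And>y. y < N2 \<Longrightarrow> a4 6 y = 1 + of_bool (y mod d \<in> residue_sums d ?H)"
            and fr4: "\<forall>r. r \<notin> process_regs \<union> {22, 23, 35, 36} \<longrightarrow> v4 r = v3 r"
          show "Q v4 a4 T4"
          proof (rule post[OF T4])
            show "a4 6 y = 1 + of_bool (y \<in> residue_sums d (mset xs))" if "y < d" for y
              using a4[of y] that dN(1) N2_le(2) by (simp add: residue_sums_mod)
            show "\<forall>r. r \<notin> {17..37} \<longrightarrow> v4 r = v r"
            proof (intro allI impI)
              fix r :: nat assume r: "r \<notin> {17..37}"
              have "r \<notin> process_regs \<union> {22, 23, 35, 36}" using r by auto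
              then have "v4 r = v3 r" using fr4 by blast
              also have "r \<notin> {20, 24, 25, 26, 27, 28}" using r by auto
              then have "v3 r = (?v2(26 := i)) r" using fr3 by blast
              also have "\<dots> = v r" using r by auto
              finally show "v4 r = v r" .
            qed
          qed
        qed
      qed (use A in auto)
    qed (use v a in auto)
    moreover have "100 \<le> T1" using T1 by linarith
    moreover have "Nn + Nn < Z" using N2_le(1) N2 by (intro n_less_Z) linarith
    moreover have "0 < Z" "2 < Z" using n_less_Z by simp_all
    moreover have "n * n < Z" by (rule less_Z_quad) linarith
    moreover have "n * n * (n * n) = Bn" unfolding Bn by (simp add: eval_nat_numeral)
    moreover have "Bn < Z" by (rule name_bound(3)) simp
    ultimately show "wp setup_consts (wp fill (wp grow (wp main_loop Q))) ?v1 a T1"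
      using v N2[symmetric] by (intro vc_sound) (simp add: setup_consts_def mult_2; intro conjI; linarith)
  qed (use TT v in simp_all)
  then show ?thesis by (intro vc_sound) (simp add: residues_def vc_Blk vc_Sq)
qed

end

section \<open>Running time\<close>

lemma card_multiples_le:
  assumes "k \<le> K"
  shows "card {c::nat. c < 2 ^ K \<and> 2 ^ (K - k) dvd c} \<le> (2::nat) ^ k"
proof -
  have "{c::nat. c < 2 ^ K \<and> 2 ^ (K - k) dvd c} \<subseteq> (\<lambda>i. 2 ^ (K - k) * i) ` {..<(2::nat) ^ k}"
  proof
    fix c :: nat assume "c \<in> {c. c < 2 ^ K \<and> 2 ^ (K - k) dvd c}"
    then obtain i where i: "c = 2 ^ (K - k) * i" "2 ^ (K - k) * i < 2 ^ K" by (auto elim: dvdE)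
    have "(2::nat) ^ K = 2 ^ (K - k) * 2 ^ k" using assms by (simp flip: power_add)
    then have "i < 2 ^ k" using i(2) by simp
    then show "c \<in> (\<lambda>i. 2 ^ (K - k) * i) ` {..<2 ^ k}" using i(1) by blast
  qed
  then have "card {c::nat. c < 2 ^ K \<and> 2 ^ (K - k) dvd c} \<le> card {..<(2::nat) ^ k}"
    by (rule surj_card_le[OF finite_lessThan])
  then show ?thesis by simp
qed

text \<open>Trial divisor \<open>d\<close> costs a constant times \<open>L / d\<close>; the harmonic
  sum supplies the only logarithm.\<close>

lemma (in instance_ram) search_time_le: "real search_time \<le> 190 * (real n * log 2 (real n))"
proof -
  define l where "l = log 2 (real n)"
  have L: "1 \<le> L" "2 * L \<le> n" by (rule L_ge) simp
  have l1: "1 \<le> l" unfolding l_def using n_ge by simp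
  have "real search_time = (\<Sum>d=1..L. 40 * real (Suc L div d) + 150)"
    unfolding search_time_def atLeastLessThanSuc_atLeastAtMost by (simp add: add.commute)
  also have "\<dots> \<le> (\<Sum>d=1..L. 40 * real (Suc L) * (1 / real d) + 150)"
  proof (rule sum_mono)
    fix d assume "d \<in> {1..L}"
    have "real (Suc L div d) \<le> real (Suc L) / real d" by (rule of_nat_div_le_of_nat)
    then have "40 * real (Suc L div d) \<le> 40 * (real (Suc L) / real d)" by linarith
    then show "40 * real (Suc L div d) + 150 \<le> 40 * real (Suc L) * (1 / real d) + 150" by simp
  qed
  also have "\<dots> = 40 * real (Suc L) * (\<Sum>d=1..L. 1 / real d) + 150 * real L"
    by (simp add: sum.distrib sum_distrib_left)
  also have "\<dots> \<le> 40 * real n * l + 150 * real n"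
  proof (intro add_mono mult_mono)
    have "(\<Sum>d=1..L. 1 / real d) \<le> log 2 (2 * real L)" by (rule harmonic_le_log) (use L in simp)
    also have "\<dots> \<le> l" unfolding l_def using L by (intro log_mono) auto
    finally show "(\<Sum>d=1..L. 1 / real d) \<le> l" .
  qed (use L in \<open>auto intro!: sum_nonneg\<close>)
  also have "\<dots> \<le> 40 * real n * l + 150 * (real n * l)"
    using mult_left_mono[OF l1, of "real n"] by linarith
  finally show ?thesis unfolding l_def by simp
qed

context shift_tree
begin

lemma grow_time_le: "grow_time 1 \<le> K * (150 * N2 + 300)"
proof -
  have "grow_time 1 \<le> (\<Sum>k=1..K. 150 * N2 + 300)"
    unfolding grow_time_def
  proof (rule sum_mono)
    fix k :: nat
    have "N2 div 2 ^ k \<le> N2" by simp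
    then show "150 * (N2 div 2 ^ k + 1) + 150 \<le> 150 * N2 + 300" by simp
  qed
  then show ?thesis by simp
qed

text \<open>Level \<open>k\<close> is rebuilt for at most \<open>2 ^ k\<close> of the
  \<open>Nn\<close> indices and has about \<open>N2 / 2 ^ k\<close> blocks, so each level costs
  linear time altogether; this is the gain from bit reversal. The constant is
  \<open>650 = 150 + 2 * 150 + 200\<close>.\<close>

lemma main_time_le: "main_time 0 \<le> 650 * (K * Nn) + 250 * Nn"
proof -
  have lev: "(\<Sum>c=0..<Nn. level_time c k) \<le> 650 * Nn" if k: "k \<le> K" for k
  proof -
    define B where "B = 150 * (N2 div 2 ^ k) + 200"
    have "(\<Sum>c=0..<Nn. level_time c k) = (\<Sum>c=0..<Nn. 150 + (if 2 ^ (K - k) dvd c then B else 0))"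
      unfolding level_time_def B_def by (intro sum.cong) auto
    also have "\<dots> = 150 * Nn + (\<Sum>c=0..<Nn. if 2 ^ (K - k) dvd c then B else 0)"
      by (simp add: sum.distrib)
    also have "(\<Sum>c=0..<Nn. if 2 ^ (K - k) dvd c then B else 0) = card {c::nat. c < 2 ^ K \<and> 2 ^ (K - k) dvd c} * B"
      unfolding Nn by (subst sum.inter_filter[symmetric]) auto
    also have "\<dots> \<le> 2 ^ k * B" using card_multiples_le[OF k] by (rule mult_le_mono1)
    also have "2 ^ k * B = 150 * (N2 div 2 ^ k * 2 ^ k) + 200 * 2 ^ k" by (simp add: B_def algebra_simps)
    also have "\<dots> \<le> 150 * N2 + 200 * Nn"
      by (intro add_mono mult_le_mono2 div_times_less_eq_dividend pow_le[OF k])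
    finally show ?thesis using N2 by linarith
  qed
  have "main_time 0 = (\<Sum>k=1..K. \<Sum>c=0..<Nn. level_time c k) + 250 * Nn"
    unfolding main_time_def by (subst sum.swap) (simp add: sum.distrib)
  also have "(\<Sum>k=1..K. \<Sum>c=0..<Nn. level_time c k) \<le> (\<Sum>k=1..K. 650 * Nn)"
    by (intro sum_mono lev) simp
  finally show ?thesis by simp
qed

lemma K_le_log: "real K \<le> log 2 (real n)"
proof -
  have "real (2 ^ K) \<le> real n" unfolding of_nat_le_iff using N2_le Nn by linarith
  then show ?thesis using n_ge by (simp add: le_log_iff powr_realpow)
qed

lemma residues_time_le: "real residues_time \<le> 6200 * (real n * log 2 (real n))"
proof -
  define l where "l = log 2 (real n)"
  have l1: "1 \<le> l" unfolding l_def using n_ge by simp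
  have K: "real K \<le> l" unfolding l_def by (rule K_le_log)
  have n1: "real n \<le> real n * l" using mult_left_mono[OF l1, of "real n"] by simp
  have Kn: "real (K * m) \<le> real n * l" if "m \<le> n" for m
  proof -
    have "real K * real m \<le> l * real n" using K that l1 by (intro mult_mono) auto
    then show ?thesis by (simp add: mult.commute)
  qed
  have le: "Nn \<le> n" "N2 \<le> n" "d \<le> n" "K \<le> n" using N2_le dN K_le by linarith+
  have "residues_time \<le> 40 * K + 60 * N2 + K * (150 * N2 + 300) + (650 * (K * Nn) + 250 * Nn) +
      (item_time + 50) * n + new_time * d + 400"
    using grow_time_le main_time_le by linarith
  also have "\<dots> = 150 * (K * N2) + 650 * (K * Nn) + 100 * (K * n) + 2980 * (K * d) + 340 * (K * 1)
      + 60 * N2 + 250 * Nn + 450 * n + 1150 * d + 400"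
    by (simp add: algebra_simps)
  finally have "real residues_time \<le> real (150 * (K * N2) + 650 * (K * Nn) + 100 * (K * n) + 2980 * (K * d) + 340 * (K * 1)
      + 60 * N2 + 250 * Nn + 450 * n + 1150 * d + 400)" unfolding of_nat_le_iff .
  also have "\<dots> = 150 * real (K * N2) + 650 * real (K * Nn) + 100 * real (K * n) + 2980 * real (K * d) + 340 * real (K * 1)
      + 60 * real N2 + 250 * real Nn + 450 * real n + 1150 * real d + 400" by simp
  also have "\<dots> \<le> 150 * (real n * l) + 650 * (real n * l) + 100 * (real n * l) + 2980 * (real n * l) + 340 * (real n * l)
      + 60 * real n + 250 * real n + 450 * real n + 1150 * real n + real n"
    using le n_ge by (intro add_mono mult_left_mono Kn) auto
  also have "\<dots> \<le> 6200 * (real n * l)" using n1 by linarith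
  finally show ?thesis unfolding l_def .
qed

end

section \<open>Preprocessing and queries\<close>

text \<open>The programs defined in the locales mention none of the locale parameters, so they are
  closed constants and one program serves all inputs and word sizes. The four leading instructions
  compute the stride as \<open>n ^ 8 * n ^ 2\<close>.\<close>

definition preprocess :: com where
  "preprocess = Seq (Seq (Arith 51 Times 0 0) (Seq (Arith 52 Times 51 51)
     (Seq (Arith 53 Times 52 52) (Arith 50 Times 53 51))))
     (compile (Blk instance_ram.find_modulus ;; Blk (instance_ram.hist 5 16) ;; Blk shift_tree.residues))"

text \<open>Subtracting 1 turns the names 1 and 2 of absent and present residues into the
  answer.\<close>

definition lookup :: stm where
  "lookup = Asg 0 (Arr 6 (V 1 \<odot> V 16) \<ominus> N 1)"

context instance_ram
begin

definition prepared :: "vars \<Rightarrow> arrs \<Rightarrow> bool" where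
  "prepared v a \<longleftrightarrow> is_modulus (v 16) (mset xs) \<and>
     (\<forall>y < v 16. a 6 y = 1 + of_bool (y \<in> residue_sums (v 16) (mset xs)))"

lemma wp_residues:
  assumes v: "v 0 = n" "v 16 = d" "is_modulus d (mset xs)" and a: "\<And>q. q \<in> {6, 7, 8} \<Longrightarrow> a q = (\<lambda>_. 0)"
    and a5: "a 5 = count (image_mset (\<lambda>x. x mod d) (mset xs))"
    and T: "T + 2 < n ^ 4" "6200 * (real n * log 2 (real n)) \<le> real T"
    and post: "\<And>v' a' T'. prepared v' a' \<Longrightarrow> v' 1 = v 1 \<Longrightarrow> Q v' a' T'"
  shows "wp shift_tree.residues Q v a T"
proof -
  have d: "1 \<le> d" "d \<le> n div 1000" using v(3) unfolding is_modulus_def by (simp_all add: n_def)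
  have "\<exists>K. d \<le> 2 ^ K \<and> (2::nat) ^ K < 2 * d"
    using d(1)
  proof (induction d rule: dec_induct)
    case (step m)
    then obtain K where K: "m \<le> 2 ^ K" "(2::nat) ^ K < 2 * m" by blast
    show ?case
    proof (cases "m = 2 ^ K")
      case True then show ?thesis by (intro exI[of _ "Suc K"]) simp
    next
      case False then show ?thesis using K by (intro exI[of _ K]) simp
    qed
  qed (intro exI[of _ 0], simp)
  then obtain K where K: "d \<le> 2 ^ K" "(2::nat) ^ K < 2 * d" by blast
  interpret shift_tree w Z xs n "2 * 2 ^ K" "n ^ 4" K d "2 ^ K"
    by unfold_locales (use d K in auto)
  show ?thesis
  proof (rule residues[where R = 0])
    have "real residues_time \<le> real T" using residues_time_le T(2) by linarith
    then show "0 + residues_time \<le> T" unfolding of_nat_le_iff by linarith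
    fix v' and a' :: arrs and T' assume a': "\<And>y. y < d \<Longrightarrow> a' 6 y = 1 + of_bool (y \<in> residue_sums d (mset xs))"
      and fr: "\<forall>r. r \<notin> {17..37} \<longrightarrow> v' r = v r"
    have "v' 16 = d" "v' 1 = v 1" using fr v by simp_all
    then show "Q v' a' T'" using a' v(3) by (intro post) (simp_all add: prepared_def)
  qed (use v a a5 T in auto)
qed

lemma wp_preprocess:
  assumes v: "v 0 = n" "v 9 = 0" and a0: "\<And>i. i < n \<Longrightarrow> a 0 i = xs ! i" and az: "\<And>q. q \<noteq> 0 \<Longrightarrow> a q = (\<lambda>_. 0)"
    and T: "T + 2 < n ^ 4" "6902 * (real n * log 2 (real n)) \<le> real T"
    and post: "\<And>v' a' T'. prepared v' a' \<Longrightarrow> v' 1 = v 1 \<Longrightarrow> Q v' a' T'"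
  shows "wp (Blk find_modulus ;; Blk (hist 5 16) ;; Blk shift_tree.residues) Q v a T"
proof -
  define l where "l = log 2 (real n)"
  have l1: "1 \<le> l" unfolding l_def using n_ge by simp
  have n1: "real n \<le> real n * l" using mult_left_mono[OF l1, of "real n"] by simp
  have nr: "1300 \<le> real n" using n_ge by simp
  define R where "R = nat \<lceil>6200 * (real n * l)\<rceil>"
  have R: "6200 * (real n * l) \<le> real R" "real R \<le> 6200 * (real n * l) + 1"
    unfolding R_def using n1 nr by linarith+
  have "real (R + 60 * n + 60 + 260 * n + 2 * search_time + 400) \<le> real T"
    using R(2) search_time_le n1 nr T(2)
    unfolding l_def[symmetric] of_nat_add of_nat_mult of_nat_numeral by linarith
  then have TT: "R + 60 * n + 60 + 260 * n + 2 * search_time + 400 \<le> T" unfolding of_nat_le_iff .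
  have "wp find_modulus (\<lambda>v' a' T'. T' \<le> T \<longrightarrow> wp (hist 5 16) (wp shift_tree.residues Q) v' a' T') v a T"
  proof (rule find_modulus[where R = "R + 60 * n + 60"])
    fix v1 a1 T1 assume T1: "R + 60 * n + 60 \<le> T1" and fr1: "\<forall>r. r \<notin> {2..16} \<longrightarrow> v1 r = v r"
      and fa1: "\<forall>q. q \<notin> {2, 3, 4, 10} \<longrightarrow> a1 q = a q" and d: "is_modulus (v1 16) (mset xs)"
    show "T1 \<le> T \<longrightarrow> wp (hist 5 16) (wp shift_tree.residues Q) v1 a1 T1"
    proof
      assume T1T: "T1 \<le> T"
      have v1: "v1 0 = n" "v1 1 = v 1" using fr1 v by auto
      have az1: "a1 q = (\<lambda>_. 0)" if "q \<in> {5, 6, 7, 8}" for q using that fa1 az by auto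
      have a01: "a1 0 i = xs ! i" if "i < n" for i using that fa1 a0 by simp
      have "wp (hist 5 16) (\<lambda>v' a' T'. T' \<le> T1 \<longrightarrow> wp shift_tree.residues Q v' a' T') v1 a1 T1"
      proof (rule hist[where m = "v1 16" and R = R])
        fix v2 T2 assume T2: "R \<le> T2" and fr2: "\<forall>r. r \<notin> {3, 4} \<longrightarrow> v2 r = v1 r"
        let ?a2 = "a1(5 := count (image_mset (\<lambda>x. x mod v1 16) (mset xs)))"
        show "T2 \<le> T1 \<longrightarrow> wp shift_tree.residues Q v2 ?a2 T2"
        proof
          assume T21: "T2 \<le> T1"
          have v2: "v2 0 = n" "v2 16 = v1 16" "v2 1 = v 1" using fr2 v1 by simp_all
          show "wp shift_tree.residues Q v2 ?a2 T2"
          proof (rule wp_residues[OF v2(1,2) d])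
            show "T2 + 2 < n ^ 4" using T21 T1T T(1) by linarith
            have "real R \<le> real T2" using T2 by simp
            then show "6200 * (real n * log 2 (real n)) \<le> real T2" using R(1) unfolding l_def by linarith
            show "Q v' a' T'" if "prepared v' a'" "v' 1 = v2 1" for v' a' T'
              using post[OF that(1)] that(2) v2(3) by simp
            show "?a2 q = (\<lambda>_. 0)" if "q \<in> {6, 7, 8}" for q
            proof -
              have "a1 q = (\<lambda>_. 0)" by (rule az1) (use that in blast)
              moreover have "q \<noteq> 5" using that by auto
              ultimately show ?thesis by simp
            qed
          qed simp
        qed
      next
        show "a1 5 = (\<lambda>_. 0)" by (rule az1) simp
      qed (use v1 a01 T1 in simp_all)
      then show "wp (hist 5 16) (wp shift_tree.residues Q) v1 a1 T1" by (rule wp_fuel)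
    qed
  qed (use v a0 az TT in auto)
  then have "wp find_modulus (wp (hist 5 16) (wp shift_tree.residues Q)) v a T" by (rule wp_fuel)
  then show ?thesis by (intro vc_sound) (simp add: vc_Blk vc_Sq)
qed

text \<open>A target is already in register 1, so that the lemma serves both statements:
  \<open>t = 0\<close> is the plain input state, and in the one-shot program the target survives
  until the lookup.\<close>

lemma preprocess:
  assumes t: "t < Z"
  shows "\<exists>k s v a. exec w preprocess (with_target t (input xs)) k s \<and> real k \<le> 7000 * (real n * log 2 (real n)) \<and>
    rel v a s \<and> prepared v a \<and> v 1 = t"
proof -
  define l where "l = log 2 (real n)"
  have l1: "1 \<le> l" unfolding l_def using n_ge by simp
  have n1: "real n \<le> real n * l" using mult_left_mono[OF l1, of "real n"] by simp
  have nr: "1300 \<le> real n" using n_ge by simp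
  define T where "T = nat \<lceil>6902 * (real n * l)\<rceil>"
  have T: "6902 * (real n * l) \<le> real T" "real T \<le> 6902 * (real n * l) + 1"
    unfolding T_def using n1 nr by linarith+
  \<comment> \<open>The logarithm is at most \<open>n\<close>, so the time is quadratic at worst,
    far below the bound \<open>n ^ 4\<close> on names.\<close>
  have T4: "T + 2 < n ^ 4"
  proof -
    have "log 2 (real n) \<le> log 2 (2 ^ n)" using n_ge less_exp[of n]
      by (intro log_mono) (auto simp: of_nat_less_numeral_power_cancel_iff less_imp_le)
    then have "l \<le> real n" by (simp add: l_def)
    then have "real n * l \<le> real n * real n" by (intro mult_left_mono) auto
    then have "real T \<le> real (6903 * (n * n))" using T(2) n1 nr
      unfolding of_nat_mult of_nat_numeral by linarith
    then have "T + 2 < 7000 * (n * n)" unfolding of_nat_le_iff using n_le_cube(3) by linarith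
    also have "\<dots> \<le> (1300 * 1300) * (n * n)" by simp
    also have "\<dots> \<le> (n * n) * (n * n)" using n_ge by (intro mult_le_mono) auto
    also have "\<dots> = n ^ 4" by (simp add: eval_nat_numeral)
    finally show ?thesis .
  qed
  let ?s0 = "with_target t (input xs)"
  let ?set = "Seq (Arith 51 Times 0 0) (Seq (Arith 52 Times 51 51) (Seq (Arith 53 Times 52 52) (Arith 50 Times 53 51)))"
  let ?s1 = "set_reg 51 (binop_val Times (regs ?s0 0) (regs ?s0 0) mod 2 ^ w) ?s0"
  let ?s2 = "set_reg 52 (binop_val Times (regs ?s1 51) (regs ?s1 51) mod 2 ^ w) ?s1"
  let ?s3 = "set_reg 53 (binop_val Times (regs ?s2 52) (regs ?s2 52) mod 2 ^ w) ?s2"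
  let ?s4 = "set_reg 50 (binop_val Times (regs ?s3 53) (regs ?s3 51) mod 2 ^ w) ?s3"
  have ex: "exec w ?set ?s0 (1 + (1 + (1 + 1))) ?s4"
    by (rule exec.Seq exec.Arith)+
  have pw: "n ^ j \<le> Z" if "j \<le> 10" for j unfolding Z_def using n_ge that by (intro power_increasing) auto
  have Zw: "Z < 2 ^ w" using word Z2 by linarith
  have m: "n ^ j mod 2 ^ w = n ^ j" if "j \<le> 10" for j using pw[OF that] Zw by simp
  define v :: vars where "v = (\<lambda>_. 0)(0 := n, 1 := t)"
  define a :: arrs where "a q i = (if q = 0 \<and> i < n then xs ! i else 0)" for q i
  have r0: "regs ?s0 0 = n" by (simp add: with_target_def set_reg_def input_def n_def)
  have e: "n * n = n ^ 2" "n ^ 2 * n ^ 2 = n ^ 4" "n ^ 4 * n ^ 4 = n ^ 8" "n ^ 8 * n ^ 2 = n ^ 10"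
    by (simp_all add: eval_nat_numeral)
  have r1: "regs ?s1 51 = n ^ 2" using m[of 2] r0 e by (simp add: set_reg_def)
  have r2: "regs ?s2 52 = n ^ 4" "regs ?s2 51 = n ^ 2" using m[of 4] r1 e by (simp_all add: set_reg_def)
  have r3: "regs ?s3 53 = n ^ 8" "regs ?s3 51 = n ^ 2" using m[of 8] r2 e by (simp_all add: set_reg_def)
  have r4: "regs ?s4 50 = Z" using m[of 10] r3 e by (simp add: set_reg_def Z_def)
  have "rel v a ?s4" unfolding rel_def
  proof (intro conjI allI impI)
    show "regs ?s4 x = v x" if "x < 50" for x
      using that by (simp add: set_reg_def v_def with_target_def input_def n_def)
    show "regs ?s4 50 = Z" by (rule r4)
    show "mem ?s4 (q * Z + i) = a q i" if "q < 20" "i < Z" for q i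
    proof -
      have nZ: "n < Z" by (rule n_less_Z) simp
      have "q * Z + i < n \<longleftrightarrow> q = 0 \<and> i < n"
      proof (cases q)
        case (Suc p)
        then have "Z \<le> q * Z + i" by simp
        then show ?thesis using nZ Suc by linarith
      qed simp
      then show ?thesis by (auto simp: set_reg_def with_target_def input_def a_def n_def)
    qed
    show "v x < Z" for x using t n_less_Z by (simp add: v_def)
    show "a q i < Z" for q i
    proof (cases "q = 0 \<and> i < n")
      case True
      then have "a q i < n * n" using xs_range[of "xs ! i"] by (simp add: a_def n_def)
      then show ?thesis by (intro less_Z_quad) linarith
    next
      case False
      moreover have "0 < Z" by (rule n_less_Z) simp
      ultimately show ?thesis unfolding a_def by (simp only: if_False)
    qed
  qed
  moreover have "wp (Blk find_modulus ;; Blk (hist 5 16) ;; Blk shift_tree.residues)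
    (\<lambda>v' a' T'. prepared v' a' \<and> v' 1 = t) v a T"
    by (rule wp_preprocess) (use T T4 in \<open>auto simp: v_def a_def l_def\<close>)
  ultimately obtain k s v' a' T' where k: "exec w (compile (Blk find_modulus ;; Blk (hist 5 16) ;; Blk shift_tree.residues)) ?s4 k s"
    "k + T' \<le> T" "rel v' a' s" "prepared v' a'" "v' 1 = t"
    unfolding wp_def by blast
  have "exec w preprocess ?s0 (1 + (1 + (1 + 1)) + k) s"
    unfolding preprocess_def by (rule exec.Seq[OF ex k(1)])
  moreover have "real (1 + (1 + (1 + 1)) + k) \<le> 7000 * (real n * log 2 (real n))"
    using k(2) T(2) n1 nr unfolding l_def[symmetric] by linarith
  ultimately show ?thesis using k(3-5) by blast
qed

lemma lookup:
  assumes s: "rel v a s" "prepared v a" and t: "v 1 = t"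
    and iff: "\<And>d. is_modulus d (mset xs) \<Longrightarrow> t \<in> subset_sums (mset xs) \<longleftrightarrow> t mod d \<in> residue_sums d (mset xs)"
  shows "\<exists>k s' v'. exec w (compile lookup) s k s' \<and> k \<le> 13 \<and> rel v' a s' \<and> prepared v' a \<and>
    regs s' 0 = of_bool (t \<in> subset_sums (mset xs))"
proof -
  let ?b = "of_bool (t \<in> subset_sums (mset xs)) :: nat"
  have d: "is_modulus (v 16) (mset xs)" using s(2) unfolding prepared_def by blast
  then have "t mod v 16 < v 16" unfolding is_modulus_def by simp
  then have a6: "a 6 (t mod v 16) = Suc ?b" using s(2) iff[OF d] unfolding prepared_def by simp
  have "Suc 0 < Z" using n_less_Z by simp
  then have "wp lookup (\<lambda>v' a' T'. v' = v(0 := ?b) \<and> a' = a) v a 13"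
    by (intro vc_sound) (simp add: lookup_def t[simplified] a6)
  then obtain k s' T' where k: "exec w (compile lookup) s k s'" "k + T' \<le> 13" "rel (v(0 := ?b)) a s'"
    using s(1) unfolding wp_def by blast
  have "prepared (v(0 := ?b)) a" using s(2) unfolding prepared_def by simp
  moreover have "regs s' 0 = ?b" using k(3) unfolding rel_def by simp
  ultimately show ?thesis using k by (intro exI[of _ k] exI[of _ s'] exI[of _ "v(0 := ?b)"]) simp
qed

lemma rel_with_target: "rel v a s \<Longrightarrow> t < Z \<Longrightarrow> rel (v(1 := t)) a (with_target t s)"
  unfolding rel_def with_target_def set_reg_def by simp

text \<open>Among the variables a query changes only registers 0 and 1, and it changes no array, so
  the prepared state survives any sequence of queries.\<close>

lemma serves_lookup:
  assumes "rel v a s" "prepared v a"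
    and "\<And>t. t \<in> set ts \<Longrightarrow> t < Z"
    and "\<And>t d. t \<in> set ts \<Longrightarrow> is_modulus d (mset xs) \<Longrightarrow>
      t \<in> subset_sums (mset xs) \<longleftrightarrow> t mod d \<in> residue_sums d (mset xs)"
  shows "serves w (compile lookup) 13 (subset_sums (mset xs)) s ts"
  using assms
proof (induction ts arbitrary: v s)
  case (Cons t ts)
  have "rel (v(1 := t)) a (with_target t s)" using Cons.prems by (intro rel_with_target) auto
  moreover have "prepared (v(1 := t)) a" using Cons.prems(2) unfolding prepared_def by simp
  ultimately obtain k s' v' where k: "exec w (compile lookup) (with_target t s) k s'" "k \<le> 13"
    "rel v' a s'" "prepared v' a" "regs s' 0 = of_bool (t \<in> subset_sums (mset xs))"
    using lookup[of "v(1 := t)" a "with_target t s" t] Cons.prems(4)[of t] by auto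
  have "decides w (compile lookup) 13 (subset_sums (mset xs)) s t s'"
    unfolding decides_def using k by (intro exI[of _ k]) simp
  moreover have "serves w (compile lookup) 13 (subset_sums (mset xs)) s' ts"
    using Cons.prems by (intro Cons.IH[OF k(3,4)]) auto
  ultimately show ?case by auto
qed simp

end

text \<open>The factor 11 in the word size is the exponent 10 of the stride plus one more power of
  \<open>n\<close>, which covers the twenty arrays since \<open>n\<close> is at least 1300.\<close>

lemma instance_ramI:
  assumes X: "X \<noteq> {#}" "0 \<notin># X" "dense (C_delta X) X" "mset xs = X" and w: "word_size_ok 11 X w"
  shows "instance_ram w (size X ^ 10) xs (size X)"
proof
  define n where "n = size X"
  note b = dense_bounds[OF X(1-3)]
  have n: "1300 \<le> n" using b(4) by (simp add: n_def)
  have "real n ^ 11 \<le> real (n + max_elem X) ^ 11" by (intro power_mono) auto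
  also have "\<dots> = 2 powr (11 * log 2 (real (n + max_elem X)))"
    using n by (simp add: powr_powr[symmetric] mult.commute[of 11] powr_numeral flip: powr_powr)
  also have "\<dots> \<le> 2 powr real w" using w unfolding word_size_ok_def n_def by (intro powr_mono) auto
  also have "\<dots> = 2 ^ w" by (simp add: powr_realpow)
  finally have "real (n ^ 11) \<le> real (2 ^ w)" by simp
  then have "n ^ 11 \<le> 2 ^ w" unfolding of_nat_le_iff .
  moreover have "20 * n ^ 10 \<le> n * n ^ 10" using n by (intro mult_le_mono1) simp
  ultimately show "20 * size X ^ 10 \<le> 2 ^ w" by (simp add: n_def eval_nat_numeral)
  have "2 \<le> n" using n by simp
  also have "n = n ^ 1" by simp
  also have "\<dots> \<le> n ^ 10" using n by (intro power_increasing) auto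
  finally show "2 \<le> size X ^ 10" by (simp add: n_def)
qed (use X dense_bounds[OF X(1-3)] in auto)

text \<open>A target has to be a legal variable value. Density bounds the largest element by
  \<open>n ^ 2\<close> and so the total by \<open>n ^ 3\<close>.\<close>

lemma target_less:
  assumes X: "X \<noteq> {#}" "0 \<notin># X" "dense (C_delta X) X" and t: "real t \<le> real (\<Sum>\<^sub># X) / 2"
  shows "t < size X ^ 10"
proof -
  note b = dense_bounds[OF X]
  have "max_elem X \<le> 1699200 * max_mult X * max_elem X" using b(2) by simp
  then have "max_elem X \<le> size X ^ 2" using b(5) by linarith
  moreover have "\<Sum>\<^sub># X \<le> size X * max_elem X" by (intro sum_mset_le le_max_elem)
  ultimately have "\<Sum>\<^sub># X \<le> size X * size X ^ 2" by (meson le_trans mult_le_mono2)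
  also have "\<dots> = size X ^ 3" by (simp add: eval_nat_numeral)
  also have "\<dots> < size X ^ 10" using b(4) by (intro power_strict_increasing) auto
  finally show ?thesis using t by linarith
qed

text \<open>In the one-shot statement density comes from the target: the two bounds on
  \<open>t\<close> enclose it, and cancelling the total leaves exactly the inequality in
  \<open>dense\<close>. For the second claim, \<open>0.5 * 1699200\<close> exceeds
  \<open>4 + 2 * 169920\<close> and the logarithms are at least 1.\<close>

lemma target_bounds:
  assumes X: "X \<noteq> {#}" "0 \<notin># X" and t: "real t \<le> real (\<Sum>\<^sub># X) / 2"
      "real t \<ge> 0.5 * C_delta X * real (max_mult X) * real (max_elem X) * real (\<Sum>\<^sub># X) / real (size X) ^ 2"
  shows "dense (C_delta X) X"
    and "real t \<ge> (4 + 2 * C_lambda X) * real (max_mult X) * real (max_elem X) * real (\<Sum>\<^sub># X) / real (size X) ^ 2"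
proof -
  define \<sigma> where "\<sigma> = \<Sum>\<^sub># X"
  note t = t[folded \<sigma>_def]
  define c where "c = real (max_mult X) * real (max_elem X) * real \<sigma> / real (size X) ^ 2"
  obtain x where x: "x \<in># X" using X by (meson multiset_nonemptyE)
  have "0 < x" using x X(2) by (cases x) auto
  then have s0: "0 < \<sigma>" unfolding \<sigma>_def using x by (metis gr0I sum_mset_0_iff not_less0)
  have n0: "1 \<le> size X" using X(1) by (simp add: Suc_leI nonempty_has_size)
  have c: "C_delta X * real (max_mult X) * real (max_elem X) * real \<sigma> / real (size X) ^ 2 \<le> real \<sigma>"
    using t by (simp add: field_simps)
  then have "(C_delta X * real (max_mult X) * real (max_elem X)) * real \<sigma> \<le> real (size X) ^ 2 * real \<sigma>"
  proof -
    have "0 < real (size X) ^ 2" using X(1) by simp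
    then show ?thesis using c by (simp only: pos_divide_le_eq mult.commute)
  qed
  moreover have "0 < real \<sigma>" using s0 by simp
  ultimately show "dense (C_delta X) X" unfolding dense_def by (rule mult_right_le_imp_le)
  have mu: "1 \<le> max_mult X" using count_le_max_mult[of X x] x
    by (metis One_nat_def Suc_leI count_greater_zero_iff le_trans)
  define lm ln where "lm = log 2 (2 * real (max_mult X))" and "ln = log 2 (2 * real (size X))"
  have l: "1 \<le> lm" "1 \<le> ln" using mu n0 by (auto simp: lm_def ln_def)
  have "lm * 1 \<le> lm * lm" using l by (intro mult_left_mono) auto
  moreover have "1 * lm ^ 2 \<le> ln * lm ^ 2" using l by (intro mult_right_mono) auto
  ultimately have "4 + 2 * (169920 * lm) \<le> 0.5 * (1699200 * ln * lm ^ 2)"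
    using l(1) unfolding power2_eq_square by linarith
  then have "4 + 2 * C_lambda X \<le> 0.5 * C_delta X" unfolding C_lambda_def C_delta_def lm_def ln_def .
  then have "(4 + 2 * C_lambda X) * c \<le> 0.5 * C_delta X * c"
    by (rule mult_right_mono) (simp add: c_def)
  then show "real t \<ge> (4 + 2 * C_lambda X) * real (max_mult X) * real (max_elem X) * real (\<Sum>\<^sub># X) / real (size X) ^ 2"
    unfolding \<sigma>_def[symmetric]
    using t(2) unfolding c_def by (simp add: mult.assoc)
qed

lemma quasilinear: "(\<lambda>n. c * (real n * log 2 (real n)) + b) \<in> soft_O real"
proof -
  have "(\<lambda>n. c * (real n * log 2 (real n)) + b) \<in> O(\<lambda>n. real n * log 2 (real n) ^ 1)"
  proof (rule bigoI[where c = "\<bar>c\<bar> + \<bar>b\<bar>"], rule eventually_sequentiallyI[of 2])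
    fix n :: nat assume n: "2 \<le> n"
    define u where "u = real n * log 2 (real n)"
    have "1 * 1 \<le> u" unfolding u_def using n by (intro mult_mono) auto
    then have u: "1 \<le> u" by simp
    have "\<bar>c * u + b\<bar> \<le> \<bar>c\<bar> * u + \<bar>b\<bar> * 1" using u abs_triangle_ineq[of "c * u" b] by (simp add: abs_mult)
    also have "\<dots> \<le> \<bar>c\<bar> * u + \<bar>b\<bar> * u" using u by (intro add_left_mono mult_left_mono) auto
    finally show "norm (c * (real n * log 2 (real n)) + b) \<le> (\<bar>c\<bar> + \<bar>b\<bar>) * norm (real n * log 2 (real n) ^ 1)"
      using u by (simp add: u_def[symmetric] distrib_right)
  qed
  then show ?thesis unfolding soft_O_def by blast
qed

theorem theorem4p4:
  shows
    "(\<exists>(P :: com) (Q :: com) (\<kappa> :: nat) (T :: nat \<Rightarrow> real) (b :: real).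
        T \<in> soft_O real \<and>
        (\<forall>(X :: nat multiset) (xs :: nat list) (w :: nat).
           X \<noteq> {#} \<and> 0 \<notin># X \<and> dense (C_delta X) X \<and> mset xs = X \<and> word_size_ok \<kappa> X w \<longrightarrow>
           (\<exists>k s. exec w P (input xs) k s \<and> real k \<le> T (size X) \<and>
              (\<forall>ts. (\<forall>t \<in> set ts.
                        real t \<le> real (\<Sum>\<^sub># X) / 2 \<and>
                        real t \<ge> (4 + 2 * C_lambda X) * real (max_mult X) * real (max_elem X)
                                   * real (\<Sum>\<^sub># X) / real (size X) ^ 2) \<longrightarrow>
                    serves w Q b (subset_sums X) s ts))))
     \<and>
     (\<exists>(R :: com) (\<kappa> :: nat) (T :: nat \<Rightarrow> real).
        T \<in> soft_O real \<and>
        (\<forall>(X :: nat multiset) (xs :: nat list) (w :: nat) (t :: nat).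
           X \<noteq> {#} \<and> 0 \<notin># X \<and> mset xs = X \<and> word_size_ok \<kappa> X w \<and>
           real t \<le> real (\<Sum>\<^sub># X) / 2 \<and>
           real t \<ge> 0.5 * C_delta X * real (max_mult X) * real (max_elem X)
                      * real (\<Sum>\<^sub># X) / real (size X) ^ 2 \<longrightarrow>
           (\<exists>s. decides w R (T (size X)) (subset_sums X) (input xs) t s)))"
proof
  let ?T = "\<lambda>n. 7000 * (real n * log 2 (real n)) + 0"
  show "\<exists>(P :: com) (Q :: com) (\<kappa> :: nat) (T :: nat \<Rightarrow> real) (b :: real).
        T \<in> soft_O real \<and>
        (\<forall>(X :: nat multiset) (xs :: nat list) (w :: nat).
           X \<noteq> {#} \<and> 0 \<notin># X \<and> dense (C_delta X) X \<and> mset xs = X \<and> word_size_ok \<kappa> X w \<longrightarrow>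
           (\<exists>k s. exec w P (input xs) k s \<and> real k \<le> T (size X) \<and>
              (\<forall>ts. (\<forall>t \<in> set ts.
                        real t \<le> real (\<Sum>\<^sub># X) / 2 \<and>
                        real t \<ge> (4 + 2 * C_lambda X) * real (max_mult X) * real (max_elem X)
                                   * real (\<Sum>\<^sub># X) / real (size X) ^ 2) \<longrightarrow>
                    serves w Q b (subset_sums X) s ts)))"
  proof (rule exI[of _ preprocess], rule exI[of _ "compile lookup"], rule exI[of _ 11], rule exI[of _ ?T],
      rule exI[of _ 13], intro conjI allI impI)
    show "?T \<in> soft_O real" by (rule quasilinear)
    fix X xs w assume "X \<noteq> {#} \<and> 0 \<notin># X \<and> dense (C_delta X) X \<and> mset xs = X \<and> word_size_ok 11 X w"
    then have X: "X \<noteq> {#}" "0 \<notin># X" "dense (C_delta X) X" "mset xs = X" and w: "word_size_ok 11 X w" by blast+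
    interpret instance_ram w "size X ^ 10" xs "size X" by (rule instance_ramI[OF X w])
    have t0: "with_target 0 (input xs) = input xs"
      using n_ge by (auto simp: with_target_def set_reg_def input_def)
    have "0 < size X ^ 10" using n_ge by simp
    from preprocess[OF this] obtain k s v a where k: "exec w preprocess (input xs) k s"
      "real k \<le> 7000 * (real (size X) * log 2 (real (size X)))" "rel v a s" "prepared v a"
      unfolding t0 by blast
    show "\<exists>k s. exec w preprocess (input xs) k s \<and> real k \<le> ?T (size X) \<and>
              (\<forall>ts. (\<forall>t \<in> set ts.
                        real t \<le> real (\<Sum>\<^sub># X) / 2 \<and>
                        real t \<ge> (4 + 2 * C_lambda X) * real (max_mult X) * real (max_elem X)
                                   * real (\<Sum>\<^sub># X) / real (size X) ^ 2) \<longrightarrow>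
                    serves w (compile lookup) 13 (subset_sums X) s ts)"
    proof (rule exI[of _ k], rule exI[of _ s], intro conjI allI impI)
      fix ts assume ts: "\<forall>t \<in> set ts. real t \<le> real (\<Sum>\<^sub># X) / 2 \<and>
        real t \<ge> (4 + 2 * C_lambda X) * real (max_mult X) * real (max_elem X)
                                   * real (\<Sum>\<^sub># X) / real (size X) ^ 2"
      have "serves w (compile lookup) 13 (subset_sums (mset xs)) s ts"
      proof (rule serves_lookup[OF k(3,4)])
        show "t < size X ^ 10" if "t \<in> set ts" for t using target_less[OF X(1-3)] ts that by blast
        show "t \<in> subset_sums (mset xs) \<longleftrightarrow> t mod d \<in> residue_sums d (mset xs)"
          if "t \<in> set ts" "is_modulus d (mset xs)" for t d
          using subset_sum_iff_residue[OF X(1-3), of d t] ts that unfolding X(4) residue_sums_def by blast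
      qed
      then show "serves w (compile lookup) 13 (subset_sums X) s ts" unfolding X(4) .
    qed (use k in simp_all)
  qed
next
  let ?T = "\<lambda>n. 7000 * (real n * log 2 (real n)) + 13"
  show "\<exists>(R :: com) (\<kappa> :: nat) (T :: nat \<Rightarrow> real).
        T \<in> soft_O real \<and>
        (\<forall>(X :: nat multiset) (xs :: nat list) (w :: nat) (t :: nat).
           X \<noteq> {#} \<and> 0 \<notin># X \<and> mset xs = X \<and> word_size_ok \<kappa> X w \<and>
           real t \<le> real (\<Sum>\<^sub># X) / 2 \<and>
           real t \<ge> 0.5 * C_delta X * real (max_mult X) * real (max_elem X)
                      * real (\<Sum>\<^sub># X) / real (size X) ^ 2 \<longrightarrow>
           (\<exists>s. decides w R (T (size X)) (subset_sums X) (input xs) t s))"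
  proof (rule exI[of _ "Seq preprocess (compile lookup)"], rule exI[of _ 11], rule exI[of _ ?T], intro conjI allI impI)
    show "?T \<in> soft_O real" by (rule quasilinear)
    fix X xs w t assume asm: "X \<noteq> {#} \<and> 0 \<notin># X \<and> mset xs = X \<and> word_size_ok 11 X w \<and>
           real t \<le> real (\<Sum>\<^sub># X) / 2 \<and>
           real t \<ge> 0.5 * C_delta X * real (max_mult X) * real (max_elem X)
                      * real (\<Sum>\<^sub># X) / real (size X) ^ 2"
    then have X': "X \<noteq> {#}" "0 \<notin># X" "mset xs = X" and w: "word_size_ok 11 X w"
      and t: "real t \<le> real (\<Sum>\<^sub># X) / 2" by blast+
    note tb = target_bounds[OF X'(1,2) t]
    have dens: "dense (C_delta X) X"
      and t2: "real t \<ge> (4 + 2 * C_lambda X) * real (max_mult X) * real (max_elem X) * real (\<Sum>\<^sub># X) / real (size X) ^ 2"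
      using tb asm by blast+
    interpret instance_ram w "size X ^ 10" xs "size X" by (rule instance_ramI[OF X'(1,2) dens X'(3) w])
    from preprocess[OF target_less[OF X'(1,2) dens t]] obtain k s v a where
      k: "exec w preprocess (with_target t (input xs)) k s"
      "real k \<le> 7000 * (real (size X) * log 2 (real (size X)))" "rel v a s" "prepared v a" "v 1 = t"
      by blast
    have "t \<in> subset_sums (mset xs) \<longleftrightarrow> t mod d \<in> residue_sums d (mset xs)" if "is_modulus d (mset xs)" for d
      using subset_sum_iff_residue[OF X'(1,2) dens, of d t] t t2 that unfolding X'(3) residue_sums_def by blast
    from lookup[OF k(3-5) this] obtain k' s' where k': "exec w (compile lookup) s k' s'" "k' \<le> 13"
      "regs s' 0 = of_bool (t \<in> subset_sums X)" unfolding X'(3) by blast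
    have "exec w (Seq preprocess (compile lookup)) (with_target t (input xs)) (k + k') s'"
      by (rule exec.Seq[OF k(1) k'(1)])
    then show "\<exists>s. decides w (Seq preprocess (compile lookup)) (?T (size X)) (subset_sums X) (input xs) t s"
      unfolding decides_def using k(2) k'(2,3) by (intro exI[of _ s'] exI[of _ "k + k'"]) simp
  qed
qed

end
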